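(* There is no imaginary quadratic discriminant $\Delta$ with $|\Delta|\le 10^{11}$ and $h(\Delta)>3$ such that the singular moduli of discriminant $\Delta$ are roots of a polynomial $t^m+At^n+B$ with $A,B\in\mathbb{Q}$, integers $m>n>0$, $B\neq 0$.
   Context: An imaginary quadratic discriminant is an integer $\Delta<0$ with $\Delta\equiv0,1\pmod4$; $h(\Delta)$ is the class number of the order of discriminant $\Delta$; the singular moduli of discriminant $\Delta$ are the $h(\Delta)$ CM $j$-invariants whose CM order has discriminant $\Delta$. *)

theory Defs
  imports "HOL-Analysis.Analysis" "HOL-Computational_Algebra.Polynomial"
begin

definition imag_quad_disc :: "int \<Rightarrow> bool" where
  "imag_quad_disc \<Delta> \<longleftrightarrow> \<Delta> < 0 \<and> (\<Delta> mod 4 = 0 \<or> \<Delta> mod 4 = 1)"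

definition zspan :: "complex \<Rightarrow> complex \<Rightarrow> complex set" where
  "zspan w1 w2 = {of_int a * w1 + of_int b * w2 | a b. True}"

(* Every order of an imaginary quadratic field, embedded in the complex numbers, has a Z-basis
   (1, w). Its discriminant is the square of the determinant of the two embeddings (identity and
   complex conjugation) applied to that basis, i.e. (w - cnj w)^2. For \<Delta> < 0 the equation forces
   w to be non-real, and closure under multiplication makes w a quadratic integer. *)
definition imag_quad_order_of_disc :: "int \<Rightarrow> complex set \<Rightarrow> bool" where
  "imag_quad_order_of_disc \<Delta> R \<longleftrightarrow>
     (\<forall>x\<in>R. \<forall>y\<in>R. x * y \<in> R) \<and>
     (\<exists>w. R = zspan 1 w \<and> (w - cnj w)\<^sup>2 = of_int \<Delta>)"

definition quad_order :: "int \<Rightarrow> complex set" where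
  "quad_order \<Delta> = zspan 1 ((of_int \<Delta> + csqrt (of_int \<Delta>)) / 2)"


(* Fraction field inside the complex numbers. *)
definition frac_field :: "complex set \<Rightarrow> complex set" where
  "frac_field R = {a / b | a b. a \<in> R \<and> b \<in> R \<and> b \<noteq> 0}"

definition frac_ideal :: "complex set \<Rightarrow> complex set \<Rightarrow> bool" where
  "frac_ideal R I \<longleftrightarrow>
     0 \<in> I \<and> I \<noteq> {0} \<and>
     (\<forall>x\<in>I. \<forall>y\<in>I. x + y \<in> I) \<and>
     (\<forall>r\<in>R. \<forall>x\<in>I. r * x \<in> I) \<and>
     (\<exists>d\<in>R. d \<noteq> 0 \<and> (\<forall>x\<in>I. d * x \<in> R))"

definition ideal_mult :: "complex set \<Rightarrow> complex set \<Rightarrow> complex set" where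
  "ideal_mult I J = {(\<Sum>k<n. a k * b k) | (n::nat) a b. \<forall>k<n. a k \<in> I \<and> b k \<in> J}"

definition invertible_ideals :: "complex set \<Rightarrow> complex set set" where
  "invertible_ideals R = {I. frac_ideal R I \<and> (\<exists>J. frac_ideal R J \<and> ideal_mult I J = R)}"

definition ideal_class_rel :: "complex set \<Rightarrow> (complex set \<times> complex set) set" where
  "ideal_class_rel R = {(I, J). I \<in> invertible_ideals R \<and> J \<in> invertible_ideals R \<and>
     (\<exists>c \<in> frac_field R. c \<noteq> 0 \<and> J = (*) c ` I)}"

(* The order of the Picard group of R: invertible fractional ideals modulo principal ones. *)
definition class_number :: "complex set \<Rightarrow> nat" where
  "class_number R = card (invertible_ideals R // ideal_class_rel R)"

definition disc_class_number :: "int \<Rightarrow> nat" where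
  "disc_class_number \<Delta> = class_number (quad_order \<Delta>)"


(* Unordered sums over the nonzero lattice points; absolutely convergent for k > 2. *)
definition eisenstein_sum :: "nat \<Rightarrow> complex set \<Rightarrow> complex" where
  "eisenstein_sum k L = (\<Sum>\<^sub>\<infinity>w\<in>L - {0}. 1 / w ^ k)"

(* Normalised so that the square lattice has j = 1728. *)
definition j_invariant :: "complex set \<Rightarrow> complex" where
  "j_invariant L =
     (let g2 = 60 * eisenstein_sum 4 L; g3 = 140 * eisenstein_sum 6 L
      in 1728 * g2 ^ 3 / (g2 ^ 3 - 27 * g3\<^sup>2))"

(* The endomorphism ring of the elliptic curve C/L. *)
definition multiplier_ring :: "complex set \<Rightarrow> complex set" where
  "multiplier_ring L = {c. \<forall>w\<in>L. c * w \<in> L}"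

(* Every complex elliptic curve is C/(Z + Z\<tau>) for some \<tau> in the upper half plane. *)
definition singular_moduli :: "int \<Rightarrow> complex set" where
  "singular_moduli \<Delta> = {j_invariant (zspan 1 \<tau>) | \<tau>.
     Im \<tau> > 0 \<and> imag_quad_order_of_disc \<Delta> (multiplier_ring (zspan 1 \<tau>))}"


lemma zspan_shift:
  assumes "w' = of_int k + w \<or> w' = of_int k - w"
  shows "zspan 1 w' = zspan 1 w"
proof -
  have sub: "zspan 1 u \<subseteq> zspan 1 v" if "u = of_int k + v \<or> u = of_int k - v" for k u v
  proof
    fix x assume "x \<in> zspan 1 u"
    then obtain a b where x: "x = of_int a * 1 + of_int b * u"
      unfolding zspan_def by blast
    from that have "x = of_int (a + b * k) * 1 + of_int b * v
                  \<or> x = of_int (a + b * k) * 1 + of_int (- b) * v"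
    proof
      assume u: "u = of_int k + v"
      show ?thesis unfolding x u by (simp add: algebra_simps)
    next
      assume u: "u = of_int k - v"
      show ?thesis unfolding x u by (simp add: algebra_simps)
    qed
    then show "x \<in> zspan 1 v" unfolding zspan_def by blast
  qed
  have "w = of_int (- k) + w' \<or> w = of_int k - w'"
    using assms by auto
  then have "zspan 1 w \<subseteq> zspan 1 w'" using sub by blast
  with sub[OF assms] show ?thesis by blast
qed

(* There is exactly one order of each imaginary quadratic discriminant. *)
lemma imag_quad_order_of_disc_iff:
  assumes "imag_quad_disc \<Delta>"
  shows "imag_quad_order_of_disc \<Delta> R \<longleftrightarrow> R = quad_order \<Delta>"
proof -
  define s where "s = csqrt (of_int \<Delta>)"
  have s2: "s\<^sup>2 = of_int \<Delta>" unfolding s_def by simp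
  have neg: "\<Delta> < 0" and md: "\<Delta> mod 4 = 0 \<or> \<Delta> mod 4 = 1"
    using assms by (auto simp: imag_quad_disc_def)
  have s: "s = \<i> * of_real (sqrt (of_int (- \<Delta>)))"
    using csqrt_of_real_nonpos[of "of_int \<Delta>"] neg unfolding s_def by simp
  have cs: "cnj s = - s" unfolding s by simp
  define w0 where "w0 = (of_int \<Delta> + s) / 2"
  have Q: "quad_order \<Delta> = zspan 1 w0"
    unfolding quad_order_def w0_def s_def ..
  show ?thesis
  proof
    assume R: "R = quad_order \<Delta>"
    have "4 dvd \<Delta> * \<Delta> - \<Delta>"
    proof -
      have "4 dvd \<Delta> \<or> 4 dvd \<Delta> - 1" using md by presburger
      then have "4 dvd \<Delta> * (\<Delta> - 1)" by auto
      then show ?thesis by (simp add: algebra_simps)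
    qed
    then obtain q where q: "\<Delta> * \<Delta> - \<Delta> = 4 * q" by blast
    have qc: "of_int \<Delta> * of_int \<Delta> - of_int \<Delta> = (4 * of_int q :: complex)"
      using arg_cong[OF q, of "of_int :: int \<Rightarrow> complex"] by simp
    have "4 * (w0 * w0) = of_int \<Delta> * of_int \<Delta> + 2 * of_int \<Delta> * s + s\<^sup>2"
      unfolding w0_def by (simp add: field_simps power2_eq_square)
    also have "\<dots> = 4 * (of_int \<Delta> * w0 - of_int q)"
      using qc unfolding w0_def s2 by (simp add: field_simps)
    finally have w0sq: "w0 * w0 = of_int \<Delta> * w0 - of_int q"
      by (simp only: mult_cancel_left) simp
    have cl: "x * y \<in> zspan 1 w0" if xy: "x \<in> zspan 1 w0" "y \<in> zspan 1 w0" for x y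
    proof -
      obtain a b c d where "x = of_int a * 1 + of_int b * w0" "y = of_int c * 1 + of_int d * w0"
        using xy unfolding zspan_def by blast
      then have "x * y = of_int a * of_int c + (of_int a * of_int d + of_int b * of_int c) * w0
                       + of_int b * of_int d * (w0 * w0)"
        by (simp add: algebra_simps)
      also have "\<dots> = of_int (a * c - b * d * q) * 1 + of_int (a * d + b * c + b * d * \<Delta>) * w0"
        unfolding w0sq by (simp add: algebra_simps)
      finally show ?thesis unfolding zspan_def by blast
    qed
    have "(w0 - cnj w0)\<^sup>2 = of_int \<Delta>"
      unfolding w0_def using cs s2 by (simp add: field_simps)
    with cl show "imag_quad_order_of_disc \<Delta> R"
      unfolding imag_quad_order_of_disc_def R Q by blast
  next
    assume "imag_quad_order_of_disc \<Delta> R"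
    then obtain w where cl: "\<forall>x\<in>R. \<forall>y\<in>R. x * y \<in> R" and R: "R = zspan 1 w"
      and d: "(w - cnj w)\<^sup>2 = of_int \<Delta>"
      unfolding imag_quad_order_of_disc_def by blast
    have "w = of_int 0 * 1 + of_int 1 * w" by simp
    then have "w \<in> R" unfolding R zspan_def by blast
    with cl have "w * w \<in> R" by blast
    then obtain p q where pq: "w * w = of_int p * 1 + of_int q * w"
      unfolding R zspan_def by blast
    have d': "w - cnj w = 2 * \<i> * of_real (Im w)"
      by (simp add: complex_eq_iff)
    have im0: "Im w \<noteq> 0" using d neg unfolding d' by auto
    have "Im (w * w) = of_int q * Im w" unfolding pq by simp
    then have re: "2 * Re w = of_int q" using im0 by auto
    have "Re (w * w) = of_int p + of_int q * Re w" unfolding pq by simp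
    then have rp: "(Re w)\<^sup>2 - (Im w)\<^sup>2 = of_int p + of_int q * Re w"
      by (simp add: power2_eq_square)
    have "- 4 * (Im w)\<^sup>2 = of_int \<Delta>"
      using arg_cong[OF d, of Re] unfolding d' by (simp add: power2_eq_square)
    moreover have rq: "Re w = of_int q / 2" using re by simp
    ultimately have "real_of_int \<Delta> = real_of_int (q * q + 4 * p)"
      using rp unfolding rq by (simp add: power2_eq_square field_simps)
    then have D: "\<Delta> = q * q + 4 * p" by linarith
    have "even (q - \<Delta>)" unfolding D by simp
    then obtain k where k: "q = \<Delta> + 2 * k" by (metis add_diff_cancel_left' diff_add_cancel add.commute dvdE)
    have "(w - cnj w - s) * (w - cnj w + s) = 0"
      using d s2 by (simp add: power2_eq_square algebra_simps)
    then have "w - cnj w = s \<or> w - cnj w = - s"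
      by (auto simp: eq_neg_iff_add_eq_0)
    moreover have "w + cnj w = of_int q"
      using re by (simp add: complex_eq_iff)
    moreover have "2 * w = (w + cnj w) + (w - cnj w)" by simp
    ultimately have "2 * w = of_int q + s \<or> 2 * w = of_int q - s" by (metis uminus_add_conv_diff add.commute)
    then have "w = of_int k + w0 \<or> w = of_int (k + \<Delta>) - w0"
      unfolding w0_def k by (auto simp: field_simps)
    then show "R = quad_order \<Delta>"
      unfolding R Q using zspan_shift by blast
  qed
qed

end

(* An equation t^m + A t^n + B satisfied by three singular moduli is refuted in two ways.

   If 7 is inert in the order, fix a valuation ring V of the complex numbers with 1/7 not in V. The
   Weierstrass function is evaluated at the torsion points killed by sqrt(Delta); since their
   number is prime to 7 and Delta^3 = -1 modulo 7, the value of g3 is divisible by 7, so that every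
   nonzero singular modulus is a unit congruent to 1728 modulo 49. A trinomial has at most two
   roots in such a residue disc.

   Otherwise one compares absolute values. Let x0 be the principal (dominant) modulus and x, y two
   others with |y| < |x|. The three equations give |x| - |y| <= 4 |x|^2 / |x0|, which is tiny. On the
   other hand j = 1/q + 744 + O(q), so two forms with different leading coefficients produce
   |x| - |y| large. With class number at least four such a pair exists as soon as a small prime p
   splits, or ramifies with p^2 not dividing Delta: at most two classes have leading coefficient p. As 7 is
   not inert, p = 7 works for |Delta| > 402 unless 49 divides Delta, and then two forms with leading
   coefficient 49 and different arguments of q are compared. The remaining discriminants form a
   short list. *)

theory Submission
  imports Defs "HOL-Complex_Analysis.Complex_Analysis"
begin

section \<open>The Weierstrass function\<close>

text \<open>Why 7 serves both halves. The coefficient g3 = 140 G6 carries an explicit factor 7, and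
  E6 = E_(7-1) lifts the Hasse invariant at 7; 1728 is the only supersingular j-invariant in
  characteristic 7. So at an inert 7 it is enough that 20 G6 be integral for a lattice scaled to
  have an integral Weierstrass equation, and comparing the sum over (1 / sqrt Delta) L with the sum
  over L gives exactly this, with explicit formulas for wp in place of a theory of reduction. If 7
  is not inert, it is itself a candidate for a leading coefficient.

  The obstacle of the analytic half: the constant 744 in j is not small against the separation of
  absolute values. Put Q(a) = exp(pi sqrt|Delta| / a). Two forms with leading coefficients a < b are
  separated only if Q(a) - Q(b) exceeds 2 * 744 plus the error terms, so sizes alone settle a pair
  only when Q(a) is in the thousands and b / a is not too close to 1. Otherwise the argument of 1/q
  must enter, as it changes |1/q + 744| by an amount comparable to 744.\<close>

lemma has_field_derivative_infsum:
  fixes f :: "'a \<Rightarrow> complex \<Rightarrow> complex"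
  assumes deriv: "\<And>x z. x \<in> X \<Longrightarrow> z \<in> cball z0 r \<Longrightarrow> (f x has_field_derivative f' x z) (at z)"
    and bound: "\<And>x z. x \<in> X \<Longrightarrow> z \<in> cball z0 r \<Longrightarrow> norm (f x z) \<le> M x"
    and M: "M summable_on X" and r: "r > 0"
  shows "((\<lambda>z. \<Sum>\<^sub>\<infinity>x\<in>X. f x z) has_field_derivative (\<Sum>\<^sub>\<infinity>x\<in>X. f' x z0)) (at z0)"
proof -
  let ?F = "finite_subsets_at_top X"
  \<comment> \<open>For holomorphic terms, uniform convergence along the net of finite subsets
    passes to the derivatives, so the majorant of \<open>f\<close> controls the sum of
    \<open>f'\<close> as well.\<close>
  have u: "uniform_limit (cball z0 r) (\<lambda>Y z. \<Sum>x\<in>Y. f x z) (\<lambda>z. \<Sum>\<^sub>\<infinity>x\<in>X. f x z) ?F"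
    by (rule Weierstrass_m_test_general[OF bound M])
  have e: "\<forall>\<^sub>F Y in ?F. continuous_on (cball z0 r) (\<lambda>z. \<Sum>x\<in>Y. f x z) \<and>
      (\<forall>w\<in>ball z0 r. ((\<lambda>z. \<Sum>x\<in>Y. f x z) has_field_derivative (\<Sum>x\<in>Y. f' x w)) (at w))"
  proof (rule eventually_finite_subsets_at_top_weakI, intro conjI ballI)
    fix Y assume Y: "finite Y" "Y \<subseteq> X"
    show "continuous_on (cball z0 r) (\<lambda>z. \<Sum>x\<in>Y. f x z)"
    proof (intro continuous_on_sum)
      fix x assume "x \<in> Y"
      then show "continuous_on (cball z0 r) (f x)"
        using deriv Y by (meson DERIV_isCont continuous_at_imp_continuous_on subsetD)
    qed
    fix w assume "w \<in> ball z0 r"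
    then show "((\<lambda>z. \<Sum>x\<in>Y. f x z) has_field_derivative (\<Sum>x\<in>Y. f' x w)) (at w)"
      using deriv Y by (intro DERIV_sum) (auto simp: subset_iff)
  qed
  obtain g' where g': "\<And>w. w \<in> ball z0 r \<Longrightarrow>
      ((\<lambda>z. \<Sum>\<^sub>\<infinity>x\<in>X. f x z) has_field_derivative g' w) (at w) \<and> ((\<lambda>Y. \<Sum>x\<in>Y. f' x w) \<longlongrightarrow> g' w) ?F"
    using has_complex_derivative_uniform_limit[OF e u _ r] by (metis finite_subsets_at_top_neq_bot)
  have "z0 \<in> ball z0 r" using r by simp
  from g'[OF this] have "((\<lambda>x. f' x z0) has_sum g' z0) X" unfolding has_sum_def by simp
  then show ?thesis using g'[OF \<open>z0 \<in> ball z0 r\<close>] infsumI by metis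
qed

lemma powr_minus_three_halves:
  fixes x :: real
  assumes "x > 0"
  shows "x powr (-3/2) = 1 / sqrt x ^ 3"
proof -
  have "x powr (-3/2) = (x powr (1/2)) powr (- 3)" by (simp only: powr_powr) simp
  also have "\<dots> = 1 / ((x powr (1/2)) powr 3)" by (subst powr_minus) (rule inverse_eq_divide)
  also have "\<dots> = 1 / sqrt x ^ 3" using assms by (simp add: powr_half_sqrt)
  finally show ?thesis .
qed

text \<open>The exponent is half of 3, the smallest power summed over a lattice: the two-dimensional
  series will be compared with a product of two of these.\<close>

lemma summable_on_int_powr: "(\<lambda>a::int. (1 + \<bar>real_of_int a\<bar>) powr (-3/2)) summable_on UNIV"
proof -
  have "summable (\<lambda>n. real n powr (-3/2))" by (simp add: summable_real_powr_iff)
  then have s: "summable (\<lambda>n. real (Suc n) powr (-3/2))" by (rule summable_Suc_iff[THEN iffD2])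
  then have n: "(\<lambda>n. (1 + real n) powr (-3/2)) summable_on (UNIV :: nat set)"
    by (subst summable_on_UNIV_nonneg_real_iff) (auto simp: add.commute)
  have 1: "(\<lambda>a::int. (1 + \<bar>real_of_int a\<bar>) powr (-3/2)) summable_on range int"
    using n by (subst summable_on_reindex) (auto simp: o_def)
  have "summable (\<lambda>n. real (Suc (Suc n)) powr (-3/2))" using s by (rule summable_Suc_iff[THEN iffD2])
  then have n2: "(\<lambda>n. (2 + real n) powr (-3/2)) summable_on (UNIV :: nat set)"
    by (subst summable_on_UNIV_nonneg_real_iff) (auto simp: add.commute add.left_commute)
  have 2: "(\<lambda>a::int. (1 + \<bar>real_of_int a\<bar>) powr (-3/2)) summable_on range (\<lambda>n. - int (Suc n))"
    using n2 by (subst summable_on_reindex) (auto simp: o_def inj_on_def add.commute add.left_commute)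
  have "(UNIV :: int set) = range int \<union> range (\<lambda>n. - int (Suc n))"
  proof -
    have "x \<in> range int \<union> range (\<lambda>n. - int (Suc n))" for x :: int
      by (cases x rule: int_cases) blast+
    then show ?thesis by blast
  qed
  moreover have "range int \<inter> range (\<lambda>n. - int (Suc n)) = {}" by auto
  ultimately show ?thesis using summable_on_Un_disjoint[OF 1 2] by simp
qed

section \<open>Plane lattices and the convergence of their sums\<close>

lemma zspan_iff: "x \<in> zspan w1 w2 \<longleftrightarrow> (\<exists>a b. x = of_int a * w1 + of_int b * w2)"
  by (auto simp: zspan_def)

locale cx_lattice =
  fixes w1 w2 :: complex
  assumes nonreal: "Im (w2 / w1) \<noteq> 0"
begin

abbreviation L :: "complex set" where "L \<equiv> zspan w1 w2"

lemma w1_nz: "w1 \<noteq> 0" using nonreal by auto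

lemma L_0 [simp]: "0 \<in> L"
  unfolding zspan_iff by (rule exI[of _ 0], rule exI[of _ 0]) simp

lemma L_w1: "w1 \<in> L" unfolding zspan_iff by (rule exI[of _ 1], rule exI[of _ 0]) simp
lemma L_w2: "w2 \<in> L" unfolding zspan_iff by (rule exI[of _ 0], rule exI[of _ 1]) simp

lemma L_add: "x \<in> L \<Longrightarrow> y \<in> L \<Longrightarrow> x + y \<in> L"
  unfolding zspan_iff
proof (elim exE)
  fix a b c d assume "x = of_int a * w1 + of_int b * w2" "y = of_int c * w1 + of_int d * w2"
  then show "\<exists>a b. x + y = of_int a * w1 + of_int b * w2"
    by (intro exI[of _ "a + c"] exI[of _ "b + d"]) (simp add: algebra_simps)
qed

lemma L_mult: "x \<in> L \<Longrightarrow> of_int k * x \<in> L"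
  unfolding zspan_iff
proof (elim exE)
  fix a b assume "x = of_int a * w1 + of_int b * w2"
  then show "\<exists>a b. of_int k * x = of_int a * w1 + of_int b * w2"
    by (intro exI[of _ "k * a"] exI[of _ "k * b"]) (simp add: algebra_simps)
qed

lemma L_uminus [simp]: "- x \<in> L \<longleftrightarrow> x \<in> L"
  using L_mult[of _ "-1"] by (metis minus_minus mult_minus1 of_int_1 of_int_minus)

lemma L_diff: "x \<in> L \<Longrightarrow> y \<in> L \<Longrightarrow> x - y \<in> L"
  using L_add[of x "- y"] by simp

lemma L_add_iff: "l \<in> L \<Longrightarrow> z + l \<in> L \<longleftrightarrow> z \<in> L"
  using L_add L_diff by (metis add_diff_cancel_right')

text \<open>The imaginary part of \<open>t = w2 / w1\<close> bounds \<open>b\<close>, then the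
  triangle inequality bounds \<open>a\<close>. Discreteness, convergence, independence of the basis
  and finiteness in discs all follow from this comparison with the l1 norm.\<close>

lemma norm_ge:
  obtains c where "c > 0" "\<And>a b. c * (\<bar>a\<bar> + \<bar>b\<bar>) \<le> norm (of_real a * w1 + of_real b * w2)"
proof -
  define t where "t = w2 / w1"
  define y where "y = \<bar>Im t\<bar>"
  have y: "y > 0" using nonreal by (simp add: y_def t_def)
  define K where "K = 1 + (norm t + 1) / y"
  have K: "K > 0" using y by (simp add: K_def add_pos_nonneg)
  have n1: "\<bar>a\<bar> + \<bar>b\<bar> \<le> K * norm (of_real a + of_real b * t)" for a b :: real
  proof -
    let ?n = "norm (of_real a + of_real b * t)"
    have "\<bar>Im (of_real a + of_real b * t)\<bar> \<le> ?n" by (rule abs_Im_le_cmod)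
    then have b: "\<bar>b\<bar> * y \<le> ?n" by (simp add: y_def abs_mult)
    have "norm (of_real a :: complex) \<le> ?n + norm (of_real b * t)"
      using norm_triangle_ineq4[of "of_real a + of_real b * t" "of_real b * t"] by simp
    then have "\<bar>a\<bar> \<le> ?n + \<bar>b\<bar> * norm t" by (simp add: norm_mult)
    then have "\<bar>a\<bar> + \<bar>b\<bar> \<le> ?n + \<bar>b\<bar> * (norm t + 1)" by (simp add: algebra_simps)
    also have "\<dots> \<le> ?n + ?n / y * (norm t + 1)"
      using b y by (intro add_left_mono mult_right_mono) (auto simp: field_simps)
    also have "\<dots> = K * ?n" using y by (simp add: K_def field_simps)
    finally show ?thesis .
  qed
  show thesis
  proof (rule that[of "norm w1 / K"])
    show "norm w1 / K > 0" using w1_nz K by simp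
    fix a b :: real
    have "of_real a * w1 + of_real b * w2 = w1 * (of_real a + of_real b * t)"
      using w1_nz by (simp add: t_def field_simps)
    then have e: "norm (of_real a * w1 + of_real b * w2) = norm w1 * norm (of_real a + of_real b * t)"
      by (simp add: norm_mult)
    have "norm w1 / K * (\<bar>a\<bar> + \<bar>b\<bar>) \<le> norm w1 / K * (K * norm (of_real a + of_real b * t))"
      using n1 K by (intro mult_left_mono) auto
    then show "norm w1 / K * (\<bar>a\<bar> + \<bar>b\<bar>) \<le> norm (of_real a * w1 + of_real b * w2)"
      using K by (simp add: e)
  qed
qed

lemma L_separated: obtains e where "e > 0" "\<And>x. x \<in> L \<Longrightarrow> x \<noteq> 0 \<Longrightarrow> e \<le> norm x"
proof -
  obtain c where c: "c > 0" "\<And>a b. c * (\<bar>a\<bar> + \<bar>b\<bar>) \<le> norm (of_real a * w1 + of_real b * w2)"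
    by (rule norm_ge) blast
  show thesis
  proof (rule that[OF c(1)])
    fix x assume "x \<in> L" "x \<noteq> 0"
    then obtain a b where x: "x = of_int a * w1 + of_int b * w2" by (auto simp: zspan_iff)
    have "a \<noteq> 0 \<or> b \<noteq> 0" using \<open>x \<noteq> 0\<close> x by auto
    then have "1 \<le> \<bar>real_of_int a\<bar> + \<bar>real_of_int b\<bar>" by linarith
    then have "c * 1 \<le> c * (\<bar>real_of_int a\<bar> + \<bar>real_of_int b\<bar>)" using c(1) by (intro mult_left_mono) auto
    also have "\<dots> \<le> norm x" using c(2)[of a b] by (simp add: x)
    finally show "c \<le> norm x" by simp
  qed
qed

lemma closed_subset_L: assumes "X \<subseteq> L" shows "closed X"
proof -
  obtain e where e: "e > 0" "\<And>x. x \<in> L \<Longrightarrow> x \<noteq> 0 \<Longrightarrow> e \<le> norm x" by (rule L_separated) blast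
  show ?thesis
  proof (rule discrete_imp_closed[OF e(1)], intro ballI impI)
    fix x y assume "x \<in> X" "y \<in> X" "dist y x < e"
    then show "y = x" using e(2)[of "y - x"] L_diff assms by (force simp: dist_norm)
  qed
qed

lemma open_compl_L: "open (- L)" using closed_subset_L by auto

lemma countable_L: "countable L"
proof -
  have "L = (\<lambda>(a, b). of_int a * w1 + of_int b * w2) ` UNIV"
    by (auto simp: zspan_def image_def)
  then show ?thesis by (metis countableI_type countable_image)
qed

lemma connected_compl_L: "connected (- L)"
  using path_connected_complement_countable[OF _ countable_L] path_connected_imp_connected by auto

lemma coords_unique:
  assumes "of_real a * w1 + of_real b * w2 = of_real c * w1 + of_real d * w2"
  shows "a = c" "b = d"
proof -
  obtain k where k: "k > 0" "\<And>a b. k * (\<bar>a\<bar> + \<bar>b\<bar>) \<le> norm (of_real a * w1 + of_real b * w2)"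
    by (rule norm_ge) blast
  have "of_real (a - c) * w1 + of_real (b - d) * w2 = 0" using assms by (simp add: algebra_simps)
  then have "k * (\<bar>a - c\<bar> + \<bar>b - d\<bar>) \<le> 0" using k(2)[of "a - c" "b - d"] by simp
  then have "\<bar>a - c\<bar> + \<bar>b - d\<bar> \<le> 0" using k(1) by (simp add: mult_le_0_iff)
  then show "a = c" "b = d" by auto
qed

lemma summable_L: "k \<ge> 3 \<Longrightarrow> (\<lambda>w. 1 / (1 + norm w) ^ k) summable_on L"
proof -
  assume k: "k \<ge> 3"
  obtain c where c: "c > 0" "\<And>a b. c * (\<bar>a\<bar> + \<bar>b\<bar>) \<le> norm (of_real a * w1 + of_real b * w2)"
    by (rule norm_ge) blast
  define d where "d = min c 1"
  have d: "d > 0" "d \<le> 1" "d \<le> c" using c(1) by (auto simp: d_def)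
  let ?f = "\<lambda>a::int. (1 + \<bar>real_of_int a\<bar>) powr (-3/2)"
  let ?h = "\<lambda>(a::int, b::int). of_int a * w1 + of_int b * w2"
  have s: "(\<lambda>(a, b). ?f a * ?f b) summable_on (UNIV \<times> UNIV)"
  proof (rule summable_on_SigmaI[where g = "\<lambda>a. ?f a * (\<Sum>\<^sub>\<infinity>b. ?f b)"])
    show "(\<lambda>a. ?f a * (\<Sum>\<^sub>\<infinity>b. ?f b)) summable_on UNIV"
      by (rule summable_on_cmult_left[OF summable_on_int_powr])
    fix a :: int
    have "((\<lambda>b. ?f a * ?f b) has_sum ?f a * (\<Sum>\<^sub>\<infinity>b. ?f b)) UNIV"
      by (rule has_sum_cmult_right[OF has_sum_infsum[OF summable_on_int_powr]])
    then show "((\<lambda>b. case (a, b) of (a, b) \<Rightarrow> ?f a * ?f b) has_sum ?f a * (\<Sum>\<^sub>\<infinity>b. ?f b)) UNIV"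
      by simp
  qed auto
  have "(\<lambda>(a, b). (8 / (2 * d) ^ 3) * (?f a * ?f b)) summable_on (UNIV \<times> UNIV)"
    using summable_on_cmult_right[OF s, of "8 / (2 * d) ^ 3"] by (simp add: case_prod_unfold)
  then have "(\<lambda>x. 1 / (1 + norm (?h x)) ^ k) summable_on (UNIV \<times> UNIV)"
  proof (rule summable_on_comparison_test)
    fix x :: "int \<times> int"
    obtain a b where x: "x = (a, b)" by fastforce
    define A B where "A = 1 + \<bar>real_of_int a\<bar>" and "B = 1 + \<bar>real_of_int b\<bar>"
    have AB: "A \<ge> 1" "B \<ge> 1" by (auto simp: A_def B_def)
    have "d * (A + B) / 2 \<le> d * (1 + (\<bar>real_of_int a\<bar> + \<bar>real_of_int b\<bar>))"
      using d by (auto simp: A_def B_def field_simps)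
    also have "\<dots> \<le> 1 + c * (\<bar>real_of_int a\<bar> + \<bar>real_of_int b\<bar>)"
      using d by (simp add: distrib_left mult_right_mono add_mono)
    also have "\<dots> \<le> 1 + norm (?h x)" using c(2)[of a b] by (simp add: x)
    finally have l: "d * (A + B) / 2 \<le> 1 + norm (?h x)" .
    \<comment> \<open>The arithmetic-geometric mean replaces the linear form by a product, so that
      the double series factors.\<close>
    have "sqrt (A * B) \<le> (A + B) / 2" using arith_geo_mean_sqrt[of A B] AB by auto
    then have "d * sqrt (A * B) \<le> 1 + norm (?h x)" using l d
      by (smt (verit, best) mult_left_mono times_divide_eq_right)
    then have "(d * sqrt (A * B)) ^ 3 \<le> (1 + norm (?h x)) ^ 3"
      using d AB by (intro power_mono) auto
    also have "\<dots> \<le> (1 + norm (?h x)) ^ k" using k by (intro power_increasing) auto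
    finally have *: "(d * sqrt (A * B)) ^ 3 \<le> (1 + norm (?h x)) ^ k" .
    have pos: "0 < (d * sqrt (A * B)) ^ 3" using d AB by simp
    have p: "?f a = 1 / (sqrt A) ^ 3" "?f b = 1 / (sqrt B) ^ 3"
      unfolding A_def[symmetric] B_def[symmetric] using AB
        powr_minus_three_halves[of A] powr_minus_three_halves[of B] by simp_all
    have "1 / (1 + norm (?h x)) ^ k \<le> 1 / (d * sqrt (A * B)) ^ 3"
      using * pos by (intro divide_left_mono mult_pos_pos) linarith+
    also have "\<dots> = 8 / (2 * d) ^ 3 * (?f a * ?f b)"
      unfolding p by (simp add: power_mult_distrib real_sqrt_mult)
    finally show "1 / (1 + norm (?h x)) ^ k \<le> (case x of (a, b) \<Rightarrow> (8 / (2 * d) ^ 3) * (?f a * ?f b))"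
      by (simp add: x)
  qed (auto simp: case_prod_unfold)
  moreover have inj: "inj_on ?h (UNIV \<times> UNIV)"
  proof (rule inj_onI, clarify)
    fix a b a' b' :: int
    assume "of_int a * w1 + of_int b * w2 = of_int a' * w1 + of_int b' * w2"
    then show "a = a' \<and> b = b'"
      using coords_unique[of "real_of_int a" "real_of_int b" "real_of_int a'" "real_of_int b'"] by simp
  qed
  moreover have L: "L = ?h ` (UNIV \<times> UNIV)" by (auto simp: zspan_def image_def)
  ultimately show ?thesis unfolding L by (subst summable_on_reindex) (simp_all add: comp_def)
qed

text \<open>Lattice points beyond \<open>B\<close> are at distance at least half of
  \<open>1 + norm w\<close> by the triangle inequality; those closer are at distance at least
  \<open>r\<close>. One constant \<open>K\<close> covers both ranges.\<close>

lemma far_bound: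
  assumes "X \<subseteq> L" "z0 \<notin> X"
  obtains r K where "r > 0" "K > 0" "\<And>z w. z \<in> cball z0 r \<Longrightarrow> w \<in> X \<Longrightarrow> K * (1 + norm w) \<le> norm (z - w)"
proof -
  have "open (- X)" using closed_subset_L[OF assms(1)] by auto
  then obtain e where e: "e > 0" "ball z0 e \<subseteq> - X" using assms(2) by (meson ComplI open_contains_ball)
  define r where "r = e / 2"
  define B where "B = 2 * (norm z0 + r) + 2"
  have r: "r > 0" using e by (simp add: r_def)
  have B: "B \<ge> 2" using r by (simp add: B_def)
  then have B: "B > 0" "B \<ge> 2" by auto
  define K where "K = min (1/2) (r / B)"
  have K: "K > 0" "K \<le> 1/2" "K * B \<le> r" using r B by (auto simp: K_def min_def field_simps)
  show thesis
  proof (rule that[OF r K(1)])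
    fix z w assume z: "z \<in> cball z0 r" and w: "w \<in> X"
    have zz: "norm (z - z0) \<le> r" using z by (simp add: dist_norm norm_minus_commute)
    have "w \<notin> ball z0 e" using e w by auto
    then have "e \<le> norm (z0 - w)" by (simp add: dist_norm)
    then have 1: "r \<le> norm (z - w)"
      using zz norm_triangle_ineq[of "z0 - z" "z - w"] by (simp add: r_def norm_minus_commute)
    show "K * (1 + norm w) \<le> norm (z - w)"
    proof (cases "1 + norm w \<le> B")
      case True
      then have "K * (1 + norm w) \<le> K * B" using K by (intro mult_left_mono) auto
      then show ?thesis using K 1 by linarith
    next
      case False
      have "norm z \<le> norm z0 + r" using zz norm_triangle_ineq[of z0 "z - z0"] by simp
      then have "norm w - (norm z0 + r) \<le> norm (z - w)"
        using norm_triangle_ineq2[of w z] by (simp add: norm_minus_commute)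
      then have "(1 + norm w) / 2 \<le> norm (z - w)" using False by (simp add: B_def)
      moreover have "K * (1 + norm w) \<le> 1/2 * (1 + norm w)" using K by (intro mult_right_mono) auto
      ultimately show ?thesis by simp
    qed
  qed
qed

text \<open>For \<open>k \<ge> 3\<close>, multiplying \<open>T L k\<close> by (-1)^k (k-1)! gives
  the derivative of order k - 2 of the Weierstrass function; with \<open>L\<close> replaced by
  \<open>L - {0}\<close> one gets the same derivative of its regular part at 0.\<close>

definition T :: "complex set \<Rightarrow> nat \<Rightarrow> complex \<Rightarrow> complex" where
  "T X k z = (\<Sum>\<^sub>\<infinity>w\<in>X. 1 / (z - w) ^ k)"

lemma T_bound:
  assumes "X \<subseteq> L" "z0 \<notin> X" 
  obtains r M where "r > 0" "M > 0" "cball z0 r \<inter> X = {}"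
    "\<And>z w k. z \<in> cball z0 r \<Longrightarrow> w \<in> X \<Longrightarrow> norm (1 / (z - w) ^ k) \<le> M ^ k * (1 / (1 + norm w) ^ k)"
proof -
  obtain r K where K: "r > 0" "K > 0" "\<And>z w. z \<in> cball z0 r \<Longrightarrow> w \<in> X \<Longrightarrow> K * (1 + norm w) \<le> norm (z - w)"
    using far_bound[OF assms] by blast
  show thesis
  proof (rule that[of r "1 / K"])
    show "r > 0" "1 / K > 0" using K by auto
    have "norm (z - w) > 0" if "z \<in> cball z0 r" "w \<in> X" for z w
      using K(3)[OF that] K(2) by (smt (verit) mult_pos_pos norm_ge_zero)
    then show "cball z0 r \<inter> X = {}" by fastforce
    fix z w k assume zw: "z \<in> cball z0 r" "w \<in> X"
    have "0 < K * (1 + norm w)" using K by (simp add: add_pos_nonneg)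
    moreover have "(K * (1 + norm w)) ^ k \<le> norm (z - w) ^ k"
      using K(3)[OF zw] K(2) by (intro power_mono) (auto simp: )
    moreover have "0 < (K * (1 + norm w)) ^ k" using \<open>0 < K * (1 + norm w)\<close> by (rule zero_less_power)
    ultimately have "1 / norm (z - w) ^ k \<le> 1 / (K * (1 + norm w)) ^ k"
      by (intro divide_left_mono mult_pos_pos) linarith+
    then show "norm (1 / (z - w) ^ k) \<le> (1 / K) ^ k * (1 / (1 + norm w) ^ k)"
      by (simp only: norm_divide norm_power power_mult_distrib power_divide norm_one) simp
  qed
qed

lemma T_summable:
  assumes "X \<subseteq> L" "z \<notin> X" "k \<ge> 3"
  shows "(\<lambda>w. norm (1 / (z - w) ^ k)) summable_on X"
proof -
  obtain r M where M0: "r > 0" "M > 0" "cball z r \<inter> X = {}" "\<And>z' w k. z' \<in> cball z r \<Longrightarrow> w \<in> X \<Longrightarrow> norm (1 / (z' - w) ^ k) \<le> M ^ k * (1 / (1 + norm w) ^ k)"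
    by (rule T_bound[OF assms(1,2)]) blast
  have "(\<lambda>w. M ^ k * (1 / (1 + norm w) ^ k)) summable_on X"
    by (intro summable_on_cmult_right summable_on_subset_banach[OF summable_L[OF assms(3)] assms(1)])
  then show ?thesis
  proof (rule summable_on_comparison_test)
    fix w assume w: "w \<in> X"
    have zc: "z \<in> cball z r" using M0(1) by simp
    show "norm (1 / (z - w) ^ k) \<le> M ^ k * (1 / (1 + norm w) ^ k)" by (rule M0(4)[OF zc w])
  qed simp
qed

lemma T_deriv:
  assumes "X \<subseteq> L" "z \<notin> X" "k \<ge> 3"
  shows "(T X k has_field_derivative - of_nat k * T X (Suc k) z) (at z)"
proof -
  obtain r M where M: "r > 0" "M > 0" "cball z r \<inter> X = {}" "\<And>z' w k. z' \<in> cball z r \<Longrightarrow> w \<in> X \<Longrightarrow> norm (1 / (z' - w) ^ k) \<le> M ^ k * (1 / (1 + norm w) ^ k)"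
    by (rule T_bound[OF assms(1,2)]) blast
  have "((\<lambda>z. \<Sum>\<^sub>\<infinity>w\<in>X. 1 / (z - w) ^ k) has_field_derivative (\<Sum>\<^sub>\<infinity>w\<in>X. - of_nat k * (1 / (z - w) ^ Suc k))) (at z)"
  proof (rule has_field_derivative_infsum[where r = r and M = "\<lambda>w. M ^ k * (1 / (1 + norm w) ^ k)"])
    show "(\<lambda>w. M ^ k * (1 / (1 + norm w) ^ k)) summable_on X"
      by (intro summable_on_cmult_right summable_on_subset_banach[OF summable_L[OF assms(3)] assms(1)])
    fix w z' assume w: "w \<in> X" "z' \<in> cball z r"
    have "z' \<noteq> w" using M(3) w by auto
    then have nz: "z' - w \<noteq> 0" by simp
    obtain j where k: "k = Suc j" using assms(3) by (cases k) auto
    have "((\<lambda>z. 1 / (z - w) ^ k) has_field_derivative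
        (0 * (z' - w) ^ k - 1 * (of_nat k * (z' - w) ^ j)) / ((z' - w) ^ k * (z' - w) ^ k)) (at z')"
    proof (intro DERIV_divide)
      have "((\<lambda>z. z - w) has_field_derivative 1) (at z')"
        by (auto intro!: derivative_eq_intros)
      from DERIV_power_Suc[OF this, of j] show "((\<lambda>z. (z - w) ^ k) has_field_derivative of_nat k * (z' - w) ^ j) (at z')"
        by (simp add: k)
    qed (use nz in auto)
    also have "(0 * (z' - w) ^ k - 1 * (of_nat k * (z' - w) ^ j)) / ((z' - w) ^ k * (z' - w) ^ k)
        = - of_nat k * (1 / (z' - w) ^ Suc k)"
      using nz by (simp add: k divide_simps)
    finally show "((\<lambda>z. 1 / (z - w) ^ k) has_field_derivative - of_nat k * (1 / (z' - w) ^ Suc k)) (at z')" .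
  next
    fix w z' assume "w \<in> X" "z' \<in> cball z r"
    then show "norm (1 / (z' - w) ^ k) \<le> M ^ k * (1 / (1 + norm w) ^ k)" by (intro M(4))
  qed (rule M(1))
  then show ?thesis unfolding T_def[abs_def] infsum_cmult_right' .
qed
end

lemma higher_deriv_chain:
  assumes "open S" "\<And>k z. z \<in> S \<Longrightarrow> (D k has_field_derivative D (Suc k) z) (at z)" "z \<in> S"
  shows "(deriv ^^ k) (D 0) z = D k z"
  using assms(3)
proof (induction k arbitrary: z)
  case (Suc k)
  have "eventually (\<lambda>w. (deriv ^^ k) (D 0) w = D k w) (nhds z)"
    using Suc assms(1) by (auto simp: eventually_nhds)
  then have "deriv ((deriv ^^ k) (D 0)) z = deriv (D k) z" by (rule deriv_cong_ev) simp
  also have "\<dots> = D (Suc k) z" using assms(2)[OF Suc.prems] by (rule DERIV_imp_deriv)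
  finally show ?case by simp
qed simp

text \<open>With all derivatives supplied as an explicit chain, a Laurent computation at a pole
  becomes a polynomial identity with a holomorphic remainder \<open>m\<close>.\<close>

lemma taylor_chain:
  assumes D: "\<And>k z. z \<in> ball a r \<Longrightarrow> (D k has_field_derivative D (Suc k) z) (at z)" and r: "r > 0"
  obtains m where "m holomorphic_on ball 0 r"
    "\<And>u. u \<in> ball 0 r \<Longrightarrow> D 0 (a + u) = (\<Sum>k<n. D k a / fact k * u ^ k) + u ^ n * m u"
proof -
  let ?c = "\<lambda>k. D k a / fact k"
  have hol: "D 0 holomorphic_on ball a r"
    using D[of _ 0] by (meson field_differentiable_at_within field_differentiable_def holomorphic_on_def)
  have c: "(deriv ^^ k) (D 0) a = D k a" for k
    using higher_deriv_chain[of "ball a r" D a k] D r by simp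
  have s: "(\<lambda>k. ?c k * u ^ k) sums D 0 (a + u)" if "u \<in> ball 0 r" for u
    using holomorphic_power_series[OF hol, of "a + u"] that by (simp add: c dist_norm)
  \<comment> \<open>The value at 0 is the next Taylor coefficient, which makes \<open>m\<close> the
    sum of the shifted power series everywhere in the ball.\<close>
  define m where "m = (\<lambda>u. if u = 0 then ?c n else (D 0 (a + u) - (\<Sum>k<n. ?c k * u ^ k)) / u ^ n)"
  have ms: "(\<lambda>k. ?c (k + n) * (u - 0) ^ k) sums m u" if u: "u \<in> ball 0 r" for u
  proof (cases "u = 0")
    case True
    have "(\<lambda>k. ?c (k + n) * 0 ^ k) sums ?c n"
      using powser_sums_zero[of "\<lambda>k. ?c (k + n)"] by simp
    then show ?thesis using True by (simp add: m_def)
  next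
    case False
    have s1: "(\<lambda>k. ?c (k + n) * u ^ (k + n)) sums (D 0 (a + u) - (\<Sum>k<n. ?c k * u ^ k))"
      using sums_split_initial_segment[OF s[OF u], of n] by simp
    then have "(\<lambda>k. ?c (k + n) * u ^ (k + n) / u ^ n) sums m u"
      using sums_divide[OF s1, of "u ^ n"] False unfolding m_def by simp
    then show ?thesis using False by (simp add: power_add)
  qed
  show thesis
  proof (rule that)
    show "m holomorphic_on ball 0 r" by (rule power_series_holomorphic[OF ms])
    fix u :: complex assume u: "u \<in> ball 0 r"
    show "D 0 (a + u) = (\<Sum>k<n. ?c k * u ^ k) + u ^ n * m u"
    proof (cases "u = 0")
      case True
      then have "D 0 (a + u) = D 0 a" by simp
      moreover have "(\<Sum>k<n. ?c k * u ^ k) + u ^ n * m u = D 0 a"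
        using True by (cases n) (simp_all add: m_def sum.lessThan_Suc_shift)
      ultimately show ?thesis by simp
    qed (simp add: m_def)
  qed
qed

section \<open>The Weierstrass function: derivative, parity, periods\<close>

context cx_lattice begin

abbreviation L0 :: "complex set" where "L0 \<equiv> L - {0}"
abbreviation G :: "nat \<Rightarrow> complex" where "G k \<equiv> eisenstein_sum k L"

text \<open>The Weierstrass function without its pole at 0. Keeping it apart leaves a function that
  is holomorphic near 0 and can be expanded there.\<close>

definition R :: "complex \<Rightarrow> complex" where
  "R z = (\<Sum>\<^sub>\<infinity>w\<in>L0. 1 / (z - w)\<^sup>2 - 1 / w\<^sup>2)"
definition wp :: "complex \<Rightarrow> complex" where "wp z = 1 / z\<^sup>2 + R z"
definition wp' :: "complex \<Rightarrow> complex" where "wp' z = - 2 * T L 3 z"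

lemma L0_sub: "L0 \<subseteq> L" by auto

lemma isolated_L: "\<exists>e>0. L \<inter> ball z e \<subseteq> {z}"
proof -
  have "open (- (L - {z}))" using closed_subset_L[of "L - {z}"] by (simp only: open_closed double_complement) auto
  moreover have "z \<in> - (L - {z})" by simp
  ultimately obtain e where "e > 0" "ball z e \<subseteq> - (L - {z})" by (meson open_contains_ball)
  then show ?thesis by blast
qed

lemma R_summable_deriv:
  assumes "z \<notin> L0"
  shows "(R has_field_derivative - 2 * T L0 3 z) (at z)"
proof -
  obtain r M where M: "r > 0" "M > 0" "cball z r \<inter> L0 = {}"
    "\<And>z' w k. z' \<in> cball z r \<Longrightarrow> w \<in> L0 \<Longrightarrow> norm (1 / (z' - w) ^ k) \<le> M ^ k * (1 / (1 + norm w) ^ k)"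
    by (rule T_bound[OF L0_sub assms]) blast
  have "0 \<notin> L0" by simp
  then obtain r0 M0 where M0: "r0 > 0" "M0 > 0" "cball 0 r0 \<inter> L0 = {}"
    "\<And>z' w k. z' \<in> cball 0 r0 \<Longrightarrow> w \<in> L0 \<Longrightarrow> norm (1 / (z' - w) ^ k) \<le> M0 ^ k * (1 / (1 + norm w) ^ k)"
    using T_bound[OF L0_sub] by metis
  have M0': "norm (1 / w ^ k) \<le> M0 ^ k * (1 / (1 + norm w) ^ k)" if "w \<in> L0" for w k
    using M0(4)[of 0 w k] that M0(1) by (simp add: norm_divide norm_power)
  define B where "B = norm z + r"
  have B: "B \<ge> 0" using M(1) by (simp add: B_def)
  define C where "C = B * (2 + B) * M\<^sup>2 * M0\<^sup>2"
  have "((\<lambda>z. \<Sum>\<^sub>\<infinity>w\<in>L0. 1 / (z - w)\<^sup>2 - 1 / w\<^sup>2) has_field_derivative (\<Sum>\<^sub>\<infinity>w\<in>L0. - 2 * (1 / (z - w) ^ 3))) (at z)"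
  proof (rule has_field_derivative_infsum[where r = r and M = "\<lambda>w. C * (1 / (1 + norm w) ^ 3)"])
    show "(\<lambda>w. C * (1 / (1 + norm w) ^ 3)) summable_on L0"
      by (intro summable_on_cmult_right summable_on_subset_banach[OF summable_L L0_sub]) simp
    fix w z' assume w: "w \<in> L0" "z' \<in> cball z r"
    have nz: "z' - w \<noteq> 0" using M(3) w by auto
    show "((\<lambda>z. 1 / (z - w)\<^sup>2 - 1 / w\<^sup>2) has_field_derivative - 2 * (1 / (z' - w) ^ 3)) (at z')"
    proof -
      have "((\<lambda>z. 1 / (z - w)\<^sup>2 - 1 / w\<^sup>2) has_field_derivative
          (0 * (z' - w)\<^sup>2 - 1 * (2 * (z' - w))) / ((z' - w)\<^sup>2 * (z' - w)\<^sup>2) - 0) (at z')"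
        using nz by (intro DERIV_divide DERIV_diff DERIV_const) (auto intro!: derivative_eq_intros)
      also have "(0 * (z' - w)\<^sup>2 - 1 * (2 * (z' - w))) / ((z' - w)\<^sup>2 * (z' - w)\<^sup>2) - 0 = - 2 * (1 / (z' - w) ^ 3)"
        using nz by (simp add: divide_simps power2_eq_square power3_eq_cube)
      finally show ?thesis .
    qed
    have wn: "w \<noteq> 0" using w by auto
    \<comment> \<open>The numerator is only linear in \<open>w\<close>, so the difference decays
      like |w|^(-3), which is summable over the lattice.\<close>
    have "1 / (z' - w)\<^sup>2 - 1 / w\<^sup>2 = z' * (2 * w - z') * (1 / (z' - w) ^ 2) * (1 / w ^ 2)"
      using nz wn by (simp add: divide_simps) (simp add: power2_eq_square algebra_simps)
    then have "norm (1 / (z' - w)\<^sup>2 - 1 / w\<^sup>2) = norm z' * norm (2 * w - z') * norm (1 / (z' - w) ^ 2) * norm (1 / w ^ 2)"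
      by (simp only: norm_mult)
    also have "\<dots> \<le> B * ((2 + B) * (1 + norm w)) * (M ^ 2 * (1 / (1 + norm w) ^ 2)) * (M0 ^ 2 * (1 / (1 + norm w) ^ 2))"
    proof (intro mult_mono M(4)[OF w(2,1)] M0'[OF w(1)])
      show zB: "norm z' \<le> B" using w(2) norm_triangle_ineq[of z "z' - z"] by (simp add: B_def dist_norm norm_minus_commute)
      have "norm (2 * w - z') \<le> 2 * norm w + B"
        using norm_triangle_ineq4[of "2 * w" z'] zB by (simp add: norm_mult)
      also have "\<dots> \<le> (2 + B) * (1 + norm w)" using B by (simp add: algebra_simps)
      finally show "norm (2 * w - z') \<le> (2 + B) * (1 + norm w)" .
    qed (use B M M0 in auto)
    also have "\<dots> = C * (1 / (1 + norm w) ^ 3)"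
    proof -
      have "1 + norm w \<noteq> 0" by (smt (verit) norm_ge_zero)
      then show ?thesis unfolding C_def by (simp add: divide_simps power2_eq_square power3_eq_cube)
    qed
    finally show "norm (1 / (z' - w)\<^sup>2 - 1 / w\<^sup>2) \<le> C * (1 / (1 + norm w) ^ 3)" .
  qed (use M in auto)
  then show ?thesis unfolding T_def R_def[abs_def] infsum_cmult_right' .
qed

lemma T_L_split: "z \<notin> L \<Longrightarrow> k \<ge> 3 \<Longrightarrow> T L k z = 1 / z ^ k + T L0 k z"
proof -
  assume z: "z \<notin> L" "k \<ge> 3"
  then have "z \<notin> L0" by simp
  then have "(\<lambda>w. 1 / (z - w) ^ k) summable_on L0"
    by (rule abs_summable_summable[OF T_summable[OF L0_sub _ z(2)]])
  then have "infsum (\<lambda>w. 1 / (z - w) ^ k) (insert 0 L0) = 1 / (z - 0) ^ k + infsum (\<lambda>w. 1 / (z - w) ^ k) L0"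
    by (rule infsum_insert) simp
  moreover have "insert 0 L0 = L" by auto
  ultimately show ?thesis unfolding T_def by simp
qed

lemma wp_deriv: assumes "z \<notin> L" shows "(wp has_field_derivative wp' z) (at z)"
proof -
  have z: "z \<noteq> 0" using assms by auto
  have "((\<lambda>z. 1 / z\<^sup>2 + R z) has_field_derivative (0 * z\<^sup>2 - 1 * (2 * z)) / (z\<^sup>2 * z\<^sup>2) + - 2 * T L0 3 z) (at z)"
    using assms z by (intro DERIV_add DERIV_divide R_summable_deriv) (auto intro!: derivative_eq_intros)
  also have "(0 * z\<^sup>2 - 1 * (2 * z)) / (z\<^sup>2 * z\<^sup>2) + - 2 * T L0 3 z = wp' z"
    unfolding wp'_def T_L_split[OF assms, of 3, simplified] using z
    by (simp add: divide_simps power2_eq_square power3_eq_cube algebra_simps)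
  finally show ?thesis unfolding wp_def[abs_def] .
qed

lemma T_periodic: assumes "l \<in> L" shows "T L k (z + l) = T L k z"
proof -
  have "bij_betw (\<lambda>w. w + l) L L"
    by (rule bij_betwI[where g = "\<lambda>w. w - l"]) (use assms L_add L_diff in auto)
  from infsum_reindex_bij_betw[OF this, of "\<lambda>w. 1 / (z + l - w) ^ k"] show ?thesis
    by (simp add: T_def)
qed

lemma bij_uminus: "bij_betw uminus L L" "bij_betw uminus L0 L0"
proof -
  show "bij_betw uminus L L" by (rule bij_betwI[where g = uminus]) auto
  show "bij_betw uminus L0 L0" by (rule bij_betwI[where g = uminus]) auto
qed

lemma T_minus: "X = L \<or> X = L0 \<Longrightarrow> T X k (- z) = (-1) ^ k * T X k z"
proof -
  assume "X = L \<or> X = L0"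
  then have "bij_betw uminus X X" using bij_uminus by auto
  from infsum_reindex_bij_betw[OF this, of "\<lambda>w. 1 / (- z - w) ^ k"]
  have "T X k (- z) = (\<Sum>\<^sub>\<infinity>w\<in>X. 1 / (- z + w) ^ k)" by (simp add: T_def)
  also have "\<dots> = (\<Sum>\<^sub>\<infinity>w\<in>X. (-1) ^ k * (1 / (z - w) ^ k))"
  proof (intro infsum_cong)
    fix w
    have "(- z + w) ^ k = (-1) ^ k * (z - w) ^ k"
      by (simp flip: power_mult_distrib)
    then show "1 / (- z + w) ^ k = (-1) ^ k * (1 / (z - w) ^ k)"
      by (cases "even k") auto
  qed
  finally show ?thesis unfolding T_def infsum_cmult_right' .
qed

lemma R_even: "R (- z) = R z"
proof -
  from infsum_reindex_bij_betw[OF bij_uminus(2), of "\<lambda>w. 1 / (- z - w)\<^sup>2 - 1 / w\<^sup>2"]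
  have "R (- z) = (\<Sum>\<^sub>\<infinity>w\<in>L0. 1 / (- z + w)\<^sup>2 - 1 / w\<^sup>2)" by (simp add: R_def)
  also have "(\<lambda>w. 1 / (- z + w)\<^sup>2 - 1 / w\<^sup>2) = (\<lambda>w. 1 / (z - w)\<^sup>2 - 1 / w\<^sup>2)"
    by (simp add: power2_commute)
  finally show ?thesis by (simp add: R_def)
qed

lemma wp_even: "wp (- z) = wp z" by (simp add: wp_def R_even)
lemma wp'_odd: "wp' (- z) = - wp' z" by (simp add: wp'_def T_minus)

lemma half_notin: "w1 / 2 \<notin> L" "w2 / 2 \<notin> L"
proof -
  show "w1 / 2 \<notin> L"
  proof
    assume "w1 / 2 \<in> L"
    then obtain a b where "w1 / 2 = of_int a * w1 + of_int b * w2" by (auto simp: zspan_iff)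
    then have "1/2 = real_of_int a" using coords_unique(1)[of "1/2" 0 "of_int a" "of_int b"] by simp
    then have "real_of_int (2 * a) = real_of_int 1" by simp
    then have "2 * a = 1" by (simp only: of_int_eq_iff)
    then show False by presburger
  qed
  show "w2 / 2 \<notin> L"
  proof
    assume "w2 / 2 \<in> L"
    then obtain a b where "w2 / 2 = of_int a * w1 + of_int b * w2" by (auto simp: zspan_iff)
    then have "1/2 = real_of_int b" using coords_unique(2)[of 0 "1/2" "of_int a" "of_int b"] by simp
    then have "real_of_int (2 * b) = real_of_int 1" by simp
    then have "2 * b = 1" by (simp only: of_int_eq_iff)
    then show False by presburger
  qed
qed

text \<open>The derivative is periodic, so the increment under \<open>w\<close> is constant on the
  connected complement of \<open>L\<close>. At \<open>- (w / 2)\<close>, which must avoid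
  \<open>L\<close>, evenness shows that it is 0.\<close>

lemma wp_periodic_gen:
  assumes "w \<in> L" "w / 2 \<notin> L" "z \<notin> L" shows "wp (z + w) = wp z"
proof -
  let ?f = "\<lambda>z. wp (z + w) - wp z"
  have d: "(?f has_field_derivative 0) (at z)" if z: "z \<in> - L" for z
  proof -
    have zw: "z + w \<notin> L" using z L_add_iff[OF assms(1)] by auto
    have "((\<lambda>z. wp (z + w)) has_field_derivative wp' (z + w)) (at z)"
      using DERIV_at_within_shift[THEN iffD1] wp_deriv[OF zw] by (simp add: DERIV_shift)
    then have "(?f has_field_derivative wp' (z + w) - wp' z) (at z)"
      using wp_deriv z by (intro DERIV_diff) auto
    then show ?thesis by (simp add: wp'_def T_periodic[OF assms(1)])
  qed
  have "?f constant_on - L"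
    by (rule has_field_derivative_0_imp_constant_on[OF _ connected_compl_L open_compl_L]) (use d in auto)
  then obtain c where c: "\<And>z. z \<in> - L \<Longrightarrow> ?f z = c" unfolding constant_on_def by blast
  have "- (w / 2) \<in> - L" using assms(2) by simp
  from c[OF this] have "c = 0" by (simp add: wp_even)
  then show ?thesis using c[of z] assms(3) by simp
qed

lemma wp_periodic: assumes "l \<in> L" "z \<notin> L" shows "wp (z + l) = wp z"
proof -
  have 1: "wp (z + of_nat n * w) = wp z" if "w \<in> L" "w / 2 \<notin> L" "z \<notin> L" for n w z
  proof (induction n)
    case (Suc n)
    have "of_nat n * w \<in> L" using L_mult[OF that(1), of "int n"] by simp
    then have "wp (z + of_nat n * w + w) = wp (z + of_nat n * w)"
      using that L_add_iff by (intro wp_periodic_gen) auto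
    then show ?case using Suc by (simp add: algebra_simps)
  qed simp
  have 2: "wp (z + of_int k * w) = wp z" if w: "w \<in> L" "w / 2 \<notin> L" "z \<notin> L" for k w z
  proof (cases k rule: int_cases2)
    case (nonneg n)
    then show ?thesis using 1[OF w] by simp
  next
    case (nonpos n)
    have "z + of_int k * w \<notin> L" using w L_add_iff[OF L_mult[OF w(1)]] by auto
    from 1[OF w(1,2) this, of n] show ?thesis using nonpos by simp
  qed
  obtain a b where l: "l = of_int a * w1 + of_int b * w2" using assms(1) by (auto simp: zspan_iff)
  have "z + of_int a * w1 \<notin> L" using assms(2) L_add_iff[OF L_mult[OF L_w1]] by auto
  then show ?thesis
    using 2[OF L_w2 half_notin(2), of "z + of_int a * w1" b] 2[OF L_w1 half_notin(1) assms(2), of a]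
    by (simp add: l add.assoc)
qed

end

section \<open>Liouville's theorem and the differential equations\<close>

context cx_lattice begin

lemma real_coords: obtains a b :: real where "z = of_real a * w1 + of_real b * w2"
proof -
  define t where "t = w2 / w1"
  define b where "b = Im (z / w1) / Im t"
  define a where "a = Re (z / w1) - b * Re t"
  have "Im t \<noteq> 0" using nonreal by (simp add: t_def)
  then have "z / w1 = of_real a + of_real b * t" by (simp add: complex_eq_iff a_def b_def)
  then have "z = of_real a * w1 + of_real b * (t * w1)" using w1_nz by (simp add: field_simps)
  then show thesis using that w1_nz by (simp add: t_def)
qed

text \<open>All singularities are removable, so \<open>f\<close> extends to an entire function
  \<open>h\<close>; its values are already taken on a compact period parallelogram, so it is
  constant. The constant is read off at the single point \<open>s0\<close>, while at the other
  points of \<open>S\<close> only the existence of a limit has to be known.\<close>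

lemma elliptic_const:
  assumes iso: "\<And>z. \<exists>e>0. S \<inter> ball z e \<subseteq> {z}"
    and S: "\<And>z l. l \<in> L \<Longrightarrow> z + l \<in> S \<longleftrightarrow> z \<in> S"
    and per: "\<And>z l. z \<notin> S \<Longrightarrow> l \<in> L \<Longrightarrow> f (z + l) = f z"
    and diff: "\<And>z. z \<notin> S \<Longrightarrow> f field_differentiable (at z)"
    and lims: "\<And>s. s \<in> S \<Longrightarrow> \<exists>l. (f \<longlongrightarrow> l) (at s)"
    and s0: "s0 \<in> S" "(f \<longlongrightarrow> c) (at s0)"
    and z: "z \<notin> S"
  shows "f z = c"
proof -
  define h where "h z = (if z \<in> S then Lim (at z) f else f z)" for z
  have fh: "\<forall>\<^sub>F u in at z. f u = h u" for z
  proof -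
    obtain e where e: "e > 0" "S \<inter> ball z e \<subseteq> {z}" using iso by blast
    have "\<forall>\<^sub>F u in at z. u \<in> ball z e - {z}" using e(1) by (intro eventually_at_in_open) auto
    then show ?thesis by eventually_elim (use e(2) in \<open>auto simp: h_def\<close>)
  qed
  have lim: "(f \<longlongrightarrow> h z) (at z)" for z
  proof (cases "z \<in> S")
    case True
    then obtain l where l: "(f \<longlongrightarrow> l) (at z)" using lims by blast
    then have "Lim (at z) f = l" by (intro tendsto_Lim) auto
    then show ?thesis using l True by (simp add: h_def)
  next
    case False
    then have "isCont f z" using diff field_differentiable_imp_continuous_at by blast
    then show ?thesis using False by (simp add: h_def isCont_def)
  qed
  have lim_h: "(h \<longlongrightarrow> h z) (at z)" for z
    using Lim_transform_eventually[OF lim fh] .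
  have hol: "h holomorphic_on UNIV"
  proof -
    have "\<exists>e>0. h holomorphic_on ball z e" for z
    proof -
      obtain e where e: "e > 0" "S \<inter> ball z e \<subseteq> {z}" using iso by blast
      have "h holomorphic_on ball z e"
      proof (rule no_isolated_singularity'[where K = "{z}"])
        show "h holomorphic_on ball z e - {z}"
        proof (rule holomorphic_transform[where f = f])
          show "f holomorphic_on ball z e - {z}"
            unfolding holomorphic_on_def using e(2) diff field_differentiable_at_within by blast
        qed (use e(2) in \<open>auto simp: h_def\<close>)
        show "(h \<longlongrightarrow> h w) (at w within ball z e)" if "w \<in> {z}" for w
          using lim_h by (rule tendsto_within_subset) simp
      qed auto
      then show ?thesis using e(1) by blast
    qed
    then have "h field_differentiable at z" for z
      by (meson centre_in_ball holomorphic_on_imp_differentiable_at open_ball)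
    then show ?thesis by (simp add: holomorphic_on_def)
  qed
  have cont: "continuous_on UNIV h" using hol holomorphic_on_imp_continuous_on by blast
  have hper: "h (z + l) = h z" if l: "l \<in> L" for z l
  proof -
    obtain e where e: "e > 0" "S \<inter> ball z e \<subseteq> {z}" using iso by blast
    have "(\<lambda>u. h (u + l)) \<midarrow>z\<rightarrow> h (z + l)" using LIM_offset[OF lim_h[of "z + l"], of l] by simp
    moreover have "\<forall>\<^sub>F u in at z. h (u + l) = h u"
    proof -
      have "\<forall>\<^sub>F u in at z. u \<in> ball z e - {z}" using e(1) by (intro eventually_at_in_open) auto
      then show ?thesis
      proof eventually_elim
        case (elim u)
        then have "u \<notin> S" using e(2) by auto
        then show ?case using S[OF l] per[OF _ l] by (simp add: h_def)
      qed
    qed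
    ultimately have "h \<midarrow>z\<rightarrow> h (z + l)" by (rule Lim_transform_eventually)
    then show ?thesis using lim_h[of z] by (metis LIM_unique)
  qed
  define P where "P = (\<lambda>(a::real, b::real). h (of_real a * w1 + of_real b * w2)) ` ({0..1} \<times> {0..1})"
  have "compact P" unfolding P_def case_prod_unfold
    by (intro compact_continuous_image continuous_intros compact_Times continuous_on_compose2[OF cont]) auto
  moreover have "range h \<subseteq> P"
  proof clarify
    fix z
    obtain a b :: real where ab: "z = of_real a * w1 + of_real b * w2" by (rule real_coords)
    define l where "l = of_int (- floor a) * w1 + of_int (- floor b) * w2"
    have "l \<in> L" unfolding zspan_iff l_def by blast
    have "z + l = of_real (frac a) * w1 + of_real (frac b) * w2"
      by (simp add: ab l_def frac_def algebra_simps)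
    then have "h z = h (of_real (frac a) * w1 + of_real (frac b) * w2)" using hper[OF \<open>l \<in> L\<close>, of z] by simp
    then show "h z \<in> P" unfolding P_def
      by (intro image_eqI[where x = "(frac a, frac b)"]) (auto simp: less_imp_le frac_lt_1)
  qed
  ultimately have "bounded (range h)" using bounded_subset compact_imp_bounded by blast
  then obtain C where C: "\<And>z. h z = C"
    using Liouville_theorem[OF hol] by (auto simp: constant_on_def)
  have "(f \<longlongrightarrow> C) (at s0)" using lim[of s0] C by simp
  then have "C = c" using s0(2) LIM_unique by blast
  then show ?thesis using C[of z] z by (simp add: h_def)
qed

lemma lim_translate:
  fixes f :: "complex \<Rightarrow> complex"
  assumes per: "\<And>z. z \<notin> S \<Longrightarrow> f (z + l) = f z" and iso: "\<exists>e>0. S \<inter> ball s e \<subseteq> {s}"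
    and lim: "(f \<longlongrightarrow> c) (at s)"
  shows "(f \<longlongrightarrow> c) (at (s + l))"
proof -
  obtain e where e: "e > 0" "S \<inter> ball s e \<subseteq> {s}" using iso by blast
  have "\<forall>\<^sub>F u in at s. u \<in> ball s e - {s}" using e(1) by (intro eventually_at_in_open) auto
  then have "\<forall>\<^sub>F u in at s. f u = f (u + l)"
  proof eventually_elim
    case (elim u)
    then have "u \<notin> S" using e(2) by auto
    then show ?case using per by simp
  qed
  then have "(\<lambda>u. f (u + l)) \<midarrow>s\<rightarrow> c" using lim by (rule Lim_transform_eventually[rotated])
  then show ?thesis using LIM_offset[of "\<lambda>u. f (u + l)" c s "- l"] by simp
qed

lemma elliptic_const_L:
  assumes per: "\<And>z l. z \<notin> L \<Longrightarrow> l \<in> L \<Longrightarrow> f (z + l) = f z"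
    and diff: "\<And>z. z \<notin> L \<Longrightarrow> f field_differentiable (at z)"
    and lim: "(f \<longlongrightarrow> c) (at 0)" and z: "z \<notin> L"
  shows "f z = c"
proof (rule elliptic_const[where S = L and ?s0.0 = 0 and f = f and z = z])
  fix s assume "s \<in> L"
  then show "\<exists>l. (f \<longlongrightarrow> l) (at s)" using lim_translate[of L f s, OF per isolated_L lim] by auto
qed (use assms isolated_L L_add_iff in auto)

text \<open>\<open>RD\<close> and \<open>WD\<close> are the chains fed to
  \<open>taylor_chain\<close>. Order 0 is a case of its own because the series behind
  \<open>T X 2\<close> does not converge absolutely.\<close>

definition RD :: "nat \<Rightarrow> complex \<Rightarrow> complex" where
  "RD k = (if k = 0 then R else (\<lambda>z. (-1) ^ k * fact (Suc k) * T L0 (k + 2) z))"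
definition WD :: "nat \<Rightarrow> complex \<Rightarrow> complex" where
  "WD k = (if k = 0 then wp else (\<lambda>z. (-1) ^ k * fact (Suc k) * T L (k + 2) z))"

lemma RD_deriv: "z \<notin> L0 \<Longrightarrow> (RD k has_field_derivative RD (Suc k) z) (at z)"
proof (cases k)
  case 0
  then show "z \<notin> L0 \<Longrightarrow> ?thesis" using R_summable_deriv[of z] by (simp add: RD_def numeral_3_eq_3)
next
  case (Suc j)
  assume z: "z \<notin> L0"
  have e: "RD (Suc j) = (\<lambda>z. (-1) ^ Suc j * fact (Suc (Suc j)) * T L0 (Suc j + 2) z)"
    unfolding RD_def by (simp only: nat.simps if_False)
  have "(RD (Suc j) has_field_derivative (-1) ^ Suc j * fact (Suc (Suc j)) * (- of_nat (Suc j + 2) * T L0 (Suc (Suc j + 2)) z)) (at z)"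
    unfolding e by (rule DERIV_cmult[OF T_deriv[OF L0_sub z]]) simp
  then show ?thesis by (simp add: RD_def Suc algebra_simps)
qed

lemma WD_deriv: "z \<notin> L \<Longrightarrow> (WD k has_field_derivative WD (Suc k) z) (at z)"
proof (cases k)
  case 0
  then show "z \<notin> L \<Longrightarrow> ?thesis" using wp_deriv[of z] by (simp add: WD_def wp'_def numeral_3_eq_3)
next
  case (Suc j)
  assume z: "z \<notin> L"
  have e: "WD (Suc j) = (\<lambda>z. (-1) ^ Suc j * fact (Suc (Suc j)) * T L (Suc j + 2) z)"
    unfolding WD_def by (simp only: nat.simps if_False)
  have "(WD (Suc j) has_field_derivative (-1) ^ Suc j * fact (Suc (Suc j)) * (- of_nat (Suc j + 2) * T L (Suc (Suc j + 2)) z)) (at z)"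
    unfolding e by (rule DERIV_cmult[OF T_deriv[OF subset_refl z]]) simp
  then show ?thesis by (simp add: WD_def Suc algebra_simps)
qed

lemma R_0: "R 0 = 0" by (simp add: R_def)

lemma T_L0_0: "T L0 k 0 = (-1) ^ k * G k"
proof -
  have "T L0 k 0 = (\<Sum>\<^sub>\<infinity>w\<in>L0. (-1) ^ k * (1 / w ^ k))"
    unfolding T_def
  proof (intro infsum_cong)
    fix w :: complex
    show "1 / (0 - w) ^ k = (-1) ^ k * (1 / w ^ k)" by (cases "even k") auto
  qed
  then show ?thesis unfolding infsum_cmult_right' eisenstein_sum_def .
qed

lemma G_odd: "odd k \<Longrightarrow> G k = 0"
proof -
  assume "odd k"
  then have "T L0 k 0 = - T L0 k 0" using T_minus[of L0 k 0] by (simp add: uminus_power_if)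
  then have "2 * T L0 k 0 = 0" by (simp only: mult_2) (metis add.right_inverse)
  then show ?thesis using T_L0_0[of k] by simp
qed

lemma RD_0: "k > 0 \<Longrightarrow> RD k 0 = fact (Suc k) * G (k + 2)"
  by (simp add: RD_def T_L0_0)

lemma ball_L0: obtains r where "r > 0" "ball 0 r \<inter> L0 = {}"
proof -
  obtain e where e: "e > 0" "L \<inter> ball 0 e \<subseteq> {0}" using isolated_L[of 0] by blast
  then have "ball 0 e \<inter> L0 = {}" by auto
  with e(1) show thesis by (rule that)
qed

text \<open>The Taylor coefficient of order k at 0 is (k + 1) G(k + 2), and the sums of odd weight
  vanish by symmetry.\<close>

lemma R_taylor:
  obtains r m where "r > 0" "m holomorphic_on ball 0 r" "ball 0 r \<inter> L0 = {}"
    "\<And>u. u \<in> ball 0 r \<Longrightarrow> R u = 3 * G 4 * u\<^sup>2 + 5 * G 6 * u ^ 4 + u ^ 6 * m u"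
proof -
  obtain r where r: "r > 0" "ball 0 r \<inter> L0 = {}" by (rule ball_L0) blast
  obtain m where m: "m holomorphic_on ball 0 r"
    "\<And>u. u \<in> ball 0 r \<Longrightarrow> RD 0 (0 + u) = (\<Sum>k<6. RD k 0 / fact k * u ^ k) + u ^ 6 * m u"
    using r by (rule_tac taylor_chain[of 0 r RD 6]) (auto intro!: RD_deriv)
  have z: "G (Suc (Suc (Suc 0))) = 0" "G (Suc (Suc (Suc (Suc (Suc 0))))) = 0"
    "G (Suc (Suc (Suc (Suc (Suc (Suc (Suc 0))))))) = 0"
    by (rule G_odd, simp)+
  have "(\<Sum>k<6. RD k 0 / fact k * u ^ k) = 3 * G 4 * u\<^sup>2 + 5 * G 6 * u ^ 4" for u
    by (simp add: eval_nat_numeral RD_0 z fact_reduce) (simp add: RD_def R_0)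
  then show thesis using that[OF r(1) m(1) r(2)] m(2) by (simp add: RD_def)
qed

lemma R'_taylor:
  obtains r m where "r > 0" "m holomorphic_on ball 0 r" "ball 0 r \<inter> L0 = {}"
    "\<And>u. u \<in> ball 0 r \<Longrightarrow> - 2 * T L0 3 u = 6 * G 4 * u + 20 * G 6 * u ^ 3 + u ^ 5 * m u"
proof -
  obtain r where r: "r > 0" "ball 0 r \<inter> L0 = {}" by (rule ball_L0) blast
  obtain m where m: "m holomorphic_on ball 0 r"
    "\<And>u. u \<in> ball 0 r \<Longrightarrow> RD (Suc 0) (0 + u) = (\<Sum>k<5. RD (Suc k) 0 / fact k * u ^ k) + u ^ 5 * m u"
    using r by (rule_tac taylor_chain[of 0 r "\<lambda>k. RD (Suc k)" 5]) (auto intro!: RD_deriv)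
  have z: "G (Suc (Suc (Suc 0))) = 0" "G (Suc (Suc (Suc (Suc (Suc 0))))) = 0"
    "G (Suc (Suc (Suc (Suc (Suc (Suc (Suc 0))))))) = 0"
    by (rule G_odd, simp)+
  have "(\<Sum>k<5. RD (Suc k) 0 / fact k * u ^ k) = 6 * G 4 * u + 20 * G 6 * u ^ 3" for u
    by (simp add: eval_nat_numeral RD_0 z fact_reduce)
  then show thesis using that[OF r(1) m(1) r(2)] m(2) by (simp add: RD_def numeral_3_eq_3)
qed

end

context cx_lattice begin

text \<open>Each limit at a pole below is found by exhibiting a continuous \<open>N\<close> that
  equals the function after the principal parts have been cancelled by hand.\<close>

lemma continuous_lim_0:
  fixes N f :: "complex \<Rightarrow> complex"
  assumes "r > 0" "continuous_on (ball 0 r) N" "\<And>u. u \<in> ball 0 r \<Longrightarrow> u \<noteq> 0 \<Longrightarrow> f u = N u"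
  shows "(f \<longlongrightarrow> N 0) (at 0)"
proof -
  have "isCont N 0" using assms(1,2) continuous_on_eq_continuous_at[of "ball 0 r" N] by simp
  then have "(N \<longlongrightarrow> N 0) (at 0)" by (simp add: isCont_def)
  moreover have "\<forall>\<^sub>F u in at 0. N u = f u"
  proof -
    have "\<forall>\<^sub>F u in at 0. u \<in> ball 0 r - {0}" using assms(1) by (intro eventually_at_in_open) auto
    then show ?thesis by eventually_elim (use assms(3) in auto)
  qed
  ultimately show ?thesis by (rule Lim_transform_eventually)
qed

lemma T_diff: "z \<notin> L \<Longrightarrow> k \<ge> 3 \<Longrightarrow> T L k field_differentiable (at z)"
  using T_deriv[OF subset_refl] field_differentiable_def by blast
lemma wp_diff: "z \<notin> L \<Longrightarrow> wp field_differentiable (at z)"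
  using wp_deriv field_differentiable_def by blast
lemma wp'_diff: "z \<notin> L \<Longrightarrow> wp' field_differentiable (at z)"
  unfolding wp'_def[abs_def] using T_diff by (intro field_differentiable_mult field_differentiable_const) auto
lemma wp'_periodic: "l \<in> L \<Longrightarrow> wp' (z + l) = wp' z"
  by (simp add: wp'_def T_periodic)

lemma continuous_T_L0: "ball 0 r \<inter> L0 = {} \<Longrightarrow> k \<ge> 3 \<Longrightarrow> continuous_on (ball 0 r) (T L0 k)"
proof (rule continuous_at_imp_continuous_on, rule ballI)
  fix z :: complex assume "ball 0 r \<inter> L0 = {}" "k \<ge> 3" "z \<in> ball 0 r"
  then show "isCont (T L0 k) z" using T_deriv[OF L0_sub, of z k] DERIV_isCont by blast
qed

lemma near_0: "ball 0 r \<inter> L0 = {} \<Longrightarrow> u \<in> ball 0 r \<Longrightarrow> u \<noteq> 0 \<Longrightarrow> u \<notin> L"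
  by blast

text \<open>This is wp'' = 6 wp^2 - g2 / 2 divided by 6, with g2 = 60 G4. The difference of the two
  sides is elliptic and tends to 0 at the origin.\<close>

lemma wp_ODE2:
  assumes "z \<notin> L"
  shows "T L 4 z = (wp z)\<^sup>2 - 5 * G 4"
proof -
  let ?f = "\<lambda>z. T L 4 z - (wp z)\<^sup>2 + 5 * G 4"
  obtain r m where r: "r > 0" "m holomorphic_on ball 0 r" "ball 0 r \<inter> L0 = {}"
    "\<And>u. u \<in> ball 0 r \<Longrightarrow> R u = 3 * G 4 * u\<^sup>2 + 5 * G 6 * u ^ 4 + u ^ 6 * m u"
    by (rule R_taylor) blast
  define N where "N = (\<lambda>u. T L0 4 u - 6 * G 4 - 10 * G 6 * u^2 - 2 * u^4 * m u
     - (3 * G 4 * u\<^sup>2 + 5 * G 6 * u ^ 4 + u ^ 6 * m u)\<^sup>2 + 5 * G 4)"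
  have "(?f \<longlongrightarrow> N 0) (at 0)"
  proof (rule continuous_lim_0[OF r(1)])
    show "continuous_on (ball 0 r) N"
      unfolding N_def using holomorphic_on_imp_continuous_on[OF r(2)] continuous_T_L0[OF r(3), of 4]
      by (intro continuous_intros) auto
    fix u :: complex assume u: "u \<in> ball 0 r" "u \<noteq> 0"
    \<comment> \<open>With 1/u as a variable \<open>i\<close> subject to \<open>u * i = 1\<close>,
      the cancellation of the principal part is a polynomial identity.\<close>
    define i where "i = 1 / u"
    have ui: "u * i = 1" using u(2) by (simp add: i_def)
    have iv: "c / u ^ n = c * i ^ n" for c n by (simp add: i_def power_one_over)
    have wu: "wp u = i\<^sup>2 + (3 * G 4 * u\<^sup>2 + 5 * G 6 * u ^ 4 + u ^ 6 * m u)"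
      unfolding wp_def r(4)[OF u(1)] iv by simp
    have tu: "T L 4 u = i ^ 4 + T L0 4 u" using T_L_split[OF near_0[OF r(3) u], of 4] by (simp add: iv)
    show "?f u = N u" unfolding N_def wu tu using ui by algebra
  qed
  moreover have "N 0 = 0" by (simp add: N_def T_L0_0)
  ultimately have lim: "(?f \<longlongrightarrow> 0) (at 0)" by simp
  have "?f z = 0"
  proof (rule elliptic_const_L[OF _ _ lim assms])
    show "?f (z + l) = ?f z" if "z \<notin> L" "l \<in> L" for z l
      using that by (simp add: T_periodic wp_periodic)
    show "?f field_differentiable (at z)" if "z \<notin> L" for z
      unfolding power2_eq_square
      by (intro field_differentiable_add field_differentiable_diff field_differentiable_const T_diff
           field_differentiable_mult wp_diff that) auto
  qed
  then show ?thesis by (simp add: algebra_simps)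
qed

lemma wp_ODE1:
  assumes "z \<notin> L"
  shows "(wp' z)\<^sup>2 = 4 * wp z ^ 3 - 60 * G 4 * wp z - 140 * G 6"
proof -
  let ?f = "\<lambda>z. (wp' z)\<^sup>2 - 4 * wp z ^ 3 + 60 * G 4 * wp z + 140 * G 6"
  obtain r1 m where r1: "r1 > 0" "m holomorphic_on ball 0 r1" "ball 0 r1 \<inter> L0 = {}"
    "\<And>u. u \<in> ball 0 r1 \<Longrightarrow> R u = 3 * G 4 * u\<^sup>2 + 5 * G 6 * u ^ 4 + u ^ 6 * m u"
    by (rule R_taylor) blast
  obtain r2 n where r2: "r2 > 0" "n holomorphic_on ball 0 r2" "ball 0 r2 \<inter> L0 = {}"
    "\<And>u. u \<in> ball 0 r2 \<Longrightarrow> - 2 * T L0 3 u = 6 * G 4 * u + 20 * G 6 * u ^ 3 + u ^ 5 * n u"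
    by (rule R'_taylor) blast
  define r where "r = min r1 r2"
  have r: "r > 0" "ball 0 r \<subseteq> ball 0 r1" "ball 0 r \<subseteq> ball 0 r2" using r1(1) r2(1) by (auto simp: r_def)
  define s t where "s = (\<lambda>u. 3 * G 4 + 5 * G 6 * u^2 + u^4 * m u)" and "t = (\<lambda>u. 6 * G 4 + 20 * G 6 * u^2 + u^4 * n u)"
  define N where "N = (\<lambda>u. - 4 * u^2 * n u - 12 * u^2 * m u + u^2 * (t u)^2 - 12 * u^2 * (s u)^2
     - 4 * u^6 * (s u)^3 + 60 * G 4 * u^2 * s u)"
  have "(?f \<longlongrightarrow> N 0) (at 0)"
  proof (rule continuous_lim_0[OF r(1)])
    have "continuous_on (ball 0 r) m" "continuous_on (ball 0 r) n"
      using holomorphic_on_imp_continuous_on[OF r1(2)] holomorphic_on_imp_continuous_on[OF r2(2)]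
        continuous_on_subset r(2,3) by blast+
    then show "continuous_on (ball 0 r) N"
      unfolding N_def s_def t_def by (intro continuous_intros)
    fix u :: complex assume u: "u \<in> ball 0 r" "u \<noteq> 0"
    have u1: "u \<in> ball 0 r1" and u2: "u \<in> ball 0 r2"
        by (fact subsetD[OF r(2) u(1)], fact subsetD[OF r(3) u(1)])
    define i where "i = 1 / u"
    have ui: "u * i = 1" using u(2) by (simp add: i_def)
    have iv: "c / u ^ n = c * i ^ n" for c n by (simp add: i_def power_one_over)
    have wu: "wp u = i\<^sup>2 + u\<^sup>2 * s u"
      unfolding wp_def r1(4)[OF u1] s_def iv by algebra
    have "wp' u = - 2 / u ^ 3 + (- 2 * T L0 3 u)"
      unfolding wp'_def T_L_split[OF near_0[OF r1(3) u1 u(2)] order_refl] by (simp add: algebra_simps)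
    then have tu: "wp' u = - 2 * i ^ 3 + u * t u"
      unfolding r2(4)[OF u2] t_def iv by algebra
    \<comment> \<open>The last coefficient of the principal part: the constants cancel as -4*6 -
      12*3 + 60 = 0, and the next order leaves -4*20 - 12*5 = -140, the origin of the 140 in
      g3.\<close>
    have A: "- 4 * t u - 12 * s u + 60 * G 4 = - 140 * G 6 * u\<^sup>2 + u\<^sup>2 * (- 4 * u^2 * n u - 12 * u^2 * m u)"
      unfolding s_def t_def by algebra
    have "?f u = (- 4 * t u - 12 * s u + 60 * G 4) * i\<^sup>2 + u^2 * (t u)^2 - 12 * u^2 * (s u)^2
     - 4 * u^6 * (s u)^3 + 60 * G 4 * u^2 * s u + 140 * G 6"
      unfolding wu tu using ui by algebra
    also have "\<dots> = N u" unfolding A N_def using ui by algebra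
    finally show "?f u = N u" .
  qed
  moreover have "N 0 = 0" by (simp add: N_def)
  ultimately have lim: "(?f \<longlongrightarrow> 0) (at 0)" by simp
  have "?f z = 0"
  proof (rule elliptic_const_L[OF _ _ lim assms])
    show "?f (z + l) = ?f z" if "z \<notin> L" "l \<in> L" for z l
      using that by (simp add: wp'_periodic wp_periodic)
    show "?f field_differentiable (at z)" if "z \<notin> L" for z
      unfolding power2_eq_square power3_eq_cube
      by (intro field_differentiable_add field_differentiable_diff field_differentiable_const
           field_differentiable_mult wp_diff wp'_diff that)
  qed
  then show ?thesis by (simp add: algebra_simps)
qed

lemma T_L_5:
  assumes "z \<notin> L" shows "- 2 * T L 5 z = wp z * wp' z"
proof -
  have 1: "(T L 4 has_field_derivative - of_nat 4 * T L 5 z) (at z)"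
    using T_deriv[OF subset_refl assms, of 4] by simp
  have 2: "((\<lambda>z. (wp z)\<^sup>2 - 5 * G 4) has_field_derivative 2 * wp z * wp' z) (at z)"
    using wp_deriv[OF assms] by (auto intro!: derivative_eq_intros)
  have "((\<lambda>z. (wp z)\<^sup>2 - 5 * G 4) has_field_derivative - of_nat 4 * T L 5 z) (at z)"
    by (rule has_field_derivative_transform_within_open[OF 1 open_compl_L]) (use assms wp_ODE2 in auto)
  from DERIV_unique[OF this 2] show ?thesis by simp
qed

text \<open>The left side is the fourth derivative of wp. Its expression as a polynomial in wp with
  integral coefficients in g2 and g3 is what makes sums over torsion points integral.\<close>

lemma T_L_6:
  assumes "z \<notin> L" shows "120 * T L 6 z = 120 * wp z ^ 3 - 18 * (60 * G 4) * wp z - 12 * (140 * G 6)"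
proof -
  have 1: "((\<lambda>z. - 2 * T L 5 z) has_field_derivative - 2 * (- of_nat 5 * T L 6 z)) (at z)"
    using T_deriv[OF subset_refl assms, of 5] by (intro DERIV_cmult) simp
  have "((\<lambda>z. wp z * wp' z) has_field_derivative wp' z * wp' z + (- 2 * (- of_nat 3 * T L 4 z)) * wp z) (at z)"
    unfolding wp'_def[abs_def] using wp_deriv[OF assms, unfolded wp'_def] T_deriv[OF subset_refl assms, of 3]
    by (intro DERIV_mult DERIV_cmult) auto
  then have 2: "((\<lambda>z. wp z * wp' z) has_field_derivative (wp' z)\<^sup>2 + 6 * T L 4 z * wp z) (at z)"
    by (simp add: power2_eq_square)
  have "((\<lambda>z. wp z * wp' z) has_field_derivative - 2 * (- of_nat 5 * T L 6 z)) (at z)"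
    by (rule has_field_derivative_transform_within_open[OF 1 open_compl_L]) (use assms T_L_5 in auto)
  from DERIV_unique[OF this 2] have "10 * T L 6 z = (wp' z)\<^sup>2 + 6 * T L 4 z * wp z" by simp
  then have "12 * (10 * T L 6 z) = 12 * ((wp' z)\<^sup>2 + 6 * T L 4 z * wp z)" by (rule arg_cong)
  also have "\<dots> = 120 * wp z ^ 3 - 18 * (60 * G 4) * wp z - 12 * (140 * G 6)"
    unfolding wp_ODE1[OF assms] wp_ODE2[OF assms] by (simp add: algebra_simps power2_eq_square power3_eq_cube)
  finally show ?thesis by simp
qed

text \<open>For fixed \<open>v\<close> and with denominators cleared, the difference of the two
  sides is elliptic in \<open>u\<close>, with possible poles only on \<open>L\<close> and on its
  translate by \<open>- v\<close>. At 0 a limit merely has to exist; at \<open>- v\<close> it is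
  computed and vanishes by the differential equation at \<open>v\<close>.\<close>

theorem wp_addition:
  assumes u: "u \<notin> L" and v: "v \<notin> L" and uv: "u + v \<notin> L"
  shows "2 * wp (u + v) * (wp u - wp v)\<^sup>2 =
    (wp u + wp v) * (2 * wp u * wp v - 30 * G 4) - 140 * G 6 - wp' u * wp' v"
proof -
  define x y where "x = wp v" and "y = wp' v"
  define S where "S = L \<union> {z. z + v \<in> L}"
  let ?f = "\<lambda>u. 2 * wp (u + v) * (wp u - x)\<^sup>2 - (wp u + x) * (2 * wp u * x - 30 * G 4) + 140 * G 6 + wp' u * y"
  have nvL: "- v \<notin> L" using v by simp
  have iso: "\<exists>e>0. S \<inter> ball z e \<subseteq> {z}" for z
  proof -
    obtain e1 where e1: "e1 > 0" "L \<inter> ball z e1 \<subseteq> {z}" using isolated_L by blast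
    obtain e2 where e2: "e2 > 0" "L \<inter> ball (z + v) e2 \<subseteq> {z + v}" using isolated_L by blast
    have "S \<inter> ball z (min e1 e2) \<subseteq> {z}"
    proof
      fix w assume w: "w \<in> S \<inter> ball z (min e1 e2)"
      show "w \<in> {z}"
      proof (cases "w \<in> L")
        case True then show ?thesis using w e1 by auto
      next
        case False
        then have "w + v \<in> L" using w by (auto simp: S_def)
        moreover have "w + v \<in> ball (z + v) e2" using w by (auto simp: dist_norm)
        ultimately show ?thesis using e2 by auto
      qed
    qed
    then show ?thesis using e1 e2 by (metis min_less_iff_conj)
  qed
  have per: "?f (z + l) = ?f z" if "z \<notin> S" "l \<in> L" for z l
  proof -
    have "z \<notin> L" "z + v \<notin> L" using that(1) by (auto simp: S_def)
    moreover have "z + l + v = z + v + l" by (simp add: algebra_simps)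
    ultimately have "wp (z + l + v) = wp (z + v)" "wp (z + l) = wp z" "wp' (z + l) = wp' z"
      using wp_periodic[OF that(2)] wp'_periodic[OF that(2)] by metis+
    then show ?thesis by simp
  qed
  have diff: "?f field_differentiable (at z)" if "z \<notin> S" for z
  proof -
    have z: "z \<notin> L" "z + v \<notin> L" using that by (auto simp: S_def)
    have "(\<lambda>u. wp (u + v)) field_differentiable (at z)"
      using wp_deriv[OF z(2)] DERIV_shift field_differentiable_def by blast
    then show ?thesis unfolding power2_eq_square
      by (intro field_differentiable_add field_differentiable_diff field_differentiable_const
           field_differentiable_mult wp_diff wp'_diff z)
  qed
  have lim0: "\<exists>c. (?f \<longlongrightarrow> c) (at 0)"
  proof -
    obtain r1 m1 where r1: "r1 > 0" "m1 holomorphic_on ball 0 r1" "ball 0 r1 \<inter> L0 = {}"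
      "\<And>u. u \<in> ball 0 r1 \<Longrightarrow> R u = 3 * G 4 * u\<^sup>2 + 5 * G 6 * u ^ 4 + u ^ 6 * m1 u"
      by (rule R_taylor) blast
    obtain r2 where r2: "r2 > 0" "ball v r2 \<subseteq> - L"
      using open_compl_L v by (meson ComplI open_contains_ball)
    obtain m where m: "m holomorphic_on ball 0 r2"
      "\<And>u. u \<in> ball 0 r2 \<Longrightarrow> WD 0 (v + u) = (\<Sum>k<4. WD k v / fact k * u ^ k) + u ^ 4 * m u"
      using r2 by (rule_tac taylor_chain[of v r2 WD 4]) (auto intro!: WD_deriv)
    define r where "r = min r1 r2"
    have r: "r > 0" "ball 0 r \<subseteq> ball 0 r1" "ball 0 r \<subseteq> ball 0 r2" using r1(1) r2(1) by (auto simp: r_def)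
    define \<rho> where "\<rho> = (\<lambda>u. 3 * G 4 + 5 * G 6 * u^2 + u^4 * m1 u)"
    \<comment> \<open>\<open>P\<close> expands \<open>wp (u + v)\<close> to order 4 because
      \<open>(wp u - x)\<^sup>2\<close> has a pole of order 4; its coefficients are wp''/2 and
      wp'''/6 at \<open>v\<close>. \<open>K\<close> is what remains of that square after the
      principal part i^4 - 2 x i^2.\<close>
    define P where "P = (\<lambda>u. x + y * u + (3 * x\<^sup>2 - 15 * G 4) * u\<^sup>2 + 2 * x * y * u ^ 3 + u ^ 4 * m u)"
    define K where "K = (\<lambda>u. 2 * \<rho> u + x\<^sup>2 - 2 * x * u\<^sup>2 * \<rho> u + u ^ 4 * (\<rho> u)\<^sup>2)"
    define N where "N = (\<lambda>u. - 2 * x * (6 * x\<^sup>2 - 30 * G 4) - 8 * x\<^sup>2 * y * u + 2 * m u * (1 - 2 * x * u\<^sup>2)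
       + 2 * P u * K u - (4 * x * \<rho> u + 2 * x * u ^ 4 * (\<rho> u)\<^sup>2 + (2 * x\<^sup>2 - 30 * G 4) * (u\<^sup>2 * \<rho> u) - 30 * G 4 * x)
       + 140 * G 6 + (- 2 * T L0 3 u) * y)"
    have "(?f \<longlongrightarrow> N 0) (at 0)"
    proof (rule continuous_lim_0[OF r(1)])
      have "continuous_on (ball 0 r) m" "continuous_on (ball 0 r) m1" "continuous_on (ball 0 r) (T L0 3)"
        using holomorphic_on_imp_continuous_on[OF r1(2)] holomorphic_on_imp_continuous_on[OF m(1)]
          continuous_T_L0[OF r1(3), of 3] continuous_on_subset r(2,3) by blast+
      then show "continuous_on (ball 0 r) N"
        unfolding N_def \<rho>_def P_def K_def by (intro continuous_intros)
      fix u :: complex assume u: "u \<in> ball 0 r" "u \<noteq> 0"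
      have u1: "u \<in> ball 0 r1" and u2: "u \<in> ball 0 r2"
        by (fact subsetD[OF r(2) u(1)], fact subsetD[OF r(3) u(1)])
    define i where "i = 1 / u"
    have ui: "u * i = 1" using u(2) by (simp add: i_def)
    have iv: "c / u ^ n = c * i ^ n" for c n by (simp add: i_def power_one_over)
      have wu: "wp u = i\<^sup>2 + u\<^sup>2 * \<rho> u"
        unfolding wp_def r1(4)[OF u1] \<rho>_def iv by algebra
      have "wp' u = - 2 / u ^ 3 + (- 2 * T L0 3 u)"
        unfolding wp'_def T_L_split[OF near_0[OF r1(3) u1 u(2)] order_refl] by (simp add: algebra_simps)
      then have tu: "wp' u = - 2 * i ^ 3 + (- 2 * T L0 3 u)" by (simp only: iv)
      have pu: "wp (u + v) = P u"
      proof -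
        have "(\<Sum>k<4. WD k v / fact k * u ^ k) = x + y * u + 6 * T L 4 v / 2 * u\<^sup>2 + (- 24 * T L 5 v) / 6 * u ^ 3"
          by (simp add: eval_nat_numeral WD_def x_def y_def wp'_def fact_reduce)
        also have "\<dots> = x + y * u + (3 * x\<^sup>2 - 15 * G 4) * u\<^sup>2 + 2 * x * y * u ^ 3"
        proof -
          have "6 * T L 4 v / 2 = 3 * x\<^sup>2 - 15 * G 4"
            unfolding wp_ODE2[OF v] x_def by (simp add: field_simps)
          moreover have "(- 24 * T L 5 v) / 6 = 2 * x * y"
            using T_L_5[OF v] unfolding x_def y_def by simp
          ultimately show ?thesis by (simp only:)
        qed
        finally show ?thesis using m(2)[OF u2] by (simp add: P_def WD_def add.commute)
      qed
      have "2 * P u * (wp u - x)\<^sup>2 = 2 * P u * (i ^ 4 - 2 * x * i\<^sup>2) + 2 * P u * K u"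
        unfolding wu K_def using ui by algebra
      also have "2 * P u * (i ^ 4 - 2 * x * i\<^sup>2) = 2 * x * i^4 + 2 * y * i^3 + (2 * x\<^sup>2 - 30 * G 4) * i^2
           - 2 * x * (6 * x\<^sup>2 - 30 * G 4) - 8 * x\<^sup>2 * y * u + 2 * m u * (1 - 2 * x * u\<^sup>2)"
        unfolding P_def using ui by algebra
      finally have A: "2 * P u * (wp u - x)\<^sup>2 = 2 * x * i^4 + 2 * y * i^3 + (2 * x\<^sup>2 - 30 * G 4) * i^2
           - 2 * x * (6 * x\<^sup>2 - 30 * G 4) - 8 * x\<^sup>2 * y * u + 2 * m u * (1 - 2 * x * u\<^sup>2) + 2 * P u * K u" .
      have B: "(wp u + x) * (2 * wp u * x - 30 * G 4) = 2 * x * i^4 + (2 * x\<^sup>2 - 30 * G 4) * i^2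
          + (4 * x * \<rho> u + 2 * x * u ^ 4 * (\<rho> u)\<^sup>2 + (2 * x\<^sup>2 - 30 * G 4) * (u\<^sup>2 * \<rho> u) - 30 * G 4 * x)"
        unfolding wu using ui by algebra
      show "?f u = N u" unfolding pu A B tu N_def by algebra
    qed
    then show ?thesis by blast
  qed
  \<comment> \<open>The double pole of \<open>wp (u + v)\<close> meets the square of a function
    vanishing at \<open>- v\<close>, which contributes 2 y^2; the term with \<open>wp'\<close>
    contributes - y^2.\<close>
  have limv: "(?f \<longlongrightarrow> 0) (at (- v))"
  proof -
    obtain r1 m1 where r1: "r1 > 0" "m1 holomorphic_on ball 0 r1" "ball 0 r1 \<inter> L0 = {}"
      "\<And>u. u \<in> ball 0 r1 \<Longrightarrow> R u = 3 * G 4 * u\<^sup>2 + 5 * G 6 * u ^ 4 + u ^ 6 * m1 u"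
      by (rule R_taylor) blast
    obtain r2 where r2: "r2 > 0" "ball (- v) r2 \<subseteq> - L"
      using open_compl_L nvL by (meson ComplI open_contains_ball)
    obtain m where m: "m holomorphic_on ball 0 r2"
      "\<And>u. u \<in> ball 0 r2 \<Longrightarrow> WD 0 (- v + u) = (\<Sum>k<2. WD k (- v) / fact k * u ^ k) + u ^ 2 * m u"
      using r2 by (rule_tac taylor_chain[of "- v" r2 WD 2]) (auto intro!: WD_deriv)
    define r where "r = min r1 r2"
    have r: "r > 0" "ball 0 r \<subseteq> ball 0 r1" "ball 0 r \<subseteq> ball 0 r2" using r1(1) r2(1) by (auto simp: r_def)
    define q where "q = (\<lambda>u. - y + u * m u)"
    define N where "N = (\<lambda>u. 2 * (1 + u\<^sup>2 * (3 * G 4 * u\<^sup>2 + 5 * G 6 * u ^ 4 + u ^ 6 * m1 u)) * (q u)\<^sup>2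
       - (x + u * q u + x) * (2 * (x + u * q u) * x - 30 * G 4) + 140 * G 6 + wp' (u - v) * y)"
    have "((\<lambda>u. ?f (u - v)) \<longlongrightarrow> N 0) (at 0)"
    proof (rule continuous_lim_0[OF r(1)])
      have "continuous_on (ball 0 r) m" "continuous_on (ball 0 r) m1"
        using holomorphic_on_imp_continuous_on[OF r1(2)] holomorphic_on_imp_continuous_on[OF m(1)]
          continuous_on_subset r(2,3) by blast+
      moreover have "continuous_on (ball 0 r) (\<lambda>u. wp' (u - v))"
      proof (rule continuous_on_compose2[of "ball (- v) r2" wp'])
        show "continuous_on (ball (- v) r2) wp'"
          by (intro continuous_at_imp_continuous_on ballI field_differentiable_imp_continuous_at wp'_diff) (use r2 in auto)
        show "(\<lambda>u. u - v) ` ball 0 r \<subseteq> ball (- v) r2"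
          by (auto simp: dist_norm r_def)
      qed (intro continuous_intros)
      ultimately show "continuous_on (ball 0 r) N"
        unfolding N_def q_def by (intro continuous_intros)
      fix u :: complex assume u: "u \<in> ball 0 r" "u \<noteq> 0"
      have u1: "u \<in> ball 0 r1" and u2: "u \<in> ball 0 r2"
        by (fact subsetD[OF r(2) u(1)], fact subsetD[OF r(3) u(1)])
      have wu: "wp (u - v + v) = 1 / u\<^sup>2 + (3 * G 4 * u\<^sup>2 + 5 * G 6 * u ^ 4 + u ^ 6 * m1 u)"
        using r1(4)[OF u1] by (simp add: wp_def)
      have "wp (u - v) = wp (- v) + wp' (- v) * u + u\<^sup>2 * m u"
        using m(2)[OF u2] by (simp add: eval_nat_numeral WD_def wp'_def)
      then have pu: "wp (u - v) = x + u * q u"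
        by (simp add: wp_even wp'_odd x_def y_def q_def algebra_simps power2_eq_square)
      have sq: "2 * (1 / u\<^sup>2 + X) * (x + u * Q - x)\<^sup>2 = 2 * (1 + u\<^sup>2 * X) * Q\<^sup>2" for X Q
        using u(2) by (simp add: field_simps)
      show "?f (u - v) = N u" unfolding wu pu N_def sq ..
    qed
    moreover have "N 0 = 0"
    proof -
      have "N 0 = y\<^sup>2 - (4 * x ^ 3 - 60 * G 4 * x - 140 * G 6)"
        by (simp add: N_def q_def wp'_odd y_def algebra_simps power2_eq_square power3_eq_cube)
      also have "\<dots> = 0" using wp_ODE1[OF v] by (simp add: x_def y_def)
      finally show ?thesis .
    qed
    ultimately have "((\<lambda>u. ?f (u - v)) \<longlongrightarrow> 0) (at 0)" by simp
    from LIM_offset[OF this, of v] show ?thesis by simp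
  qed
  have "?f u = 0"
  proof (rule elliptic_const[OF iso _ per diff])
    show "z + l \<in> S \<longleftrightarrow> z \<in> S" if "l \<in> L" for z l
    proof -
      have "z + l + v = z + v + l" by (simp add: algebra_simps)
      then show ?thesis using L_add_iff[OF that, of z] L_add_iff[OF that, of "z + v"]
        unfolding S_def Un_iff mem_Collect_eq by metis
    qed
    show "- v \<in> S" by (simp add: S_def)
    show "(?f \<longlongrightarrow> 0) (at (- v))" by (rule limv)
    show "u \<notin> S" using u uv by (auto simp: S_def)
    fix s assume "s \<in> S"
    then consider "s \<in> L" | "s + v \<in> L" by (auto simp: S_def)
    then show "\<exists>c. (?f \<longlongrightarrow> c) (at s)"
    proof cases
      case 1
      obtain c where "(?f \<longlongrightarrow> c) (at 0)" using lim0 by blast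
      from lim_translate[of S ?f s, OF per[OF _ 1] iso this] show ?thesis by auto
    next
      case 2
      from lim_translate[of S ?f "s + v", OF per[OF _ 2] iso limv] show ?thesis by auto
    qed
  qed
  then show ?thesis by (simp add: x_def y_def algebra_simps)
qed

end

section \<open>A place over 7 and trinomials\<close>

definition subring :: "complex set \<Rightarrow> bool" where
  "subring A \<longleftrightarrow> 1 \<in> A \<and> (\<forall>x\<in>A. \<forall>y\<in>A. x - y \<in> A) \<and> (\<forall>x\<in>A. \<forall>y\<in>A. x * y \<in> A)"

lemma subringD:
  assumes "subring A"
  shows "1 \<in> A" "0 \<in> A" "x \<in> A \<Longrightarrow> y \<in> A \<Longrightarrow> x - y \<in> A" "x \<in> A \<Longrightarrow> y \<in> A \<Longrightarrow> x * y \<in> A"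
    "x \<in> A \<Longrightarrow> - x \<in> A" "x \<in> A \<Longrightarrow> y \<in> A \<Longrightarrow> x + y \<in> A"
proof -
  show 1: "1 \<in> A" using assms by (simp add: subring_def)
  show d: "x - y \<in> A" if "x \<in> A" "y \<in> A" for x y using that assms by (simp add: subring_def)
  show "x * y \<in> A" if "x \<in> A" "y \<in> A" for x y using that assms by (simp add: subring_def)
  show 0: "0 \<in> A" using d[OF 1 1] by simp
  show m: "- x \<in> A" if "x \<in> A" for x using d[OF 0 that] by simp
  show "x + y \<in> A" if "x \<in> A" "y \<in> A" for x y using d[OF that(1) m[OF that(2)]] by simp
qed

lemma subring_sum: "subring A \<Longrightarrow> (\<And>i. i \<in> I \<Longrightarrow> f i \<in> A) \<Longrightarrow> sum f I \<in> A"
  by (induction I rule: infinite_finite_induct) (auto simp: subringD)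

lemma subring_power: "subring A \<Longrightarrow> x \<in> A \<Longrightarrow> x ^ n \<in> A"
  by (induction n) (auto simp: subringD)

lemma subring_of_nat: "subring A \<Longrightarrow> of_nat n \<in> A"
  by (induction n) (auto simp: subringD)

lemma subring_of_int: "subring A \<Longrightarrow> of_int k \<in> A"
  by (cases k rule: int_cases2) (auto simp: subringD subring_of_nat)

definition coeffs_in :: "complex set \<Rightarrow> complex poly \<Rightarrow> bool" where
  "coeffs_in A p \<longleftrightarrow> (\<forall>i. coeff p i \<in> A)"

lemma coeffs_in_arith:
  assumes "subring A" "coeffs_in A p" "coeffs_in A q"
  shows "coeffs_in A (p + q)" "coeffs_in A (p - q)" "coeffs_in A (p * q)"
  using assms by (auto simp: coeffs_in_def coeff_mult subringD intro!: subring_sum)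

definition adjoin :: "complex set \<Rightarrow> complex \<Rightarrow> complex set" where
  "adjoin A x = {poly p x | p. coeffs_in A p}"

lemma subring_adjoin: assumes A: "subring A" shows "subring (adjoin A x)"
  unfolding subring_def
proof (intro conjI ballI)
  have "coeffs_in A 1" using A by (auto simp: coeffs_in_def one_pCons coeff_pCons subringD split: nat.split)
  then show "1 \<in> adjoin A x" unfolding adjoin_def by (auto intro!: exI[of _ 1])
  fix y z assume "y \<in> adjoin A x" "z \<in> adjoin A x"
  then obtain p q where p: "coeffs_in A p" "y = poly p x" and q: "coeffs_in A q" "z = poly q x"
    by (auto simp: adjoin_def)
  have "coeffs_in A (p - q)" "coeffs_in A (p * q)"
    using p q A by (auto simp: coeffs_in_def coeff_mult subringD intro!: subring_sum)
  then show "y - z \<in> adjoin A x" "y * z \<in> adjoin A x"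
    unfolding adjoin_def using p q by (metis (mono_tags, lifting) mem_Collect_eq poly_diff, metis (mono_tags, lifting) mem_Collect_eq poly_mult)
qed

lemma adjoin_sub: assumes A: "subring A" shows "A \<subseteq> adjoin A x"
proof
  fix a assume "a \<in> A"
  then have "coeffs_in A [:a:]" using A by (auto simp: coeffs_in_def coeff_pCons subringD split: nat.split)
  then show "a \<in> adjoin A x" unfolding adjoin_def by (auto intro!: exI[of _ "[:a:]"])
qed

lemma adjoin_x: assumes A: "subring A" shows "x \<in> adjoin A x"
proof -
  have "coeffs_in A [:0, 1:]" using A by (auto simp: coeffs_in_def coeff_pCons subringD split: nat.split)
  then show ?thesis unfolding adjoin_def by (auto intro!: exI[of _ "[:0, 1:]"])
qed

text \<open>The descent step of Chevalley's extension theorem. Since \<open>1 - 7 * b\<close> is a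
  unit for the constant term \<open>b\<close> of \<open>q\<close>, the relation for
  \<open>y = 1 / x\<close> expresses x^m through lower powers of x, and this replaces the leading
  term of \<open>p\<close>.\<close>

lemma degree_descent:
  assumes A: "subring A" and inv: "\<And>b. b \<in> A \<Longrightarrow> inverse (1 - 7 * b) \<in> A"
    and n7: "1 / 7 \<notin> A" and xy: "x * y = 1"
    and p: "coeffs_in A p" "poly p x = 1 / 7" and q: "coeffs_in A q" "poly q y = 1 / 7"
    and deg: "degree q \<le> degree p"
  obtains p' where "coeffs_in A p'" "poly p' x = 1 / 7" "degree p' < degree p"
proof -
  define m n where "m = degree q" and "n = degree p"
  have m0: "m > 0"
  proof (rule ccontr)
    assume "\<not> m > 0"
    then obtain c where "q = [:c:]" by (auto simp: m_def elim!: degree_eq_zeroE)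
    then have "poly q y = coeff q 0" by simp
    then show False using q n7 by (metis coeffs_in_def)
  qed
  define b where "b = coeff q 0"
  define w where "w = inverse (1 - 7 * b)"
  have bA: "b \<in> A" using q by (simp add: b_def coeffs_in_def)
  have wA: "w \<in> A" unfolding w_def using inv bA by blast
  have "1 - 7 * b \<noteq> 0"
  proof
    assume "1 - 7 * b = 0"
    then have "b = 1 / 7" by (simp add: field_simps)
    then show False using bA n7 by metis
  qed
  then have w1: "w * (1 - 7 * b) = 1" by (simp add: w_def)
  have "1 / 7 = (\<Sum>j\<le>m. coeff q j * y ^ j)" using q(2) by (simp add: poly_altdef m_def)
  also have "\<dots> = b + (\<Sum>j\<in>{1..m}. coeff q j * y ^ j)"
    by (simp add: b_def atMost_atLeast0 sum.atLeast_Suc_atMost)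
  finally have "1 - 7 * b = 7 * (\<Sum>j\<in>{1..m}. coeff q j * y ^ j)" by (simp add: field_simps)
  then have "w * (7 * (\<Sum>j\<in>{1..m}. coeff q j * y ^ j)) = 1" using w1 by simp
  then have "x ^ m = w * (7 * (\<Sum>j\<in>{1..m}. coeff q j * y ^ j)) * x ^ m" by (simp only: mult_1)
  also have "\<dots> = (\<Sum>j\<in>{1..m}. 7 * w * coeff q j * (y ^ j * x ^ m))"
    by (simp add: sum_distrib_left sum_distrib_right mult_ac)
  also have "\<dots> = (\<Sum>j\<in>{1..m}. 7 * w * coeff q j * x ^ (m - j))"
  proof (intro sum.cong refl)
    fix j assume "j \<in> {1..m}"
    then have "x ^ m = x ^ j * x ^ (m - j)" by (simp flip: power_add)
    then have "y ^ j * x ^ m = (x * y) ^ j * x ^ (m - j)" by (simp add: power_mult_distrib)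
    then show "7 * w * coeff q j * (y ^ j * x ^ m) = 7 * w * coeff q j * x ^ (m - j)" by (simp add: xy)
  qed
  finally have xm: "x ^ m = (\<Sum>j\<in>{1..m}. 7 * w * coeff q j * x ^ (m - j))" .
  define r where "r = (\<Sum>j\<in>{1..m}. monom (7 * w * coeff q j) (m - j))"
  have rx: "poly r x = x ^ m" by (simp add: xm r_def poly_sum poly_monom)
  have A7: "7 \<in> A" using subring_of_nat[OF A, of 7] by simp
  have rc: "coeffs_in A r"
    unfolding coeffs_in_def r_def coeff_sum coeff_monom
    using A q wA A7 by (auto intro!: subring_sum simp: subringD coeffs_in_def)
  have rd: "degree r < m"
  proof -
    have "degree r \<le> m - 1" unfolding r_def
      by (intro degree_sum_le) (auto intro: order.trans[OF degree_monom_le])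
    then show ?thesis using m0 by simp
  qed
  define c where "c = coeff p n"
  define p' where "p' = p - monom c n + monom c (n - m) * r"
  have mn: "m \<le> n" using deg by (simp add: m_def n_def)
  show thesis
  proof (rule that)
    have "c \<in> A" using p by (simp add: c_def coeffs_in_def)
    then have "coeffs_in A (monom c k)" for k using A by (simp add: coeffs_in_def subringD)
    then show "coeffs_in A p'" using p rc unfolding p'_def
      by (intro coeffs_in_arith[OF A])
    have "x ^ (n - m) * x ^ m = x ^ n" using mn by (simp flip: power_add)
    then show "poly p' x = 1 / 7" using p(2) by (simp add: p'_def poly_monom rx)
    have d1: "degree (p - monom c n) < n"
    proof -
      have "degree (p - monom c n) \<le> n" by (intro degree_diff_le) (auto simp: n_def degree_monom_le)
      moreover have "coeff (p - monom c n) n = 0" by (simp add: c_def)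
      ultimately show ?thesis using m0 mn
        by (metis coeff_0 degree_0 gr_zeroI le_neq_implies_less leading_coeff_0_iff le_zero_eq)
    qed
    have d2: "degree (monom c (n - m) * r) < n"
    proof -
      have "degree (monom c (n - m) * r) \<le> degree (monom c (n - m)) + degree r" by (rule degree_mult_le)
      also have "\<dots> \<le> (n - m) + degree r" by (simp add: degree_monom_le)
      also have "\<dots> < n" using rd mn by simp
      finally show ?thesis .
    qed
    show "degree p' < degree p" using degree_add_less[OF d1 d2] by (simp add: p'_def n_def)
  qed
qed

text \<open>The maximal subrings of \<open>\<complex>\<close> that do not contain \<open>1/7\<close> are valuation rings.\<close>

lemma exists_place:
  obtains V where "subring V" "1 / 7 \<notin> V" "\<And>x. x \<in> V \<or> inverse x \<in> V"
proof -
  let ?F = "{A. subring A \<and> 1 / 7 \<notin> A}"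
  have "\<exists>M\<in>?F. \<forall>X\<in>?F. M \<subseteq> X \<longrightarrow> X = M"
  proof (rule subset_Zorn_nonempty)
    have "(1 / 7 :: complex) \<notin> \<int>"
    proof
      assume "(1 / 7 :: complex) \<in> \<int>"
      then obtain k :: int where "1 / 7 = (of_int k :: complex)" by (auto elim: Ints_cases)
      then have "(of_int (7 * k) :: complex) = of_int 1" by (simp add: field_simps)
      then have "7 * k = 1" by (simp only: of_int_eq_iff)
      then show False by presburger
    qed
    then have "\<int> \<in> ?F" by (auto simp: subring_def)
    then show "?F \<noteq> {}" by blast
    fix C assume C: "C \<noteq> {}" "subset.chain ?F C"
    have CF: "C \<subseteq> ?F" using C(2) by (simp add: subset_chain_def)
    have two: "\<exists>A\<in>C. x \<in> A \<and> y \<in> A" if "x \<in> \<Union>C" "y \<in> \<Union>C" for x y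
      using that C(2) unfolding subset_chain_def by blast
    have "subring (\<Union>C)" unfolding subring_def
    proof (intro conjI ballI)
      show "1 \<in> \<Union>C" using C(1) CF subringD(1) by blast
      fix x y assume "x \<in> \<Union>C" "y \<in> \<Union>C"
      then obtain A where "A \<in> C" "x \<in> A" "y \<in> A" using two by blast
      then show "x - y \<in> \<Union>C" "x * y \<in> \<Union>C" using CF subringD(3,4) by blast+
    qed
    then show "\<Union>C \<in> ?F" using CF by blast
  qed
  then obtain V where V: "subring V" "1 / 7 \<notin> V" and max: "\<And>X. subring X \<Longrightarrow> 1 / 7 \<notin> X \<Longrightarrow> V \<subseteq> X \<Longrightarrow> X = V"
    by blast
  have adj: "x \<in> V" if "1 / 7 \<notin> adjoin V x" for x
    using max[OF subring_adjoin[OF V(1)] that adjoin_sub[OF V(1)]] adjoin_x[OF V(1), of x] by simp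
  \<comment> \<open>7 lies in the Jacobson radical of a maximal such ring: clearing denominators by
    \<open>?u ^ n\<close> puts \<open>?u ^ n / 7\<close> into \<open>V\<close>, but
    \<open>?u ^ n\<close> is 1 modulo 7, so 1/7 would be in \<open>V\<close>.\<close>
  have inv: "inverse (1 - 7 * b) \<in> V" if b: "b \<in> V" for b
  proof (rule adj, rule notI)
    let ?u = "1 - 7 * b"
    assume "1 / 7 \<in> adjoin V (inverse ?u)"
    then obtain p where p: "coeffs_in V p" "poly p (inverse ?u) = 1 / 7" by (auto simp: adjoin_def)
    have V7: "7 \<in> V" using subring_of_nat[OF V(1), of 7] by simp
    have uV: "?u \<in> V" using b V7 V(1) by (simp add: subringD)
    have u0: "?u \<noteq> 0"
    proof
      assume "?u = 0"
      then have "b = 1 / 7" by (simp add: field_simps)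
      then show False using b V by metis
    qed
    define n where "n = degree p"
    have "?u ^ n * poly p (inverse ?u) = (\<Sum>i\<le>n. coeff p i * (inverse ?u ^ i * ?u ^ n))"
      by (simp add: poly_altdef n_def sum_distrib_left mult_ac)
    also have "\<dots> = (\<Sum>i\<le>n. coeff p i * ?u ^ (n - i))"
    proof (intro sum.cong refl)
      fix i assume "i \<in> {..n}"
      then have "?u ^ n = ?u ^ i * ?u ^ (n - i)" by (simp flip: power_add)
      then have "inverse ?u ^ i * ?u ^ n = (inverse ?u * ?u) ^ i * ?u ^ (n - i)"
        by (simp only: power_mult_distrib mult.assoc)
      then show "coeff p i * (inverse ?u ^ i * ?u ^ n) = coeff p i * ?u ^ (n - i)" using u0 by simp
    qed
    also have "\<dots> \<in> V" using p(1) V(1) uV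
      by (auto intro!: subring_sum subringD subring_power simp: coeffs_in_def)
    finally have e: "?u ^ n / 7 \<in> V" using p(2) by simp
    have "\<exists>c\<in>V. ?u ^ n = 1 - 7 * c"
    proof (induction n)
      case 0
      then show ?case using subringD(2)[OF V(1)] by (intro bexI[of _ 0]) auto
    next
      case (Suc n)
      then obtain c where c: "c \<in> V" "?u ^ n = 1 - 7 * c" by blast
      have "?u ^ Suc n = ?u * (1 - 7 * c)" using c(2) by (simp only: power_Suc)
      then have "?u ^ Suc n = 1 - 7 * (b + c - 7 * b * c)" by (simp add: algebra_simps)
      moreover have "b + c - 7 * b * c \<in> V" using b c V7 V(1) by (simp add: subringD)
      ultimately show ?case by blast
    qed
    then obtain c where c: "c \<in> V" "?u ^ n = 1 - 7 * c" by blast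
    have "1 / 7 = ?u ^ n / 7 + c" unfolding c(2) by (simp add: field_simps)
    also have "\<dots> \<in> V" using subringD(6)[OF V(1) e c(1)] .
    finally show False using V(2) by simp
  qed
  have tot: "x \<in> V \<or> inverse x \<in> V" for x
  proof (rule ccontr)
    assume *: "\<not> (x \<in> V \<or> inverse x \<in> V)"
    then have x0: "x \<noteq> 0" using subringD(2)[OF V(1)] by auto
    define y where "y = inverse x"
    have xy: "x * y = 1" "y * x = 1" using x0 by (auto simp: y_def)
    \<comment> \<open>Two relations, one in \<open>x\<close> and one in \<open>1 / x\<close>, cannot
      coexist: the one of larger degree can always be shortened with the help of the other.\<close>
    have no: False if "coeffs_in V p" "poly p x = 1 / 7" "coeffs_in V q" "poly q y = 1 / 7" for p q
      using that
    proof (induction "degree p + degree q" arbitrary: p q rule: less_induct)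
      case less
      show False
      proof (cases "degree q \<le> degree p")
        case True
        obtain p' where "coeffs_in V p'" "poly p' x = 1 / 7" "degree p' < degree p"
          by (rule degree_descent[OF V(1) inv V(2) xy(1) less.prems(1,2,3,4) True])
        then show False using less.hyps[of p' q] less.prems by auto
      next
        case False
        then have le: "degree p \<le> degree q" by simp
        obtain q' where "coeffs_in V q'" "poly q' y = 1 / 7" "degree q' < degree q"
          by (rule degree_descent[OF V(1) inv V(2) xy(2) less.prems(3,4,1,2) le])
        then show False using less.hyps[of p q'] less.prems by auto
      qed
    qed
    have "1 / 7 \<in> adjoin V x" "1 / 7 \<in> adjoin V y" using adj * by (auto simp: y_def)
    then obtain p q where "coeffs_in V p" "1 / 7 = poly p x" "coeffs_in V q" "1 / 7 = poly q y"
      unfolding adjoin_def mem_Collect_eq by metis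
    then show False using no by metis
  qed
  show thesis by (rule that[OF V tot])
qed

locale place7 =
  fixes V :: "complex set"
  assumes V: "subring V" and V7: "1 / 7 \<notin> V" and total: "\<And>x. x \<in> V \<or> inverse x \<in> V"
begin

lemmas V_rules = subringD[OF V] subring_sum[OF V] subring_power[OF V] subring_of_nat[OF V] subring_of_int[OF V]

text \<open>The maximal ideal of the valuation ring: 0 and the elements whose inverse falls outside.
  That it lies in \<open>V\<close> is a consequence of totality.\<close>

definition M :: "complex set" where "M = {x. x = 0 \<or> inverse x \<notin> V}"

lemma M_sub: "x \<in> M \<Longrightarrow> x \<in> V"
  using total V_rules(2) by (auto simp: M_def)

lemma unit: "x \<in> V \<Longrightarrow> x \<notin> M \<Longrightarrow> inverse x \<in> V \<and> x \<noteq> 0"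
  by (auto simp: M_def)

lemma one_M: "1 \<notin> M" using V_rules(1) by (simp add: M_def)

lemma M_mult: assumes "x \<in> M" "y \<in> V" shows "y * x \<in> M"
proof (rule ccontr)
  assume "y * x \<notin> M"
  then have nz: "y * x \<noteq> 0" and i: "inverse (y * x) \<in> V" by (auto simp: M_def)
  have "y * inverse (y * x) \<in> V" using V_rules(4) i assms(2) by blast
  also have "y * inverse (y * x) = inverse x" using nz by (simp add: field_simps)
  finally show False using assms(1) nz by (simp add: M_def)
qed

lemma M_add: assumes "x \<in> M" "y \<in> M" shows "x + y \<in> M"
proof (cases "x = 0 \<or> y = 0")
  case True then show ?thesis using assms by auto
next
  case False
  have *: "a + b \<in> M" if "a \<in> M" "b * inverse a \<in> V" "a \<noteq> 0" for a b
  proof -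
    have "(1 + b * inverse a) * a \<in> M" by (rule M_mult[OF that(1) V_rules(6)[OF V_rules(1) that(2)]])
    moreover have "(1 + b * inverse a) * a = a + b" using that(3) by (simp add: distrib_right)
    ultimately show ?thesis by simp
  qed
  have "y * inverse x \<in> V \<or> x * inverse y \<in> V"
    using total[of "y * inverse x"] by (simp add: mult.commute)
  then show ?thesis using *[of x y] *[of y x] assms False by (auto simp: add.commute)
qed

lemma M_minus: "x \<in> M \<Longrightarrow> - x \<in> M"
  using M_mult[of x "- 1"] V_rules(1,5) by simp
lemma M_diff: "x \<in> M \<Longrightarrow> y \<in> M \<Longrightarrow> x - y \<in> M"
  using M_add[of x "- y"] M_minus by simp

lemma seven_M: "7 \<in> M" using V7 by (simp add: M_def inverse_eq_divide)

lemma unit_of_int: "\<not> 7 dvd k \<Longrightarrow> of_int k \<notin> M"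
proof
  assume k: "\<not> 7 dvd k" "of_int k \<in> M"
  have "prime (7::int)" by simp
  then have "coprime 7 k" using k(1) by (rule prime_imp_coprime)
  then obtain a b where ab: "a * 7 + b * k = 1" by (metis bezout_int coprime_imp_gcd_eq_1)
  have "of_int a * 7 + of_int b * of_int k \<in> M"
    by (intro M_add M_mult seven_M k V_rules)
  also have "of_int a * 7 + of_int b * of_int k = (of_int (a * 7 + b * k) :: complex)" by simp
  finally show False using one_M by (simp add: ab)
qed

lemma inverse_of_int: "\<not> 7 dvd k \<Longrightarrow> 1 / of_int k \<in> V"
  using unit[OF V_rules(10) unit_of_int] by (simp add: inverse_eq_divide)

lemma numerals_V: "numeral k \<in> V" using V_rules(9)[of "numeral k"] by simp

lemma one_plus_M: assumes "x \<in> M" shows "1 + x \<in> V" "1 + x \<noteq> 0" "inverse (1 + x) \<in> V"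
proof -
  show v: "1 + x \<in> V" by (rule V_rules(6)[OF V_rules(1) M_sub[OF assms]])
  have "1 + x \<notin> M"
  proof
    assume "1 + x \<in> M"
    from M_diff[OF this assms] show False using one_M by simp
  qed
  then show "1 + x \<noteq> 0" "inverse (1 + x) \<in> V" using unit[OF v] by auto
qed

text \<open>Valuation rings are integrally closed, here for the equation X^k = c. It allows roots to
  be taken after normalising by a twelfth root.\<close>

lemma power_V: assumes "x ^ k \<in> V" "k > 0" shows "x \<in> V"
proof (rule ccontr)
  assume x: "x \<notin> V"
  then have x0: "x \<noteq> 0" using V_rules by auto
  have i: "inverse x \<in> V" using x total by blast
  obtain j where k: "k = Suc j" using assms(2) by (cases k) auto
  have "x ^ k * inverse x ^ j \<in> V" by (intro V_rules assms i)
  also have "x ^ k * inverse x ^ j = x" using x0 by (simp add: k power_inverse)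
  finally show False using x by simp
qed

end

text \<open>One step of Legendre's formula: the multiples of 7 up to k contribute 7^(k div 7) times
  a smaller factorial, all other factors are prime to 7.\<close>

lemma fact_seven: "\<exists>c. \<not> (7::nat) dvd c \<and> fact k = 7 ^ (k div 7) * fact (k div 7) * c"
proof (induction k)
  case (Suc k)
  then obtain c where c: "\<not> (7::nat) dvd c" "fact k = 7 ^ (k div 7) * fact (k div 7) * c" by blast
  show ?case
  proof (cases "7 dvd Suc k")
    case True
    then have d1: "Suc k div 7 = Suc (k div 7)" by (subst div_Suc) (simp add: dvd_eq_mod_eq_0)
    have d2: "Suc k = 7 * Suc (k div 7)" using dvd_mult_div_cancel[OF True] unfolding d1 by simp
    note d = d1 d2
    have "fact (Suc k) = Suc k * (7 ^ (k div 7) * fact (k div 7) * c)" using c(2) by simp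
    also have "\<dots> = 7 ^ (Suc k div 7) * fact (Suc k div 7) * c"
      unfolding d(1) by (subst d(2)) (simp add: algebra_simps)
    finally show ?thesis using c(1) by blast
  next
    case False
    then have d: "Suc k div 7 = k div 7" by (subst div_Suc) (simp add: dvd_eq_mod_eq_0)
    have "\<not> 7 dvd c * Suc k"
      using prime_dvd_mult_iff[of "7::nat" c "Suc k"] False c(1) by simp
    moreover have "fact (Suc k) = 7 ^ (Suc k div 7) * fact (Suc k div 7) * (c * Suc k)"
      unfolding d using c(2) by (simp add: algebra_simps)
    ultimately show ?thesis by blast
  qed
qed auto

lemma two_choose_two: "2 * of_nat (k choose 2) = (of_nat k * (of_nat k - 1) :: 'a :: comm_ring_1)"
proof -
  have "2 dvd k * (k - 1)" by (cases k) auto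
  then have "2 * (k choose 2) = k * (k - 1)" by (simp add: choose_two)
  then have "of_nat (2 * (k choose 2)) = (of_nat (k * (k - 1)) :: 'a)" by (rule arg_cong)
  then show ?thesis by (cases k) (auto simp: algebra_simps)
qed

text \<open>Falling factorials are X times a cofactor. On the two points \<open>m\<close>,
  \<open>n\<close> the cofactor may be reduced modulo the monic polynomial (X - m)(X - n), which
  keeps integer coefficients and leaves degree at most 1.\<close>

lemma choose_reduce:
  fixes m n k :: nat
  assumes "k > 0"
  shows "\<exists>u w :: int. \<forall>x\<in>{m, n}.
    fact k * of_nat (x choose k) = (of_int u * of_nat x + of_int w * of_nat x * (of_nat x - 1) :: complex)"
proof -
  define f where "f k x = (\<Prod>i=0..<k. (of_nat x - of_nat i :: complex))" for k x :: nat
  have f: "fact k * of_nat (x choose k) = f k x" for k x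
    by (simp add: f_def binomial_gbinomial gbinomial_prod_rev)
  have "\<exists>u w :: int. \<forall>x\<in>{m, n}. f (Suc k) x = of_int u * of_nat x + of_int w * of_nat x * (of_nat x - 1)" for k
  proof (induction k)
    case 0
    then show ?case by (intro exI[of _ 1] exI[of _ 0]) (simp add: f_def)
  next
    case (Suc k)
    then obtain u w :: int where uw: "\<And>x. x \<in> {m, n} \<Longrightarrow> f (Suc k) x = of_int u * of_nat x + of_int w * of_nat x * (of_nat x - 1)" by blast
    \<comment> \<open>The coefficients, in the basis 1, X - 1, of the remainder of (u + w (X - 1))
      (X - k - 1) modulo (X - m)(X - n).\<close>
    define u' w' where "u' = - int k * u + w * (int m + int n - 1 - int m * int n)"
      and "w' = u + w * (int m + int n - int k - 2)"
    have "f (Suc (Suc k)) x = of_int u' * of_nat x + of_int w' * of_nat x * (of_nat x - 1)" if x: "x \<in> {m, n}" for x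
    proof -
      have r: "(of_nat x - of_nat m) * (of_nat x - of_nat n :: complex) = 0" using x by auto
      have "f (Suc (Suc k)) x = f (Suc k) x * (of_nat x - of_nat (Suc k))" by (simp add: f_def)
      also have "\<dots> = (of_int u * of_nat x + of_int w * of_nat x * (of_nat x - 1)) * (of_nat x - of_nat k - 1)"
        by (simp add: uw[OF x] algebra_simps)
      also have "\<dots> = of_int u' * of_nat x + of_int w' * of_nat x * (of_nat x - 1)"
        unfolding u'_def w'_def of_int_add of_int_diff of_int_mult of_int_minus of_int_of_nat_eq of_int_1 of_int_numeral
        using r by algebra
      finally show ?thesis .
    qed
    then show ?case by blast
  qed note S = this
  obtain j where "k = Suc j" using assms by (cases k) auto
  then show ?thesis using S[of j] by (simp only: f)
qed

context place7 begin

text \<open>Legendre gives about k/6 factors 7 in k!. The cruder k div 3 is enough and survives the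
  recursion, because j + j div 3 with j = k div 7 stays below (7 j) div 3.\<close>

lemma inverse_fact: "7 ^ (k div 3) / fact k \<in> V"
proof (induction k rule: less_induct)
  case (less k)
  obtain c where c: "\<not> (7::nat) dvd c" "fact k = 7 ^ (k div 7) * fact (k div 7) * c" using fact_seven by blast
  have c0: "1 / of_nat c \<in> V" using inverse_of_int[of "int c"] c(1) by (simp add: int_dvd_int_iff[of 7, simplified])
  have fk: "(fact k :: complex) = 7 ^ (k div 7) * fact (k div 7) * of_nat c"
    using arg_cong[OF c(2), of "of_nat :: nat \<Rightarrow> complex"] by simp
  show ?case
  proof (cases "k = 0")
    case True then show ?thesis using V_rules by simp
  next
    case False
    define j where "j = k div 7"
    have "j < k" using False by (simp add: j_def)
    then have I: "7 ^ (j div 3) / fact j \<in> V" by (rule less)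
    have "j + j div 3 \<le> (j + 2 * j * 3) div 3" by (simp only: div_mult_self1)
    also have "\<dots> \<le> k div 3" by (intro div_le_mono) (simp add: j_def)
    finally have le: "j + j div 3 \<le> k div 3" .
    have "7 ^ (k div 3) / fact k = 7 ^ (k div 3 - (j + j div 3)) * (7 ^ (j div 3) / fact j) * (1 / of_nat c :: complex)"
    proof -
      define e where "e = k div 3 - (j + j div 3)"
      have "k div 3 = e + j + j div 3" using le by (simp add: e_def)
      then have "(7::complex) ^ (k div 3) = 7 ^ (k div 3 - (j + j div 3)) * 7 ^ j * 7 ^ (j div 3)"
        by (simp add: power_add)
      then show ?thesis unfolding fk j_def[symmetric] by simp
    qed
    also have "\<dots> \<in> V" by (intro V_rules numerals_V I c0)
    finally show ?thesis .
  qed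
qed

text \<open>In \<open>trinomial_close_roots\<close> the coefficient \<open>Q k\<close> is
  accompanied by at least k - 2 factors divisible by 7. One is saved for the conclusion, so k - 3
  remain to pay for the denominator k!.\<close>

lemma inverse_fact3: assumes "k \<ge> 3" shows "7 ^ (k - 3) / fact k \<in> V"
proof (cases "k < 7")
  case True
  then have "k div 7 = 0" by simp
  then obtain c where c: "\<not> (7::nat) dvd c" "fact k = c" using fact_seven[of k] by auto
  have "(fact k :: complex) = of_nat c" by (metis c(2) of_nat_fact)
  then have "1 / fact k \<in> V" using inverse_of_int[of "int c"] c(1)
    by (simp add: int_dvd_int_iff[of 7, simplified])
  then have "7 ^ (k - 3) * (1 / fact k) \<in> V" by (intro V_rules numerals_V)
  then show ?thesis by simp
next
  case False
  then have "k div 3 \<le> k - 3" by presburger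
  then have "(7::complex) ^ (k - 3) = 7 ^ (k - 3 - k div 3) * 7 ^ (k div 3)"
    by (simp only: power_add[symmetric] le_add_diff_inverse2)
  then have "7 ^ (k - 3) / fact k = 7 ^ (k - 3 - k div 3) * (7 ^ (k div 3) / fact k :: complex)"
    by simp
  also have "\<dots> \<in> V" by (intro V_rules numerals_V inverse_fact)
  finally show ?thesis .
qed

text \<open>A trinomial has at most two roots in a residue disc of \<open>V\<close> of radius \<open>|7|\<close>: the binomial
  expansion around one root is dominated by its terms of degree at most two, because
  \<open>k! Q\<^sub>k\<close> is an integral combination of \<open>Q\<^sub>1\<close> and \<open>2 Q\<^sub>2\<close>.\<close>

lemma trinomial_close_roots:
  fixes \<alpha> \<beta> \<gamma> x s t :: complex
  assumes mn: "0 < n" "n < m" and a: "\<alpha> \<noteq> 0" and x: "x \<noteq> 0"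
    and st: "s / 7 \<in> V" "t / 7 \<in> V" "s \<noteq> 0" "t \<noteq> 0" "s \<noteq> t"
    and roots: "\<alpha> * x ^ m + \<beta> * x ^ n + \<gamma> = 0"
      "\<alpha> * (x * (1 + s)) ^ m + \<beta> * (x * (1 + s)) ^ n + \<gamma> = 0"
      "\<alpha> * (x * (1 + t)) ^ m + \<beta> * (x * (1 + t)) ^ n + \<gamma> = 0"
  shows False
proof -
  \<comment> \<open>Rescaling moves the root \<open>x\<close> to 1; \<open>Q k\<close> is then the
    k-th coefficient of a (1 + s)^m + b (1 + s)^n in powers of s.\<close>
  define a b where "a = \<alpha> * x ^ m" and "b = \<beta> * x ^ n"
  define Q where "Q k = a * of_nat (m choose k) + b * of_nat (n choose k)" for k
  have a0: "a \<noteq> 0" using a x by (simp add: a_def)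
  have E: "(\<Sum>k<m. Q (Suc k) * s ^ k) = 0"
    if "s \<noteq> 0" "\<alpha> * (x * (1 + s)) ^ m + \<beta> * (x * (1 + s)) ^ n + \<gamma> = 0" for s
  proof -
    have bin: "(1 + s) ^ j = 1 + s * (\<Sum>k<m. of_nat (j choose Suc k) * s ^ k)" if "j \<le> m" for j
    proof -
      have "(1 + s) ^ j = (\<Sum>k\<le>j. of_nat (j choose k) * s ^ k)"
        using binomial_ring[of s 1 j] by (simp add: add.commute)
      also have "\<dots> = (\<Sum>k\<le>m. of_nat (j choose k) * s ^ k)"
        using that by (intro sum.mono_neutral_left) auto
      also have "\<dots> = 1 + (\<Sum>k<m. of_nat (j choose Suc k) * s ^ Suc k)"
        by (simp add: lessThan_Suc_atMost[symmetric] sum.lessThan_Suc_shift del: sum.lessThan_Suc)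
      finally show ?thesis by (simp add: sum_distrib_left mult_ac)
    qed
    have "a * (1 + s) ^ m + b * (1 + s) ^ n + \<gamma> = 0"
      using that(2) unfolding a_def b_def power_mult_distrib by (simp only: mult.assoc)
    moreover have "a + b + \<gamma> = 0" using roots(1) by (simp add: a_def b_def)
    ultimately have "a * (1 + s) ^ m + b * (1 + s) ^ n + \<gamma> = a + b + \<gamma>" by (simp only:)
    then have "a * (1 + s) ^ m + b * (1 + s) ^ n - (a + b) = 0" by simp
    then have "s * (a * (\<Sum>k<m. of_nat (m choose Suc k) * s ^ k) + b * (\<Sum>k<m. of_nat (n choose Suc k) * s ^ k)) = 0"
      using bin[of m] bin[of n] mn by (simp add: algebra_simps)
    then have "a * (\<Sum>k<m. of_nat (m choose Suc k) * s ^ k) + b * (\<Sum>k<m. of_nat (n choose Suc k) * s ^ k) = 0"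
      using that(1) by simp
    then show ?thesis by (simp add: Q_def sum_distrib_left sum.distrib algebra_simps)
  qed
  have Es: "(\<Sum>k<m. Q (Suc k) * s ^ k) = 0" and Et: "(\<Sum>k<m. Q (Suc k) * t ^ k) = 0"
    using E st roots by auto
  have Q12: "Q 1 \<noteq> 0 \<or> Q 2 \<noteq> 0"
  proof (rule ccontr)
    assume "\<not> ?thesis"
    then have q1: "a * of_nat m + b * of_nat n = 0" and q2: "Q 2 = 0" by (auto simp: Q_def)
    have "2 * Q 2 = a * (2 * of_nat (m choose 2)) + b * (2 * of_nat (n choose 2))"
      by (simp add: Q_def algebra_simps)
    then have "2 * Q 2 = a * (of_nat m * (of_nat m - 1)) + b * (of_nat n * (of_nat n - 1))"
      unfolding two_choose_two .
    then have "a * (of_nat m * (of_nat m - 1)) + b * (of_nat n * (of_nat n - 1)) = 0" using q2 by simp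
    then have "a * of_nat m * (of_nat m - of_nat n) = 0" using q1 by algebra
    then show False using a0 mn by auto
  qed
  \<comment> \<open>\<open>g\<close> is whichever of \<open>Q 1\<close>, \<open>Q 2\<close> has the
    larger absolute value at the place, so that one of the two quotients is 1. The contradiction
    will be that both quotients are divisible by 7.\<close>
  obtain g where g: "g \<noteq> 0" "Q 1 / g \<in> V" "Q 2 / g \<in> V" "g = Q 1 \<or> g = Q 2"
  proof (cases "Q 1 = 0 \<or> Q 2 = 0")
    case True
    then show thesis using that[of "if Q 1 = 0 then Q 2 else Q 1"] Q12 V_rules by auto
  next
    case False
    then show thesis using total[of "Q 1 / Q 2"] that[of "Q 2"] that[of "Q 1"] V_rules by auto
  qed
  have Qk: "7 ^ (k - 3) * Q k / g \<in> V" if "k \<ge> 3" for k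
  proof -
    have k0: "k > 0" using that by simp
    obtain u w :: int where uw: "\<And>x. x \<in> {m, n} \<Longrightarrow>
       fact k * of_nat (x choose k) = (of_int u * of_nat x + of_int w * of_nat x * (of_nat x - 1) :: complex)"
      using choose_reduce[where m = m and n = n, OF k0] by blast
    have "fact k * Q k = a * (fact k * of_nat (m choose k)) + b * (fact k * of_nat (n choose k))"
      by (simp add: Q_def algebra_simps)
    also have "\<dots> = of_int u * Q 1 + of_int w * 2 * Q 2"
      using uw[of m] uw[of n] by (simp add: Q_def mult.assoc flip: two_choose_two) (simp add: algebra_simps)
    finally have Qk: "Q k = (of_int u * Q 1 + of_int w * 2 * Q 2) / fact k" by (simp add: field_simps)
    have "7 ^ (k - 3) * Q k / g = (7 ^ (k - 3) / fact k) * (of_int u * (Q 1 / g) + of_int w * 2 * (Q 2 / g))"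
      unfolding Qk by (simp add: add_divide_distrib distrib_left mult_ac)
    also have "\<dots> \<in> V" by (intro V_rules inverse_fact3 that g numerals_V)
    finally show ?thesis .
  qed
  have "7 * (s / 7) \<in> V" "7 * (t / 7) \<in> V" by (intro V_rules(4) numerals_V st)+
  then have sV: "s \<in> V" "t \<in> V" by simp_all
  have m2: "m \<ge> 2" using mn by simp
  \<comment> \<open>The divided difference of the two expansions eliminates \<open>Q 1\<close> and
    isolates \<open>Q 2\<close> up to terms divisible by 7; the expansion at \<open>s\<close> then
    handles \<open>Q 1\<close>.\<close>
  have "(\<Sum>k<m. Q (Suc k) * (s ^ k - t ^ k)) = 0"
    using Es Et by (simp add: right_diff_distrib sum_subtractf)
  also have "(\<Sum>k<m. Q (Suc k) * (s ^ k - t ^ k)) = (s - t) * (\<Sum>k<m. Q (Suc k) * (\<Sum>i<k. s ^ i * t ^ (k - Suc i)))"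
  proof -
    have "s ^ k - t ^ k = (s - t) * (\<Sum>i<k. s ^ i * t ^ (k - Suc i))" for k
      by (simp add: power_diff_sumr2 mult.commute[of "s ^ _"])
    then show ?thesis by (simp add: sum_distrib_left mult.left_commute)
  qed
  finally have H: "(\<Sum>k<m. Q (Suc k) * (\<Sum>i<k. s ^ i * t ^ (k - Suc i))) = 0" using st(5) by simp
  have two: "{..<m} = insert 0 (insert 1 {2..<m})" using m2 by auto
  have t7: "s ^ i * t ^ j / 7 ^ (i + j) \<in> V" for i j
  proof -
    have "s ^ i * t ^ j / 7 ^ (i + j) = (s / 7) ^ i * (t / 7) ^ j" by (simp add: power_divide power_add)
    then show ?thesis using st V_rules by simp
  qed
  have small: "Q (Suc k) * (s ^ i * t ^ j) / g / 7 \<in> V" if "k \<ge> 2" "i + j \<ge> k - 1" for k i j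
  proof -
    have e: "i + j = Suc k - 3 + (i + j - (k - 1)) + 1" using that by simp
    have "(7::complex) ^ (i + j) = 7 ^ (Suc k - 3) * 7 ^ (i + j - (k - 1)) * 7"
      by (subst e) (simp add: power_add)
    then have "Q (Suc k) * (s ^ i * t ^ j) / g / 7 =
        (7 ^ (Suc k - 3) * Q (Suc k) / g) * 7 ^ (i + j - (k - 1)) * (s ^ i * t ^ j / 7 ^ (i + j))"
      by simp
    also have "\<dots> \<in> V" by (intro V_rules Qk t7 numerals_V) (use that in auto)
    finally show ?thesis .
  qed
  have "Q 2 / g / 7 = - (\<Sum>k\<in>{2..<m}. \<Sum>i<k. Q (Suc k) * (s ^ i * t ^ (k - Suc i)) / g / 7)"
  proof -
    have "Q 2 + (\<Sum>k\<in>{2..<m}. Q (Suc k) * (\<Sum>i<k. s ^ i * t ^ (k - Suc i))) = 0"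
      using H unfolding two by (simp add: numeral_2_eq_2)
    then have "Q 2 = - (\<Sum>k\<in>{2..<m}. Q (Suc k) * (\<Sum>i<k. s ^ i * t ^ (k - Suc i)))"
      by (simp add: eq_neg_iff_add_eq_0)
    then show ?thesis by (simp add: sum_divide_distrib sum_distrib_left)
  qed
  also have "\<dots> \<in> V"
    by (intro V_rules small) auto
  finally have q2: "Q 2 / g / 7 \<in> V" .
  have "Q 1 / g / 7 = - (s * (Q 2 / g / 7) + (\<Sum>k\<in>{2..<m}. Q (Suc k) * (s ^ k * t ^ 0) / g / 7))"
  proof -
    have "Q 1 + (Q 2 * s + (\<Sum>k\<in>{2..<m}. Q (Suc k) * s ^ k)) = 0"
      using Es unfolding two by (simp add: numeral_2_eq_2)
    then have "Q 1 = - (Q 2 * s + (\<Sum>k\<in>{2..<m}. Q (Suc k) * s ^ k))"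
      by (simp only: eq_neg_iff_add_eq_0)
    then show ?thesis by (simp add: sum_divide_distrib add_divide_distrib diff_divide_distrib mult.commute)
  qed
  also have "\<dots> \<in> V"
    by (intro V_rules small q2 sV) auto
  finally have q1: "Q 1 / g / 7 \<in> V" .
  show False using q1 q2 g V7 by auto
qed

end

section \<open>Reduction modulo 7\<close>

context cx_lattice begin

text \<open>The Weierstrass equation reads \<open>\<wp>'\<^sup>2 = 4 (\<wp>\<^sup>3 - ga \<wp>) - de\<close>, that is, \<open>g\<^sub>2 = 4 ga\<close> and \<open>g\<^sub>3 = de\<close>.\<close>

definition ga :: complex where "ga = 15 * G 4"
definition de :: complex where "de = 140 * G 6"

lemma wp_ODE: "z \<notin> L \<Longrightarrow> (wp' z)\<^sup>2 = 4 * wp z ^ 3 - 4 * ga * wp z - de"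
  using wp_ODE1 by (simp add: ga_def de_def)

lemma wp_add:
  assumes "u \<notin> L" "v \<notin> L" "u + v \<notin> L"
  shows "2 * wp (u + v) * (wp u - wp v)\<^sup>2 = (wp u + wp v) * (2 * wp u * wp v - 2 * ga) - de - wp' u * wp' v"
  using wp_addition[OF assms] by (simp add: ga_def de_def)

text \<open>The symmetric functions of \<open>wp (u + v)\<close> and \<open>wp (u - v)\<close> are
  free of wp', so they can be estimated at the place from the values of wp alone.\<close>

lemma wp_sum_product:
  assumes u: "u \<notin> L" and v: "v \<notin> L" and uv: "u + v \<notin> L" "u - v \<notin> L" and d: "wp u \<noteq> wp v"
  shows "(wp (u + v) + wp (u - v)) * (wp u - wp v)\<^sup>2 = (wp u + wp v) * (2 * wp u * wp v - 2 * ga) - de"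
    and "wp (u + v) * wp (u - v) * (wp u - wp v)\<^sup>2 = (wp u * wp v + ga)\<^sup>2 + de * (wp u + wp v)"
proof -
  let ?S = "(wp u + wp v) * (2 * wp u * wp v - 2 * ga) - de"
  have a: "2 * wp (u + v) * (wp u - wp v)\<^sup>2 = ?S - wp' u * wp' v"
    using wp_add[OF u v uv(1)] .
  have "- v \<notin> L" "u + - v \<notin> L" using v uv by auto
  from wp_add[OF u this] have b: "2 * wp (u - v) * (wp u - wp v)\<^sup>2 = ?S + wp' u * wp' v"
    by (simp add: wp_even wp'_odd)
  show "(wp (u + v) + wp (u - v)) * (wp u - wp v)\<^sup>2 = (wp u + wp v) * (2 * wp u * wp v - 2 * ga) - de"
    using a b by algebra
  have q: "4 * (wp (u + v) * wp (u - v) * (wp u - wp v)\<^sup>2) * (wp u - wp v)\<^sup>2 = ?S\<^sup>2 - (wp' u)\<^sup>2 * (wp' v)\<^sup>2"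
  proof -
    have "4 * (wp (u + v) * wp (u - v) * (wp u - wp v)\<^sup>2) * (wp u - wp v)\<^sup>2
      = (2 * wp (u + v) * (wp u - wp v)\<^sup>2) * (2 * wp (u - v) * (wp u - wp v)\<^sup>2)" by algebra
    also have "\<dots> = ?S\<^sup>2 - (wp' u)\<^sup>2 * (wp' v)\<^sup>2" unfolding a b by algebra
    finally show ?thesis .
  qed
  have "?S\<^sup>2 - (wp' u)\<^sup>2 * (wp' v)\<^sup>2 = 4 * ((wp u * wp v + ga)\<^sup>2 + de * (wp u + wp v)) * (wp u - wp v)\<^sup>2"
    unfolding wp_ODE[OF u] wp_ODE[OF v] by algebra
  then have E: "4 * (wp (u + v) * wp (u - v) * (wp u - wp v)\<^sup>2) * (wp u - wp v)\<^sup>2 =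
     4 * ((wp u * wp v + ga)\<^sup>2 + de * (wp u + wp v)) * (wp u - wp v)\<^sup>2" using q by simp
  show "wp (u + v) * wp (u - v) * (wp u - wp v)\<^sup>2 = (wp u * wp v + ga)\<^sup>2 + de * (wp u + wp v)"
  proof -
    have "4 * (wp u - wp v)\<^sup>2 \<noteq> 0" using d by simp
    moreover have "a = b" if "4 * a * d = 4 * b * d" "4 * d \<noteq> 0" for a b d :: complex
      using that by simp
    ultimately show ?thesis using E by blast
  qed
qed

text \<open>Put u = v + e in the product formula and let e tend to 0: wp(e) e^2 tends to 1, and the
  difference quotient of wp to wp' v.\<close>

lemma wp_duplication:
  assumes v: "v \<notin> L" and v2: "2 * v \<notin> L" and y: "wp' v \<noteq> 0"
  shows "wp (2 * v) * (wp' v)\<^sup>2 = ((wp v)\<^sup>2 + ga)\<^sup>2 + 2 * de * wp v"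
proof -
  let ?x = "wp v"
  have lim1: "((\<lambda>e. (wp (v + e) - ?x) / e) \<longlongrightarrow> wp' v) (at 0)"
    using wp_deriv[OF v] by (simp add: DERIV_def)
  obtain r m where r: "r > 0" "m holomorphic_on ball 0 r" "ball 0 r \<inter> L0 = {}"
    "\<And>u. u \<in> ball 0 r \<Longrightarrow> R u = 3 * G 4 * u\<^sup>2 + 5 * G 6 * u ^ 4 + u ^ 6 * m u"
    by (rule R_taylor) blast
  define N where "N = (\<lambda>u. 1 + u\<^sup>2 * (3 * G 4 * u\<^sup>2 + 5 * G 6 * u ^ 4 + u ^ 6 * m u))"
  have "((\<lambda>e. wp e * e\<^sup>2) \<longlongrightarrow> N 0) (at 0)"
  proof (rule continuous_lim_0[OF r(1)])
    show "continuous_on (ball 0 r) N"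
      unfolding N_def using holomorphic_on_imp_continuous_on[OF r(2)] by (intro continuous_intros)
    fix u :: complex assume u: "u \<in> ball 0 r" "u \<noteq> 0"
    have "(1 / u\<^sup>2 + X) * u\<^sup>2 = 1 + u\<^sup>2 * X" for X using u(2) by (simp add: field_simps)
    then show "wp u * u\<^sup>2 = N u" unfolding wp_def r(4)[OF u(1)] N_def .
  qed
  then have lim2: "((\<lambda>e. wp e * e\<^sup>2) \<longlongrightarrow> 1) (at 0)" by (simp add: N_def)
  have cont: "isCont wp z" if "z \<notin> L" for z using wp_deriv[OF that] DERIV_isCont by blast
  have lim3: "((\<lambda>e. wp (2 * v + e)) \<longlongrightarrow> wp (2 * v)) (at 0)"
    using cont[OF v2] by (simp add: isCont_iff)
  have lim4: "((\<lambda>e. wp (v + e)) \<longlongrightarrow> ?x) (at 0)"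
    using cont[OF v] by (simp add: isCont_iff)
  have "((\<lambda>e. wp (2 * v + e) * (wp e * e\<^sup>2) * ((wp (v + e) - ?x) / e)\<^sup>2) \<longlongrightarrow> wp (2 * v) * 1 * (wp' v)\<^sup>2) (at 0)"
    by (intro tendsto_intros lim1 lim2 lim3)
  moreover have "\<forall>\<^sub>F e in at 0. wp (2 * v + e) * (wp e * e\<^sup>2) * ((wp (v + e) - ?x) / e)\<^sup>2 =
      (wp (v + e) * ?x + ga)\<^sup>2 + de * (wp (v + e) + ?x)"
  proof -
    have ev: "\<forall>\<^sub>F e in at 0. z + e \<notin> L" if "z \<notin> L" for z
    proof -
      have "((\<lambda>e. z + e) \<longlongrightarrow> z + 0) (at 0)" by (intro tendsto_intros)
      then have "\<forall>\<^sub>F e in at 0. z + e \<in> - L"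
        using open_compl_L that by (intro topological_tendstoD) auto
      then show ?thesis by simp
    qed
    have "\<forall>\<^sub>F e in at 0. (wp (v + e) - ?x) / e \<noteq> 0"
      using tendsto_imp_eventually_ne[OF lim1 y] .
    moreover have "\<forall>\<^sub>F e in at 0. e \<in> ball 0 r - {0}" using r(1) by (intro eventually_at_in_open) auto
    moreover note ev[OF v] ev[OF v2]
    ultimately show ?thesis
    proof eventually_elim
      case (elim e)
      have e: "e \<notin> L" "e \<noteq> 0" using elim(2) r(3) by auto
      have d: "wp (v + e) \<noteq> ?x" using elim(1) by auto
      have ve: "v + e + v = 2 * v + e" "v + e - v = e" by simp_all
      then have "v + e + v \<notin> L" "v + e - v \<notin> L" using elim(4) e by simp_all
      from wp_sum_product(2)[OF elim(3) v this d]
      have "wp (2 * v + e) * wp e * (wp (v + e) - ?x)\<^sup>2 = (wp (v + e) * ?x + ga)\<^sup>2 + de * (wp (v + e) + ?x)"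
        unfolding ve .
      moreover have "wp (2 * v + e) * (wp e * e\<^sup>2) * ((wp (v + e) - ?x) / e)\<^sup>2 = wp (2 * v + e) * wp e * (wp (v + e) - ?x)\<^sup>2"
        using e(2) by (simp add: power_divide)
      ultimately show ?case by simp
    qed
  qed
  ultimately have "((\<lambda>e. (wp (v + e) * ?x + ga)\<^sup>2 + de * (wp (v + e) + ?x)) \<longlongrightarrow> wp (2 * v) * (wp' v)\<^sup>2) (at 0)"
    by (simp add: Lim_transform_eventually)
  moreover have "((\<lambda>e. (wp (v + e) * ?x + ga)\<^sup>2 + de * (wp (v + e) + ?x)) \<longlongrightarrow> (?x * ?x + ga)\<^sup>2 + de * (?x + ?x)) (at 0)"
    by (intro tendsto_intros lim4)
  ultimately have "wp (2 * v) * (wp' v)\<^sup>2 = (?x * ?x + ga)\<^sup>2 + de * (?x + ?x)"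
    by (rule LIM_unique)
  then show ?thesis by (simp add: power2_eq_square algebra_simps)
qed

end

locale lattice_place = cx_lattice + place7 +
  assumes gaV: "15 * eisenstein_sum 4 (zspan w1 w2) \<in> V" and deV: "140 * eisenstein_sum 6 (zspan w1 w2) \<in> V"
begin

lemma ga_V: "ga \<in> V" using gaV by (simp add: ga_def)
lemma de_V: "de \<in> V" using deV by (simp add: de_def)

text \<open>The points \<open>w\<close> with \<open>\<wp>(w) \<notin> V\<close> form the kernel of reduction; there
  \<open>1/\<wp>(n w) \<equiv> n\<^sup>2/\<wp>(w)\<close> modulo higher order terms, so it has no torsion prime to 7.\<close>

lemma torsion_integral:
  assumes w: "w \<notin> L" and N: "of_int N * w \<in> L" "\<not> 7 dvd N"
  shows "wp w \<in> V"
proof (rule ccontr)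
  assume wV: "wp w \<notin> V"
  define \<xi> where "\<xi> = 1 / wp w"
  have x0: "wp w \<noteq> 0" using wV V_rules(2) by auto
  have xi0: "\<xi> \<noteq> 0" using x0 by (simp add: \<xi>_def)
  have wxi: "wp w * \<xi> = 1" using x0 by (simp add: \<xi>_def)
  have xiM: "\<xi> \<in> M" using wV by (simp add: M_def \<xi>_def inverse_eq_divide)
  have xiV: "\<xi> \<in> V" using xiM by (rule M_sub)
  \<comment> \<open>The ideal generated by the square of \<xi>; congruences modulo \<open>I\<close>
    express "up to higher order terms" in the kernel of reduction.\<close>
  define I where "I = {y. y / \<xi>\<^sup>2 \<in> V}"
  have I_add: "a + b \<in> I" if "a \<in> I" "b \<in> I" for a b
    using that V_rules(6) by (simp add: I_def add_divide_distrib)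
  have I_minus: "- a \<in> I" if "a \<in> I" for a
    using that V_rules(5)[of "a / \<xi>\<^sup>2"] by (simp add: I_def)
  have I_diff: "a - b \<in> I" if "a \<in> I" "b \<in> I" for a b
    using I_add[OF that(1) I_minus[OF that(2)]] by simp
  have I_sq: "\<xi>\<^sup>2 * c \<in> I" if "c \<in> V" for c using that xi0 by (simp add: I_def)
  have I_mult: "c * a \<in> I" if "c \<in> V" "a \<in> I" for a c
    using that V_rules(4)[of c "a / \<xi>\<^sup>2"] by (simp add: I_def)
  have inv1: "1 / (1 + \<xi>\<^sup>2 * c) - 1 \<in> I \<and> 1 + \<xi>\<^sup>2 * c \<noteq> 0 \<and> 1 / (1 + \<xi>\<^sup>2 * c) \<in> V" if "c \<in> V" for c
  proof -
    have "\<xi>\<^sup>2 * c \<in> M" using M_mult[OF xiM, of "\<xi> * c"] V_rules(4)[OF xiV that] by (simp add: power2_eq_square mult_ac)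
    from one_plus_M[OF this] have u: "1 + \<xi>\<^sup>2 * c \<noteq> 0" "inverse (1 + \<xi>\<^sup>2 * c) \<in> V" by auto
    have "1 / (1 + \<xi>\<^sup>2 * c) - 1 = \<xi>\<^sup>2 * (- c * inverse (1 + \<xi>\<^sup>2 * c))"
      using u(1) by (simp add: field_simps)
    then show ?thesis using u I_sq[OF V_rules(4)[OF V_rules(5)[OF that] u(2)]] by (simp add: inverse_eq_divide)
  qed
  have y0: "wp' w \<noteq> 0"
  proof
    assume "wp' w = 0"
    then have "4 * wp w ^ 3 - 4 * ga * wp w - de = 0" using wp_ODE[OF w] by simp
    then have "4 = (\<xi> * (4 * ga + de * \<xi>)) * \<xi>" using wxi by algebra
    also have "\<dots> \<in> M" by (intro M_mult xiM V_rules xiV ga_V de_V numerals_V)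
    finally show False using unit_of_int[of 4] by simp
  qed
  have two: "2 * w \<notin> L"
  proof
    assume "2 * w \<in> L"
    then have "wp' (- w + 2 * w) = wp' (- w)" by (rule wp'_periodic)
    then show False using y0 by (simp add: wp'_odd)
  qed
  \<comment> \<open>The value 0 at lattice points is the value of 1 / wp at its pole, so one
    recursion holds whether or not a multiple of \<open>w\<close> is a period.\<close>
  define xi where "xi n = (if of_nat n * w \<in> L then 0 else 1 / wp (of_nat n * w))" for n :: nat
  have dup: "wp (2 * w) \<noteq> 0" "1 / wp (2 * w) - 4 * \<xi> \<in> I"
  proof -
    define U where "U = 1 + \<xi>\<^sup>2 * (2 * ga + ga\<^sup>2 * \<xi>\<^sup>2 + 2 * de * \<xi>)"
    have "2 * ga + ga\<^sup>2 * \<xi>\<^sup>2 + 2 * de * \<xi> \<in> V" by (intro V_rules ga_V de_V xiV numerals_V)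
    then have U: "1 / U - 1 \<in> I" "U \<noteq> 0" "1 / U \<in> V" using inv1 unfolding U_def by blast+
    have "wp (2 * w) * (4 * wp w ^ 3 - 4 * ga * wp w - de) = ((wp w)\<^sup>2 + ga)\<^sup>2 + 2 * de * wp w"
      using wp_duplication[OF w two y0] unfolding wp_ODE[OF w] .
    then have *: "wp (2 * w) * (\<xi> * (4 - 4 * ga * \<xi>\<^sup>2 - de * \<xi> ^ 3)) = U"
      unfolding U_def using wxi by algebra
    then show nz: "wp (2 * w) \<noteq> 0" using U(2) by auto
    have "1 / wp (2 * w) = \<xi> * (4 - 4 * ga * \<xi>\<^sup>2 - de * \<xi> ^ 3) * (1 / U)"
      using nz U(2) * by (simp add: divide_simps mult.commute)
    then have "1 / wp (2 * w) - 4 * \<xi> = 4 * \<xi> * (1 / U - 1) + \<xi>\<^sup>2 * (- (\<xi> * (4 * ga) + de * \<xi>\<^sup>2) * (1 / U))"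
      by algebra
    also have "\<dots> \<in> I" by (intro I_add I_mult I_sq U V_rules xiV ga_V de_V numerals_V)
    finally show "1 / wp (2 * w) - 4 * \<xi> \<in> I" .
  qed
  have sym: "wp a = wp b" if "a - b \<in> L" "b \<notin> L" for a b
    using wp_periodic[OF that(1) that(2)] by simp
  have sym': "wp a = wp b" if "a + b \<in> L" "b \<notin> L" for a b
    using wp_periodic[OF that(1), of "- b"] that(2) by (simp add: wp_even)
  \<comment> \<open>The parallelogram law for 1 / wp modulo \<open>I\<close>, whose solution is n^2
    \<xi>. The lattice cases replace \<open>wp (u + w)\<close> or \<open>wp (u - w)\<close> by a
    value at \<open>w\<close> or \<open>2 * w\<close>.\<close>
  have step: "(of_nat (Suc (Suc n)) * w \<notin> L \<longrightarrow> wp (of_nat (Suc (Suc n)) * w) \<noteq> 0) \<and>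
      xi (Suc (Suc n)) + xi n - 2 * \<xi> - 2 * xi (Suc n) \<in> I"
    if n0: "of_nat n * w \<notin> L \<Longrightarrow> wp (of_nat n * w) \<noteq> 0"
      and n1: "of_nat (Suc n) * w \<notin> L \<Longrightarrow> wp (of_nat (Suc n) * w) \<noteq> 0"
      and xV: "xi (Suc n) / \<xi> \<in> V" for n
  proof -
    define u where "u = of_nat (Suc n) * w"
    have e: "of_nat (Suc (Suc n)) * w = u + w" "of_nat n * w = u - w" by (simp_all add: u_def algebra_simps)
    have xi: "xi (Suc (Suc n)) = (if u + w \<in> L then 0 else 1 / wp (u + w))"
      "xi n = (if u - w \<in> L then 0 else 1 / wp (u - w))" "xi (Suc n) = (if u \<in> L then 0 else 1 / wp u)"
      by (simp_all only: xi_def e) (simp_all only: u_def)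
    have Iz: "0 \<in> I" using I_sq[OF V_rules(2)] by simp
    consider "u \<in> L" | "u \<notin> L" "u - w \<in> L" | "u \<notin> L" "u + w \<in> L" | "u \<notin> L" "u - w \<notin> L" "u + w \<notin> L" by blast
    then show ?thesis
    proof cases
      case 1
      have a: "u + w \<notin> L" "u - w \<notin> L"
        using L_add_iff[OF 1, of w] L_add_iff[OF 1, of "- w"] w by (simp_all add: add.commute)
      have b: "wp (u + w) = wp w" "wp (u - w) = wp w"
        by (rule sym; use 1 w in simp)(rule sym'; use 1 w in simp)
      show ?thesis unfolding xi unfolding e using a b 1 x0 Iz by (simp add: \<xi>_def)
    next
      case 2
      have b: "wp u = wp w" "wp (u + w) = wp (2 * w)"
        by (rule sym; use 2 w in simp)(rule sym; use 2 two in simp)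
      have a: "u + w \<notin> L" using L_add_iff[OF 2(2), of "2 * w"] two by (simp add: algebra_simps)
      show ?thesis unfolding xi unfolding e using a b 2 dup by (simp add: \<xi>_def)
    next
      case 3
      have b: "wp u = wp w" "wp (u - w) = wp (2 * w)"
        by (rule sym'; use 3 w in simp)(rule sym'; use 3 two in \<open>simp add: add.commute\<close>)
      have a: "u - w \<notin> L" using L_add_iff[OF 3(2), of "- (2 * w)"] two by (simp add: algebra_simps)
      show ?thesis unfolding xi unfolding e using a b 3 dup by (simp add: \<xi>_def)
    next
      case 4
      define \<eta> where "\<eta> = 1 / wp u"
      have u0: "wp u \<noteq> 0" using n1 4(1) by (simp add: u_def)
      have wu: "wp u * \<eta> = 1" using u0 by (simp add: \<eta>_def)
      have m0: "wp (u - w) \<noteq> 0" using n0 4(2) by (simp add: e)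
      define c where "c = \<eta> / \<xi>"
      have cV: "c \<in> V" using xV 4(1) by (simp add: c_def xi \<eta>_def)
      have eta: "\<eta> = c * \<xi>" using xi0 by (simp add: c_def)
      \<comment> \<open>Were the values equal, the addition formulas for \<open>w\<close> and
        \<open>- w\<close> would force \<open>wp' u * wp' w = 0\<close>, since neither
        \<open>u + w\<close> nor \<open>u - w\<close> is a period.\<close>
      have d: "wp u \<noteq> wp w"
      proof
        assume d: "wp u = wp w"
        have "(wp' u)\<^sup>2 = (wp' w)\<^sup>2" unfolding wp_ODE[OF 4(1)] wp_ODE[OF w] d ..
        then have u'0: "wp' u \<noteq> 0" using y0 by auto
        have nw: "- w \<notin> L" "u + - w \<notin> L" using w 4 by auto
        have "wp' u * wp' w = 0"
          using wp_add[OF 4(1) w 4(3)] wp_add[OF 4(1) nw] d unfolding wp_even wp'_odd by algebra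
        then show False using u'0 y0 by simp
      qed
      define U W where "U = 1 + \<xi>\<^sup>2 * (2 * ga * c + ga\<^sup>2 * (c\<^sup>2 * \<xi>\<^sup>2) + de * c * (\<xi> + \<eta>))"
        and "W = (\<xi> + \<eta>) * (2 - 2 * ga * (\<xi> * \<eta>)) - de * (\<xi>\<^sup>2 * \<eta>\<^sup>2)"
      have eV: "\<eta> \<in> V" unfolding eta by (intro V_rules cV xiV)
      have "2 * ga * c + ga\<^sup>2 * (c\<^sup>2 * \<xi>\<^sup>2) + de * c * (\<xi> + \<eta>) \<in> V"
        by (intro V_rules ga_V de_V xiV cV eV numerals_V)
      then have U: "1 / U - 1 \<in> I" "U \<noteq> 0" "1 / U \<in> V" using inv1 unfolding U_def by blast+
      define d2 where "d2 = (\<xi> - \<eta>)\<^sup>2"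
      have dd: "(wp u - wp w)\<^sup>2 * (\<xi> * \<eta>)\<^sup>2 = d2"
        unfolding d2_def using wu wxi by algebra
      have P: "wp (u + w) * wp (u - w) * d2 = U"
      proof -
        have "wp (u + w) * wp (u - w) * (wp u - wp w)\<^sup>2 * (\<xi> * \<eta>)\<^sup>2 =
            ((wp u * wp w + ga)\<^sup>2 + de * (wp u + wp w)) * (\<xi> * \<eta>)\<^sup>2"
          unfolding wp_sum_product(2)[OF 4(1) w 4(3,2) d] ..
        moreover have "((wp u * wp w + ga)\<^sup>2 + de * (wp u + wp w)) * (\<xi> * \<eta>)\<^sup>2 = U"
          unfolding U_def using wu wxi eta by algebra
        ultimately show ?thesis unfolding dd[symmetric] by (simp add: mult.assoc)
      qed
      have S: "(wp (u + w) + wp (u - w)) * d2 = W"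
      proof -
        have "(wp (u + w) + wp (u - w)) * (wp u - wp w)\<^sup>2 * (\<xi> * \<eta>)\<^sup>2 =
            ((wp u + wp w) * (2 * wp u * wp w - 2 * ga) - de) * (\<xi> * \<eta>)\<^sup>2"
          unfolding wp_sum_product(1)[OF 4(1) w 4(3,2) d] ..
        moreover have "((wp u + wp w) * (2 * wp u * wp w - 2 * ga) - de) * (\<xi> * \<eta>)\<^sup>2 = W"
          unfolding W_def using wu wxi by algebra
        ultimately have "(wp (u + w) + wp (u - w)) * (wp u - wp w)\<^sup>2 * (\<xi> * \<eta>)\<^sup>2 = W" by (rule trans)
        then show ?thesis unfolding dd[symmetric] by (simp only: mult.assoc)
      qed
      have p0: "wp (u + w) \<noteq> 0" and d20: "d2 \<noteq> 0" using P U(2) by auto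
      have "1 / wp (u + w) + 1 / wp (u - w) = ((wp (u + w) + wp (u - w)) * d2) / (wp (u + w) * wp (u - w) * d2)"
        using p0 m0 d20 by (simp add: divide_simps add.commute)
      also have "\<dots> = W * (1 / U)" unfolding P S by simp
      finally have WU: "1 / wp (u + w) + 1 / wp (u - w) = W * (1 / U)" .
      have "W * r - 2 * \<xi> - 2 * \<eta> =
         2 * (\<xi> + \<eta>) * (r - 1) + \<xi>\<^sup>2 * ((- (\<xi> + \<eta>) * (2 * ga) * c - de * \<eta>\<^sup>2) * r)" for r
        unfolding W_def using eta by algebra
      then have "1 / wp (u + w) + 1 / wp (u - w) - 2 * \<xi> - 2 * \<eta> =
         2 * (\<xi> + \<eta>) * (1 / U - 1) + \<xi>\<^sup>2 * ((- (\<xi> + \<eta>) * (2 * ga) * c - de * \<eta>\<^sup>2) * (1 / U))"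
        unfolding WU .
      also have "\<dots> \<in> I" by (intro I_add I_mult I_sq U V_rules xiV eV cV ga_V de_V numerals_V)
      finally show ?thesis unfolding xi unfolding e using 4 p0 by (simp add: \<eta>_def)
    qed
  qed
  define P where "P n \<longleftrightarrow> (of_nat n * w \<notin> L \<longrightarrow> wp (of_nat n * w) \<noteq> 0) \<and> xi n - of_nat n ^ 2 * \<xi> \<in> I" for n :: nat
  have PV: "xi n / \<xi> \<in> V" if "P n" for n
  proof -
    have "(xi n - of_nat n ^ 2 * \<xi>) / \<xi>\<^sup>2 * \<xi> + of_nat n ^ 2 \<in> V"
      using that by (intro V_rules xiV) (auto simp: P_def I_def)
    also have "(xi n - of_nat n ^ 2 * \<xi>) / \<xi>\<^sup>2 * \<xi> + of_nat n ^ 2 = xi n / \<xi>"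
      using xi0 by (simp add: field_simps power2_eq_square)
    finally show ?thesis .
  qed
  have "P n \<and> P (Suc n)" for n
  proof (induction n)
    case 0
    have "0 \<in> I" using I_sq[OF V_rules(2)] by simp
    then show ?case using w x0 by (simp add: P_def xi_def \<xi>_def)
  next
    case (Suc n)
    have s: "of_nat (Suc (Suc n)) * w \<notin> L \<longrightarrow> wp (of_nat (Suc (Suc n)) * w) \<noteq> 0"
      "xi (Suc (Suc n)) + xi n - 2 * \<xi> - 2 * xi (Suc n) \<in> I"
      using step[of n] Suc PV by (auto simp: P_def)
    have "xi (Suc (Suc n)) - of_nat (Suc (Suc n)) ^ 2 * \<xi> =
      (xi (Suc (Suc n)) + xi n - 2 * \<xi> - 2 * xi (Suc n)) - (xi n - of_nat n ^ 2 * \<xi>)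
       + 2 * (xi (Suc n) - of_nat (Suc n) ^ 2 * \<xi>)"
      by (simp add: algebra_simps power2_eq_square)
    also have "\<dots> \<in> I"
    proof -
      have "xi n - of_nat n ^ 2 * \<xi> \<in> I" "xi (Suc n) - of_nat (Suc n) ^ 2 * \<xi> \<in> I"
        using Suc unfolding P_def by blast+
      then show ?thesis by (intro I_add[OF I_diff[OF s(2)] I_mult[OF numerals_V]])
    qed
    finally show ?case using s(1) Suc by (simp add: P_def)
  qed
  then have "P (nat \<bar>N\<bar>)" by blast
  moreover have "of_nat (nat \<bar>N\<bar>) * w \<in> L"
  proof (cases "N \<ge> 0")
    case False
    then have "of_nat (nat \<bar>N\<bar>) * w = - (of_int N * w)" by simp
    then show ?thesis using N(1) by simp
  qed (use N(1) in simp)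
  ultimately have "- (of_nat (nat \<bar>N\<bar>) ^ 2 * \<xi>) / \<xi>\<^sup>2 \<in> V" by (simp add: P_def xi_def I_def)
  moreover have "(of_nat (nat \<bar>N\<bar>) :: complex) ^ 2 = of_int (N\<^sup>2)"
  proof -
    have "int (nat \<bar>N\<bar>) ^ 2 = N\<^sup>2" by simp
    then show ?thesis by (metis of_int_of_nat_eq of_int_power)
  qed
  ultimately have "- (of_int (N\<^sup>2) * \<xi>) / \<xi>\<^sup>2 \<in> V" by simp
  \<comment> \<open>As \<open>N w\<close> is a period, N^2 \<xi> is itself divisible by the square
    of \<xi>; thus N^2 would be divisible by \<xi>, although it is prime to 7.\<close>
  from M_mult[OF xiM this] have "- (of_int (N\<^sup>2) * \<xi>) / \<xi>\<^sup>2 * \<xi> \<in> M" .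
  also have "- (of_int (N\<^sup>2) * \<xi>) / \<xi>\<^sup>2 * \<xi> = - of_int (N\<^sup>2)" using xi0 by (simp add: power2_eq_square)
  finally have "of_int (N\<^sup>2) \<in> M" using M_minus by fastforce
  moreover have "\<not> 7 dvd N\<^sup>2" using N(2) prime_dvd_power[of "7::int" N 2] by auto
  ultimately show False using unit_of_int by blast
qed

end

section \<open>Rescaling and division points\<close>

lemma zspan_scale: "(*) c ` zspan w1 w2 = zspan (c * w1) (c * w2)"
proof (intro set_eqI iffI)
  fix x assume "x \<in> (*) c ` zspan w1 w2"
  then obtain a b where "x = c * (of_int a * w1 + of_int b * w2)" by (auto simp: zspan_def)
  then have "x = of_int a * (c * w1) + of_int b * (c * w2)" by (simp add: algebra_simps)
  then show "x \<in> zspan (c * w1) (c * w2)" unfolding zspan_iff by blast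
next
  fix x assume "x \<in> zspan (c * w1) (c * w2)"
  then obtain a b where "x = of_int a * (c * w1) + of_int b * (c * w2)" by (auto simp: zspan_def)
  then have "x = c * (of_int a * w1 + of_int b * w2)" by (simp add: algebra_simps)
  moreover have "of_int a * w1 + of_int b * w2 \<in> zspan w1 w2" unfolding zspan_iff by blast
  ultimately show "x \<in> (*) c ` zspan w1 w2" by blast
qed

lemma eisenstein_scale:
  assumes "c \<noteq> 0"
  shows "eisenstein_sum k ((*) c ` L) = eisenstein_sum k L / c ^ k"
proof -
  have b: "bij_betw ((*) c) (L - {0}) ((*) c ` L - {0})"
    using assms by (auto simp: bij_betw_def inj_on_def)
  have "eisenstein_sum k ((*) c ` L) = (\<Sum>\<^sub>\<infinity>w\<in>L - {0}. 1 / (c * w) ^ k)"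
    unfolding eisenstein_sum_def using infsum_reindex_bij_betw[OF b, of "\<lambda>w. 1 / w ^ k"] by simp
  also have "\<dots> = (\<Sum>\<^sub>\<infinity>w\<in>L - {0}. (1 / c ^ k) * (1 / w ^ k))"
    by (simp add: power_mult_distrib)
  also have "\<dots> = (1 / c ^ k) * eisenstein_sum k L"
    unfolding infsum_cmult_right' eisenstein_sum_def ..
  finally show ?thesis by simp
qed

lemma cx_lattice_scale: "cx_lattice w1 w2 \<Longrightarrow> c \<noteq> 0 \<Longrightarrow> cx_lattice (c * w1) (c * w2)"
  by (simp add: cx_lattice_def)

context cx_lattice begin

text \<open>The sum of 1 / z^6 over (1 / s) L is computed twice: homogeneity gives s^6 G6, and
  splitting into cosets of \<open>L\<close> gives G6 plus one value of \<open>T L 6\<close> for each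
  nonzero class. \<open>N\<close> guarantees that there are finitely many classes and that they are
  torsion.\<close>

lemma division_points_sum:
  assumes s: "s \<noteq> 0" "\<And>l. l \<in> L \<Longrightarrow> s * l \<in> L"
    and N: "N > 0" "\<And>l. s * l \<in> L \<Longrightarrow> of_int N * l \<in> L"
  shows "\<exists>W. finite W \<and> (\<forall>w\<in>W. w \<notin> L \<and> of_int N * w \<in> L) \<and>
    (s ^ 6 - 1) * G 6 = (\<Sum>w\<in>W. T L 6 w)"
proof -
  define D where "D = {z. s * z \<in> L}"
  have LD: "L \<subseteq> D" using s by (auto simp: D_def)
  have D_add: "x + y \<in> D" if "x \<in> D" "y \<in> D" for x y
    using that L_add by (auto simp: D_def distrib_left)
  define F where "F = (\<lambda>(a::int, b::int). (of_int a * w1 + of_int b * w2) / of_int N) ` ({0..N} \<times> {0..N}) \<inter> (D - L)"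
  have finF: "finite F" by (auto simp: F_def)
  have cover: "\<exists>w\<in>F. z - w \<in> L" if z: "z \<in> D - L" for z
  proof -
    have "of_int N * z \<in> L" using N z by (auto simp: D_def)
    then obtain a b where ab: "of_int N * z = of_int a * w1 + of_int b * w2" by (auto simp: zspan_iff)
    define l where "l = of_int (a div N) * w1 + of_int (b div N) * w2"
    have l: "l \<in> L" unfolding zspan_iff l_def by blast
    define a' b' where "a' = a mod N" and "b' = b mod N"
    have bnd: "a' \<in> {0..N}" "b' \<in> {0..N}"
      using N(1) by (auto simp: a'_def b'_def intro: less_imp_le)
    define w where "w = z - l"
    have aN: "(of_int a :: complex) = of_int (a div N) * of_int N + of_int (a mod N)"
      "(of_int b :: complex) = of_int (b div N) * of_int N + of_int (b mod N)"
      by (simp_all only: of_int_mult[symmetric] of_int_add[symmetric] div_mult_mod_eq)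
    have "of_int N * w = of_int a' * w1 + of_int b' * w2"
    proof -
      have "of_int N * w = of_int N * z - of_int N * l" by (simp add: w_def algebra_simps)
      also have "\<dots> = of_int a' * w1 + of_int b' * w2"
        unfolding ab l_def a'_def b'_def using aN by (simp add: algebra_simps)
      finally show ?thesis .
    qed
    then have "w = (of_int a' * w1 + of_int b' * w2) / of_int N" using N(1) by (simp add: field_simps)
    moreover have zw: "z - w = l" by (simp add: w_def)
    moreover have wD: "w \<in> D - L"
    proof
      have "- l \<in> D" using l LD by auto
      moreover have "w = z + (- l)" by (simp add: w_def)
      ultimately show "w \<in> D" "w \<notin> L" using D_add[of z "- l"] LD L_add_iff[of "- l" z] z l by auto
    qed
    ultimately have "w \<in> F" using bnd unfolding F_def by (auto intro!: image_eqI[where x = "(a', b')"])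
    moreover have "z - w \<in> L" unfolding zw using l .
    ultimately show ?thesis by blast
  qed
  \<comment> \<open>The box behind \<open>F\<close> may meet a class more than once;
    \<open>W\<close> selects one point from each.\<close>
  define cls where "cls z = {x. x - z \<in> L}" for z
  define W where "W = (\<lambda>C. SOME w. w \<in> F \<and> w \<in> C) ` (cls ` F)"
  have cls_eq: "cls x = cls y" if "x - y \<in> L" for x y
  proof -
    have "z - x \<in> L \<longleftrightarrow> z - y \<in> L" for z
      using L_add_iff[OF that, of "z - x"] by (simp add: algebra_simps)
    then show ?thesis by (simp add: cls_def)
  qed
  have cls_self: "x \<in> cls x" for x by (simp add: cls_def)
  have finW: "finite W" using finF by (simp add: W_def)
  have pick: "(SOME w. w \<in> F \<and> w \<in> cls f) \<in> F \<and> (SOME w. w \<in> F \<and> w \<in> cls f) \<in> cls f" if "f \<in> F" for f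
    by (rule someI[of _ f]) (use that cls_self in auto)
  have WF: "W \<subseteq> F" using pick by (auto simp: W_def)
  have uniq: "w = w'" if ww: "w \<in> W" "w' \<in> W" "w - w' \<in> L" for w w'
  proof -
    obtain f where f: "f \<in> F" "w = (SOME w. w \<in> F \<and> w \<in> cls f)"
      using ww(1) unfolding W_def by blast
    obtain f' where f': "f' \<in> F" "w' = (SOME w. w \<in> F \<and> w \<in> cls f')"
      using ww(2) unfolding W_def by blast
    have "w \<in> cls f" "w' \<in> cls f'" using pick f f' by auto
    then have a: "w - f \<in> L" "w' - f' \<in> L" by (simp_all add: cls_def)
    have "cls w = cls f" "cls w' = cls f'" using cls_eq[OF a(1)] cls_eq[OF a(2)] by auto
    then have "cls f = cls f'" using cls_eq[OF ww(3)] by simp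
    then show ?thesis using f f' by simp
  qed
  have coverW: "\<exists>w\<in>W. z - w \<in> L" if z: "z \<in> D - L" for z
  proof -
    obtain f where f: "f \<in> F" "z - f \<in> L" using cover[OF z] by blast
    define w where "w = (SOME w. w \<in> F \<and> w \<in> cls f)"
    have "w \<in> W" using f by (auto simp: W_def w_def)
    moreover have "w - f \<in> L" using pick[OF f(1)] by (simp add: w_def cls_def)
    then have "z - w \<in> L" using L_diff[OF f(2), of "w - f"] by simp
    ultimately show ?thesis by blast
  qed
  have WDL: "w \<in> D - L" if "w \<in> W" for w using that WF by (auto simp: F_def)
  have sumD: "(\<lambda>z. 1 / z ^ 6) summable_on (D - {0})"
  proof -
    have "bij_betw (\<lambda>z. s * z) (D - {0}) L0"
      by (rule bij_betwI[where g = "\<lambda>z. z / s"]) (use s in \<open>auto simp: D_def\<close>)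
    moreover have "(\<lambda>w. s ^ 6 * (1 / w ^ 6)) summable_on L0"
    proof (intro summable_on_cmult_right)
      have "(\<lambda>w. norm (1 / (0 - w) ^ 6)) summable_on L0"
        by (rule T_summable[OF L0_sub]) auto
      then have "(\<lambda>w. 1 / (0 - w) ^ 6) summable_on L0" by (rule abs_summable_summable)
      then show "(\<lambda>w. 1 / w ^ 6) summable_on L0" by simp
    qed
    ultimately have "(\<lambda>z. s ^ 6 * (1 / (s * z) ^ 6)) summable_on (D - {0})"
      using summable_on_reindex_bij_betw[of "\<lambda>z. s * z" "D - {0}" L0 "\<lambda>w. s ^ 6 * (1 / w ^ 6)"] by simp
    then show ?thesis using s(1) by (simp add: power_mult_distrib)
  qed
  have "s ^ 6 * G 6 = (\<Sum>\<^sub>\<infinity>z\<in>D - {0}. 1 / z ^ 6)"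
  proof -
    have "bij_betw (\<lambda>z. s * z) (D - {0}) L0"
      by (rule bij_betwI[where g = "\<lambda>z. z / s"]) (use s in \<open>auto simp: D_def\<close>)
    from infsum_reindex_bij_betw[OF this, of "\<lambda>w. s ^ 6 * (1 / w ^ 6)"]
    have "(\<Sum>\<^sub>\<infinity>z\<in>D - {0}. s ^ 6 * (1 / (s * z) ^ 6)) = s ^ 6 * G 6"
      unfolding infsum_cmult_right' eisenstein_sum_def .
    moreover have "s ^ 6 * (1 / (s * z) ^ 6) = 1 / z ^ 6" for z using s(1) by (simp add: power_mult_distrib)
    ultimately show ?thesis by simp
  qed
  also have "D - {0} = L0 \<union> (D - L)" using LD by auto
  also have "(\<Sum>\<^sub>\<infinity>z\<in>L0 \<union> (D - L). 1 / z ^ 6) = (\<Sum>\<^sub>\<infinity>z\<in>L0. 1 / z ^ 6) + (\<Sum>\<^sub>\<infinity>z\<in>D - L. 1 / z ^ 6)"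
    by (intro infsum_Un_disjoint summable_on_subset_banach[OF sumD]) (use LD in auto)
  also have "(\<Sum>\<^sub>\<infinity>z\<in>L0. 1 / z ^ 6) = G 6" by (simp add: eisenstein_sum_def)
  finally have main: "(s ^ 6 - 1) * G 6 = (\<Sum>\<^sub>\<infinity>z\<in>D - L. 1 / z ^ 6)" by (simp add: algebra_simps)
  have inj: "inj_on (\<lambda>(w, l). w - l) (W \<times> L)"
  proof (rule inj_onI, clarify)
    fix w l w' l' assume h: "w \<in> W" "l \<in> L" "w' \<in> W" "l' \<in> L" "w - l = w' - l'"
    then have "w - w' = l - l'" by (simp add: algebra_simps)
    then have "w - w' \<in> L" using L_diff h by simp
    then have "w = w'" using uniq h by blast
    then show "w = w' \<and> l = l'" using h(5) by simp
  qed
  have img: "D - L = (\<lambda>(w, l). w - l) ` (W \<times> L)"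
  proof (intro set_eqI iffI)
    fix z assume "z \<in> D - L"
    then obtain w where w: "w \<in> W" "z - w \<in> L" using coverW by blast
    then have "w - z \<in> L" using L_uminus[of "z - w"] by simp
    then show "z \<in> (\<lambda>(w, l). w - l) ` (W \<times> L)" using w by (intro image_eqI[where x = "(w, w - z)"]) auto
  next
    fix z assume "z \<in> (\<lambda>(w, l). w - l) ` (W \<times> L)"
    then obtain w l where wl: "w \<in> W" "l \<in> L" "z = w - l" by auto
    moreover from wl(2) have "- l \<in> D" using LD by auto
    ultimately show "z \<in> D - L" using WDL[of w] D_add[of w "- l"] LD L_add_iff[of "- l" w] by auto
  qed
  have bij: "bij_betw (\<lambda>(w, l). w - l) (W \<times> L) (D - L)"
    using inj img by (auto simp: bij_betw_def)
  have sD: "(\<lambda>z. 1 / z ^ 6) summable_on (D - L)"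
    by (rule summable_on_subset_banach[OF sumD]) auto
  have "(\<Sum>\<^sub>\<infinity>z\<in>D - L. 1 / z ^ 6) = (\<Sum>\<^sub>\<infinity>(w, l)\<in>W \<times> L. 1 / (w - l) ^ 6)"
    using infsum_reindex_bij_betw[OF bij, of "\<lambda>z. 1 / z ^ 6"] by (simp add: case_prod_unfold)
  also have "\<dots> = (\<Sum>\<^sub>\<infinity>w\<in>W. \<Sum>\<^sub>\<infinity>l\<in>L. 1 / (w - l) ^ 6)"
  proof (rule infsum_Sigma'_banach[symmetric])
    show "(\<lambda>(w, l). 1 / (w - l) ^ 6) summable_on W \<times> L"
      using sD summable_on_reindex_bij_betw[OF bij, of "\<lambda>z. 1 / z ^ 6"] by (simp add: case_prod_unfold)
  qed
  also have "\<dots> = (\<Sum>w\<in>W. T L 6 w)" using finW by (simp add: T_def)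
  finally have "(s ^ 6 - 1) * G 6 = (\<Sum>w\<in>W. T L 6 w)" using main by simp
  moreover have "w \<notin> L \<and> of_int N * w \<in> L" if "w \<in> W" for w
    using WDL[OF that] N(2) by (auto simp: D_def)
  ultimately show ?thesis using finW by blast
qed

end

context lattice_place begin

text \<open>Multiplying the sum over division points by 120 makes every term integral, by
  \<open>T_L_6\<close> and \<open>torsion_integral\<close>. As 6 (Delta^3 - 1) is prime to 7, this
  shows that 20 G6 is integral, and \<open>de\<close> is 7 times that.\<close>

lemma de_divisible:
  assumes s: "s\<^sup>2 = of_int \<Delta>" "\<And>l. l \<in> L \<Longrightarrow> s * l \<in> L" and \<Delta>: "\<Delta> mod 7 \<in> {3, 5, 6}"
  shows "de / 7 \<in> V"
proof -
  have d7: "\<not> 7 dvd \<Delta>" using \<Delta> by auto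
  then have D0: "\<Delta> \<noteq> 0" by auto
  have s0: "s \<noteq> 0" using s(1) D0 by auto
  have D0: "\<bar>\<Delta>\<bar> > 0" using D0 by simp
  have N: "of_int \<bar>\<Delta>\<bar> * l \<in> L" if "s * l \<in> L" for l
  proof -
    have "of_int \<Delta> * l \<in> L"
      using s(2)[OF that] s(1) by (simp add: power2_eq_square mult.assoc[symmetric])
    then show ?thesis by (cases "\<Delta> \<ge> 0") auto
  qed
  obtain W where W: "finite W" "\<And>w. w \<in> W \<Longrightarrow> w \<notin> L \<and> of_int \<bar>\<Delta>\<bar> * w \<in> L"
    "(s ^ 6 - 1) * G 6 = (\<Sum>w\<in>W. T L 6 w)"
    using division_points_sum[OF s0 s(2) D0 N] by blast
  have s6: "s ^ 6 = of_int (\<Delta> ^ 3)"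
  proof -
    have "s ^ 6 = (s\<^sup>2) ^ 3" by (simp flip: power_mult)
    then show ?thesis by (simp add: s(1))
  qed
  \<comment> \<open>Euler's criterion: a nonresidue modulo 7 has cube -1, so the number is -2 modulo
    7.\<close>
  have u7: "\<not> 7 dvd \<Delta> ^ 3 - 1"
  proof -
    have "\<Delta> ^ 3 mod 7 = (\<Delta> mod 7) ^ 3 mod 7" by (simp add: power_mod)
    also have "\<dots> = 6" using \<Delta> by auto
    finally show ?thesis by presburger
  qed
  have "120 * ((s ^ 6 - 1) * G 6) = (\<Sum>w\<in>W. 120 * wp w ^ 3 - 72 * ga * wp w - 12 * de)"
    unfolding W(3) sum_distrib_left
  proof (intro sum.cong refl)
    fix w assume "w \<in> W"
    then have "w \<notin> L" using W(2) by blast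
    from T_L_6[OF this] show "120 * T L 6 w = 120 * wp w ^ 3 - 72 * ga * wp w - 12 * de"
      by (simp add: ga_def de_def)
  qed
  also have "\<dots> \<in> V"
    using W(2) d7 by (intro V_rules numerals_V ga_V de_V torsion_integral[of _ "\<bar>\<Delta>\<bar>"]) auto
  finally have "120 * ((s ^ 6 - 1) * G 6) \<in> V" .
  moreover have "1 / of_int 6 \<in> V" by (rule inverse_of_int) simp
  ultimately have "1 / of_int 6 * (1 / of_int (\<Delta> ^ 3 - 1)) * (120 * ((s ^ 6 - 1) * G 6)) \<in> V"
    using V_rules(4) inverse_of_int[OF u7] by blast
  also have "1 / of_int 6 * (1 / of_int (\<Delta> ^ 3 - 1)) * (120 * ((s ^ 6 - 1) * G 6)) = de / 7"
  proof -
    have "of_int (\<Delta> ^ 3 - 1) \<noteq> (0 :: complex)" using u7 by (metis dvd_0_right of_int_0_eq_iff)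
    moreover have "1 / of_int 6 * (1 / E) * (120 * (E * G 6)) = 20 * G 6" if "E \<noteq> 0" for E
      using that by (simp add: field_simps)
    ultimately have "1 / of_int 6 * (1 / of_int (\<Delta> ^ 3 - 1)) * (120 * (of_int (\<Delta> ^ 3 - 1) * G 6)) = 20 * G 6"
      by blast
    moreover have "s ^ 6 - 1 = of_int (\<Delta> ^ 3 - 1)" by (simp add: s6)
    ultimately show ?thesis by (simp only:) (simp add: de_def)
  qed
  finally show ?thesis .
qed

end

context place7 begin

text \<open>After rescaling the lattice so that one of \<open>ga\<close>, \<open>de\<close> is a unit, \<open>de\<close> is divisible by 7, hence
  \<open>ga\<close> is the unit and \<open>j\<close> reduces to 1728.\<close>

lemma j_supersingular:
  assumes lat: "cx_lattice w1 w2" and s: "s\<^sup>2 = of_int \<Delta>" "\<And>l. l \<in> zspan w1 w2 \<Longrightarrow> s * l \<in> zspan w1 w2"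
    and \<Delta>: "\<Delta> mod 7 \<in> {3, 5, 6}" and j0: "j_invariant (zspan w1 w2) \<noteq> 0"
  shows "(j_invariant (zspan w1 w2) - 1728) / 7 \<in> V"
proof -
  define A B where "A = 15 * eisenstein_sum 4 (zspan w1 w2)" and "B = 140 * eisenstein_sum 6 (zspan w1 w2)"
  have j: "j_invariant (zspan w1 w2) = 1728 * (4 * A) ^ 3 / ((4 * A) ^ 3 - 27 * B\<^sup>2)"
    by (simp add: j_invariant_def A_def B_def Let_def)
  have A0: "A \<noteq> 0" and d0: "(4 * A) ^ 3 - 27 * B\<^sup>2 \<noteq> 0" using j0 unfolding j by auto
  have main: "B' / 7 \<in> V" if c: "c \<noteq> 0" and A': "A' = A / c ^ 4" "A' \<in> V" and B': "B' = B / c ^ 6" "B' \<in> V" for c A' B'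
  proof -
    interpret cx_lattice "c * w1" "c * w2" using cx_lattice_scale[OF lat c] .
    interpret lattice_place "c * w1" "c * w2" V
    proof unfold_locales
      show "15 * eisenstein_sum 4 (zspan (c * w1) (c * w2)) \<in> V" "140 * eisenstein_sum 6 (zspan (c * w1) (c * w2)) \<in> V"
        using A' B' unfolding zspan_scale[symmetric] eisenstein_scale[OF c] by (simp_all add: A_def B_def)
    qed
    have "s * l \<in> zspan (c * w1) (c * w2)" if "l \<in> zspan (c * w1) (c * w2)" for l
      using that s(2) unfolding zspan_scale[symmetric] by (auto simp: mult.left_commute)
    from de_divisible[OF s(1) this \<Delta>] show ?thesis
      using B' unfolding de_def zspan_scale[symmetric] eisenstein_scale[OF c] by (simp add: B_def)
  qed
  \<comment> \<open>Scaling the lattice by \<open>c\<close> divides both A^3 and B^2 by c^12.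
    Choosing the larger of the two as c^12 makes both quotients integral and one of them equal to
    1.\<close>
  obtain c where c: "c \<noteq> 0" "c ^ 12 = (if B\<^sup>2 / A ^ 3 \<in> V then A ^ 3 else B\<^sup>2)"
  proof -
    define t where "t = (if B\<^sup>2 / A ^ 3 \<in> V then A ^ 3 else B\<^sup>2)"
    have t0: "t \<noteq> 0" using A0 V_rules(2) by (auto simp: t_def)
    obtain c where "c ^ 12 = t" using exists_complex_root[of 12 t] by auto
    moreover from this have "c \<noteq> 0" using t0 by auto
    ultimately show thesis using that[of c] by (simp add: t_def)
  qed
  define A' B' where "A' = A / c ^ 4" and "B' = B / c ^ 6"
  have A3: "A' ^ 3 = A ^ 3 / c ^ 12" and B2: "B'\<^sup>2 = B\<^sup>2 / c ^ 12"
    by (simp_all add: A'_def B'_def power_divide flip: power_mult)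
  have tot: "B\<^sup>2 / A ^ 3 \<in> V \<or> A ^ 3 / B\<^sup>2 \<in> V" using total[of "B\<^sup>2 / A ^ 3"] by simp
  have "A' ^ 3 \<in> V"
    unfolding A3 c(2) using tot A0 V_rules(1) by auto
  then have A'V: "A' \<in> V" by (rule power_V) simp
  have "B'\<^sup>2 \<in> V"
  proof (cases "B\<^sup>2 / A ^ 3 \<in> V")
    case False
    then have "B \<noteq> 0" using V_rules(2) by auto
    then show ?thesis unfolding B2 c(2) using False V_rules(1) by simp
  qed (simp add: B2 c(2))
  then have B'V: "B' \<in> V" by (rule power_V) simp
  have B7: "B' / 7 \<in> V" using main[OF c(1) A'_def A'V B'_def B'V] .
  have B27: "B'\<^sup>2 / 7 \<in> V" using V_rules(4)[OF B7 B'V] by (simp add: power2_eq_square)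
  have cA: "c ^ 12 = A ^ 3"
  proof (rule ccontr)
    assume "\<not> ?thesis"
    then have "c ^ 12 = B\<^sup>2" using c(2) by (auto split: if_splits)
    then have "B'\<^sup>2 = 1" using c(1) B2 by (metis divide_self power_not_zero)
    then show False using B27 V7 by simp
  qed
  have A1: "A' ^ 3 = 1" using cA A0 by (simp add: A3)
  define D where "D = 64 - 27 * B'\<^sup>2"
  have D: "D \<noteq> 0" "inverse D \<in> V"
  proof -
    have "27 * (B'\<^sup>2 / 7) * 7 \<in> M" by (intro M_mult[OF seven_M] V_rules numerals_V B27)
    then have BM: "27 * B'\<^sup>2 \<in> M" by simp
    have DV: "D \<in> V" unfolding D_def by (intro V_rules numerals_V B'V)
    have "D \<notin> M"
    proof
      assume "D \<in> M"
      from M_add[OF this BM] have "of_int 64 \<in> M" by (simp add: D_def)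
      then show False using unit_of_int[of 64] by simp
    qed
    then show "D \<noteq> 0" "inverse D \<in> V" using unit[OF DV] by auto
  qed
  have "j_invariant (zspan w1 w2) = 1728 * 64 / D"
  proof -
    have c12: "c ^ 12 \<noteq> 0" using c(1) by simp
    have "(4 * A) ^ 3 = 64 * c ^ 12" unfolding cA by (simp add: power_mult_distrib)
    moreover have "B\<^sup>2 = B'\<^sup>2 * c ^ 12" using c12 by (simp add: B2)
    ultimately have "j_invariant (zspan w1 w2) = 1728 * (64 * c ^ 12) / ((64 - 27 * B'\<^sup>2) * c ^ 12)"
      unfolding j by (simp only: left_diff_distrib mult.assoc)
    then show ?thesis using c12 by (simp add: D_def)
  qed
  then have "(j_invariant (zspan w1 w2) - 1728) / 7 = 1728 * 27 * (B'\<^sup>2 / 7) * inverse D"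
    using D(1) by (simp add: field_simps) (simp add: D_def algebra_simps)?
  also have "\<dots> \<in> V" by (intro V_rules numerals_V B27 D)
  finally show ?thesis .
qed

end

text \<open>If 7 is inert, all nonzero singular moduli are congruent to 1728 modulo a place over 7.\<close>

theorem no_trinomial_inert_7:
  fixes A B :: complex and m n :: nat
  assumes \<Delta>: "\<Delta> mod 7 \<in> {3, 5, 6}" and mn: "0 < n" "n < m"
    and s: "s\<^sup>2 = of_int \<Delta>"
    and mod: "\<And>x. x \<in> {x1, x2, x3} \<Longrightarrow> x \<noteq> 0 \<and> x ^ m + A * x ^ n + B = 0 \<and>
       (\<exists>w1 w2. cx_lattice w1 w2 \<and> x = j_invariant (zspan w1 w2) \<and> (\<forall>l \<in> zspan w1 w2. s * l \<in> zspan w1 w2))"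
    and dist: "x1 \<noteq> x2" "x1 \<noteq> x3" "x2 \<noteq> x3"
  shows False
proof -
  obtain V where V: "subring V" "1 / 7 \<notin> V" "\<And>x. x \<in> V \<or> inverse x \<in> V" by (rule exists_place) blast
  interpret place7 V using V by unfold_locales auto
  have cong: "(x - 1728) / 7 \<in> V" if x: "x \<in> {x1, x2, x3}" for x
  proof -
    obtain w1 w2 where w: "cx_lattice w1 w2" "x = j_invariant (zspan w1 w2)" "\<forall>l \<in> zspan w1 w2. s * l \<in> zspan w1 w2"
      using mod[OF x] by blast
    have "j_invariant (zspan w1 w2) \<noteq> 0" using mod[OF x] w(2) by auto
    from j_supersingular[OF w(1) s bspec[OF w(3)] \<Delta> this] show ?thesis by (simp add: w(2))
  qed
  have x0: "x1 \<noteq> 0" using mod by simp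
  have unit1: "inverse x1 \<in> V"
  proof -
    have m: "7 * ((x1 - 1728) / 7) \<in> M" using M_mult[OF seven_M cong[of x1]] by (simp add: mult.commute)
    have "x1 \<notin> M"
    proof
      assume "x1 \<in> M"
      from M_diff[OF this m] have "x1 - 7 * ((x1 - 1728) / 7) \<in> M" .
      moreover have "x1 - 7 * ((x1 - 1728) / 7) = of_int 1728" by (simp add: field_simps)
      ultimately have "of_int 1728 \<in> M" by (simp only:)
      then show False using unit_of_int[of 1728] by simp
    qed
    moreover have "x1 \<in> V"
    proof -
      have "7 * ((x1 - 1728) / 7) + 1728 \<in> V" by (intro V_rules numerals_V cong) simp
      moreover have "7 * ((x1 - 1728) / 7) + 1728 = x1" by (simp add: field_simps)
      ultimately show ?thesis by (simp only:)
    qed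
    ultimately show ?thesis using unit by blast
  qed
  have q: "(x - x1) / x1 / 7 \<in> V" if "x \<in> {x1, x2, x3}" for x
  proof -
    have "((x - 1728) / 7 - (x1 - 1728) / 7) * inverse x1 \<in> V"
      by (intro V_rules cong that unit1) simp
    then show ?thesis by (simp add: field_simps)
  qed
  have r: "x1 * (1 + (x - x1) / x1) = x" for x using x0 by (simp add: field_simps)
  show False
  proof (rule trinomial_close_roots[OF mn, of 1 x1 "(x2 - x1) / x1" "(x3 - x1) / x1" A B])
    show "(x2 - x1) / x1 / 7 \<in> V" "(x3 - x1) / x1 / 7 \<in> V" by (rule q, simp)+
    show "(x2 - x1) / x1 \<noteq> 0" "(x3 - x1) / x1 \<noteq> 0" "(x2 - x1) / x1 \<noteq> (x3 - x1) / x1" using x0 dist by auto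
  qed (use mod x0 in \<open>simp_all add: r\<close>)
qed

section \<open>Lattices and ideal classes\<close>

context cx_lattice begin

lemma wp_double_pole: assumes "w \<in> L" shows "((\<lambda>e. wp (w + e) * e\<^sup>2) \<longlongrightarrow> 1) (at 0)"
proof -
  obtain r m where r: "r > 0" "m holomorphic_on ball 0 r" "ball 0 r \<inter> L0 = {}"
    "\<And>u. u \<in> ball 0 r \<Longrightarrow> R u = 3 * G 4 * u\<^sup>2 + 5 * G 6 * u ^ 4 + u ^ 6 * m u"
    by (rule R_taylor) blast
  define N where "N = (\<lambda>u. 1 + u\<^sup>2 * (3 * G 4 * u\<^sup>2 + 5 * G 6 * u ^ 4 + u ^ 6 * m u))"
  have "((\<lambda>e. wp (w + e) * e\<^sup>2) \<longlongrightarrow> N 0) (at 0)"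
  proof (rule continuous_lim_0[OF r(1)])
    show "continuous_on (ball 0 r) N"
      unfolding N_def using holomorphic_on_imp_continuous_on[OF r(2)] by (intro continuous_intros)
    fix u :: complex assume u: "u \<in> ball 0 r" "u \<noteq> 0"
    have "wp (w + u) = wp u" using wp_periodic[OF assms near_0[OF r(3) u]] by (simp add: add.commute)
    moreover have "(1 / u\<^sup>2 + X) * u\<^sup>2 = 1 + u\<^sup>2 * X" for X using u(2) by (simp add: field_simps)
    then have "wp u * u\<^sup>2 = N u" unfolding wp_def r(4)[OF u(1)] N_def .
    ultimately show "wp (w + u) * u\<^sup>2 = N u" by simp
  qed
  then show ?thesis by (simp add: N_def)
qed

lemma wp_holomorphic: "wp holomorphic_on - L"
  by (rule holomorphic_onI, rule field_differentiable_at_within, rule wp_diff) simp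

lemma finite_L_cball: "finite (L \<inter> cball 0 B)"
proof -
  obtain c where c: "c > 0" "\<And>a b. c * (\<bar>a\<bar> + \<bar>b\<bar>) \<le> norm (of_real a * w1 + of_real b * w2)"
    by (rule norm_ge) blast
  define n where "n = \<lceil>B / c\<rceil>"
  have "L \<inter> cball 0 B \<subseteq> (\<lambda>(a, b). of_int a * w1 + of_int b * w2) ` ({-n..n} \<times> {-n..n})"
  proof
    fix x assume x: "x \<in> L \<inter> cball 0 B"
    then obtain a b where ab: "x = of_int a * w1 + of_int b * w2" by (auto simp: zspan_iff)
    have "c * (\<bar>real_of_int a\<bar> + \<bar>real_of_int b\<bar>) \<le> B" using c(2)[of a b] x ab by simp
    then have "\<bar>real_of_int a\<bar> + \<bar>real_of_int b\<bar> \<le> B / c" using c(1) by (simp add: field_simps)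
    also have "\<dots> \<le> of_int n" by (simp add: n_def)
    finally have "\<bar>a\<bar> + \<bar>b\<bar> \<le> n" by linarith
    then have "a \<in> {-n..n}" "b \<in> {-n..n}" by auto
    then show "x \<in> (\<lambda>(a, b). of_int a * w1 + of_int b * w2) ` ({-n..n} \<times> {-n..n})"
      unfolding ab by (intro image_eqI[where x = "(a, b)"]) auto
  qed
  then show ?thesis by (rule finite_subset) auto
qed

end

text \<open>The lattice is determined by \<open>G\<^sub>4\<close> and \<open>G\<^sub>6\<close>: the difference \<open>d\<close> of the two \<open>\<wp>\<close>-functions satisfies
  \<open>z\<^sup>2 d'' = (12 + O(z\<^sup>2)) d\<close>, which forces all its Taylor coefficients except the fourth to vanish.\<close>

lemma lattice_eq_of_eisenstein_sub:
  assumes l1: "cx_lattice w1 w2" and l2: "cx_lattice v1 v2"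
    and G: "eisenstein_sum 4 (zspan w1 w2) = eisenstein_sum 4 (zspan v1 v2)"
      "eisenstein_sum 6 (zspan w1 w2) = eisenstein_sum 6 (zspan v1 v2)"
  shows "zspan w1 w2 \<subseteq> zspan v1 v2"
proof -
  interpret A: cx_lattice w1 w2 by fact
  interpret B: cx_lattice v1 v2 by fact
  define d where "d z = A.R z - B.R z" for z
  obtain r1 where r1: "r1 > 0" "ball 0 r1 \<inter> A.L0 = {}" by (rule A.ball_L0) blast
  obtain r2 where r2: "r2 > 0" "ball 0 r2 \<inter> B.L0 = {}" by (rule B.ball_L0) blast
  define r where "r = min r1 r2"
  have r: "r > 0" "ball 0 r \<inter> A.L0 = {}" "ball 0 r \<inter> B.L0 = {}"
    using r1 r2 by (auto simp: r_def)
  define D where "D k z = A.RD k z - B.RD k z" for k z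
  have Dd: "(D k has_field_derivative D (Suc k) z) (at z)" if "z \<in> ball 0 r" for k z
    unfolding D_def using that r by (intro DERIV_diff A.RD_deriv B.RD_deriv) auto
  have D0: "D 0 = d" by (auto simp: D_def d_def A.RD_def B.RD_def)
  have AR: "A.R holomorphic_on ball 0 r"
  proof (rule holomorphic_onI, rule field_differentiable_at_within)
    fix z :: complex assume "z \<in> ball 0 r"
    then have "z \<notin> A.L0" using r(2) by auto
    from A.R_summable_deriv[OF this] show "A.R field_differentiable at z"
      unfolding field_differentiable_def by (rule exI)
  qed
  have BR: "B.R holomorphic_on ball 0 r"
  proof (rule holomorphic_onI, rule field_differentiable_at_within)
    fix z :: complex assume "z \<in> ball 0 r"
    then have "z \<notin> B.L0" using r(3) by auto
    from B.R_summable_deriv[OF this] show "B.R field_differentiable at z"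
      unfolding field_differentiable_def by (rule exI)
  qed
  have D2hol: "D 2 holomorphic_on ball 0 r"
  proof (rule holomorphic_onI, rule field_differentiable_at_within)
    fix z :: complex assume "z \<in> ball 0 r"
    from Dd[OF this] show "D 2 field_differentiable at z"
      unfolding field_differentiable_def by (rule exI)
  qed
  have dhol: "d holomorphic_on ball 0 r" unfolding d_def[abs_def] by (intro holomorphic_intros AR BR)
  have exp: "f has_fps_expansion fps_expansion f 0" if "f holomorphic_on ball 0 r" for f
  proof (rule analytic_at_imp_has_fps_expansion_0)
    show "f analytic_on {0}" unfolding analytic_at
      using that r(1) by (intro exI[of _ "ball 0 r"]) simp
  qed
  define F H E where "F = fps_expansion d 0" and "H = fps_expansion (\<lambda>z. A.R z + B.R z) 0" and "E = fps_expansion (D 2) 0"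
  have Fe: "d has_fps_expansion F" and He: "(\<lambda>z. A.R z + B.R z) has_fps_expansion H" and Ee: "D 2 has_fps_expansion E"
    unfolding F_def H_def E_def by (intro exp dhol D2hol holomorphic_intros AR BR)+
  have dk: "(deriv ^^ k) d 0 = D k 0" for k
    using higher_deriv_chain[of "ball 0 r" D 0 k] Dd r(1) by (simp add: D0)
  have Fk: "fps_nth F k = D k 0 / fact k" for k by (simp add: F_def fps_expansion_def dk)
  have Ek: "fps_nth E k = of_nat ((k + 1) * (k + 2)) * fps_nth F (k + 2)" for k
  proof -
    have "(deriv ^^ k) (D 2) 0 = D (k + 2) 0"
      using higher_deriv_chain[of "ball 0 r" "\<lambda>k. D (k + 2)" 0 k] Dd r(1) by (simp add: numeral_2_eq_2)
    then have "fps_nth E k = D (k + 2) 0 / fact k" by (simp add: E_def fps_expansion_def)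
    moreover have "fact (k + 2) = (of_nat ((k + 1) * (k + 2)) * fact k :: complex)" by (simp add: algebra_simps)
    moreover have "of_nat ((k + 1) * (k + 2)) \<noteq> (0 :: complex)" by (simp only: of_nat_eq_0_iff) simp
    moreover have "d / g = c * (d / (c * g))" if "c \<noteq> 0" for c d g :: complex using that by simp
    ultimately show ?thesis unfolding Fk by metis
  qed
  \<comment> \<open>Subtract the two equations wp'' = 6 wp^2 - g2 / 2, which share g2. The sum of
    the two wp-functions starts with 2 / z^2, whence the factor 12 = 6 * 2.\<close>
  have ev: "\<forall>\<^sub>F z in nhds 0. z\<^sup>2 * D 2 z = d z * (12 + 6 * (z\<^sup>2 * (A.R z + B.R z)))"
  proof -
    have "\<forall>\<^sub>F z in nhds 0. z \<in> ball 0 r" using r(1) by (intro eventually_nhds_in_open) auto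
    then show ?thesis
    proof eventually_elim
      case (elim z)
      show ?case
      proof (cases "z = 0")
        case True then show ?thesis by (simp add: d_def A.R_0 B.R_0)
      next
        case False
        have zA: "z \<notin> A.L" using A.near_0[OF r(2) elim False] .
        have zB: "z \<notin> B.L" using B.near_0[OF r(3) elim False] .
        define i where "i = 1 / z"
        have zi: "z * i = 1" using False by (simp add: i_def)
        have iv: "1 / z ^ n = i ^ n" for n by (simp add: i_def power_one_over)
        have eA: "i ^ 4 + A.T A.L0 4 z = (i\<^sup>2 + A.R z)\<^sup>2 - 5 * A.G 4"
          using A.wp_ODE2[OF zA] A.T_L_split[OF zA, of 4] by (simp add: A.wp_def iv)
        have eB: "i ^ 4 + B.T B.L0 4 z = (i\<^sup>2 + B.R z)\<^sup>2 - 5 * A.G 4"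
          using B.wp_ODE2[OF zB] B.T_L_split[OF zB, of 4] by (simp add: B.wp_def iv G)
        have D2: "D 2 z = 6 * A.T A.L0 4 z - 6 * B.T B.L0 4 z"
          by (simp add: D_def A.RD_def B.RD_def fact_numeral eval_nat_numeral)
        show ?thesis unfolding D2 d_def using eA eB zi by algebra
      qed
    qed
  qed
  have "(\<lambda>z. z\<^sup>2 * D 2 z) has_fps_expansion fps_X\<^sup>2 * E"
    by (intro fps_expansion_intros Ee)
  moreover have "(\<lambda>z. d z * (12 + 6 * (z\<^sup>2 * (A.R z + B.R z)))) has_fps_expansion F * (12 + 6 * (fps_X\<^sup>2 * H))"
    by (intro fps_expansion_intros Fe He)
  ultimately have eq: "fps_X\<^sup>2 * E = F * (12 + 6 * (fps_X\<^sup>2 * H))"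
    unfolding has_fps_expansion_cong[OF ev refl] by (rule fps_expansion_unique_complex)
  have F0: "fps_nth F k = 0" for k
  proof (induction k rule: less_induct)
    case (less k)
    consider "k = 0" | "k = 1" | "k = 4" | "k \<ge> 2" "k \<noteq> 4" by linarith
    then show ?case
    proof cases
      case 1 then show ?thesis by (simp add: Fk D0 d_def A.R_0 B.R_0)
    next
      case 2 then show ?thesis by (simp add: Fk D_def A.RD_0 B.RD_0 A.G_odd B.G_odd)
    next
      case 3 then show ?thesis by (simp add: Fk D_def A.RD_0 B.RD_0 G)
    next
      case 4
      have "fps_nth (fps_X\<^sup>2 * E) k = fps_nth E (k - 2)"
        using 4 by (simp add: fps_X_power_mult_nth)
      also have "\<dots> = of_nat ((k - 1) * k) * fps_nth F k"
        unfolding Ek using 4 by (simp add: numeral_2_eq_2 Suc_diff_Suc le_add_diff_inverse2 del: of_nat_mult)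
      finally have l: "fps_nth (fps_X\<^sup>2 * E) k = of_nat ((k - 1) * k) * fps_nth F k" .
      have c: "F * (12 + 6 * (fps_X\<^sup>2 * H)) = fps_const 12 * F + fps_const 6 * (fps_X\<^sup>2 * (F * H))"
        by (simp add: numeral_fps_const algebra_simps)
      have "fps_nth (fps_X\<^sup>2 * (F * H)) k = fps_nth (F * H) (k - 2)"
        using 4 by (simp add: fps_X_power_mult_nth)
      also have "\<dots> = 0" unfolding fps_mult_nth
        using 4 less by (intro sum.neutral) auto
      finally have "fps_nth (F * (12 + 6 * (fps_X\<^sup>2 * H))) k = 12 * fps_nth F k"
        unfolding c by simp
      with l eq have m: "(of_nat ((k - 1) * k) - 12) * fps_nth F k = 0" by (simp add: algebra_simps)
      \<comment> \<open>The indicial equation k (k - 1) = 12 has only the root 4 here, and the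
        coefficient of order 4 vanishes because the G6 agree.\<close>
      have "(k - 1) * k \<noteq> 12"
      proof (cases "k \<le> 3")
        case True
        then have "k = 2 \<or> k = 3" using 4 by auto
        then show ?thesis by auto
      next
        case False
        then have "4 * 5 \<le> (k - 1) * k" using 4 by (intro mult_le_mono) auto
        then show ?thesis by linarith
      qed
      then have "(of_nat ((k - 1) * k) :: complex) \<noteq> of_nat 12" using of_nat_eq_iff by blast
      then have "(of_nat ((k - 1) * k) - 12 :: complex) \<noteq> 0" by (simp del: of_nat_mult)
      then show ?thesis using m by (simp only: mult_eq_0_iff) simp
    qed
  qed
  then have "F = 0" by (simp add: fps_eq_iff)
  then have "\<forall>\<^sub>F z in nhds 0. d z = 0" using Fe by (simp add: has_fps_expansion_0_iff)
  then obtain e where e: "e > 0" "\<And>z. z \<in> ball 0 e \<Longrightarrow> d z = 0"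
    by (auto simp: eventually_nhds_metric dist_commute)
  define \<epsilon> where "\<epsilon> = min e r"
  define U where "U = - (A.L \<union> B.L)"
  have U: "open U" "connected U"
  proof -
    show "open U" unfolding U_def using A.closed_subset_L[of A.L] B.closed_subset_L[of B.L] by auto
    have "countable (A.L \<union> B.L)" using A.countable_L B.countable_L by simp
    then show "connected U" unfolding U_def
      by (intro path_connected_imp_connected path_connected_complement_countable) simp
  qed
  have wpU: "A.wp z = B.wp z" if "z \<in> U" for z
  proof (rule analytic_continuation_open[where f = A.wp and g = B.wp and s = "ball 0 \<epsilon> - {0}" and s' = U])
    have "\<epsilon> > 0" using e(1) r(1) by (simp add: \<epsilon>_def)
    then have "of_real (\<epsilon> / 2) \<in> ball (0::complex) \<epsilon> - {0}" by simp
    then show "ball (0::complex) \<epsilon> - {0} \<noteq> {}" by blast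
    show "ball 0 \<epsilon> - {0} \<subseteq> U" using A.near_0[OF r(2)] B.near_0[OF r(3)] by (auto simp: U_def \<epsilon>_def)
    show "A.wp holomorphic_on U" "B.wp holomorphic_on U"
      unfolding U_def by (intro holomorphic_on_subset[OF A.wp_holomorphic] holomorphic_on_subset[OF B.wp_holomorphic]; blast)+
    show "A.wp z = B.wp z" if "z \<in> ball 0 \<epsilon> - {0}" for z
      using e(2)[of z] that by (simp add: A.wp_def B.wp_def d_def \<epsilon>_def)
  qed (use U that in \<open>simp_all add: open_delete\<close>)
  show ?thesis
  proof
    fix w assume w: "w \<in> zspan w1 w2"
    show "w \<in> zspan v1 v2"
    proof (rule ccontr)
      \<comment> \<open>The two wp-functions agree off both lattices, but one has a double pole at
        \<open>w\<close> and the other would be finite there.\<close>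
      assume nB: "w \<notin> B.L"
      obtain e1 where e1: "e1 > 0" "A.L \<inter> ball w e1 \<subseteq> {w}" using A.isolated_L by blast
      obtain e2 where e2: "e2 > 0" "B.L \<inter> ball w e2 \<subseteq> {w}" using B.isolated_L by blast
      have "\<forall>\<^sub>F h in at 0. h \<in> ball 0 (min e1 e2) - {0}" using e1 e2 by (intro eventually_at_in_open) auto
      then have ev: "\<forall>\<^sub>F h in at 0. A.wp (w + h) * h\<^sup>2 = B.wp (w + h) * h\<^sup>2"
      proof eventually_elim
        case (elim h)
        then have "w + h \<in> ball w e1" "w + h \<in> ball w e2" "w + h \<noteq> w" by (auto simp: dist_norm)
        then have "w + h \<in> U" using e1 e2 by (auto simp: U_def)
        then show ?case using wpU by simp
      qed
      have "isCont B.wp w" using B.wp_deriv[OF nB] DERIV_isCont by blast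
      then have "((\<lambda>h. B.wp (w + h)) \<longlongrightarrow> B.wp w) (at 0)" by (simp add: isCont_iff)
      then have "((\<lambda>h. B.wp (w + h) * h\<^sup>2) \<longlongrightarrow> B.wp w * 0\<^sup>2) (at 0)" by (intro tendsto_intros)
      moreover have "((\<lambda>h. B.wp (w + h) * h\<^sup>2) \<longlongrightarrow> 1) (at 0)"
        using A.wp_double_pole[OF w] ev by (rule Lim_transform_eventually)
      ultimately have "B.wp w * 0\<^sup>2 = 1" by (rule LIM_unique)
      then show False by simp
    qed
  qed
qed

text \<open>Equality of j says that A^3 and B^2 are scaled by the same factor. A fourth root of A /
  A', available since j is nonzero, matches G4, and G6 up to sign; replacing \<open>c\<close> by i c
  changes that sign and keeps c^4.\<close>

lemma j_injective:
  assumes l1: "cx_lattice w1 w2" and l2: "cx_lattice v1 v2"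
    and j: "j_invariant (zspan w1 w2) = j_invariant (zspan v1 v2)" "j_invariant (zspan w1 w2) \<noteq> 0"
  shows "\<exists>c. c \<noteq> 0 \<and> zspan v1 v2 = (*) c ` zspan w1 w2"
proof -
  define A B where "A = eisenstein_sum 4 (zspan w1 w2)" and "B = eisenstein_sum 6 (zspan w1 w2)"
  define A' B' where "A' = eisenstein_sum 4 (zspan v1 v2)" and "B' = eisenstein_sum 6 (zspan v1 v2)"
  define D D' where "D = (60 * A) ^ 3 - 27 * (140 * B)\<^sup>2" and "D' = (60 * A') ^ 3 - 27 * (140 * B')\<^sup>2"
  have ja: "j_invariant (zspan w1 w2) = 1728 * (60 * A) ^ 3 / D" "j_invariant (zspan v1 v2) = 1728 * (60 * A') ^ 3 / D'"
    by (simp_all add: j_invariant_def A_def B_def A'_def B'_def D_def D'_def Let_def)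
  have nz: "A \<noteq> 0" "D \<noteq> 0" "A' \<noteq> 0" "D' \<noteq> 0" using j ja by auto
  have "A ^ 3 * D' = A' ^ 3 * D" using j(1) nz unfolding ja by (simp add: frac_eq_eq power_mult_distrib)
  then have cross: "A ^ 3 * B'\<^sup>2 = A' ^ 3 * B\<^sup>2" unfolding D_def D'_def by algebra
  obtain c where c: "c ^ 4 = A / A'" 
    using exists_complex_root[of 4 "A / A'"] by (metis zero_neq_numeral)
  have c0: "c \<noteq> 0" using c nz by auto
  have c12: "c ^ 12 = (A / A') ^ 3" unfolding c[symmetric] by (simp flip: power_mult)
  have "(B / c ^ 6)\<^sup>2 = B\<^sup>2 / c ^ 12" by (simp add: power_divide flip: power_mult)
  also have "\<dots> = B'\<^sup>2" unfolding c12 power_divide using cross nz by (simp add: divide_simps mult.commute)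
  finally have "B / c ^ 6 = B' \<or> B / c ^ 6 = - B'" by (simp add: power2_eq_iff)
  then obtain k where k: "k \<noteq> 0" "A / k ^ 4 = A'" "B / k ^ 6 = B'"
  proof
    assume "B / c ^ 6 = B'"
    then show thesis using that[of c] c0 c nz by simp
  next
    assume b: "B / c ^ 6 = - B'"
    have "\<i> ^ 6 = - (1 :: complex)" by (simp add: eval_nat_numeral)
    then have "B / (\<i> * c) ^ 6 = B'" using b by (simp add: power_mult_distrib minus_divide_left[symmetric] nonzero_minus_divide_right[symmetric])
    moreover have "A / (\<i> * c) ^ 4 = A'" using c nz by (simp add: power_mult_distrib)
    ultimately show thesis using that[of "\<i> * c"] c0 by simp
  qed
  have l3: "cx_lattice (k * w1) (k * w2)" using cx_lattice_scale[OF l1 k(1)] .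
  have G4: "eisenstein_sum 4 (zspan (k * w1) (k * w2)) = A'" and G6: "eisenstein_sum 6 (zspan (k * w1) (k * w2)) = B'"
    using k unfolding zspan_scale[symmetric] eisenstein_scale[OF k(1)] by (simp_all add: A_def B_def)
  have "zspan (k * w1) (k * w2) = zspan v1 v2"
    using lattice_eq_of_eisenstein_sub[OF l3 l2] lattice_eq_of_eisenstein_sub[OF l2 l3] G4 G6
    by (auto simp: A'_def B'_def)
  then show ?thesis using k(1) zspan_scale by metis
qed

lemma zspan_one_iff: "x \<in> zspan 1 \<tau> \<longleftrightarrow> (\<exists>a b. x = of_int a + of_int b * \<tau>)"
  by (simp add: zspan_iff)

lemma cx_lattice_tau: "Im \<tau> \<noteq> 0 \<Longrightarrow> cx_lattice 1 \<tau>"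
  by unfold_locales simp

section \<open>Orders, CM points and binary quadratic forms\<close>

definition sqrt_disc :: "int \<Rightarrow> complex" where
  "sqrt_disc \<Delta> = \<i> * of_real (sqrt (of_int (- \<Delta>)))"

context
  fixes \<Delta> :: int
  assumes disc: "imag_quad_disc \<Delta>"
begin

lemma disc_neg: "\<Delta> < 0" using disc by (simp add: imag_quad_disc_def)

lemma sqrt_disc_sq: "(sqrt_disc \<Delta>)\<^sup>2 = of_int \<Delta>"
proof -
  have "(complex_of_real (sqrt (of_int (- \<Delta>))))\<^sup>2 = of_real ((sqrt (of_int (- \<Delta>)))\<^sup>2)" by (simp only: of_real_power)
  also have "(sqrt (of_int (- \<Delta>)))\<^sup>2 = (of_int (- \<Delta>) :: real)" using disc_neg by (intro real_sqrt_pow2) simp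
  finally show ?thesis by (simp add: sqrt_disc_def power_mult_distrib)
qed

lemma Im_sqrt_disc: "Im (sqrt_disc \<Delta>) = sqrt (of_int (- \<Delta>))" "Re (sqrt_disc \<Delta>) = 0"
  by (simp_all add: sqrt_disc_def)

lemma Im_sqrt_disc_pos: "sqrt (of_int (- \<Delta>)) > 0"
  using disc_neg by simp

definition omega :: complex where "omega = (of_int \<Delta> + sqrt_disc \<Delta>) / 2"

lemma quad_order_omega: "quad_order \<Delta> = zspan 1 omega"
proof -
  have "csqrt (of_int \<Delta>) = sqrt_disc \<Delta>"
    using csqrt_of_real_nonpos[of "of_int \<Delta>"] disc_neg by (simp add: sqrt_disc_def)
  then show ?thesis by (simp add: quad_order_def omega_def)
qed

lemma Im_omega: "Im omega = sqrt (of_int (- \<Delta>)) / 2" by (simp add: omega_def Im_sqrt_disc)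

lemma Im_omega_nz: "Im omega \<noteq> 0" using Im_omega Im_sqrt_disc_pos by linarith

lemma quad_order_shift: "(b - \<Delta>) mod 2 = 0 \<Longrightarrow> quad_order \<Delta> = zspan 1 ((of_int b + sqrt_disc \<Delta>) / 2)"
proof -
  assume "(b - \<Delta>) mod 2 = 0"
  then obtain k where "b = \<Delta> + 2 * k" by (metis add.commute diff_add_cancel mod_0_imp_dvd dvdE)
  then have "(of_int b + sqrt_disc \<Delta>) / 2 = of_int k + omega" by (simp add: omega_def field_simps)
  then show ?thesis unfolding quad_order_omega using zspan_shift by metis
qed

lemma order_mult: "x \<in> quad_order \<Delta> \<Longrightarrow> y \<in> quad_order \<Delta> \<Longrightarrow> x * y \<in> quad_order \<Delta>"
  using imag_quad_order_of_disc_iff[OF disc, of "quad_order \<Delta>"] by (simp add: imag_quad_order_of_disc_def)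

lemma order_one: "1 \<in> quad_order \<Delta>"
  unfolding quad_order_omega zspan_one_iff by (rule exI[of _ 1], rule exI[of _ 0]) simp
lemma order_omega: "omega \<in> quad_order \<Delta>"
  unfolding quad_order_omega zspan_one_iff by (rule exI[of _ 0], rule exI[of _ 1]) simp
lemma order_sqrt: "sqrt_disc \<Delta> \<in> quad_order \<Delta>"
  unfolding quad_order_omega zspan_one_iff
  by (rule exI[of _ "- \<Delta>"], rule exI[of _ 2]) (simp add: omega_def field_simps)

text \<open>CM points correspond to primitive positive definite forms \<open>(a, b, c)\<close> of discriminant \<open>\<Delta>\<close>
  through the root \<open>(- b + \<surd>\<Delta>) / 2 a\<close>.\<close>

lemma form_of_cm_point:
  assumes tau: "Im \<tau> > 0" and mr: "multiplier_ring (zspan 1 \<tau>) = quad_order \<Delta>"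
  obtains a b c :: int where "a > 0" "b\<^sup>2 - 4 * a * c = \<Delta>" "\<tau> = (- of_int b + sqrt_disc \<Delta>) / (2 * of_int a)"
    "\<And>d. d dvd a \<Longrightarrow> d dvd b \<Longrightarrow> d dvd c \<Longrightarrow> \<bar>d\<bar> = 1"
proof -
  interpret cx_lattice 1 \<tau> using tau by (intro cx_lattice_tau) simp
  have om: "omega * l \<in> L" if "l \<in> L" for l
    using order_omega that mr by (auto simp: multiplier_ring_def)
  have "omega \<in> L" using om[OF L_w1] by simp
  then obtain u a where ua: "omega = of_int u + of_int a * \<tau>" unfolding zspan_one_iff by blast
  have "omega * \<tau> \<in> L" using om[OF L_w2] .
  then obtain p q where pq: "omega * \<tau> = of_int p + of_int q * \<tau>" unfolding zspan_one_iff by blast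
  have Ia: "of_int a * Im \<tau> = sqrt (of_int (- \<Delta>)) / 2" using arg_cong[OF ua, of Im] by (simp add: Im_omega)
  have "of_int a * Im \<tau> > 0" unfolding Ia using Im_sqrt_disc_pos by (simp only: half_gt_zero)
  then have a: "a > 0" using tau by (simp add: zero_less_mult_iff)
  define b where "b = 2 * u - \<Delta>"
  define c where "c = - p"
  have at: "of_int a * \<tau> = (- of_int b + sqrt_disc \<Delta>) / 2"
    using ua by (simp add: omega_def b_def field_simps)
  have a0: "of_int a \<noteq> (0::complex)" using a by simp
  have tt: "\<tau> = (- of_int b + sqrt_disc \<Delta>) / (2 * of_int a)"
    using at a0 by (simp add: field_simps)
  have e1: "(of_int u + of_int a * \<tau>) * \<tau> = of_int p + of_int q * \<tau>" using pq ua by simp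
  have "of_int u + 2 * (of_int a * Re \<tau>) = (of_int q :: real)"
  proof -
    have "Im ((of_int u + of_int a * \<tau>) * \<tau>) = Im (of_int p + of_int q * \<tau>)" using e1 by simp
    then have "of_int u * Im \<tau> + of_int a * (2 * Re \<tau> * Im \<tau>) = of_int q * Im \<tau>" by (simp add: algebra_simps)
    then have "Im \<tau> * (of_int u + 2 * (of_int a * Re \<tau>)) = Im \<tau> * of_int q" by (simp add: algebra_simps)
    then show ?thesis using tau by simp
  qed
  moreover have "of_int a * Re \<tau> = - of_int b / 2"
    using arg_cong[OF at, of Re] by (simp add: Im_sqrt_disc)
  ultimately have "real_of_int (u - b) = of_int q" by simp
  then have q: "q = u - b" by linarith
  have "of_int a * \<tau> * \<tau> + of_int b * \<tau> + of_int c = 0"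
    using e1 by (simp add: q c_def algebra_simps)
  then have "(of_int a * \<tau>)\<^sup>2 + of_int b * (of_int a * \<tau>) + of_int a * of_int c = 0" by algebra
  moreover have "2 * (of_int a * \<tau>) = - of_int b + sqrt_disc \<Delta>" unfolding at by simp
  ultimately have "(sqrt_disc \<Delta>)\<^sup>2 - (of_int b)\<^sup>2 + 4 * of_int a * of_int c = 0" by algebra
  then have "(of_int (b\<^sup>2 - 4 * a * c) :: complex) = of_int \<Delta>" unfolding sqrt_disc_sq by (simp add: algebra_simps)
  then have d: "b\<^sup>2 - 4 * a * c = \<Delta>" by (simp only: of_int_eq_iff)
  have quad: "of_int a * \<tau> * \<tau> + of_int b * \<tau> + of_int c = 0" by fact
  \<comment> \<open>If \<open>d\<close> divides the form, then (a / d) \<tau> is also a multiplier.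
    The imaginary parts of elements of the order are multiples of that of a \<tau>, so
    \<open>d\<close> is a unit.\<close>
  have prim: "\<bar>d\<bar> = 1" if dd: "d dvd a" "d dvd b" "d dvd c" for d
  proof -
    obtain a' b' c' where d': "a = d * a'" "b = d * b'" "c = d * c'" using dd by (auto elim!: dvdE)
    have d0: "of_int d \<noteq> (0::complex)" using a d'(1) by auto
    have "of_int d * (of_int a' * \<tau> * \<tau> + of_int b' * \<tau> + of_int c') = 0"
      using quad by (simp add: d' algebra_simps)
    then have "of_int a' * \<tau> * \<tau> + of_int b' * \<tau> + of_int c' = 0" using d0 by (simp only: mult_eq_0_iff) simp
    then have q': "of_int a' * \<tau> * \<tau> = - of_int c' + (- of_int b') * \<tau>" by (simp add: algebra_simps eq_neg_iff_add_eq_0)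
    have "of_int a' * \<tau> \<in> multiplier_ring L"
      unfolding multiplier_ring_def
    proof (clarify)
      fix l assume "l \<in> L"
      then obtain x y where l: "l = of_int x + of_int y * \<tau>" unfolding zspan_one_iff by blast
      have "of_int a' * \<tau> * l = of_int x * (of_int a' * \<tau>) + of_int y * (of_int a' * \<tau> * \<tau>)" by (simp add: l algebra_simps)
      also have "\<dots> = of_int (- y * c') + of_int (x * a' - y * b') * \<tau>" unfolding q' by (simp add: algebra_simps)
      finally show "of_int a' * \<tau> * l \<in> L" unfolding zspan_one_iff by blast
    qed
    then have "of_int a' * \<tau> \<in> zspan 1 omega" using mr quad_order_omega by simp
    then obtain x y where xy: "of_int a' * \<tau> = of_int x + of_int y * omega" unfolding zspan_one_iff by blast
    have "of_int a' * Im \<tau> = of_int y * (sqrt (of_int (- \<Delta>)) / 2)" using arg_cong[OF xy, of Im] by (simp add: Im_omega)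
    then have "of_int a' * Im \<tau> = of_int y * (of_int a * Im \<tau>)" by (simp only: Ia)
    then have "real_of_int a' = of_int (y * a)" using tau by simp
    then have "a' = y * a" by (simp only: of_int_eq_iff)
    with d'(1) have "1 * a = d * y * a" by (metis mult_1 mult.assoc)
    then have "d * y = 1" using a by (metis mult_cancel_right less_irrefl)
    then show ?thesis by (auto simp: zmult_eq_1_iff)
  qed
  show thesis by (rule that[OF a d tt prim])
qed

text \<open>A multiplier x + y \<tau> satisfies a | y b and a | y c, and either coprimality yields a
  | y. For prime \<open>a\<close> the disjunction is exactly primitivity of the form.\<close>

lemma cm_point_of_form:
  assumes a: "a > 0" and d: "b\<^sup>2 - 4 * a * c = \<Delta>" and prim: "coprime a b \<or> coprime a c"
  defines "\<tau> \<equiv> (- of_int b + sqrt_disc \<Delta>) / (2 * of_int a)"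
  shows "Im \<tau> = sqrt (of_int (- \<Delta>)) / (2 * of_int a)" "Im \<tau> > 0" "multiplier_ring (zspan 1 \<tau>) = quad_order \<Delta>"
    "j_invariant (zspan 1 \<tau>) \<in> singular_moduli \<Delta>"
proof -
  have a0: "of_int a \<noteq> (0::complex)" using a by simp
  have "Im (\<tau>) = Im ((- of_int b + sqrt_disc \<Delta>) / of_int (2 * a))" by (simp add: \<tau>_def)
  also have "\<dots> = Im (- of_int b + sqrt_disc \<Delta>) / of_int (2 * a)"
    by (metis Im_divide_of_real of_real_of_int_eq)
  finally show im: "Im \<tau> = sqrt (of_int (- \<Delta>)) / (2 * of_int a)" by (simp add: Im_sqrt_disc)
  then show pos: "Im \<tau> > 0" using a Im_sqrt_disc_pos by simp
  interpret cx_lattice 1 \<tau> using pos by (intro cx_lattice_tau) simp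
  have at: "of_int a * \<tau> = (of_int (- b) + sqrt_disc \<Delta>) / 2" using a0 by (simp add: \<tau>_def)
  have par: "(- b - \<Delta>) mod 2 = 0"
  proof -
    have "b\<^sup>2 - \<Delta> = 2 * (2 * a * c)" using d by simp
    then have "even (b\<^sup>2 - \<Delta>)" by simp
    then have "even b \<longleftrightarrow> even \<Delta>" by simp
    then show ?thesis by presburger
  qed
  have O: "quad_order \<Delta> = zspan 1 (of_int a * \<tau>)" unfolding at using quad_order_shift[OF par] .
  have "4 * of_int a * (of_int a * \<tau> * \<tau> + of_int b * \<tau> + of_int c) = (2 * (of_int a * \<tau>) + of_int b)\<^sup>2 - of_int (b\<^sup>2 - 4 * a * c)"
    by (simp add: algebra_simps power2_eq_square)
  also have "2 * (of_int a * \<tau>) + of_int b = sqrt_disc \<Delta>" unfolding at by (simp add: field_simps)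
  also have "(sqrt_disc \<Delta>)\<^sup>2 - of_int (b\<^sup>2 - 4 * a * c) = 0" unfolding d sqrt_disc_sq by simp
  finally have "of_int a * \<tau> * \<tau> + of_int b * \<tau> + of_int c = 0" using a0 by (simp only: mult_eq_0_iff) simp
  then have quad: "of_int a * \<tau> * \<tau> = - of_int b * \<tau> - of_int c" by (simp add: algebra_simps eq_neg_iff_add_eq_0)
  show mr: "multiplier_ring (zspan 1 \<tau>) = quad_order \<Delta>"
  proof
    show "quad_order \<Delta> \<subseteq> multiplier_ring L"
    proof
      fix r assume "r \<in> quad_order \<Delta>"
      then obtain x y where r: "r = of_int x + of_int y * (of_int a * \<tau>)" unfolding O zspan_one_iff by blast
      show "r \<in> multiplier_ring L" unfolding multiplier_ring_def
      proof clarify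
        fix l assume "l \<in> L"
        then obtain u v where l: "l = of_int u + of_int v * \<tau>" unfolding zspan_one_iff by blast
        have "r * l = of_int x * of_int u + (of_int x * of_int v + of_int y * of_int u * of_int a) * \<tau> + of_int y * of_int v * (of_int a * \<tau> * \<tau>)"
          by (simp add: r l algebra_simps)
        also have "\<dots> = of_int (x * u - y * v * c) + of_int (x * v + y * u * a - y * v * b) * \<tau>"
          unfolding quad by (simp add: algebra_simps)
        finally show "r * l \<in> L" unfolding zspan_one_iff by blast
      qed
    qed
    show "multiplier_ring L \<subseteq> quad_order \<Delta>"
    proof
      fix r assume r: "r \<in> multiplier_ring L"
      then have "r * 1 \<in> L" "r * \<tau> \<in> L" using L_w1 L_w2 by (auto simp: multiplier_ring_def)
      then obtain x y p q where xy: "r = of_int x + of_int y * \<tau>" and pq: "r * \<tau> = of_int p + of_int q * \<tau>"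
        unfolding zspan_one_iff by auto
      have "of_int a * (r * \<tau>) = of_int a * of_int x * \<tau> + of_int y * (of_int a * \<tau> * \<tau>)" by (simp add: xy algebra_simps)
      also have "\<dots> = of_int (- (y * c)) + of_int (a * x - y * b) * \<tau>" unfolding quad by (simp add: algebra_simps)
      finally have "of_int a * (of_int p + of_int q * \<tau>) = of_int (- (y * c)) + of_int (a * x - y * b) * \<tau>"
        unfolding pq .
      then have "of_real (of_int (a * p)) * 1 + of_real (of_int (a * q)) * \<tau> = of_real (of_int (- (y * c))) * 1 + of_real (of_int (a * x - y * b)) * \<tau>"
        by (simp add: algebra_simps)
      from coords_unique[OF this] have "a * p = - (y * c)" "a * q = a * x - y * b" by (simp_all only: of_int_eq_iff)
      then have "y * c = a * (- p)" "y * b = a * (x - q)" by (simp_all add: algebra_simps)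
      then have "a dvd y * c" "a dvd y * b" by (metis dvd_triv_left)+
      then have "a dvd y" using prim 
        by (metis coprime_dvd_mult_left_iff)
      then obtain z where "y = a * z" by (auto elim: dvdE)
      then have "r = of_int x + of_int z * (of_int a * \<tau>)" by (simp add: xy algebra_simps)
      then show "r \<in> quad_order \<Delta>" unfolding O zspan_one_iff by blast
    qed
  qed
  show "j_invariant (zspan 1 \<tau>) \<in> singular_moduli \<Delta>"
    unfolding singular_moduli_def using pos mr imag_quad_order_of_disc_iff[OF disc] by blast
qed

lemma multiplier_ring_scale: "c \<noteq> 0 \<Longrightarrow> multiplier_ring ((*) c ` X) = multiplier_ring X"
proof -
  assume c: "c \<noteq> 0"
  have "(r * (c * x) \<in> (*) c ` X) = (r * x \<in> X)" for r x
  proof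
    assume "r * (c * x) \<in> (*) c ` X"
    then obtain y where "y \<in> X" "r * (c * x) = c * y" by auto
    then show "r * x \<in> X" using c by (simp add: mult.left_commute)
  next
    assume "r * x \<in> X"
    then show "r * (c * x) \<in> (*) c ` X" by (auto simp: mult.left_commute)
  qed
  then show ?thesis by (auto simp: multiplier_ring_def)
qed

text \<open>Multiply a representation of 1 as a sum of products from \<open>I\<close> and
  \<open>J\<close> by \<open>r\<close>, absorbing \<open>r\<close> into the factors from
  \<open>I\<close>.\<close>

lemma multiplier_ring_invertible:
  assumes I: "I \<in> invertible_ideals (quad_order \<Delta>)"
  shows "multiplier_ring I = quad_order \<Delta>"
proof
  have fI: "frac_ideal (quad_order \<Delta>) I" using I by (simp add: invertible_ideals_def)
  then show "quad_order \<Delta> \<subseteq> multiplier_ring I" by (auto simp: frac_ideal_def multiplier_ring_def)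
  obtain J where J: "ideal_mult I J = quad_order \<Delta>" using I by (auto simp: invertible_ideals_def)
  show "multiplier_ring I \<subseteq> quad_order \<Delta>"
  proof
    fix r assume r: "r \<in> multiplier_ring I"
    have "1 \<in> ideal_mult I J" using J order_one by simp
    then obtain n :: nat and a b where ab: "1 = (\<Sum>k<n. a k * b k)" "\<forall>k<n. a k \<in> I \<and> b k \<in> J"
      unfolding ideal_mult_def by auto
    have "r = r * (\<Sum>k<n. a k * b k)" using ab(1) by simp
    also have "\<dots> = (\<Sum>k<n. (r * a k) * b k)" by (simp add: sum_distrib_left mult.assoc)
    finally have "r = (\<Sum>k<n. (r * a k) * b k)" .
    moreover have "\<forall>k<n. r * a k \<in> I \<and> b k \<in> J" using ab(2) r by (auto simp: multiplier_ring_def)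
    ultimately have "r \<in> ideal_mult I J" unfolding ideal_mult_def mem_Collect_eq
      by (intro exI[of _ n] exI[of _ "\<lambda>k. r * a k"] exI[of _ b] conjI)
    then show "r \<in> quad_order \<Delta>" using J by simp
  qed
qed

text \<open>A pair of successive minimal vectors is a reduced basis.\<close>

lemma ideal_reduced_basis:
  assumes I: "I \<in> invertible_ideals (quad_order \<Delta>)"
  obtains c \<tau> where "c \<noteq> 0" "I = (*) c ` zspan 1 \<tau>" "Im \<tau> > 0" "\<bar>Re \<tau>\<bar> \<le> 1 / 2" "norm \<tau> \<ge> 1"
    "multiplier_ring (zspan 1 \<tau>) = quad_order \<Delta>"
proof -
  have fI: "frac_ideal (quad_order \<Delta>) I" using I by (simp add: invertible_ideals_def)
  have I0: "0 \<in> I" "I \<noteq> {0}" and I_add: "\<And>x y. x \<in> I \<Longrightarrow> y \<in> I \<Longrightarrow> x + y \<in> I"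
    and I_mult: "\<And>r x. r \<in> quad_order \<Delta> \<Longrightarrow> x \<in> I \<Longrightarrow> r * x \<in> I"
    using fI by (auto simp: frac_ideal_def)
  obtain d where d: "d \<noteq> 0" "\<And>x. x \<in> I \<Longrightarrow> d * x \<in> quad_order \<Delta>" using fI unfolding frac_ideal_def by blast
  interpret O: cx_lattice 1 omega using Im_omega_nz by (intro cx_lattice_tau)
  have int: "of_int k \<in> quad_order \<Delta>" for k
    unfolding quad_order_omega zspan_one_iff by (rule exI[of _ k], rule exI[of _ 0]) simp
  have I_int: "of_int k * x \<in> I" if "x \<in> I" for k x using I_mult[OF int that] .
  have I_neg: "- x \<in> I" if "x \<in> I" for x using I_int[OF that, of "-1"] by simp
  have fin: "finite (I \<inter> cball 0 B)" for B
  proof -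
    have "(*) d ` (I \<inter> cball 0 B) \<subseteq> O.L \<inter> cball 0 (norm d * B)"
      using d by (auto simp: quad_order_omega[symmetric] norm_mult mult_left_mono)
    then have "finite ((*) d ` (I \<inter> cball 0 B))" using O.finite_L_cball finite_subset by blast
    then show ?thesis using d(1) by (auto dest!: finite_imageD simp: inj_on_def)
  qed
  have mini: "\<exists>m\<in>A. \<forall>y\<in>A. norm m \<le> norm y" if A: "A \<subseteq> I" "A \<noteq> {}" for A
  proof -
    obtain x where x: "x \<in> A" using A by blast
    let ?S = "A \<inter> cball 0 (norm x)"
    have "finite ?S" by (rule finite_subset[OF _ fin[of "norm x"]]) (use A in blast)
    moreover have "?S \<noteq> {}" using x by auto
    ultimately have m: "arg_min_on norm ?S \<in> ?S" "\<not> (\<exists>y\<in>?S. norm y < norm (arg_min_on norm ?S))"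
      using arg_min_if_finite[of ?S norm] by auto
    have "norm (arg_min_on norm ?S) \<le> norm y" if "y \<in> A" for y
      using m that by (cases "norm y \<le> norm x") force+
    then show ?thesis using m(1) by blast
  qed
  obtain w1 where w1: "w1 \<in> I" "w1 \<noteq> 0" "\<And>y. y \<in> I \<Longrightarrow> y \<noteq> 0 \<Longrightarrow> norm w1 \<le> norm y"
    using mini[of "I - {0}"] I0 by auto
  define A where "A = {x \<in> I. Im (x / w1) \<noteq> 0}"
  have "omega * w1 \<in> A" using I_mult[OF order_omega w1(1)] w1(2) Im_omega_nz by (simp add: A_def)
  then have "A \<noteq> {}" "A \<subseteq> I" by (auto simp: A_def)
  then obtain w2 where w2: "w2 \<in> A" "\<And>y. y \<in> A \<Longrightarrow> norm w2 \<le> norm y" using mini[of A] by blast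
  define v where "v = (if Im (w2 / w1) > 0 then w2 else - w2)"
  have v: "v \<in> A" "Im (v / w1) > 0" "\<And>y. y \<in> A \<Longrightarrow> norm v \<le> norm y"
    using w2 I_neg by (auto simp: v_def A_def)
  define \<tau> where "\<tau> = v / w1"
  have vt: "v = w1 * \<tau>" using w1(2) by (simp add: \<tau>_def)
  have vI: "v \<in> I" using v(1) by (simp add: A_def)
  have tau: "Im \<tau> > 0" using v(2) by (simp add: \<tau>_def)
  have nA: "norm \<tau> \<le> norm z" if "w1 * z \<in> I" "Im z \<noteq> 0" for z
  proof -
    have "w1 * z \<in> A" using that w1(2) by (simp add: A_def)
    then have "norm w1 * norm \<tau> \<le> norm w1 * norm z" using v(3) vt by (simp add: norm_mult[symmetric])
    then show ?thesis using w1(2) by simp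
  qed
  have n1: "1 \<le> norm z" if "w1 * z \<in> I" "z \<noteq> 0" for z
  proof -
    have "norm w1 * 1 \<le> norm w1 * norm z" using w1(3)[OF that(1)] that(2) w1(2) by (simp add: norm_mult)
    then show ?thesis using w1(2) by (simp only: mult_le_cancel_left) auto
  qed
  have nt: "norm \<tau> \<ge> 1" using n1[of \<tau>] vI vt tau by force
  have re: "\<bar>Re \<tau>\<bar> \<le> 1 / 2"
  proof -
    have H: "norm \<tau> \<le> norm (\<tau> + of_int k)" if "k = 1 \<or> k = -1" for k :: int
      using nA[of "\<tau> + of_int k"] I_add[OF vI I_int[OF w1(1), of k]] tau vt by (simp add: algebra_simps)
    have "norm \<tau> \<le> norm (\<tau> + 1)" "norm \<tau> \<le> norm (\<tau> - 1)" using H[of 1] H[of "-1"] by simp_all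
    then have "(norm \<tau>)\<^sup>2 \<le> (norm (\<tau> + 1))\<^sup>2" "(norm \<tau>)\<^sup>2 \<le> (norm (\<tau> - 1))\<^sup>2" by (simp_all add: power_mono)
    then show ?thesis unfolding cmod_power2 by (simp add: power2_eq_square algebra_simps)
  qed
  have span: "I = (*) w1 ` zspan 1 \<tau>"
  proof (intro set_eqI iffI)
    fix x assume "x \<in> (*) w1 ` zspan 1 \<tau>"
    then obtain z where z: "z \<in> zspan 1 \<tau>" "x = w1 * z" by (auto elim: imageE)
    then obtain a b where "x = w1 * (of_int a + of_int b * \<tau>)" unfolding zspan_one_iff by blast
    then have "x = of_int a * w1 + of_int b * v" by (simp add: vt algebra_simps)
    then show "x \<in> I" using I_add I_int w1(1) vI by simp
  next
    fix x assume x: "x \<in> I"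
    interpret T: cx_lattice 1 \<tau> using tau by (intro cx_lattice_tau) simp
    obtain a b :: real where ab: "x / w1 = of_real a * 1 + of_real b * \<tau>" by (rule T.real_coords)
    define a' b' where "a' = a - of_int (round a)" and "b' = b - of_int (round b)"
    have small: "\<bar>a'\<bar> \<le> 1 / 2" "\<bar>b'\<bar> \<le> 1 / 2"
      using of_int_round_abs_le[of a] of_int_round_abs_le[of b] by (auto simp: a'_def b'_def abs_minus_commute)
    define z where "z = of_real a' + of_real b' * \<tau>"
    have wz: "w1 * z = x + (of_int (- round a) * w1 + of_int (- round b) * v)"
    proof -
      have "x = w1 * (of_real a + of_real b * \<tau>)" using ab w1(2) by (simp add: field_simps)
      then show ?thesis by (simp add: z_def a'_def b'_def vt algebra_simps)
    qed
    have zI: "w1 * z \<in> I" unfolding wz by (intro I_add I_int x w1(1) vI)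
    \<comment> \<open>Otherwise \<open>z\<close> competes with \<tau> for minimality, but its
      squared norm is at most 1/4 + 1/4 + |\<tau>|^2 / 4, which is below |\<tau>|^2.\<close>
    have b0: "b' = 0"
    proof (rule ccontr)
      assume "b' \<noteq> 0"
      then have "Im z \<noteq> 0" using tau by (simp add: z_def)
      then have "norm \<tau> \<le> norm z" using nA zI by blast
      then have le: "(norm \<tau>)\<^sup>2 \<le> (norm z)\<^sup>2" by (simp add: power_mono)
      have "(norm z)\<^sup>2 = a'\<^sup>2 + 2 * (a' * b' * Re \<tau>) + b'\<^sup>2 * (norm \<tau>)\<^sup>2"
        unfolding cmod_power2 z_def by (simp add: power2_eq_square algebra_simps)
      moreover have "a'\<^sup>2 \<le> 1 / 4" "b'\<^sup>2 \<le> 1 / 4"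
        using power_mono[OF small(1), of 2] power_mono[OF small(2), of 2] by (simp_all add: power2_eq_square)
      moreover have "a' * b' * Re \<tau> \<le> 1 / 8"
      proof -
        have "\<bar>a' * b' * Re \<tau>\<bar> \<le> 1 / 2 * (1 / 2) * (1 / 2)"
          unfolding abs_mult by (intro mult_mono small re) auto
        then show ?thesis by simp
      qed
      moreover have "b'\<^sup>2 * (norm \<tau>)\<^sup>2 \<le> 1 / 4 * (norm \<tau>)\<^sup>2"
        using \<open>b'\<^sup>2 \<le> 1 / 4\<close> by (intro mult_right_mono) auto
      moreover have "(norm \<tau>)\<^sup>2 \<ge> 1" using nt by simp
      ultimately show False using le by linarith
    qed
    have a0: "a' = 0"
    proof (rule ccontr)
      assume "a' \<noteq> 0"
      then have "z \<noteq> 0" "norm z \<le> 1 / 2" using b0 small by (auto simp: z_def)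
      then show False using n1[OF zI] by simp
    qed
    have "a = of_int (round a)" "b = of_int (round b)" using a0 b0 by (auto simp: a'_def b'_def)
    then have "x / w1 = of_int (round a) + of_int (round b) * \<tau>" using ab by (metis mult.right_neutral of_real_of_int_eq)
    then have "x / w1 \<in> zspan 1 \<tau>" unfolding zspan_one_iff by blast
    then show "x \<in> (*) w1 ` zspan 1 \<tau>" using w1(2) by (intro image_eqI[where x = "x / w1"]) auto
  qed
  have "multiplier_ring (zspan 1 \<tau>) = quad_order \<Delta>"
    using multiplier_ring_invertible[OF I] multiplier_ring_scale[OF w1(2)] span by simp
  then show thesis using that[OF w1(2) span tau re nt] by simp
qed

lemma frac_field_mult: "x \<in> frac_field (quad_order \<Delta>) \<Longrightarrow> y \<in> frac_field (quad_order \<Delta>) \<Longrightarrow> x * y \<in> frac_field (quad_order \<Delta>)"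
proof -
  assume "x \<in> frac_field (quad_order \<Delta>)" "y \<in> frac_field (quad_order \<Delta>)"
  then obtain a b c d where "x = a / b" "y = c / d" "b \<noteq> 0" "d \<noteq> 0"
    "a \<in> quad_order \<Delta>" "b \<in> quad_order \<Delta>" "c \<in> quad_order \<Delta>" "d \<in> quad_order \<Delta>"
    by (auto simp: frac_field_def)
  then have "x * y = (a * c) / (b * d) \<and> a * c \<in> quad_order \<Delta> \<and> b * d \<in> quad_order \<Delta> \<and> b * d \<noteq> 0"
    using order_mult by auto
  then show ?thesis unfolding frac_field_def by blast
qed

lemma frac_field_inverse: "x \<in> frac_field (quad_order \<Delta>) \<Longrightarrow> x \<noteq> 0 \<Longrightarrow> inverse x \<in> frac_field (quad_order \<Delta>)"
proof -
  assume x: "x \<in> frac_field (quad_order \<Delta>)" "x \<noteq> 0"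
  then obtain a b where "x = a / b" "b \<noteq> 0" "a \<in> quad_order \<Delta>" "b \<in> quad_order \<Delta>"
    by (auto simp: frac_field_def)
  then have "inverse x = b / a \<and> a \<noteq> 0 \<and> a \<in> quad_order \<Delta> \<and> b \<in> quad_order \<Delta>" using x by auto
  then show ?thesis unfolding frac_field_def by blast
qed

lemma homothety_in_frac_field:
  assumes I: "frac_ideal (quad_order \<Delta>) I" and J: "frac_ideal (quad_order \<Delta>) J" and c: "c \<noteq> 0" "J = (*) c ` I"
  shows "c \<in> frac_field (quad_order \<Delta>)"
proof -
  obtain x where x: "x \<in> I" "x \<noteq> 0" using I unfolding frac_ideal_def by blast
  have cx: "c * x \<in> J" using c x by auto
  obtain d where d: "d \<in> quad_order \<Delta>" "d \<noteq> 0" "d * x \<in> quad_order \<Delta>"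
    using I x unfolding frac_ideal_def by blast
  obtain e where e: "e \<in> quad_order \<Delta>" "e \<noteq> 0" "e * (c * x) \<in> quad_order \<Delta>" 
    using J cx unfolding frac_ideal_def by blast
  have "c = (d * (e * (c * x))) / (e * (d * x))" using d(2) e(2) x(2) by (simp add: field_simps)
  moreover have "d * (e * (c * x)) \<in> quad_order \<Delta>" "e * (d * x) \<in> quad_order \<Delta>" "e * (d * x) \<noteq> 0"
    using order_mult d e x by auto
  ultimately show ?thesis unfolding frac_field_def by blast
qed

lemma ideal_class_rel_Image_eq:
  assumes "(I, J) \<in> ideal_class_rel (quad_order \<Delta>)"
  shows "ideal_class_rel (quad_order \<Delta>) `` {I} = ideal_class_rel (quad_order \<Delta>) `` {J}"
proof -
  obtain c where c: "c \<in> frac_field (quad_order \<Delta>)" "c \<noteq> 0" "J = (*) c ` I"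
    and IJ: "I \<in> invertible_ideals (quad_order \<Delta>)" "J \<in> invertible_ideals (quad_order \<Delta>)"
    using assms unfolding ideal_class_rel_def by blast
  have IJ': "I = (*) (inverse c) ` J" using c by (auto simp: image_image mult.assoc[symmetric])
  have comp: "(X, Z) \<in> ideal_class_rel (quad_order \<Delta>)"
    if XY: "(X, Y) \<in> ideal_class_rel (quad_order \<Delta>)" and YZ: "(Y, Z) \<in> ideal_class_rel (quad_order \<Delta>)" for X Y Z
  proof -
    obtain a where a: "a \<in> frac_field (quad_order \<Delta>)" "a \<noteq> 0" "Y = (*) a ` X" "X \<in> invertible_ideals (quad_order \<Delta>)"
      using XY unfolding ideal_class_rel_def by blast
    obtain b where b: "b \<in> frac_field (quad_order \<Delta>)" "b \<noteq> 0" "Z = (*) b ` Y" "Z \<in> invertible_ideals (quad_order \<Delta>)"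
      using YZ unfolding ideal_class_rel_def by blast
    note ab = a b and inv = a(4) b(4)
    have "Z = (*) (b * a) ` X" using ab by (simp add: image_image mult.assoc)
    moreover have "b * a \<in> frac_field (quad_order \<Delta>)" "b * a \<noteq> 0" using frac_field_mult ab by auto
    ultimately show ?thesis using inv unfolding ideal_class_rel_def by blast
  qed
  have JI: "(J, I) \<in> ideal_class_rel (quad_order \<Delta>)"
    unfolding ideal_class_rel_def using IJ IJ' c frac_field_inverse[OF c(1,2)] nonzero_imp_inverse_nonzero by blast
  show ?thesis
  proof (intro set_eqI iffI)
    fix X assume "X \<in> ideal_class_rel (quad_order \<Delta>) `` {I}"
    then show "X \<in> ideal_class_rel (quad_order \<Delta>) `` {J}" using comp[OF JI, of X] by simp
  next
    fix X assume "X \<in> ideal_class_rel (quad_order \<Delta>) `` {J}"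
    then show "X \<in> ideal_class_rel (quad_order \<Delta>) `` {I}" using comp[OF assms, of X] by simp
  qed
qed

text \<open>The one place where the class number is used: inequivalent invertible ideals become
  pairwise non-homothetic lattices, because a homothety between fractional ideals automatically has
  its factor in the fraction field.\<close>

lemma four_reduced_points:
  assumes h: "disc_class_number \<Delta> > 3"
  obtains \<tau> :: "nat \<Rightarrow> complex" where
    "\<And>i. i < 4 \<Longrightarrow> Im (\<tau> i) > 0 \<and> \<bar>Re (\<tau> i)\<bar> \<le> 1 / 2 \<and> norm (\<tau> i) \<ge> 1 \<and> multiplier_ring (zspan 1 (\<tau> i)) = quad_order \<Delta>"
    "\<And>i j c. i < 4 \<Longrightarrow> j < 4 \<Longrightarrow> c \<noteq> 0 \<Longrightarrow> zspan 1 (\<tau> i) = (*) c ` zspan 1 (\<tau> j) \<Longrightarrow> i = j"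
proof -
  let ?R = "quad_order \<Delta>"
  let ?r = "ideal_class_rel ?R"
  let ?Q = "invertible_ideals ?R // ?r"
  have "card ?Q \<ge> 4" using h by (simp add: disc_class_number_def class_number_def)
  then obtain S where S: "S \<subseteq> ?Q" "card S = 4" "finite S" using obtain_subset_with_card_n by metis
  obtain g :: "nat \<Rightarrow> _" where g: "bij_betw g {0..<4} S" using ex_bij_betw_nat_finite[OF S(3)] S(2) by auto
  have "\<exists>I. I \<in> invertible_ideals ?R \<and> g i = ?r `` {I}" if "i < 4" for i
  proof -
    have "g i \<in> ?Q" using g S(1) that by (auto simp: bij_betw_def)
    then show ?thesis by (auto simp: quotient_def)
  qed
  then obtain I where I: "\<And>i. i < 4 \<Longrightarrow> I i \<in> invertible_ideals ?R \<and> g i = ?r `` {I i}" by metis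
  have "\<exists>c \<tau>. c \<noteq> 0 \<and> I i = (*) c ` zspan 1 \<tau> \<and> Im \<tau> > 0 \<and> \<bar>Re \<tau>\<bar> \<le> 1 / 2 \<and> norm \<tau> \<ge> 1 \<and>
    multiplier_ring (zspan 1 \<tau>) = ?R" if "i < 4" for i
    using ideal_reduced_basis[of "I i"] I[OF that] by metis
  then obtain k \<tau> where k: "\<And>i. i < 4 \<Longrightarrow> k i \<noteq> 0 \<and> I i = (*) (k i) ` zspan 1 (\<tau> i) \<and> Im (\<tau> i) > 0 \<and> \<bar>Re (\<tau> i)\<bar> \<le> 1 / 2 \<and> norm (\<tau> i) \<ge> 1 \<and>
    multiplier_ring (zspan 1 (\<tau> i)) = ?R" by metis
  show thesis
  proof (rule that)
    show "i = j" if ij: "i < 4" "j < 4" and c: "c \<noteq> 0" "zspan 1 (\<tau> i) = (*) c ` zspan 1 (\<tau> j)" for i j c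
    proof -
      define d where "d = k i * c / k j"
      have d0: "d \<noteq> 0" using k ij c by (simp add: d_def)
      have "I i = (*) (k i) ` (*) c ` zspan 1 (\<tau> j)" using k[OF ij(1)] c(2) by simp
      also have "\<dots> = (*) d ` (*) (k j) ` zspan 1 (\<tau> j)" using k[OF ij(2)] by (simp add: image_image d_def mult_ac)
      also have "\<dots> = (*) d ` I j" using k[OF ij(2)] by simp
      finally have dI: "I i = (*) d ` I j" .
      have inv: "I i \<in> invertible_ideals ?R" "I j \<in> invertible_ideals ?R" using I ij by auto
      then have "d \<in> frac_field ?R" using homothety_in_frac_field[OF _ _ d0 dI] by (auto simp: invertible_ideals_def)
      then have "(I j, I i) \<in> ?r" using inv d0 dI by (auto simp: ideal_class_rel_def)
      then have "g i = g j" using ideal_class_rel_Image_eq I ij by metis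
      then show "i = j" using g ij by (auto simp: bij_betw_def inj_on_def)
    qed
  qed (use k in blast)
qed

end

section \<open>The q-expansion of j\<close>

definition rowsum :: "nat \<Rightarrow> complex \<Rightarrow> complex" where
  "rowsum k z = (\<Sum>\<^sub>\<infinity>n::int. 1 / (z + of_int n) ^ k)"

text \<open>The integers lie in the lattice of Gaussian integers, so this is a case of the
  two-dimensional convergence already proved.\<close>

lemma row_summable:
  fixes z :: complex
  assumes z: "z \<notin> \<int>" and k: "k \<ge> 3"
  shows "(\<lambda>n::int. 1 / (z + of_int n) ^ k) summable_on UNIV"
proof -
  interpret cx_lattice 1 \<i> by unfold_locales simp
  have sub: "\<int> \<subseteq> L"
  proof
    fix x :: complex assume "x \<in> \<int>"
    then obtain a where "x = of_int a" by (auto elim: Ints_cases)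
    then show "x \<in> L" using L_mult[OF L_w1, of a] by simp
  qed
  have "(\<lambda>w. 1 / (z - w) ^ k) summable_on \<int>"
    using T_summable[OF sub z k] by (rule abs_summable_summable)
  moreover have "bij_betw (\<lambda>n::int. - of_int n :: complex) UNIV \<int>"
  proof (rule bij_betwI')
    fix y :: complex assume "y \<in> \<int>"
    then obtain a where "y = of_int a" by (auto elim: Ints_cases)
    then have "y = - of_int (- a)" by simp
    then show "\<exists>x\<in>UNIV. y = - of_int x" by blast
  qed auto
  ultimately have "(\<lambda>n::int. 1 / (z - (- of_int n)) ^ k) summable_on UNIV"
    by (subst summable_on_reindex_bij_betw)
  then show ?thesis by simp
qed

lemma not_Ints_not_nonpos: "z \<notin> \<int> \<Longrightarrow> z \<notin> \<int>\<^sub>\<le>\<^sub>0" "z \<notin> \<int> \<Longrightarrow> 1 - z \<notin> \<int>\<^sub>\<le>\<^sub>0" "z \<notin> \<int> \<Longrightarrow> 1 - z \<notin> \<int>"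
proof -
  assume z: "z \<notin> \<int>"
  then show n: "1 - z \<notin> \<int>" using Ints_diff[OF Ints_1, of "1 - z"] by auto
  show "z \<notin> \<int>\<^sub>\<le>\<^sub>0" using z nonpos_Ints_Int by blast
  show "1 - z \<notin> \<int>\<^sub>\<le>\<^sub>0" using n nonpos_Ints_Int by blast
qed

lemma polygamma_has_sum:
  fixes z :: complex
  assumes z: "z \<notin> \<int>" and n: "odd n" "n \<ge> 3"
  shows "((\<lambda>k. 1 / (z + of_int (int k)) ^ Suc n) has_sum Polygamma n z / fact n) UNIV"
proof -
  have "(\<lambda>m::int. 1 / (z + of_int m) ^ Suc n) summable_on range int"
    by (rule summable_on_subset_banach[OF row_summable[OF z]]) (use n in auto)
  then have "((\<lambda>m::int. 1 / (z + of_int m) ^ Suc n) \<circ> int) summable_on UNIV"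
    by (subst (asm) summable_on_reindex) auto
  then have s: "(\<lambda>k. 1 / (z + of_int (int k)) ^ Suc n) summable_on UNIV" by (simp add: o_def)
  then obtain S where S: "((\<lambda>k. 1 / (z + of_int (int k)) ^ Suc n) has_sum S) UNIV" by (auto simp: summable_on_def)
  have "z \<noteq> 0" using z by auto
  then have "(\<lambda>k. inverse ((z + of_nat k) ^ Suc n)) sums ((-1) ^ Suc n * Polygamma n z / fact n)"
    using n by (intro Polygamma_LIMSEQ) auto
  moreover have "(\<lambda>k. inverse ((z + of_nat k) ^ Suc n)) sums S"
    using has_sum_imp_sums[OF S] by (simp add: inverse_eq_divide)
  ultimately have "S = Polygamma n z / fact n" using n by (simp add: sums_unique2)
  then show ?thesis using S by simp
qed

text \<open>The terms with m >= 0 and m < 0 are polygamma series at z and 1 - z, the even exponent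
  absorbing the sign. The reflection formula then evaluates their sum, in the role of the partial
  fractions of the cotangent.\<close>

lemma rowsum_polygamma:
  assumes z: "z \<notin> \<int>" and n: "odd n" "n \<ge> 3"
  shows "rowsum (Suc n) z = (Polygamma n z + Polygamma n (1 - z)) / fact n"
proof -
  let ?f = "\<lambda>m::int. 1 / (z + of_int m) ^ Suc n"
  have 1: "(?f has_sum Polygamma n z / fact n) (range int)"
    using polygamma_has_sum[OF assms] by (subst has_sum_reindex) (auto simp: o_def)
  have e: "?f (- 1 - int k) = 1 / (1 - z + of_int (int k)) ^ Suc n" for k
  proof -
    have "z + of_int (- 1 - int k) = - (1 - z + of_int (int k))" by simp
    then show ?thesis using n by (simp only: power_minus_even even_Suc simp_thms)
  qed
  have 2: "(?f has_sum Polygamma n (1 - z) / fact n) (range (\<lambda>k. - 1 - int k))"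
    using polygamma_has_sum[OF not_Ints_not_nonpos(3)[OF z] n] e
    by (subst has_sum_reindex) (auto simp: o_def inj_on_def)
  have u: "range int \<union> range (\<lambda>k. - 1 - int k) = UNIV"
  proof -
    have "m \<in> range int \<union> range (\<lambda>k. - 1 - int k)" for m
    proof (cases "m \<ge> 0")
      case True then show ?thesis by (metis UnI1 nonneg_int_cases rangeI)
    next
      case False
      then have "m = - 1 - int (nat (- 1 - m))" by simp
      then show ?thesis by blast
    qed
    then show ?thesis by blast
  qed
  have "(?f has_sum Polygamma n z / fact n + Polygamma n (1 - z) / fact n) UNIV"
    unfolding u[symmetric] by (rule has_sum_Un_disjoint[OF 1 2]) auto
  then show ?thesis unfolding rowsum_def by (simp add: infsumI add_divide_distrib)
qed

abbreviation tpi :: complex where "tpi \<equiv> 2 * of_real pi * \<i>"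

fun cotpoly :: "nat \<Rightarrow> complex poly" where
  "cotpoly 0 = [:- 1 / 2, 1:]"
| "cotpoly (Suc n) = pderiv (cotpoly n) * [:0, - 1, 1:]"

lemma exp_tpi_eq_1: "exp (tpi * z) = 1 \<longleftrightarrow> z \<in> \<int>"
proof -
  have "Re (tpi * z) = - (2 * pi * Im z)" "Im (tpi * z) = 2 * pi * Re z" by simp_all
  then have "exp (tpi * z) = 1 \<longleftrightarrow> (\<exists>n::int. z = of_int n)"
    unfolding exp_eq_1 by (auto simp: complex_eq_iff)
  then show ?thesis by (auto simp: Ints_def)
qed

text \<open>In terms of \<open>v = 1 / (1 - exp (2 \<pi> \<i> z))\<close> the cotangent is linear and \<open>d/dz\<close> is \<open>2 \<pi> \<i> (v\<^sup>2 - v) d/dv\<close>.\<close>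

lemma cotpoly_deriv:
  assumes "z \<notin> \<int>"
  shows "((\<lambda>z. tpi ^ Suc n * poly (cotpoly n) (1 / (1 - exp (tpi * z)))) has_field_derivative
    tpi ^ Suc (Suc n) * poly (cotpoly (Suc n)) (1 / (1 - exp (tpi * z)))) (at z)"
proof -
  define w where "w = exp (tpi * z)"
  have w: "1 - w \<noteq> 0" using assms exp_tpi_eq_1 by (auto simp: w_def)
  have "((\<lambda>z. 1 / (1 - exp (tpi * z))) has_field_derivative (tpi * w) / (1 - w) ^ 2) (at z)"
    using w unfolding w_def by (auto intro!: derivative_eq_intros simp: power2_eq_square)
  also have "(tpi * w) / (1 - w) ^ 2 = tpi * ((1 / (1 - w))\<^sup>2 - 1 / (1 - w))"
    using w by (simp add: divide_simps power2_eq_square)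
  finally have "((\<lambda>z. tpi ^ Suc n * poly (cotpoly n) (1 / (1 - exp (tpi * z)))) has_field_derivative
     tpi ^ Suc n * (poly (pderiv (cotpoly n)) (1 / (1 - exp (tpi * z))) * (tpi * ((1 / (1 - w))\<^sup>2 - 1 / (1 - w))))) (at z)"
    by (intro DERIV_cmult DERIV_chain2[OF poly_DERIV])
  then show ?thesis by (simp add: w_def power2_eq_square algebra_simps)
qed

text \<open>Logarithmic derivative of Gamma(z) Gamma(1 - z) = pi / sin(pi z); the right side is - pi
  cot(pi z).\<close>

lemma polygamma_reflection_0:
  assumes z: "z \<notin> \<int>"
  shows "Polygamma 0 z - Polygamma 0 (1 - z) = tpi * poly (cotpoly 0) (1 / (1 - exp (tpi * z)))"
proof -
  note nz = not_Ints_not_nonpos[OF z]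
  define u where "u = exp (\<i> * (of_real pi * z))"
  have u0: "u \<noteq> 0" by (simp add: u_def)
  have u2: "exp (tpi * z) = u\<^sup>2" unfolding u_def by (simp add: power2_eq_square flip: exp_add) (simp add: algebra_simps)
  have u1: "u\<^sup>2 \<noteq> 1" using exp_tpi_eq_1[of z] z u2 by simp
  have ui: "exp (- (\<i> * (of_real pi * z))) = 1 / u" by (simp add: u_def exp_minus inverse_eq_divide)
  have sn: "sin (of_real pi * z) = (u - 1 / u) / (2 * \<i>)" unfolding sin_exp_eq ui u_def[symmetric] ..
  have cs: "cos (of_real pi * z) = (u + 1 / u) / 2" unfolding cos_exp_eq ui u_def[symmetric] ..
  have sn0: "sin (of_real pi * z) \<noteq> 0" unfolding sn using u0 u1 by (simp add: field_simps power2_eq_square)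
  have "((\<lambda>z::complex. Gamma z * Gamma (1 - z)) has_field_derivative
      Gamma z * Gamma (1 - z) * (Polygamma 0 z - Polygamma 0 (1 - z))) (at z)"
    using nz by (auto intro!: derivative_eq_intros simp: algebra_simps)
  moreover have "((\<lambda>z::complex. of_real pi / sin (of_real pi * z)) has_field_derivative
      - (of_real pi * (cos (of_real pi * z) * of_real pi) / (sin (of_real pi * z))\<^sup>2)) (at z)"
    using sn0 by (auto intro!: derivative_eq_intros simp: power2_eq_square)
  moreover have "(\<lambda>z::complex. Gamma z * Gamma (1 - z)) = (\<lambda>z. of_real pi / sin (of_real pi * z))"
    by (intro ext Gamma_reflection_complex)
  ultimately have "Gamma z * Gamma (1 - z) * (Polygamma 0 z - Polygamma 0 (1 - z)) =
      - (of_real pi * (cos (of_real pi * z) * of_real pi) / (sin (of_real pi * z))\<^sup>2)"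
    using DERIV_unique by fastforce
  then have eq: "of_real pi / sin (of_real pi * z) * (Polygamma 0 z - Polygamma 0 (1 - z)) =
      - (of_real pi * (cos (of_real pi * z) * of_real pi) / (sin (of_real pi * z))\<^sup>2)"
    unfolding Gamma_reflection_complex .
  have aux: "D = - p * c / s" if "p / s * D = - (p * (c * p) / s\<^sup>2)" "s \<noteq> 0" "p \<noteq> 0" for D p c s :: complex
  proof -
    have "p / s * D = p / s * (- p * c / s)" using that by (simp add: power2_eq_square)
    then show ?thesis using that(2,3) by (simp only: mult_cancel_left) simp
  qed
  have "Polygamma 0 z - Polygamma 0 (1 - z) = - of_real pi * cos (of_real pi * z) / sin (of_real pi * z)"
    by (rule aux[OF eq sn0]) simp
  also have "\<dots> = tpi * poly (cotpoly 0) (1 / (1 - exp (tpi * z)))"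
  proof -
    have a: "1 - u\<^sup>2 \<noteq> 0" using u1 by simp
    have "(u - 1 / u) / (2 * \<i>) = - (1 - u\<^sup>2) / (2 * \<i> * u)" "(u + 1 / u) / 2 = (1 + u\<^sup>2) / (2 * u)"
      using u0 by (simp_all add: field_simps power2_eq_square)
    then have "- of_real pi * cos (of_real pi * z) / sin (of_real pi * z) = of_real pi * \<i> * (1 + u\<^sup>2) / (1 - u\<^sup>2)"
      unfolding sn cs using u0 a by (simp add: field_simps)
    also have "\<dots> = tpi * (- 1 / 2 + 1 / (1 - u\<^sup>2))" using a by (simp add: field_simps)
    finally show ?thesis unfolding u2 by simp
  qed
  finally show ?thesis .
qed

lemma polygamma_reflection:
  "z \<notin> \<int> \<Longrightarrow> Polygamma n z - (-1) ^ n * Polygamma n (1 - z) = tpi ^ Suc n * poly (cotpoly n) (1 / (1 - exp (tpi * z)))"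
proof (induction n arbitrary: z)
  case 0 then show ?case using polygamma_reflection_0 by simp
next
  case (Suc n)
  note nz = not_Ints_not_nonpos[OF Suc.prems]
  have "((\<lambda>z. Polygamma n z - (-1) ^ n * Polygamma n (1 - z)) has_field_derivative
      Polygamma (Suc n) z - (-1) ^ n * (Polygamma (Suc n) (1 - z) * - 1)) (at z)"
    by (intro DERIV_diff DERIV_cmult DERIV_chain2[OF has_field_derivative_Polygamma] has_field_derivative_Polygamma nz)
      (auto intro!: derivative_eq_intros)
  moreover have "((\<lambda>z. Polygamma n z - (-1) ^ n * Polygamma n (1 - z)) has_field_derivative
      tpi ^ Suc (Suc n) * poly (cotpoly (Suc n)) (1 / (1 - exp (tpi * z)))) (at z)"
    by (rule has_field_derivative_transform_within_open[OF cotpoly_deriv[OF Suc.prems], of "- \<int>"])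
      (use Suc in auto)
  ultimately have "Polygamma (Suc n) z - (-1) ^ n * (Polygamma (Suc n) (1 - z) * - 1) =
      tpi ^ Suc (Suc n) * poly (cotpoly (Suc n)) (1 / (1 - exp (tpi * z)))" by (rule DERIV_unique)
  then show ?case by simp
qed

text \<open>\<open>lam4\<close> and \<open>lam6\<close> are the Eulerian closed forms of the series
  over n of n^3 w^n and n^5 w^n. As rational functions they can also be evaluated at w = -1, which
  supplies the zeta values.\<close>

definition lam4 :: "complex \<Rightarrow> complex" where "lam4 w = w * (1 + 4 * w + w\<^sup>2) / (1 - w) ^ 4"
definition lam6 :: "complex \<Rightarrow> complex" where
  "lam6 w = w * (1 + 26 * w + 66 * w\<^sup>2 + 26 * w ^ 3 + w ^ 4) / (1 - w) ^ 6"

lemma cotpoly_3: "cotpoly 3 = [:0, - 1, 7, - 12, 6:]"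
  by (simp add: numeral_3_eq_3 pderiv_pCons)

lemma cotpoly_5: "cotpoly 5 = [:0, - 1, 31, - 180, 390, - 360, 120:]"
  by (simp add: eval_nat_numeral pderiv_pCons)

lemma rowsum_lam:
  assumes z: "z \<notin> \<int>"
  shows "rowsum 4 z = tpi ^ 4 / 6 * lam4 (exp (tpi * z))" "rowsum 6 z = tpi ^ 6 / 120 * lam6 (exp (tpi * z))"
proof -
  define w where "w = exp (tpi * z)"
  define v where "v = 1 / (1 - w)"
  have w: "1 - w \<noteq> 0" using z exp_tpi_eq_1 by (auto simp: w_def)
  have wv: "w * v = v - 1" "(1 - w) * v = 1" using w by (simp_all add: v_def field_simps)
  have pw: "1 / (1 - w) ^ k = v ^ k" for k by (simp add: v_def power_one_over)
  have l4: "lam4 w = w * (1 + 4 * w + w\<^sup>2) * v ^ 4" unfolding lam4_def pw[symmetric] by simp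
  have l6: "lam6 w = w * (1 + 26 * w + 66 * w\<^sup>2 + 26 * w ^ 3 + w ^ 4) * v ^ 6" unfolding lam6_def pw[symmetric] by simp
  have "rowsum 4 z = tpi ^ 4 * poly (cotpoly 3) v / 6"
    using rowsum_polygamma[OF z, of 3] polygamma_reflection[OF z, of 3]
    by (simp add: v_def w_def fact_numeral del: cotpoly.simps power_Suc)
  also have "poly (cotpoly 3) v = lam4 w" unfolding cotpoly_3 l4 using wv by simp algebra
  finally show "rowsum 4 z = tpi ^ 4 / 6 * lam4 (exp (tpi * z))" by (simp add: w_def)
  have "rowsum 6 z = tpi ^ 6 * poly (cotpoly 5) v / 120"
    using rowsum_polygamma[OF z, of 5] polygamma_reflection[OF z, of 5]
    by (simp add: v_def w_def fact_numeral del: cotpoly.simps power_Suc)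
  also have "poly (cotpoly 5) v = lam6 w" unfolding cotpoly_5 l6 using wv by simp algebra
  finally show "rowsum 6 z = tpi ^ 6 / 120 * lam6 (exp (tpi * z))" by (simp add: w_def)
qed

lemma int_sum_even:
  fixes f :: "int \<Rightarrow> complex"
  assumes S: "(f has_sum S) {0<..}" and e: "\<And>m. f (- m) = f m"
  shows "(f has_sum 2 * S) (UNIV - {0})"
proof -
  have "(f has_sum S) {..<0}"
    using S by (rule has_sum_reindex_bij_witness[where i = uminus and j = uminus, THEN iffD1, rotated -1]) (auto simp: e)
  then have "(f has_sum (S + S)) ({0<..} \<union> {..<0})" using S by (intro has_sum_Un_disjoint) auto
  moreover have "{0<..} \<union> {..<0} = UNIV - {0::int}" by auto
  ultimately show ?thesis by simp
qed

definition zetasum :: "nat \<Rightarrow> complex" where "zetasum k = (\<Sum>\<^sub>\<infinity>n\<in>UNIV - {0::int}. 1 / of_int n ^ k)"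

text \<open>The row with \<tau>-coefficient 0 gives the zeta part; the rows m and -m agree because
  the weight is even.\<close>

lemma eisenstein_rows:
  assumes tau: "Im \<tau> > 0" and k: "even k" "k \<ge> 3"
  obtains S where "eisenstein_sum k (zspan 1 \<tau>) = zetasum k + 2 * S" "(\<lambda>j. rowsum k (of_nat (Suc j) * \<tau>)) sums S"
    "(\<lambda>n::int. 1 / (of_int n :: complex) ^ k) summable_on UNIV - {0}"
proof -
  interpret cx_lattice 1 \<tau> using tau by (intro cx_lattice_tau) simp
  define h where "h = (\<lambda>(m::int, n::int). of_int n + of_int m * \<tau>)"
  define f where "f = (\<lambda>p. 1 / h p ^ k)"
  have hinj: "inj h"
  proof (rule injI)
    fix p p' assume "h p = h p'"
    moreover obtain m n m' n' where p: "p = (m, n)" "p' = (m', n')" by (cases p, cases p')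
    ultimately have "of_real (of_int n) * 1 + of_real (of_int m) * \<tau> = of_real (of_int n') * 1 + of_real (of_int m') * \<tau>"
      by (simp add: h_def)
    from coords_unique[OF this] show "p = p'" using p by simp
  qed
  have h0: "h p = 0 \<longleftrightarrow> p = (0, 0)" for p using inj_eq[OF hinj, of p "(0, 0)"] by (simp add: h_def)
  have hL: "range h = L"
  proof (intro set_eqI iffI)
    fix x assume "x \<in> range h"
    then show "x \<in> L" unfolding zspan_one_iff h_def by (auto split: prod.splits)
  next
    fix x assume "x \<in> L"
    then obtain a b where "x = h (b, a)" unfolding zspan_one_iff h_def by auto
    then show "x \<in> range h" by simp
  qed
  have bij: "bij_betw h (UNIV - {(0, 0)}) L0"
    unfolding bij_betw_def
  proof
    show "inj_on h (UNIV - {(0, 0)})" by (rule inj_on_subset[OF hinj]) simp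
    have "h ` (UNIV - {(0, 0)}) = range h - h ` {(0, 0)}" by (rule image_set_diff[OF hinj])
    then show "h ` (UNIV - {(0, 0)}) = L0" using hL h0[of "(0, 0)"] by simp
  qed
  have "0 \<notin> L0" by simp
  from T_summable[OF L0_sub this k(2)] have "(\<lambda>w. 1 / (0 - w) ^ k) summable_on L0" by (rule abs_summable_summable)
  then have "(\<lambda>w. 1 / w ^ k) summable_on L0" using k by (simp add: power_minus_even)
  then have "((\<lambda>w. 1 / w ^ k) has_sum G k) L0" unfolding eisenstein_sum_def by (rule has_sum_infsum)
  then have tot: "(f has_sum G k) (UNIV - {(0, 0)})"
    unfolding f_def by (subst has_sum_reindex_bij_betw[OF bij])
  then have summ: "f summable_on X" if "X \<subseteq> UNIV - {(0, 0)}" for X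
    using that summable_on_subset_banach[of f "UNIV - {(0, 0)}" X] by (auto simp: summable_on_def)
  let ?S1 = "{0} \<times> (UNIV - {0::int})" and ?S2 = "(UNIV - {0::int}) \<times> (UNIV :: int set)"
  have S1: "?S1 = Pair 0 ` (UNIV - {0})" by auto
  have "f summable_on ?S1" by (rule summ) auto
  then have "(f \<circ> Pair 0) summable_on (UNIV - {0})"
    unfolding S1 by (subst (asm) summable_on_reindex) (auto simp: inj_on_def)
  moreover have fP: "f \<circ> Pair 0 = (\<lambda>n. 1 / of_int n ^ k)" by (auto simp: f_def h_def)
  ultimately have z: "(\<lambda>n::int. 1 / (of_int n :: complex) ^ k) summable_on UNIV - {0}" by simp
  then have "((f \<circ> Pair 0) has_sum zetasum k) (UNIV - {0})" unfolding zetasum_def fP by (rule has_sum_infsum)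
  then have 1: "(f has_sum zetasum k) ?S1"
    unfolding S1 by (subst has_sum_reindex) (auto simp: inj_on_def)
  define r where "r m = rowsum k (of_int m * \<tau>)" for m :: int
  have nI: "of_int m * \<tau> \<notin> \<int>" if "m \<noteq> 0" for m
  proof
    assume "of_int m * \<tau> \<in> \<int>"
    then obtain a where "of_int m * \<tau> = of_int a" by (rule Ints_cases)
    from arg_cong[OF this, of Im] show False using tau that by simp
  qed
  have row: "((\<lambda>n. f (m, n)) has_sum r m) UNIV" if "m \<noteq> 0" for m
  proof -
    have "(\<lambda>n. f (m, n)) = (\<lambda>n. 1 / (of_int m * \<tau> + of_int n) ^ k)" by (auto simp: f_def h_def add.commute)
    then show ?thesis unfolding r_def rowsum_def using row_summable[OF nI[OF that] k(2)] by simp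
  qed
  obtain S2 where S2: "(f has_sum S2) ?S2" using summ[of ?S2] by (auto simp: summable_on_def)
  have r2: "(r has_sum S2) (UNIV - {0})" by (rule has_sum_SigmaD[OF S2]) (use row in auto)
  have r_even: "r (- m) = r m" for m
    unfolding r_def rowsum_def
  proof (rule infsum_reindex_bij_witness[where i = uminus and j = uminus])
    fix n :: int
    have "of_int m * \<tau> + of_int (- n) = - (of_int (- m) * \<tau> + of_int n)" by simp
    then show "1 / (of_int m * \<tau> + of_int (- n)) ^ k = 1 / (of_int (- m) * \<tau> + of_int n) ^ k"
      using k by (simp only: power_minus_even)
  qed auto
  have "r summable_on {0<..}" by (rule summable_on_subset_banach[of _ "UNIV - {0}"]) (use r2 in \<open>auto simp: summable_on_def\<close>)
  then obtain S where S: "(r has_sum S) {0<..}" by (auto simp: summable_on_def)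
  have "S2 = 2 * S" using r2 int_sum_even[OF S r_even] by (rule has_sum_unique)
  moreover have "(f has_sum (zetasum k + S2)) (?S1 \<union> ?S2)" using 1 S2 by (rule has_sum_Un_disjoint) auto
  moreover have "?S1 \<union> ?S2 = UNIV - {(0, 0)}" by auto
  ultimately have G: "G k = zetasum k + 2 * S" using tot by (simp add: has_sum_unique)
  have "((\<lambda>j. r (int (Suc j))) has_sum S) UNIV"
    using S by (rule has_sum_reindex_bij_witness[where i = "\<lambda>j. int (Suc j)" and j = "\<lambda>m. nat (m - 1)", THEN iffD1, rotated -1]) auto
  then have "(\<lambda>j. rowsum k (of_nat (Suc j) * \<tau>)) sums S" using has_sum_imp_sums by (fastforce simp: r_def)
  with G z show thesis using that by blast
qed

text \<open>Up to 2^k, the row at 1/2 is the sum over odd n, and the even n reproduce the whole sum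
  divided by 2^k. So the zeta values come from the same closed form at w = exp(pi i) = -1.\<close>

lemma zetasum_half:
  assumes k: "k \<ge> 3" and z: "(\<lambda>n::int. 1 / (of_int n :: complex) ^ k) summable_on UNIV - {0}"
  shows "(2 ^ k - 1) * zetasum k = rowsum k (1 / 2)"
proof -
  let ?f = "\<lambda>n::int. 1 / (of_int n :: complex) ^ k"
  have Z: "(?f has_sum zetasum k) (UNIV - {0})" unfolding zetasum_def using z by (rule has_sum_infsum)
  have E: "(?f has_sum (1 / 2 ^ k * zetasum k)) ((*) 2 ` (UNIV - {0}))"
  proof (subst has_sum_reindex)
    show "((?f \<circ> (*) 2) has_sum (1 / 2 ^ k * zetasum k)) (UNIV - {0})"
      using has_sum_cmult_right[OF Z, of "1 / 2 ^ k"] by (simp add: o_def power_mult_distrib)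
  qed (auto simp: inj_on_def)
  have half: "(1 / 2 :: complex) \<notin> \<int>"
  proof
    assume "(1 / 2 :: complex) \<in> \<int>"
    then obtain a where "1 / 2 = (of_int a :: complex)" by (auto elim: Ints_cases)
    then have "(of_int (2 * a) :: complex) = of_int 1" by (simp add: mult.commute)
    then have "2 * a = 1" by (simp only: of_int_eq_iff)
    then show False by presburger
  qed
  have "((\<lambda>n::int. 1 / (1 / 2 + of_int n) ^ k) has_sum rowsum k (1 / 2)) UNIV"
    unfolding rowsum_def by (intro has_sum_infsum row_summable half k)
  from has_sum_cmult_right[OF this, of "1 / 2 ^ k"]
  have "((?f \<circ> (\<lambda>n. 2 * n + 1)) has_sum (1 / 2 ^ k * rowsum k (1 / 2))) UNIV"
    by (simp add: o_def algebra_simps flip: power_mult_distrib)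
  then have O: "(?f has_sum (1 / 2 ^ k * rowsum k (1 / 2))) (range (\<lambda>n. 2 * n + 1))"
    by (subst has_sum_reindex) (auto simp: inj_on_def)
  have u: "(*) 2 ` (UNIV - {0::int}) \<union> range (\<lambda>n. 2 * n + 1) = UNIV - {0}"
  proof (intro set_eqI iffI)
    fix x :: int assume "x \<in> UNIV - {0}"
    then show "x \<in> (*) 2 ` (UNIV - {0}) \<union> range (\<lambda>n. 2 * n + 1)"
      by (cases "even x") (auto elim!: evenE oddE)
  next
    fix x :: int assume "x \<in> (*) 2 ` (UNIV - {0}) \<union> range (\<lambda>n. 2 * n + 1)"
    then show "x \<in> UNIV - {0}" by (auto simp: image_iff) presburger
  qed
  have disj: "(*) 2 ` (UNIV - {0::int}) \<inter> range (\<lambda>n. 2 * n + 1) = {}"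
  proof (rule equals0I)
    fix x assume x: "x \<in> (*) 2 ` (UNIV - {0::int}) \<inter> range (\<lambda>n. 2 * n + 1)"
    from IntD1[OF x] have "even x" by (rule imageE) simp
    moreover from IntD2[OF x] have "odd x" by (rule imageE) simp
    ultimately show False by blast
  qed
  from has_sum_Un_disjoint[OF E O disj]
  have "(?f has_sum (1 / 2 ^ k * zetasum k + 1 / 2 ^ k * rowsum k (1 / 2))) (UNIV - {0})"
    by (simp only: u)
  then have "zetasum k = 1 / 2 ^ k * zetasum k + 1 / 2 ^ k * rowsum k (1 / 2)" using Z by (simp add: has_sum_unique)
  then show ?thesis by (simp add: field_simps)
qed

section \<open>Explicit estimates for j\<close>

lemma norm_horner:
  fixes q x c :: complex
  assumes "norm q \<le> t" "norm x \<le> B"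
  shows "norm (c + q * x) \<le> norm c + t * B"
proof -
  have "norm (c + q * x) \<le> norm c + norm q * norm x" by (metis norm_mult norm_triangle_ineq)
  also have "norm q * norm x \<le> t * B" using assms by (meson mult_mono norm_ge_zero order_trans)
  finally show ?thesis by simp
qed

text \<open>230 is just below exp(pi sqrt 3) = 230.7..., the least value of 1 / |q| on the standard
  fundamental domain, attained at its corner.\<close>

lemma inverse_power_bound:
  fixes w :: complex
  assumes w: "norm w \<le> 1 / 230"
  shows "norm (1 / (1 - w) ^ k) \<le> (230 / 229) ^ k" "1 - w \<noteq> 0"
proof -
  have "1 - norm w \<le> norm (1 - w)" by (metis norm_one norm_triangle_ineq2)
  then have n: "229 / 230 \<le> norm (1 - w)" using w by linarith
  then show "1 - w \<noteq> 0" by auto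
  have "norm (1 / (1 - w)) \<le> 230 / 229" using n frac_le[of 1 1 "229 / 230" "norm (1 - w)"] by (simp add: norm_divide)
  then show "norm (1 / (1 - w) ^ k) \<le> (230 / 229) ^ k"
    using power_mono[of "norm (1 / (1 - w))" "230 / 229" k] by (simp add: norm_power norm_divide power_divide)
qed

lemma lambert_bound:
  fixes w P :: complex
  assumes w: "norm w \<le> 1 / 230" and e: "X * (1 - w) ^ k = w ^ l * P" and P: "norm P \<le> B" "B * (230 / 229) ^ k \<le> C"
  shows "norm X \<le> C * norm w ^ l"
proof -
  have "X = w ^ l * (P * (1 / (1 - w) ^ k))" using e inverse_power_bound(2)[OF w] by (simp add: field_simps)
  then have "norm X = norm w ^ l * (norm P * norm (1 / (1 - w) ^ k))" by (simp only: norm_mult norm_power)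
  also have "\<dots> \<le> norm w ^ l * (B * (230 / 229) ^ k)"
    using P(1) inverse_power_bound(1)[OF w] order_trans[OF norm_ge_zero P(1)] by (intro mult_left_mono mult_mono) auto
  also have "\<dots> \<le> norm w ^ l * C" using P(2) by (intro mult_left_mono) auto
  finally show ?thesis by (simp add: mult.commute)
qed

lemma lam4_mult: "1 - w \<noteq> 0 \<Longrightarrow> lam4 w * (1 - w) ^ 4 = w * (1 + 4 * w + w\<^sup>2)"
  by (simp add: lam4_def)
lemma lam6_mult: "1 - w \<noteq> 0 \<Longrightarrow> lam6 w * (1 - w) ^ 6 = w * (1 + 26 * w + 66 * w\<^sup>2 + 26 * w ^ 3 + w ^ 4)"
  by (simp add: lam6_def)

text \<open>The coefficients are cubes and fifth powers of 2 and 3. After clearing the denominator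
  the remainder is an explicit polynomial, bounded by Horner's scheme at 1/230; the constants are
  rounded up from these bounds.\<close>

lemma lam_bounds:
  assumes w: "norm w \<le> 1 / 230"
  shows "norm (lam4 w - w) \<le> 9 * norm w ^ 2" "norm (lam4 w - (w + 8 * w\<^sup>2 + 27 * w ^ 3)) \<le> 66 * norm w ^ 4"
    "norm (lam6 w - w) \<le> 34 * norm w ^ 2" "norm (lam6 w - (w + 32 * w\<^sup>2 + 243 * w ^ 3)) \<le> 1070 * norm w ^ 4"
proof -
  note nz = inverse_power_bound(2)[OF w]
  show "norm (lam4 w - w) \<le> 9 * norm w ^ 2"
  proof (rule lambert_bound[OF w])
    show "(lam4 w - w) * (1 - w) ^ 4 = w\<^sup>2 * (8 + w * (- 5 + w * (4 + w * (- 1))))"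
      unfolding left_diff_distrib lam4_mult[OF nz] by (simp add: algebra_simps eval_nat_numeral)
    show "norm (8 + w * (- 5 + w * (4 + w * (- 1)))) \<le> norm (8::complex) + 1/230 * (norm (-5::complex) + 1/230 * (norm (4::complex) + 1/230 * norm (- 1 :: complex)))"
      by (intro norm_horner[OF w] order_refl)
  qed (simp add: power_divide)
  show "norm (lam4 w - (w + 8 * w\<^sup>2 + 27 * w ^ 3)) \<le> 66 * norm w ^ 4"
  proof (rule lambert_bound[OF w])
    show "(lam4 w - (w + 8 * w\<^sup>2 + 27 * w ^ 3)) * (1 - w) ^ 4 = w ^ 4 * (64 + w * (- 131 + w * (100 + w * (- 27))))"
      unfolding left_diff_distrib lam4_mult[OF nz] by (simp add: algebra_simps eval_nat_numeral)
    show "norm (64 + w * (- 131 + w * (100 + w * (- 27)))) \<le> norm (64::complex) + 1/230 * (norm (-131::complex) + 1/230 * (norm (100::complex) + 1/230 * norm (- 27 :: complex)))"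
      by (intro norm_horner[OF w] order_refl)
  qed (simp add: power_divide)
  show "norm (lam6 w - w) \<le> 34 * norm w ^ 2"
  proof (rule lambert_bound[OF w])
    show "(lam6 w - w) * (1 - w) ^ 6 = w\<^sup>2 * (32 + w * (51 + w * (46 + w * (- 14 + w * (6 + w * (- 1))))))"
      unfolding left_diff_distrib lam6_mult[OF nz] by (simp add: algebra_simps eval_nat_numeral)
    show "norm (32 + w * (51 + w * (46 + w * (- 14 + w * (6 + w * (- 1)))))) \<le> norm (32::complex) + 1/230 * (norm (51::complex) + 1/230 * (norm (46::complex) + 1/230 * (norm (- 14 :: complex) + 1/230 * (norm (6::complex) + 1/230 * norm (- 1 :: complex)))))"
      by (intro norm_horner[OF w] order_refl)
  qed (simp add: power_divide)
  show "norm (lam6 w - (w + 32 * w\<^sup>2 + 243 * w ^ 3)) \<le> 1070 * norm w ^ 4"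
  proof (rule lambert_bound[OF w])
    show "(lam6 w - (w + 32 * w\<^sup>2 + 243 * w ^ 3)) * (1 - w) ^ 6 = w ^ 4 * (1024 + w * (- 3019 + w * (4386 + w * (- 3454 + w * (1426 + w * (- 243))))))"
      unfolding left_diff_distrib lam6_mult[OF nz] by (simp add: algebra_simps eval_nat_numeral)
    show "norm (1024 + w * (- 3019 + w * (4386 + w * (- 3454 + w * (1426 + w * (- 243)))))) \<le> norm (1024::complex) + 1/230 * (norm (- 3019::complex) + 1/230 * (norm (4386::complex) + 1/230 * (norm (- 3454 :: complex) + 1/230 * (norm (1426::complex) + 1/230 * norm (- 243 :: complex)))))"
      by (intro norm_horner[OF w] order_refl)
  qed (simp add: power_divide)
qed

text \<open>A Lambert series: the coefficient of q^n is a divisor sum, which for the primes 2 and 3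
  is the coefficient of \<open>lam\<close> plus 1. In the error, \<open>c4\<close> stems from
  lam(q), \<open>c1\<close> from lam(q^2), and 2 covers lam(q^3) and the tail.\<close>

lemma lambert_series:
  fixes lam :: "complex \<Rightarrow> complex"
  assumes q: "norm q \<le> 1 / 230" and S: "(\<lambda>j. lam (q ^ Suc j)) sums S"
    and l1: "\<And>w. norm w \<le> 1 / 230 \<Longrightarrow> norm (lam w - w) \<le> c1 * norm w ^ 2"
    and l2: "\<And>w. norm w \<le> 1 / 230 \<Longrightarrow> norm (lam w - (w + c2 * w\<^sup>2 + c3 * w ^ 3)) \<le> c4 * norm w ^ 4"
    and c1: "0 \<le> c1" "c1 \<le> 34"
  shows "norm (S - (q + (c2 + 1) * q\<^sup>2 + (c3 + 1) * q ^ 3)) \<le> (c4 + c1 + 2) * norm q ^ 4"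
proof -
  define t where "t = norm q"
  have t: "0 \<le> t" "t \<le> 1 / 230" using q by (auto simp: t_def)
  have qk: "norm (q ^ Suc j) \<le> 1 / 230" for j
  proof -
    have "t ^ Suc j \<le> t ^ 1" using t by (intro power_decreasing) auto
    moreover have "norm (q ^ Suc j) = t ^ Suc j" by (simp only: t_def norm_power)
    ultimately show ?thesis using t by simp
  qed
  have lb: "norm (lam (q ^ Suc j)) \<le> 23 / 20 * t ^ Suc j" for j
  proof -
    have "norm (lam (q ^ Suc j)) \<le> norm (q ^ Suc j) + norm (lam (q ^ Suc j) - q ^ Suc j)"
      by (metis add.commute diff_add_cancel norm_triangle_ineq)
    also have "\<dots> \<le> norm (q ^ Suc j) + 34 * norm (q ^ Suc j) ^ 2"
      using l1[OF qk, of j] mult_right_mono[OF c1(2), of "norm (q ^ Suc j) ^ 2"] by simp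
    also have "norm (q ^ Suc j) ^ 2 \<le> 1 / 230 * norm (q ^ Suc j)"
      using mult_right_mono[OF qk[of j], of "norm (q ^ Suc j)"] by (simp add: power2_eq_square)
    finally have "norm (lam (q ^ Suc j)) \<le> 23 / 20 * norm (q ^ Suc j)"
      using norm_ge_zero[of "q ^ Suc j"] by linarith
    then show ?thesis by (simp only: t_def norm_power)
  qed
  have pw: "t ^ Suc (j + 3) = t ^ 4 * t ^ j" for j by (simp add: eval_nat_numeral)
  have sm: "summable (\<lambda>j. 23 / 20 * t ^ Suc (j + 3))"
  proof -
    have "summable (\<lambda>j. (23 / 20 * t ^ 4) * t ^ j)" using t by (intro summable_mult summable_geometric) auto
    then show ?thesis unfolding pw by (simp only: mult.assoc)
  qed
  have sums: "(\<lambda>j. lam (q ^ Suc (j + 3))) sums (S - (\<Sum>j<3. lam (q ^ Suc j)))"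
    using S by (rule sums_split_initial_segment)
  have "norm (S - (\<Sum>j<3. lam (q ^ Suc j))) \<le> (\<Sum>j. 23 / 20 * t ^ Suc (j + 3))"
    unfolding sums_unique[OF sums] by (intro norm_suminf_le lb sm)
  also have "\<dots> = (\<Sum>j. 23 / 20 * t ^ 4 * t ^ j)" unfolding pw by (simp only: mult.assoc)
  also have "\<dots> = 23 / 20 * t ^ 4 * (1 / (1 - t))"
    using t by (subst suminf_mult) (auto simp: suminf_geometric)
  also have "\<dots> \<le> 23 / 20 * t ^ 4 * (230 / 229)"
    using t by (intro mult_left_mono) (auto simp: field_simps)
  finally have T: "norm (S - (lam q + lam (q\<^sup>2) + lam (q ^ 3))) \<le> 23 / 20 * t ^ 4 * (230 / 229)"
    by (simp add: eval_nat_numeral)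
  have a2: "norm (lam (q\<^sup>2) - q\<^sup>2) \<le> c1 * t ^ 4"
  proof -
    have "norm (lam (q\<^sup>2) - q\<^sup>2) \<le> c1 * norm (q\<^sup>2) ^ 2" using l1[OF qk[of 1]] by (simp add: numeral_2_eq_2)
    then show ?thesis by (simp add: t_def norm_power flip: power_mult)
  qed
  have a3: "norm (lam (q ^ 3) - q ^ 3) \<le> 1 / 10 * t ^ 4"
  proof -
    have "norm (lam (q ^ 3) - q ^ 3) \<le> c1 * norm (q ^ 3) ^ 2" using l1[OF qk[of 2]] by (simp add: numeral_3_eq_3 numeral_2_eq_2)
    also have "\<dots> = c1 * t ^ 2 * t ^ 4" by (simp add: t_def norm_power flip: power_mult power_add)
    also have "\<dots> \<le> 1 / 10 * t ^ 4"
    proof (rule mult_right_mono)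
      have "c1 * t ^ 2 \<le> 34 * (1 / 230) ^ 2" using t c1 by (intro mult_mono power_mono) auto
      then show "c1 * t ^ 2 \<le> 1 / 10" by (simp add: power2_eq_square)
    qed simp
    finally show ?thesis .
  qed
  have a1: "norm (lam q - (q + c2 * q\<^sup>2 + c3 * q ^ 3)) \<le> c4 * t ^ 4" using l2[OF q] by (simp add: t_def)
  have "S - (q + (c2 + 1) * q\<^sup>2 + (c3 + 1) * q ^ 3) = (S - (lam q + lam (q\<^sup>2) + lam (q ^ 3))) +
      (lam q - (q + c2 * q\<^sup>2 + c3 * q ^ 3)) + (lam (q\<^sup>2) - q\<^sup>2) + (lam (q ^ 3) - q ^ 3)"
    by (simp add: algebra_simps)
  also have "norm \<dots> \<le> 23 / 20 * t ^ 4 * (230 / 229) + c4 * t ^ 4 + c1 * t ^ 4 + 1 / 10 * t ^ 4"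
    by (intro norm_triangle_le add_mono T a1 a2 a3)
  also have "\<dots> \<le> (c4 + c1 + 2) * t ^ 4" using t by (simp add: algebra_simps)
  finally show ?thesis by (simp add: t_def)
qed

text \<open>The two polynomials are E4 and E6 through q^3. The bounds for \<open>u\<close> and
  \<open>v\<close> are 240 * 77 and 504 * 1106 rounded up, from the errors in
  \<open>lambert_series\<close>.\<close>

lemma j_eisenstein_series:
  assumes tau: "Im \<tau> > 0" and q: "norm (exp (tpi * \<tau>)) \<le> 1 / 230"
  defines "q \<equiv> exp (tpi * \<tau>)"
  obtains u v where "norm u \<le> 18500" "norm v \<le> 560000"
    "j_invariant (zspan 1 \<tau>) = 1728 * (1 + 240 * q + 2160 * q\<^sup>2 + 6720 * q ^ 3 + q ^ 4 * u) ^ 3 /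
      ((1 + 240 * q + 2160 * q\<^sup>2 + 6720 * q ^ 3 + q ^ 4 * u) ^ 3 - (1 - 504 * q - 16632 * q\<^sup>2 - 122976 * q ^ 3 + q ^ 4 * v)\<^sup>2)"
proof -
  have q0: "q \<noteq> 0" by (simp add: q_def)
  have qn: "norm q \<le> 1 / 230" using assms by simp
  have nI: "of_nat (Suc j) * \<tau> \<notin> \<int>" for j
  proof
    assume "of_nat (Suc j) * \<tau> \<in> \<int>"
    then obtain a where "of_nat (Suc j) * \<tau> = of_int a" by (rule Ints_cases)
    from arg_cong[OF this, of Im] show False using tau by simp
  qed
  have qp: "exp (tpi * (of_nat (Suc j) * \<tau>)) = q ^ Suc j" for j
    unfolding q_def exp_of_nat_mult[symmetric] by (simp only: mult_ac)
  have half: "(1 / 2 :: complex) \<notin> \<int>" "exp (tpi * (1 / 2)) = - 1"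
  proof -
    show e: "exp (tpi * (1 / 2)) = - 1" using exp_pi_i by (simp add: mult.commute)
    show "(1 / 2 :: complex) \<notin> \<int>" using exp_tpi_eq_1[of "1 / 2"] e by auto
  qed
  obtain S4 where S4: "eisenstein_sum 4 (zspan 1 \<tau>) = zetasum 4 + 2 * S4" "(\<lambda>j. rowsum 4 (of_nat (Suc j) * \<tau>)) sums S4"
     "(\<lambda>n::int. 1 / (of_int n :: complex) ^ 4) summable_on UNIV - {0}"
    by (rule eisenstein_rows[OF tau, of 4]) auto
  obtain S6 where S6: "eisenstein_sum 6 (zspan 1 \<tau>) = zetasum 6 + 2 * S6" "(\<lambda>j. rowsum 6 (of_nat (Suc j) * \<tau>)) sums S6"
     "(\<lambda>n::int. 1 / (of_int n :: complex) ^ 6) summable_on UNIV - {0}"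
    by (rule eisenstein_rows[OF tau, of 6]) auto
  have "(2 ^ 4 - 1) * zetasum 4 = tpi ^ 4 / 48"
    using zetasum_half[OF _ S4(3)] unfolding rowsum_lam[OF half(1)] half(2) by (simp add: lam4_def)
  then have z4: "zetasum 4 = tpi ^ 4 / 720" by (simp add: field_simps)
  have "(2 ^ 6 - 1) * zetasum 6 = - (tpi ^ 6) / 480"
    using zetasum_half[OF _ S6(3)] unfolding rowsum_lam[OF half(1)] half(2) by (simp add: lam6_def)
  then have z6: "zetasum 6 = - (tpi ^ 6) / 30240" by (simp add: field_simps)
  have p0: "tpi \<noteq> 0" by simp
  have s4: "(\<lambda>j. lam4 (q ^ Suc j)) sums (6 / tpi ^ 4 * S4)"
    using sums_mult[OF S4(2), of "6 / tpi ^ 4"] unfolding rowsum_lam[OF nI] qp using p0 by (simp add: field_simps)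
  have s6: "(\<lambda>j. lam6 (q ^ Suc j)) sums (120 / tpi ^ 6 * S6)"
    using sums_mult[OF S6(2), of "120 / tpi ^ 6"] unfolding rowsum_lam[OF nI] qp using p0 by (simp add: field_simps)
  have b4: "norm (6 / tpi ^ 4 * S4 - (q + (8 + 1) * q\<^sup>2 + (27 + 1) * q ^ 3)) \<le> (66 + 9 + 2) * norm q ^ 4"
    by (rule lambert_series[OF qn s4 lam_bounds(1,2)]) auto
  have b6: "norm (120 / tpi ^ 6 * S6 - (q + (32 + 1) * q\<^sup>2 + (243 + 1) * q ^ 3)) \<le> (1070 + 34 + 2) * norm q ^ 4"
    by (rule lambert_series[OF qn s6 lam_bounds(3,4)]) auto
  define u where "u = 240 * ((6 / tpi ^ 4 * S4 - (q + (8 + 1) * q\<^sup>2 + (27 + 1) * q ^ 3)) / q ^ 4)"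
  define v where "v = - 504 * ((120 / tpi ^ 6 * S6 - (q + (32 + 1) * q\<^sup>2 + (243 + 1) * q ^ 3)) / q ^ 4)"
  have q4: "norm q ^ 4 > 0" using q0 by simp
  have "norm u = 240 * (norm (6 / tpi ^ 4 * S4 - (q + (8 + 1) * q\<^sup>2 + (27 + 1) * q ^ 3)) / norm q ^ 4)"
    unfolding u_def by (simp only: norm_mult norm_divide norm_power norm_numeral)
  also have "\<dots> \<le> 240 * 77" using b4 q4 by (intro mult_left_mono) (auto simp: pos_divide_le_eq)
  finally have u: "norm u \<le> 18500" by simp
  have "norm v = 504 * (norm (120 / tpi ^ 6 * S6 - (q + (32 + 1) * q\<^sup>2 + (243 + 1) * q ^ 3)) / norm q ^ 4)"
    unfolding v_def by (simp only: norm_mult norm_divide norm_power norm_numeral norm_minus_cancel mult_minus_left)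
  also have "\<dots> \<le> 504 * 1106" using b6 q4 by (intro mult_left_mono) (auto simp: pos_divide_le_eq)
  finally have v: "norm v \<le> 560000" by simp
  define E4 where "E4 = 1 + 240 * q + 2160 * q\<^sup>2 + 6720 * q ^ 3 + q ^ 4 * u"
  define E6 where "E6 = 1 - 504 * q - 16632 * q\<^sup>2 - 122976 * q ^ 3 + q ^ 4 * v"
  have qu: "q ^ 4 * u = 240 * (6 / tpi ^ 4 * S4 - (q + (8 + 1) * q\<^sup>2 + (27 + 1) * q ^ 3))" using q0 by (simp add: u_def)
  have qv: "q ^ 4 * v = - 504 * (120 / tpi ^ 6 * S6 - (q + (32 + 1) * q\<^sup>2 + (243 + 1) * q ^ 3))" using q0 by (simp add: v_def)
  have E4: "E4 = 1 + 240 * (6 / tpi ^ 4 * S4)" unfolding E4_def qu by (simp add: algebra_simps)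
  have E6: "E6 = 1 - 504 * (120 / tpi ^ 6 * S6)" unfolding E6_def qv by (simp add: algebra_simps)
  have G4: "60 * eisenstein_sum 4 (zspan 1 \<tau>) = tpi ^ 4 / 12 * E4" unfolding S4(1) z4 E4 using p0 by (simp add: field_simps)
  have G6: "140 * eisenstein_sum 6 (zspan 1 \<tau>) = - (tpi ^ 6) / 216 * E6" unfolding S6(1) z6 E6 using p0 by (simp add: field_simps)
  have c: "(tpi ^ 4 / 12 * E4) ^ 3 = tpi ^ 12 / 1728 * E4 ^ 3" "27 * (- (tpi ^ 6) / 216 * E6)\<^sup>2 = tpi ^ 12 / 1728 * E6\<^sup>2"
    by (simp_all add: power_mult_distrib power_divide flip: power_mult)
  have nz: "tpi ^ 12 / 1728 \<noteq> 0" using p0 by simp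
  have "j_invariant (zspan 1 \<tau>) = 1728 * (tpi ^ 12 / 1728 * E4 ^ 3) / (tpi ^ 12 / 1728 * E4 ^ 3 - tpi ^ 12 / 1728 * E6\<^sup>2)"
    unfolding j_invariant_def Let_def G4 G6 c ..
  also have "\<dots> = (tpi ^ 12 / 1728 * (1728 * E4 ^ 3)) / (tpi ^ 12 / 1728 * (E4 ^ 3 - E6\<^sup>2))"
    by (simp only: right_diff_distrib mult.left_commute)
  also have "\<dots> = 1728 * E4 ^ 3 / (E4 ^ 3 - E6\<^sup>2)" using nz by (rule mult_divide_mult_cancel_left)
  finally show thesis using that[OF u v] by (simp only: E4_def E6_def)
qed

text \<open>Here q d is the modular discriminant with d = 1 - 24 q + 252 q^2 + ..., and the second
  identity divides E4^3 by d up to second order; together they give j = 1/q + 744 + q (196884 + q n)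
  / d. The long constants are the coefficients of P^3 and P^3 - R^2 beyond the terms made
  explicit.\<close>

lemma j_expansion_identity:
  fixes q u v :: complex
  defines "P \<equiv> 1 + 240 * q + 2160 * q\<^sup>2 + 6720 * q ^ 3" and "R \<equiv> 1 - 504 * q - 16632 * q\<^sup>2 - 122976 * q ^ 3"
  defines "X \<equiv> 3 * P\<^sup>2 * u + 3 * P * q ^ 4 * u\<^sup>2 + q ^ 8 * u ^ 3"
  defines "s \<equiv> ((- 3661632 + q * (516865536 + q * (15991962624 + q * (126572544000 + q * (292626432000 + q * 303464448000)))))
      + X - 2 * R * v - q ^ 4 * v\<^sup>2) / 1728"
  defines "d \<equiv> 1 + q * (- 24 + q * (252 + q * s))"
  defines "n \<equiv> (16767072 + q * (396921600 + q * (4607539200 + q * (31115059200 + q * (126572544000 + q * (292626432000 + q * 303464448000))))))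
      + q * X - s * (1 + 744 * q)"
  shows "(P + q ^ 4 * u) ^ 3 - (R + q ^ 4 * v)\<^sup>2 = 1728 * q * d"
    "(P + q ^ 4 * u) ^ 3 = (1 + 744 * q) * d + q\<^sup>2 * (196884 + q * n)"
proof -
  have P3: "P ^ 3 = 1 + 720 * q + 179280 * q\<^sup>2 + q ^ 3 * (16954560 + q * (396921600 + q * (4607539200 + q * (31115059200 + q * (126572544000 + q * (292626432000 + q * 303464448000))))))"
    unfolding P_def by (simp add: power3_eq_cube power2_eq_square algebra_simps)
  have R2: "R\<^sup>2 = 1 - 1008 * q + 220752 * q\<^sup>2 + 16519104 * q ^ 3 + q ^ 4 * (400583232 + q * (4090673664 + q * 15123096576))"
    unfolding R_def by (simp add: eval_nat_numeral algebra_simps)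
  have s1728: "1728 * s = (- 3661632 + q * (516865536 + q * (15991962624 + q * (126572544000 + q * (292626432000 + q * 303464448000)))))
      + X - 2 * R * v - q ^ 4 * v\<^sup>2" by (simp add: s_def)
  have "(P + q ^ 4 * u) ^ 3 = P ^ 3 + q ^ 4 * X" unfolding X_def by algebra
  moreover have "(R + q ^ 4 * v)\<^sup>2 = R\<^sup>2 + q ^ 4 * (2 * R * v + q ^ 4 * v\<^sup>2)" by algebra
  ultimately show "(P + q ^ 4 * u) ^ 3 - (R + q ^ 4 * v)\<^sup>2 = 1728 * q * d"
    using P3 R2 s1728 unfolding d_def by algebra
  show "(P + q ^ 4 * u) ^ 3 = (1 + 744 * q) * d + q\<^sup>2 * (196884 + q * n)"
    using \<open>(P + q ^ 4 * u) ^ 3 = P ^ 3 + q ^ 4 * X\<close> P3 unfolding d_def n_def by algebra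
qed

text \<open>All majorants are values of polynomials at |q| = 1/230. The 51/2 in the denominator is
  24 from the leading coefficient of d - 1 plus a margin above (252 + 6300/230) / 230.\<close>

lemma j_estimate_q:
  fixes q u v :: complex
  assumes q: "norm q \<le> 1 / 230" "q \<noteq> 0" and u: "norm u \<le> 18500" and v: "norm v \<le> 560000"
  defines "E \<equiv> 1 + 240 * q + 2160 * q\<^sup>2 + 6720 * q ^ 3 + q ^ 4 * u" and "F \<equiv> 1 - 504 * q - 16632 * q\<^sup>2 - 122976 * q ^ 3 + q ^ 4 * v"
  shows "norm (1728 * E ^ 3 / (E ^ 3 - F\<^sup>2) - 1 / q - 744) \<le> norm q * (196884 + 19000000 * norm q) / (1 - 51 / 2 * norm q)"
proof -
  define P where "P = 1 + 240 * q + 2160 * q\<^sup>2 + 6720 * q ^ 3"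
  define R where "R = 1 - 504 * q - 16632 * q\<^sup>2 - 122976 * q ^ 3"
  define X where "X = 3 * P\<^sup>2 * u + 3 * P * q ^ 4 * u\<^sup>2 + q ^ 8 * u ^ 3"
  define p1 where "p1 = - 3661632 + q * (516865536 + q * (15991962624 + q * (126572544000 + q * (292626432000 + q * 303464448000))))"
  define s where "s = (p1 + X - 2 * R * v - q ^ 4 * v\<^sup>2) / 1728"
  define d where "d = 1 + q * (- 24 + q * (252 + q * s))"
  define n1 where "n1 = 16767072 + q * (396921600 + q * (4607539200 + q * (31115059200 + q * (126572544000 + q * (292626432000 + q * 303464448000)))))"
  define n where "n = n1 + q * X - s * (1 + 744 * q)"
  note id = j_expansion_identity[of q u v, folded P_def R_def, folded X_def, folded p1_def, folded s_def, folded d_def, folded n1_def, folded n_def]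
  have E: "E = P + q ^ 4 * u" and F: "F = R + q ^ 4 * v" by (simp_all add: E_def F_def P_def R_def)
  have P: "norm P \<le> 2.1"
  proof -
    have "P = 1 + q * (240 + q * (2160 + q * 6720))" unfolding P_def by (simp add: eval_nat_numeral algebra_simps)
    also have "norm \<dots> \<le> norm (1::complex) + 1/230 * (norm (240::complex) + 1/230 * (norm (2160::complex) + 1/230 * norm (6720::complex)))"
      by (intro norm_horner[OF q(1)] order_refl)
    finally show ?thesis by simp
  qed
  have R: "norm R \<le> 3.6"
  proof -
    have "R = 1 + q * (- 504 + q * (- 16632 + q * (- 122976)))" unfolding R_def by (simp add: eval_nat_numeral algebra_simps)
    also have "norm \<dots> \<le> norm (1::complex) + 1/230 * (norm (- 504::complex) + 1/230 * (norm (- 16632::complex) + 1/230 * norm (- 122976::complex)))"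
      by (intro norm_horner[OF q(1)] order_refl)
    finally show ?thesis by simp
  qed
  have p1: "norm p1 \<le> 6300000"
  proof -
    have "norm p1 \<le> norm (- 3661632::complex) + 1/230 * (norm (516865536::complex) + 1/230 * (norm (15991962624::complex)
       + 1/230 * (norm (126572544000::complex) + 1/230 * (norm (292626432000::complex) + 1/230 * norm (303464448000::complex)))))"
      unfolding p1_def by (intro norm_horner[OF q(1)] order_refl)
    then show ?thesis by simp
  qed
  have n1: "norm n1 \<le> 18600000"
  proof -
    have "norm n1 \<le> norm (16767072::complex) + 1/230 * (norm (396921600::complex) + 1/230 * (norm (4607539200::complex)
       + 1/230 * (norm (31115059200::complex) + 1/230 * (norm (126572544000::complex) + 1/230 * (norm (292626432000::complex) + 1/230 * norm (303464448000::complex))))))"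
      unfolding n1_def by (intro norm_horner[OF q(1)] order_refl)
    then show ?thesis by simp
  qed
  have qp: "norm q ^ k \<le> (1 / 230) ^ k" for k using q(1) by (intro power_mono) auto
  have X: "norm X \<le> 250000"
  proof -
    have "norm X \<le> 3 * norm P ^ 2 * norm u + 3 * norm P * norm q ^ 4 * norm u ^ 2 + norm q ^ 8 * norm u ^ 3"
      unfolding X_def by (intro norm_triangle_le add_mono) (simp_all add: norm_mult norm_power)
    also have "\<dots> \<le> 3 * 2.1 ^ 2 * 18500 + 3 * 2.1 * (1 / 230) ^ 4 * 18500 ^ 2 + (1 / 230) ^ 8 * 18500 ^ 3"
      by (intro add_mono mult_mono power_mono order_refl P u qp q(1)) auto
    finally show ?thesis by (simp add: power_divide eval_nat_numeral)
  qed
  have s: "norm s \<le> 6300"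
  proof -
    have "norm (p1 + X - 2 * R * v - q ^ 4 * v\<^sup>2) \<le> norm p1 + norm X + 2 * norm R * norm v + norm q ^ 4 * norm v ^ 2"
      by (intro order_trans[OF norm_triangle_ineq4] add_mono order_trans[OF norm_triangle_ineq]) (simp_all add: norm_mult norm_power)
    also have "\<dots> \<le> 6300000 + 250000 + 2 * 3.6 * 560000 + (1 / 230) ^ 4 * 560000 ^ 2"
      by (intro add_mono mult_mono power_mono order_refl p1 X R v qp q(1)) auto
    finally have "norm (p1 + X - 2 * R * v - q ^ 4 * v\<^sup>2) \<le> 6300 * 1728" by (simp add: power_divide eval_nat_numeral)
    then show ?thesis by (simp add: s_def norm_divide)
  qed
  have n: "norm n \<le> 19000000"
  proof -
    have "norm n \<le> norm n1 + norm q * norm X + norm s * norm (1 + 744 * q)"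
      unfolding n_def by (intro order_trans[OF norm_triangle_ineq4] add_mono order_trans[OF norm_triangle_ineq]) (simp_all add: norm_mult)
    also have "norm (1 + 744 * q) \<le> norm (1::complex) + 1 / 230 * norm (744::complex)"
      using norm_horner[OF q(1) order_refl, of 1 744] by (simp add: mult.commute)
    also have "norm n1 + norm q * norm X + norm s * (norm (1::complex) + 1 / 230 * norm (744::complex))
      \<le> 18600000 + 1 / 230 * 250000 + 6300 * (norm (1::complex) + 1 / 230 * norm (744::complex))"
      by (intro add_mono mult_mono order_refl n1 X s q(1)) auto
    finally show ?thesis using norm_ge_zero[of s] by (simp add: mult_left_mono)
  qed
  have t0: "0 < norm q" using q(2) by simp
  have d: "1 - 51 / 2 * norm q \<le> norm d" "0 < 1 - 51 / 2 * norm q"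
  proof -
    have "norm (- 24 + q * (252 + q * s)) \<le> norm (- 24 :: complex) + 1 / 230 * (norm (252 :: complex) + 1 / 230 * 6300)"
      by (intro norm_horner[OF q(1)] s)
    then have "norm (- 24 + q * (252 + q * s)) \<le> 51 / 2" by simp
    then have "norm (q * (- 24 + q * (252 + q * s))) \<le> norm q * (51 / 2)"
      unfolding norm_mult by (intro mult_left_mono) auto
    moreover have "norm (1::complex) - norm (q * (- 24 + q * (252 + q * s))) \<le> norm d"
      unfolding d_def using norm_diff_ineq[of 1 "q * (- 24 + q * (252 + q * s))"] by simp
    ultimately show "1 - 51 / 2 * norm q \<le> norm d" by simp
    show "0 < 1 - 51 / 2 * norm q" using q(1) by simp
  qed
  have d0: "d \<noteq> 0" using d by auto
  have "1728 * E ^ 3 / (E ^ 3 - F\<^sup>2) = 1728 * E ^ 3 / (1728 * (q * d))" using id(1) unfolding E F by (simp add: mult.assoc)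
  also have "\<dots> = E ^ 3 / (q * d)" by simp
  also have "\<dots> - 1 / q - 744 = (E ^ 3 - (1 + 744 * q) * d) / (q * d)" using q(2) d0 by (simp add: field_simps)
  also have "\<dots> = q\<^sup>2 * (196884 + q * n) / (q * d)" using id(2) unfolding E by simp
  also have "\<dots> = q * (196884 + q * n) / d" using q(2) by (simp add: power2_eq_square)
  finally have "norm (1728 * E ^ 3 / (E ^ 3 - F\<^sup>2) - 1 / q - 744) = norm q * norm (196884 + q * n) / norm d"
    by (simp add: norm_mult norm_divide)
  also have "\<dots> \<le> norm q * (196884 + 19000000 * norm q) / (1 - 51 / 2 * norm q)"
  proof (intro frac_le mult_left_mono d)
    have "norm (196884 + q * n) \<le> norm (196884 :: complex) + norm q * 19000000" by (rule norm_horner[OF order_refl n])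
    then show "norm (196884 + q * n) \<le> 196884 + 19000000 * norm q" by simp
    show "0 \<le> norm q * (196884 + 19000000 * norm q)" by simp
  qed simp
  finally show ?thesis .
qed

lemma exp_ge_sum: "0 \<le> x \<Longrightarrow> (\<Sum>k<n. x ^ k / fact k) \<le> exp (x :: real)"
  unfolding exp_def by (intro sum_le_suminf[THEN order_trans] summable_exp_generic) (auto simp: scaleR_conv_of_real divide_inverse mult.commute summable_exp)

lemma exp_544: "230 \<le> exp (5.44 :: real)"
proof -
  \<comment> \<open>17/25 is 5.44 / 8: at so small an argument six Taylor terms suffice before
    taking the eighth power.\<close>
  have "(\<Sum>k<6. (17/25) ^ k / fact k) \<le> exp (17/25 :: real)" by (rule exp_ge_sum) simp
  then have "1.9737 \<le> exp (17/25 :: real)" by (simp add: eval_nat_numeral fact_numeral)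
  then have "1.9737 ^ 8 \<le> exp (17/25 :: real) ^ 8" by (intro power_mono) auto
  also have "\<dots> = exp 5.44" by (simp flip: exp_of_nat_mult)
  finally show ?thesis by (simp add: eval_nat_numeral)
qed

lemma exp_pi_sqrt3: assumes "y \<ge> sqrt 3 / 2" shows "230 \<le> exp (2 * pi * y)"
proof -
  have "1.732 \<le> sqrt (3::real)" by (rule real_le_rsqrt) (simp add: power2_eq_square)
  then have "5.44 \<le> 3.1415 * sqrt 3" by simp
  also have "\<dots> \<le> pi * sqrt 3" using pi_approx(1) by (intro mult_right_mono) auto
  also have "\<dots> \<le> 2 * pi * y" using assms mult_left_mono[OF assms, of "2 * pi"] by simp
  finally have "exp (5.44 :: real) \<le> exp (2 * pi * y)" by simp
  then show ?thesis using exp_544 by linarith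
qed

text \<open>The first bound covers the whole fundamental domain; the two sharper ones serve the
  tight comparisons in \<open>discriminant_49\<close>, \<open>not_252\<close> and
  \<open>not_7987\<close>.\<close>

theorem j_estimate:
  assumes tau: "Im \<tau> \<ge> sqrt 3 / 2"
  defines "Q \<equiv> exp (2 * pi * Im \<tau>)"
  shows "norm (j_invariant (zspan 1 \<tau>) - exp (- (tpi * \<tau>)) - 744) \<le> 320000 / Q"
    "Q \<ge> 390 \<Longrightarrow> norm (j_invariant (zspan 1 \<tau>) - exp (- (tpi * \<tau>)) - 744) \<le> 263000 / Q"
    "Q \<ge> 900 \<Longrightarrow> norm (j_invariant (zspan 1 \<tau>) - exp (- (tpi * \<tau>)) - 744) \<le> 225000 / Q"
proof -
  have Q: "230 \<le> Q" unfolding Q_def by (rule exp_pi_sqrt3[OF tau])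
  define q where "q = exp (tpi * \<tau>)"
  have nq: "norm q = 1 / Q" by (simp add: q_def Q_def norm_exp_eq_Re exp_minus inverse_eq_divide)
  have q: "norm q \<le> 1 / 230" "q \<noteq> 0" using Q by (simp_all add: nq field_simps) (simp add: q_def)
  have iq: "1 / q = exp (- (tpi * \<tau>))" by (simp add: q_def exp_minus inverse_eq_divide)
  have "Im \<tau> > 0" using tau by (meson less_le_trans half_gt_zero real_sqrt_gt_zero zero_less_numeral)
  then obtain u v where "norm u \<le> 18500" "norm v \<le> 560000" and j:
    "j_invariant (zspan 1 \<tau>) = 1728 * (1 + 240 * q + 2160 * q\<^sup>2 + 6720 * q ^ 3 + q ^ 4 * u) ^ 3 /
      ((1 + 240 * q + 2160 * q\<^sup>2 + 6720 * q ^ 3 + q ^ 4 * u) ^ 3 - (1 - 504 * q - 16632 * q\<^sup>2 - 122976 * q ^ 3 + q ^ 4 * v)\<^sup>2)"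
    using q(1) unfolding q_def by (rule j_eisenstein_series)
  from j_estimate_q[OF q this(1,2)]
  have *: "norm (j_invariant (zspan 1 \<tau>) - exp (- (tpi * \<tau>)) - 744) \<le> norm q * ((196884 + 19000000 * norm q) / (1 - 51 / 2 * norm q))"
    unfolding j iq by simp
  have gen: "norm (j_invariant (zspan 1 \<tau>) - exp (- (tpi * \<tau>)) - 744) \<le> C / Q"
    if "norm q \<le> t" "t < 2 / 51" "196884 + 19000000 * t \<le> C * (1 - 51 / 2 * t)" for t C
  proof -
    have "(196884 + 19000000 * norm q) / (1 - 51 / 2 * norm q) \<le> (196884 + 19000000 * t) / (1 - 51 / 2 * t)"
      using that order_trans[OF norm_ge_zero that(1)] by (intro frac_le) auto
    also have "\<dots> \<le> C" using that by (simp add: pos_divide_le_eq)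
    finally have "norm q * ((196884 + 19000000 * norm q) / (1 - 51 / 2 * norm q)) \<le> norm q * C" by (intro mult_left_mono) auto
    then show ?thesis using * by (simp add: nq)
  qed
  show "norm (j_invariant (zspan 1 \<tau>) - exp (- (tpi * \<tau>)) - 744) \<le> 320000 / Q"
    by (rule gen[of "1 / 230"]) (use q in auto)
  show "norm (j_invariant (zspan 1 \<tau>) - exp (- (tpi * \<tau>)) - 744) \<le> 263000 / Q" if "Q \<ge> 390"
  proof -
    have "norm q \<le> 1 / 390" using that by (simp add: nq field_simps)
    then show ?thesis by (rule gen) auto
  qed
  assume "Q \<ge> 900"
  then have "norm q \<le> 1 / 900" by (simp add: nq field_simps)
  then show "norm (j_invariant (zspan 1 \<tau>) - exp (- (tpi * \<tau>)) - 744) \<le> 225000 / Q"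
    by (rule gen) auto
qed

text \<open>Eliminating A and B leaves the vanishing of the determinant with rows (z^m, z^n, 1). Its
  only term with x0^m is x0^m (x^n - y^n), so |x|^n - |y|^n is forced to be small; the worst case is
  m = n + 1.\<close>

lemma trinomial_gap:
  fixes A B :: complex
  assumes mn: "n < m" "0 < n" and r: "\<forall>z\<in>{x0, x, y}. z ^ m + A * z ^ n + B = 0"
    and o: "norm y < norm x" "norm x \<le> norm x0"
  shows "norm x - norm y \<le> 4 * (norm x)\<^sup>2 / norm x0"
proof -
  define a b c where "a = norm x0" and "b = norm x" and "c = norm y"
  have abc: "0 \<le> c" "c < b" "b \<le> a" using o by (auto simp: a_def b_def c_def)
  have "x ^ m + A * x ^ n + B = 0" "x0 ^ m + A * x0 ^ n + B = 0" "y ^ m + A * y ^ n + B = 0" using r by auto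
  moreover have "U0 * (u - w) = u0 * (U - W) + (W * u - U * w)"
    if "U + A * u + B = 0" "U0 + A * u0 + B = 0" "W + A * w + B = 0" for U U0 W u u0 w
    using that by algebra
  ultimately have id: "x0 ^ m * (x ^ n - y ^ n) = x0 ^ n * (x ^ m - y ^ m) + (y ^ m * x ^ n - x ^ m * y ^ n)" by blast
  obtain n' where n': "n = Suc n'" using mn by (cases n) auto
  obtain k where k: "m = n + Suc k" using mn by (metis less_iff_Suc_add add_Suc_right)
  have pw: "c ^ i \<le> b ^ i" for i using abc by (intro power_mono) auto
  have "b ^ n' * (b - c) \<le> b ^ n - c ^ n"
  proof -
    have "c * c ^ n' \<le> c * b ^ n'" using abc pw by (intro mult_left_mono) auto
    then show ?thesis by (simp add: n' algebra_simps)
  qed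
  also have "\<dots> \<le> norm (x ^ n - y ^ n)" using norm_triangle_ineq2[of "x ^ n" "y ^ n"] by (simp add: b_def c_def norm_power)
  finally have "a ^ m * (b ^ n' * (b - c)) \<le> a ^ m * norm (x ^ n - y ^ n)" using abc by (intro mult_left_mono) auto
  also have "\<dots> = norm (x0 ^ n * (x ^ m - y ^ m) + (y ^ m * x ^ n - x ^ m * y ^ n))"
    unfolding id[symmetric] by (simp add: norm_mult norm_power a_def)
  also have "\<dots> \<le> a ^ n * (b ^ m + c ^ m) + (c ^ m * b ^ n + b ^ m * c ^ n)"
  proof (intro norm_triangle_le add_mono)
    have "norm (x ^ m - y ^ m) \<le> b ^ m + c ^ m" using norm_triangle_ineq4[of "x ^ m" "y ^ m"] by (simp add: b_def c_def norm_power)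
    then show "norm (x0 ^ n * (x ^ m - y ^ m)) \<le> a ^ n * (b ^ m + c ^ m)" unfolding norm_mult norm_power a_def by (intro mult_left_mono) auto
    show "norm (y ^ m * x ^ n - x ^ m * y ^ n) \<le> c ^ m * b ^ n + b ^ m * c ^ n"
      using norm_triangle_ineq4[of "y ^ m * x ^ n" "x ^ m * y ^ n"] by (simp add: b_def c_def norm_power norm_mult)
  qed
  also have "\<dots> \<le> a ^ n * (b ^ m + b ^ m) + (b ^ m * a ^ n + b ^ m * a ^ n)"
    using abc pw power_mono[of b a n] order_trans[OF pw power_mono[of b a n]]
    by (intro add_mono mult_mono mult_left_mono order_refl) auto
  finally have "a ^ m * (b ^ n' * (b - c)) \<le> 4 * a ^ n * b ^ m" by simp
  \<comment> \<open>The surplus m - n - 1 = k is paid for by b <= a, which reduces every m to the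
    case m = n + 1.\<close>
  also have "\<dots> = a ^ n * b ^ n' * (4 * b\<^sup>2 * b ^ k)" by (simp add: k n' power_add power2_eq_square)
  also have "\<dots> \<le> a ^ n * b ^ n' * (4 * b\<^sup>2 * a ^ k)" using abc by (intro mult_left_mono power_mono) auto
  finally have "(a ^ n * b ^ n' * a ^ k) * (a * (b - c)) \<le> (a ^ n * b ^ n' * a ^ k) * (4 * b\<^sup>2)"
    by (simp add: k power_add mult_ac)
  moreover have "0 < a ^ n * b ^ n' * a ^ k" using abc by (intro mult_pos_pos zero_less_power) auto
  ultimately have "a * (b - c) \<le> 4 * b\<^sup>2" by (simp only: mult_le_cancel_left_pos)
  then show ?thesis using abc by (simp add: pos_le_divide_eq mult.commute flip: a_def b_def c_def)
qed

section \<open>Comparison of absolute values\<close>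

lemma exp_one_lower: "2.716 \<le> exp (1 :: real)"
proof -
  have "(\<Sum>k<6. 1 ^ k / fact k) \<le> exp (1 :: real)" by (rule exp_ge_sum) simp
  then show ?thesis by (simp add: eval_nat_numeral fact_numeral)
qed

lemma exp_lower:
  assumes "0 \<le> r"
  shows "2.716 ^ k * (1 + r + r\<^sup>2 / 2) \<le> exp (real k + r)"
proof -
  have "exp (real k + r) = exp 1 ^ k * exp r" by (simp add: exp_add flip: exp_of_nat_mult)
  moreover have "2.716 ^ k \<le> exp (1 :: real) ^ k" using exp_one_lower by (intro power_mono) auto
  moreover have "1 + r + r\<^sup>2 / 2 \<le> exp r" using assms by (rule exp_lower_Taylor_quadratic)
  ultimately show ?thesis using assms by (simp add: mult_mono)
qed

lemma exp_6_upper: "exp (6 :: real) \<le> 405"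
proof -
  have "exp 6 = exp (1 :: real) ^ 6" by (simp flip: exp_of_nat_mult)
  also have "\<dots> \<le> 2.72 ^ 6" using e_less_272 by (intro power_mono) auto
  finally show ?thesis by (simp add: power_divide)
qed

locale trinomial_disc =
  fixes \<Delta> :: int and A B :: complex and m n :: nat
  assumes disc: "imag_quad_disc \<Delta>" and mn: "n < m" "0 < n" and nzB: "B \<noteq> 0"
    and root: "\<And>x. x \<in> singular_moduli \<Delta> \<Longrightarrow> x ^ m + A * x ^ n + B = 0"
    and hgt: "disc_class_number \<Delta> > 3"
begin

definition X :: real where "X = pi * sqrt (of_int (- \<Delta>))"
definition Q :: "real \<Rightarrow> real" where "Q a = exp (X / a)"

text \<open>\<open>x\<close> is the singular modulus of a form with leading coefficient \<open>a\<close>, and \<open>1 / q = Q a * cis \<theta>\<close>.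
  The three error bounds are the same function of \<open>Q a\<close> at different thresholds.\<close>

definition cmval :: "real \<Rightarrow> real \<Rightarrow> complex \<Rightarrow> bool" where
  "cmval a \<theta> x \<longleftrightarrow> x \<in> singular_moduli \<Delta> \<and> 230 \<le> Q a \<and>
    norm (x - of_real (Q a) * cis \<theta> - 744) \<le> 320000 / Q a \<and>
    (390 \<le> Q a \<longrightarrow> norm (x - of_real (Q a) * cis \<theta> - 744) \<le> 263000 / Q a) \<and>
    (900 \<le> Q a \<longrightarrow> norm (x - of_real (Q a) * cis \<theta> - 744) \<le> 225000 / Q a)"

lemma neg: "\<Delta> < 0" by (rule disc_neg[OF disc])

lemma X_pos: "X > 0" using neg by (simp add: X_def)

lemma Im_tau: "a > 0 \<Longrightarrow> Im ((- of_int b + sqrt_disc \<Delta>) / (2 * of_int a)) = sqrt (of_int (- \<Delta>)) / (2 * of_int a)"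
proof -
  have "Im ((- of_int b + sqrt_disc \<Delta>) / of_real (of_int (2 * a))) = Im (- of_int b + sqrt_disc \<Delta>) / of_int (2 * a)"
    by (rule Im_divide_of_real)
  then show ?thesis by (simp add: Im_sqrt_disc[OF disc])
qed

lemma sqrt3_le: assumes "a > 0" "3 * a\<^sup>2 \<le> - \<Delta>" shows "sqrt 3 / 2 \<le> sqrt (of_int (- \<Delta>)) / (2 * of_int a)"
proof -
  have "sqrt (3 * (of_int a)\<^sup>2) \<le> sqrt (of_int (- \<Delta>))"
    by (rule real_sqrt_le_mono) (use of_int_le_iff[where 'a = real, THEN iffD2, OF assms(2)] in simp)
  then show ?thesis using assms(1) by (simp add: real_sqrt_mult field_simps)
qed

lemma cmval_tau:
  assumes a: "a > 0" and b: "\<tau> = (- of_int b + sqrt_disc \<Delta>) / (2 * of_int a)"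
    and mr: "multiplier_ring (zspan 1 \<tau>) = quad_order \<Delta>" and le: "3 * a\<^sup>2 \<le> - \<Delta>"
  shows "cmval (of_int a) (pi * of_int b / of_int a) (j_invariant (zspan 1 \<tau>))"
proof -
  have im: "Im \<tau> = sqrt (of_int (- \<Delta>)) / (2 * of_int a)" unfolding b by (rule Im_tau[OF a])
  have i3: "sqrt 3 / 2 \<le> Im \<tau>" unfolding im by (rule sqrt3_le[OF a le])
  have pos: "Im \<tau> > 0" using i3 by (meson less_le_trans half_gt_zero real_sqrt_gt_zero zero_less_numeral)
  have q: "exp (2 * pi * Im \<tau>) = Q (of_int a)" unfolding Q_def X_def im using a by simp
  have a0: "of_int a \<noteq> (0 :: complex)" using a by simp
  have "- (tpi * \<tau>) = of_real (X / of_int a) + \<i> * of_real (pi * of_int b / of_int a)"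
    unfolding b X_def sqrt_disc_def using a0 by (simp add: field_simps)
  then have z: "exp (- (tpi * \<tau>)) = of_real (Q (of_int a)) * cis (pi * of_int b / of_int a)"
    by (simp only: exp_add Q_def exp_of_real cis_conv_exp)
  have "j_invariant (zspan 1 \<tau>) \<in> singular_moduli \<Delta>"
    unfolding singular_moduli_def using pos mr imag_quad_order_of_disc_iff[OF disc] by blast
  moreover have "230 \<le> Q (of_int a)" using exp_pi_sqrt3[OF i3] q by simp
  ultimately show ?thesis unfolding cmval_def
    using j_estimate[OF i3, unfolded q z] by blast
qed

lemma cmval_form:
  assumes a: "a > 0" and d: "b\<^sup>2 - 4 * a * c = \<Delta>" and prim: "coprime a b \<or> coprime a c" and le: "3 * a\<^sup>2 \<le> - \<Delta>"
  shows "\<exists>x. cmval (of_int a) (pi * of_int b / of_int a) x"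
  using cmval_tau[OF a refl cm_point_of_form(3)[OF disc a d prim] le] by blast

lemma norm_cmval:
  assumes "cmval a \<theta> x"
  shows "norm x \<le> Q a + 744 + 320000 / Q a" "Q a - 744 - 320000 / Q a \<le> norm x"
proof -
  have e: "norm (x - of_real (Q a) * cis \<theta> - 744) \<le> 320000 / Q a" using assms by (simp add: cmval_def)
  have z: "norm (of_real (Q a) * cis \<theta>) = Q a" by (simp add: norm_mult Q_def)
  have "norm x \<le> norm (of_real (Q a) * cis \<theta>) + norm (744 :: complex) + norm (x - of_real (Q a) * cis \<theta> - 744)"
    using norm_triangle_ineq[of "of_real (Q a) * cis \<theta>" "744 + (x - of_real (Q a) * cis \<theta> - 744)"]
      norm_triangle_ineq[of 744 "x - of_real (Q a) * cis \<theta> - 744"] by simp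
  then show "norm x \<le> Q a + 744 + 320000 / Q a" using e z by simp
  have "norm (of_real (Q a) * cis \<theta>) \<le> norm x + norm (744 :: complex) + norm (x - of_real (Q a) * cis \<theta> - 744)"
    using norm_triangle_ineq4[of x "744 + (x - of_real (Q a) * cis \<theta> - 744)"]
      norm_triangle_ineq[of 744 "x - of_real (Q a) * cis \<theta> - 744"] by simp
  then show "Q a - 744 - 320000 / Q a \<le> norm x" using e z by simp
qed

lemma principal: "\<exists>x0. cmval 1 0 x0 \<or> cmval 1 pi x0"
proof -
  have 1: "3 * 1\<^sup>2 \<le> - \<Delta>" using disc neg unfolding imag_quad_disc_def by simp presburger
  have "\<Delta> mod 4 = 0 \<or> \<Delta> mod 4 = 1" using disc by (simp add: imag_quad_disc_def)
  then show ?thesis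
  proof
    assume "\<Delta> mod 4 = 0"
    then have "0\<^sup>2 - 4 * 1 * (- \<Delta> div 4) = \<Delta>" by simp presburger
    from cmval_form[OF _ this _ 1] show ?thesis by auto
  next
    assume "\<Delta> mod 4 = 1"
    then have "1\<^sup>2 - 4 * 1 * ((1 - \<Delta>) div 4) = \<Delta>" by simp presburger
    from cmval_form[OF _ this _ 1] show ?thesis by auto
  qed
qed

text \<open>Since a >= 2, Q(1) >= Q(a)^2, so the dominant modulus is at least quadratically larger
  and \<open>trinomial_gap\<close> is bounded by an absolute constant. 1100 is 744 + 320000 / 900
  rounded up, and at 900 the quotient has fallen below 20.\<close>

lemma gap:
  assumes x: "cmval a \<theta> x" and a: "2 \<le> a" "900 \<le> Q a" and y: "y \<in> singular_moduli \<Delta>" "norm y < norm x"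
  shows "norm x - norm y \<le> 20"
proof -
  obtain x0 \<phi> where x0: "cmval 1 \<phi> x0" using principal by blast
  have "X / 1 = X / a * a" using a by simp
  also have "\<dots> \<ge> X / a * 2" using a X_pos by (intro mult_left_mono) auto
  finally have "exp (X / a * 2) \<le> Q 1" by (simp add: Q_def)
  also have "exp (X / a * 2) = (Q a)\<^sup>2" by (simp add: Q_def power2_eq_square flip: exp_add)
  finally have Q1: "(Q a)\<^sup>2 \<le> Q 1" .
  have nx: "norm x \<le> Q a + 1100"
  proof -
    have "320000 / Q a \<le> 320000 / 900" using a(2) by (intro divide_left_mono) auto
    then show ?thesis using norm_cmval(1)[OF x] by simp
  qed
  have sq: "900 * Q a \<le> (Q a)\<^sup>2" using a(2) by (simp add: power2_eq_square)
  have n0: "(Q a)\<^sup>2 - 1100 \<le> norm x0"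
  proof -
    have "900 \<le> Q 1" using Q1 sq a(2) by linarith
    then have "320000 / Q 1 \<le> 320000 / 900" by (intro divide_left_mono) auto
    then show ?thesis using norm_cmval(2)[OF x0] Q1 by simp
  qed
  have "norm x \<le> norm x0" using nx n0 sq a(2) by linarith
  then have "norm x - norm y \<le> 4 * (norm x)\<^sup>2 / norm x0"
    by (intro trinomial_gap[OF mn _ y(2)]) (use root x x0 y in \<open>auto simp: cmval_def\<close>)
  also have "\<dots> \<le> 4 * (Q a + 1100)\<^sup>2 / ((Q a)\<^sup>2 - 1100)"
    using nx n0 sq a(2) by (intro frac_le mult_left_mono power_mono) auto
  also have "\<dots> \<le> 20"
  proof -
    have "4 * (Q a + 1100)\<^sup>2 = 4 * (Q a)\<^sup>2 + 8800 * Q a + 4840000" by (simp add: power2_eq_square algebra_simps)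
    also have "\<dots> \<le> 20 * ((Q a)\<^sup>2 - 1100)"
    proof -
      have "4 * s + 8800 * q + 4840000 \<le> 20 * (s - 1100)" if "900 * q \<le> s" "900 \<le> q" for s q :: real
        using that by simp
      from this[OF sq a(2)] show ?thesis .
    qed
    finally show ?thesis using sq a(2) by (subst pos_divide_le_eq) linarith+
  qed
  finally show ?thesis .
qed

text \<open>2910 exceeds 2 * 744 + 1392 + 20: the constant 744 of both moduli, the error at
  \<open>y\<close> (at most 320000 / 230), and the bound of \<open>gap\<close>.\<close>

lemma pair:
  assumes x: "cmval a \<theta> x" and y: "cmval b \<phi> y" and a: "2 \<le> a" "900 \<le> Q a" and d: "2910 + 320000 / Q a \<le> Q a - Q b"
  shows False
proof -
  have "320000 / Q b \<le> 320000 / 230" using y by (intro divide_left_mono) (auto simp: cmval_def)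
  then have ny: "norm y \<le> Q b + 744 + 1392" using norm_cmval(1)[OF y] by simp
  have gap20: "20 < norm x - norm y" using norm_cmval(2)[OF x] ny d by linarith
  moreover have "norm x - norm y \<le> 20" by (rule gap[OF x a]) (use y gap20 in \<open>auto simp: cmval_def\<close>)
  ultimately show False by simp
qed

text \<open>If b / a >= (p + 1) / p, the exponents X / a and X / b differ by at least L / (p + 1),
  so Q(a) - Q(b) is at least Q(a) L / (p + 1 + L).\<close>

lemma pair_ratio:
  assumes x: "cmval a \<theta> x" and y: "cmval b \<phi> y" and a: "2 \<le> a" and d: "(p + 1) * a \<le> p * b" "0 < p" and L: "L * a \<le> X" "0 < L"
    and K: "K \<le> exp L" "2910 + 320000 / K \<le> K * (L / (p + 1 + L))" "900 \<le> K"
  shows False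
proof (rule pair[OF x y a])
  have LX: "L \<le> X / a" using L a by (simp add: pos_le_divide_eq)
  have QK: "K \<le> Q a" using K(1) LX by (simp add: Q_def) (meson exp_le_cancel_iff order_trans)
  then show "900 \<le> Q a" using K by simp
  have "0 < (p + 1) * a" using a d(2) by simp
  then have b: "0 < b" using d by (metis less_le_trans zero_less_mult_pos)
  define \<delta> where "\<delta> = X / a - X / b"
  have "a / b \<le> p / (p + 1)" using b d a by (simp add: field_simps)
  then have "1 / (p + 1) \<le> 1 - a / b" using d(2) by (simp add: field_simps)
  then have "L * (1 / (p + 1)) \<le> X / a * (1 - a / b)" using LX L(2) d(2) by (intro mult_mono) auto
  also have "\<dots> = \<delta>" using a b by (simp add: \<delta>_def field_simps)
  finally have "L / (p + 1) \<le> \<delta>" by simp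
  then have "1 + L / (p + 1) \<le> exp \<delta>" using exp_ge_add_one_self[of \<delta>] by linarith
  then have e: "exp (- \<delta>) \<le> 1 / (1 + L / (p + 1))"
    unfolding exp_minus inverse_eq_divide using d(2) L(2) by (intro frac_le) (auto intro: add_pos_pos)
  have eq: "1 - 1 / (1 + L / (p + 1)) = L / (p + 1 + L)" using d(2) L(2) by (simp add: field_simps)
  have "Q b = Q a * exp (- \<delta>)" by (simp add: Q_def \<delta>_def flip: exp_add)
  then have "Q a - Q b = Q a * (1 - exp (- \<delta>))" by (simp add: algebra_simps)
  moreover have "Q a * (L / (p + 1 + L)) \<le> Q a * (1 - exp (- \<delta>))" using e eq QK K by (intro mult_left_mono) auto
  moreover have "K * (L / (p + 1 + L)) \<le> Q a * (L / (p + 1 + L))" using QK L d(2) by (intro mult_right_mono) auto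
  moreover have "320000 / Q a \<le> 320000 / K" using QK K(3) by (intro divide_left_mono) auto
  ultimately show "2910 + 320000 / Q a \<le> Q a - Q b" using K(2) by linarith
qed

text \<open>Two distinct positive integers, the smaller at most 13, have ratio at least 14/13. The
  analogue \<open>pair10\<close> allows 17 in place of 13 at the price of a larger X / a.\<close>

lemma pair9:
  assumes "cmval a \<theta> x" "cmval b \<phi> y" "2 \<le> a" "14 * a \<le> 13 * b" "9 * a \<le> X"
  shows False
proof (rule pair_ratio[OF assms(1-3), of 13 9 8000])
  show "8000 \<le> exp (9 :: real)" using exp_lower[of 0 9] by (simp add: eval_nat_numeral)
qed (use assms in auto)

lemma pair10:
  assumes "cmval a \<theta> x" "cmval b \<phi> y" "2 \<le> a" "18 * a \<le> 17 * b" "10 * a \<le> X"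
  shows False
proof (rule pair_ratio[OF assms(1-3), of 17 10 20000])
  show "20000 \<le> exp (10 :: real)" using exp_lower[of 0 10] by (simp add: eval_nat_numeral)
qed (use assms in auto)

text \<open>98596 / 10000 is 3.14^2: an integer inequality that implies k <= pi sqrt|Delta|. The
  numbers 810000 and 1000000 in the size conditions are 10000 times 9^2 and 10^2.\<close>

lemma X_ge: assumes "0 \<le> k" "10000 * k\<^sup>2 \<le> - 98596 * \<Delta>" shows "of_int k \<le> X"
proof -
  have "10000 * (of_int k)\<^sup>2 \<le> 98596 * real_of_int (- \<Delta>)"
    using of_int_le_iff[where 'a = real, THEN iffD2, OF assms(2)] by simp
  then have "(of_int k)\<^sup>2 \<le> 3.14\<^sup>2 * real_of_int (- \<Delta>)" by (simp add: power2_eq_square)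
  then have "sqrt ((of_int k)\<^sup>2) \<le> sqrt (3.14\<^sup>2 * real_of_int (- \<Delta>))" by (rule real_sqrt_le_mono)
  moreover have "sqrt (3.14\<^sup>2 * r) = 3.14 * sqrt r" for r by (simp add: real_sqrt_mult)
  ultimately have "of_int k \<le> 3.14 * sqrt (of_int (- \<Delta>))" using assms(1) by (simp only: real_sqrt_abs)
  also have "\<dots> \<le> X" unfolding X_def using pi_approx(1) neg by (intro mult_right_mono) auto
  finally show ?thesis .
qed

lemma reduced_forms:
  obtains a b c :: "nat \<Rightarrow> int" and \<tau> :: "nat \<Rightarrow> complex" where
    "\<And>i. i < 4 \<Longrightarrow> a i > 0 \<and> (b i)\<^sup>2 - 4 * a i * c i = \<Delta> \<and> - a i < b i \<and> b i \<le> a i \<and> a i \<le> c i \<and>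
      3 * (a i)\<^sup>2 \<le> - \<Delta> \<and> gcd (gcd (a i) (b i)) (c i) = 1 \<and>
      \<tau> i = (- of_int (b i) + sqrt_disc \<Delta>) / (2 * of_int (a i)) \<and> multiplier_ring (zspan 1 (\<tau> i)) = quad_order \<Delta>"
    "\<And>i j k. i < 4 \<Longrightarrow> j < 4 \<Longrightarrow> k \<noteq> 0 \<Longrightarrow> zspan 1 (\<tau> i) = (*) k ` zspan 1 (\<tau> j) \<Longrightarrow> i = j"
proof -
  obtain t :: "nat \<Rightarrow> complex" where t: "\<And>i. i < 4 \<Longrightarrow> Im (t i) > 0 \<and> \<bar>Re (t i)\<bar> \<le> 1 / 2 \<and> norm (t i) \<ge> 1 \<and> multiplier_ring (zspan 1 (t i)) = quad_order \<Delta>"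
    and inj: "\<And>i j k. i < 4 \<Longrightarrow> j < 4 \<Longrightarrow> k \<noteq> 0 \<Longrightarrow> zspan 1 (t i) = (*) k ` zspan 1 (t j) \<Longrightarrow> i = j"
    by (rule four_reduced_points[OF disc hgt]) blast
  define P where "P i a b c z \<longleftrightarrow> a > 0 \<and> b\<^sup>2 - 4 * a * c = \<Delta> \<and> - a < b \<and> b \<le> a \<and> a \<le> c \<and>
      3 * a\<^sup>2 \<le> - \<Delta> \<and> gcd (gcd a b) c = 1 \<and>
      z = (- of_int b + sqrt_disc \<Delta>) / (2 * of_int a) \<and> zspan 1 z = zspan 1 (t i)" for i and a b c :: int and z :: complex
  have "\<exists>a b c z. P i a b c z" if i: "i < 4" for i
  proof -
    have ti: "Im (t i) > 0" "\<bar>Re (t i)\<bar> \<le> 1 / 2" "norm (t i) \<ge> 1" "multiplier_ring (zspan 1 (t i)) = quad_order \<Delta>"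
      using t[OF i] by auto
    obtain a b c :: int where f: "a > 0" "b\<^sup>2 - 4 * a * c = \<Delta>" "t i = (- of_int b + sqrt_disc \<Delta>) / (2 * of_int a)"
      "\<And>d. d dvd a \<Longrightarrow> d dvd b \<Longrightarrow> d dvd c \<Longrightarrow> \<bar>d\<bar> = 1"
      by (rule form_of_cm_point[OF disc ti(1,4)]) blast
    have a0: "0 < real_of_int a" using f(1) by simp
    have im: "Im (t i) = sqrt (of_int (- \<Delta>)) / (2 * of_int a)" unfolding f(3) by (rule Im_tau[OF f(1)])
    have re: "Re (t i) = - of_int b / (2 * of_int a)"
    proof -
      have "Re ((- of_int b + sqrt_disc \<Delta>) / of_real (of_int (2 * a))) = Re (- of_int b + sqrt_disc \<Delta>) / of_int (2 * a)"
        by (rule Re_divide_of_real)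
      then show ?thesis unfolding f(3) by (simp add: Im_sqrt_disc[OF disc])
    qed
    have "\<bar>real_of_int b\<bar> \<le> of_int a" using ti(2) a0 unfolding re by (simp add: abs_divide field_simps)
    then have ba: "\<bar>b\<bar> \<le> a" by linarith
    have "1 \<le> (norm (t i))\<^sup>2" using ti(3) by simp
    also have "\<dots> = (of_int (b\<^sup>2) + of_int (- \<Delta>)) / (2 * of_int a)\<^sup>2"
      unfolding cmod_power2 im re using neg by (simp add: power_divide add_divide_distrib diff_divide_distrib)
    also have "of_int (b\<^sup>2) + of_int (- \<Delta>) = real_of_int (4 * a * c)" unfolding f(2)[symmetric] by simp
    finally have "(2 * real_of_int a)\<^sup>2 \<le> of_int (4 * a * c)" using a0 by (simp add: field_simps)
    then have "real_of_int (4 * a * a) \<le> of_int (4 * a * c)" by (simp add: power2_eq_square)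
    then have "4 * a * a \<le> 4 * a * c" by (simp only: of_int_le_iff)
    then have ac: "a \<le> c" using f(1) by simp
    have "b\<^sup>2 \<le> a\<^sup>2" using power_mono[OF ba abs_ge_zero, of 2] by simp
    moreover have "a\<^sup>2 \<le> a * c" using ac f(1) by (simp add: power2_eq_square)
    ultimately have a3: "3 * a\<^sup>2 \<le> - \<Delta>" using f(2) by (simp add: algebra_simps)
    have g: "gcd (gcd a b) c = 1" 
      using f(4)[OF dvd_trans[OF gcd_dvd1 gcd_dvd1] dvd_trans[OF gcd_dvd1 gcd_dvd2] gcd_dvd2] by simp
    show ?thesis
    proof (cases "b = - a")
      case False
      then have "P i a b c (t i)" unfolding P_def using f ba ac a3 g by auto
      then show ?thesis by blast
    next
      case True
      \<comment> \<open>The boundary case b = -a is moved to b = a by a unit translation of the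
        point, so that b runs through one period modulo 2 a.\<close>
      have "(- of_int a + sqrt_disc \<Delta>) / (2 * of_int a) = of_int (- 1) + t i"
        unfolding f(3) True using f(1) by (simp add: field_simps)
      then have "zspan 1 ((- of_int a + sqrt_disc \<Delta>) / (2 * of_int a)) = zspan 1 (t i)" by (intro zspan_shift) blast
      then have "P i a a c ((- of_int a + sqrt_disc \<Delta>) / (2 * of_int a))"
        unfolding P_def using f(1,2) True ac a3 g by auto
      then show ?thesis by blast
    qed
  qed
  then have "\<forall>i. \<exists>a b c z. i < 4 \<longrightarrow> P i a b c z" by blast
  then obtain a b c z where Pi: "\<And>i. i < 4 \<Longrightarrow> P i (a i) (b i) (c i) (z i)" by metis
  show thesis
  proof (rule that[of a b c z])
    fix i :: nat assume i: "i < 4"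
    show "a i > 0 \<and> (b i)\<^sup>2 - 4 * a i * c i = \<Delta> \<and> - a i < b i \<and> b i \<le> a i \<and> a i \<le> c i \<and>
      3 * (a i)\<^sup>2 \<le> - \<Delta> \<and> gcd (gcd (a i) (b i)) (c i) = 1 \<and>
      z i = (- of_int (b i) + sqrt_disc \<Delta>) / (2 * of_int (a i)) \<and> multiplier_ring (zspan 1 (z i)) = quad_order \<Delta>"
      using Pi[OF i] t[OF i] unfolding P_def by metis
  next
    fix i j :: nat and k :: complex
    assume "i < 4" "j < 4" "k \<noteq> 0" "zspan 1 (z i) = (*) k ` zspan 1 (z j)"
    then show "i = j" using inj Pi unfolding P_def by metis
  qed
qed

end

text \<open>For a = c both signs of b are listed, so the list may count a class twice; it serves
  only as an upper bound for the number of classes.\<close>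

definition red_forms :: "int \<Rightarrow> (int \<times> int) list" where
  "red_forms N = [(a, b). a \<leftarrow> [1..N], 3 * a * a \<le> N, b \<leftarrow> [1 - a..a],
    (b * b + N) mod (4 * a) = 0 \<and> gcd (gcd a b) ((b * b + N) div (4 * a)) = 1 \<and> a \<le> (b * b + N) div (4 * a)]"

text \<open>Some prime \<open>p \<le> 17\<close> is the leading coefficient of a primitive form of discriminant \<open>-N\<close> which is
  split or simply ramified, and \<open>p\<close> is small enough for \<open>\<pi> \<surd>N / p\<close> to be at least 9 or 10.\<close>

definition good :: "int \<Rightarrow> bool" where
  "good N \<longleftrightarrow> list_ex (\<lambda>p. (p \<le> 13 \<and> 810000 * p * p \<le> 98596 * N \<or> p \<le> 17 \<and> 1000000 * p * p \<le> 98596 * N) \<and>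
    list_ex (\<lambda>b. (b * b + N) mod (4 * p) = 0 \<and> (b mod p \<noteq> 0 \<or> ((b * b + N) div (4 * p)) mod p \<noteq> 0)) [0..2 * p - 1])
    [2, 3, 5, 7, 11, 13, 17]"

text \<open>402 is the largest N with 3.14 sqrt N < 63 = 9 * 7, the range in which 7 may fail the
  size condition. N = 1, 2, 4 modulo 7 means that 7 is inert; four values escape every criterion and
  are refuted one by one.\<close>

lemma small_discriminants:
  "list_all (\<lambda>N. N mod 4 = 1 \<or> N mod 4 = 2 \<or> N mod 7 = 1 \<or> N mod 7 = 2 \<or> N mod 7 = 4 \<or> good N \<or> length (red_forms N) \<le> 3 \<or>
     N = 160 \<or> N = 171 \<or> N = 208 \<or> N = 252) [1..402]"
  by code_simp

text \<open>The multiples of 49 below 14700, where \<open>discriminant_49\<close> takes over. The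
  two exceptions are 1323 and 7987.\<close>

lemma small_discriminants_49:
  "list_all (\<lambda>k. (49 * k) mod 4 = 1 \<or> (49 * k) mod 4 = 2 \<or> good (49 * k) \<or> k = 27 \<or> k = 163) [1..299]"
  by code_simp

context trinomial_disc
begin

lemma reduced_form_unique:
  assumes t: "zspan 1 \<tau> = zspan 1 \<tau>' \<Longrightarrow> P"
    and "\<tau> = (- of_int b + sqrt_disc \<Delta>) / (2 * of_int a)" "\<tau>' = (- of_int b' + sqrt_disc \<Delta>) / (2 * of_int a)"
    and "0 < a" "2 * a dvd b' - b"
  shows P
proof (rule t)
  obtain k where k: "b' = b + 2 * a * k" using assms(5) by (metis add.commute diff_add_cancel dvdE)
  have "\<tau> = of_int k + \<tau>'" using assms(4) unfolding assms(2,3) k by (simp add: field_simps)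
  then show "zspan 1 \<tau> = zspan 1 \<tau>'" using zspan_shift by blast
qed

text \<open>Leading coefficient 1 accounts for one class and leading coefficient p for at most two.
  So one of four classes has another leading coefficient, whose ratio to p is far enough from 1 for
  \<open>pair9\<close> or \<open>pair10\<close>.\<close>

lemma prime_form:
  assumes p: "prime p" and f: "b0\<^sup>2 - 4 * p * c0 = \<Delta>" and prim: "\<not> p dvd b0 \<or> \<not> p dvd c0"
    and size: "p \<le> 13 \<and> 810000 * p * p \<le> - 98596 * \<Delta> \<or> p \<le> 17 \<and> 1000000 * p * p \<le> - 98596 * \<Delta>"
  shows False
proof -
  obtain a b c :: "nat \<Rightarrow> int" and \<tau> :: "nat \<Rightarrow> complex" where
    R1: "\<And>i. i < 4 \<Longrightarrow> a i > 0 \<and> (b i)\<^sup>2 - 4 * a i * c i = \<Delta> \<and> - a i < b i \<and> b i \<le> a i \<and> a i \<le> c i \<and>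
      3 * (a i)\<^sup>2 \<le> - \<Delta> \<and> gcd (gcd (a i) (b i)) (c i) = 1 \<and>
      \<tau> i = (- of_int (b i) + sqrt_disc \<Delta>) / (2 * of_int (a i)) \<and> multiplier_ring (zspan 1 (\<tau> i)) = quad_order \<Delta>"
    and R2: "\<And>i j k. i < 4 \<Longrightarrow> j < 4 \<Longrightarrow> k \<noteq> 0 \<Longrightarrow> zspan 1 (\<tau> i) = (*) k ` zspan 1 (\<tau> j) \<Longrightarrow> i = j"
    by (rule reduced_forms) blast
  have same: "i = j" if ij: "i < 4" "j < 4" "a i = a j" "2 * a i dvd b j - b i" for i j
  proof (rule reduced_form_unique)
    assume "zspan 1 (\<tau> i) = zspan 1 (\<tau> j)"
    then have "zspan 1 (\<tau> i) = (*) 1 ` zspan 1 (\<tau> j)" by simp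
    then show "i = j" using R2[OF ij(1,2), of 1] by simp
  qed (use R1[OF ij(1)] R1[OF ij(2)] ij(3,4) in auto)
  \<comment> \<open>Because p is prime, the square roots of the discriminant modulo 4 p are only b0
    and - b0 modulo 2 p.\<close>
  have cong: "2 * p dvd x - b0 \<or> 2 * p dvd x + b0" if x: "x\<^sup>2 - 4 * p * y = \<Delta>" for x y
  proof -
    have sq: "(x - b0) * (x + b0) = 4 * (p * (y - c0))" using x f by (simp add: power2_eq_square algebra_simps)
    have "even ((x - b0) * (x + b0))" unfolding sq by simp
    then have ev: "even (x - b0)" "even (x + b0)" by auto
    from ev(1) obtain u where u: "x - b0 = 2 * u" by (rule evenE)
    from ev(2) obtain v where v: "x + b0 = 2 * v" by (rule evenE)
    note uv = u v
    have "4 * (u * v) = 4 * (p * (y - c0))" using sq unfolding uv by simp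
    then have "p dvd u * v" by simp
    then have "p dvd u \<or> p dvd v" using p by (simp add: prime_dvd_mult_iff)
    then show ?thesis unfolding uv by auto
  qed
  have "\<exists>i<4. a i \<noteq> 1 \<and> a i \<noteq> p"
  proof (rule ccontr)
    assume "\<not> (\<exists>i<4. a i \<noteq> 1 \<and> a i \<noteq> p)"
    then have ap: "\<And>i. i < 4 \<Longrightarrow> a i = 1 \<or> a i = p" by blast
    \<comment> \<open>The three labels stand for the principal class and the two residues of b
      modulo 2 p; four indices cannot be mapped injectively into them.\<close>
    define g where "g i = (if a i = 1 then 0 else if 2 * p dvd b i - b0 then 1 else 2 :: nat)" for i
    have "inj_on g {..<4}"
    proof (rule inj_onI)
      fix i j assume ij: "i \<in> {..<4}" "j \<in> {..<4}" "g i = g j"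
      have f2: "(b i)\<^sup>2 - 4 * a i * c i = \<Delta>" "(b j)\<^sup>2 - 4 * a j * c j = \<Delta>" using R1 ij by auto
      have p1: "p \<noteq> 1" using p by auto
      consider "a i = 1" "a j = 1" | "a i = p" "a j = p" "2 * p dvd b i - b0" "2 * p dvd b j - b0"
        | "a i = p" "a j = p" "\<not> 2 * p dvd b i - b0" "\<not> 2 * p dvd b j - b0"
        using ij(3) ap[of i] ap[of j] ij(1,2) p1 by (fastforce simp: g_def split: if_splits)
      then show "i = j"
      proof cases
        case 1
        have "(b j)\<^sup>2 - (b i)\<^sup>2 = 2 * (2 * (c j - c i))" using f2 unfolding 1 by simp
        then have "even ((b j)\<^sup>2 - (b i)\<^sup>2)" by simp
        then have "even (b j - b i)" by simp
        then show ?thesis using same[of i j] ij 1 by simp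
      next
        case 2
        have "2 * p dvd b j - b i" using dvd_diff[OF 2(4) 2(3)] by simp
        then show ?thesis using same[of i j] ij 2 by simp
      next
        case 3
        then have "2 * p dvd b i + b0" "2 * p dvd b j + b0" using cong[of "b i" "c i"] cong[of "b j" "c j"] f2 by auto
        then have "2 * p dvd b j - b i" using dvd_diff[of "2 * p" "b j + b0" "b i + b0"] by simp
        then show ?thesis using same[of i j] ij 3 by simp
      qed
    qed
    then have "card (g ` {..<4}) = 4" by (simp add: card_image)
    moreover have "g ` {..<4} \<subseteq> {0, 1, 2}" by (auto simp: g_def)
    then have "card (g ` {..<4}) \<le> card {0, 1, 2 :: nat}" by (intro card_mono) auto
    ultimately show False by simp
  qed
  then obtain i where i: "i < 4" "a i \<noteq> 1" "a i \<noteq> p" by blast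
  have Ri: "a i > 0" "3 * (a i)\<^sup>2 \<le> - \<Delta>" "\<tau> i = (- of_int (b i) + sqrt_disc \<Delta>) / (2 * of_int (a i))"
    "multiplier_ring (zspan 1 (\<tau> i)) = quad_order \<Delta>" using R1[OF i(1)] by blast+
  define x where "x = j_invariant (zspan 1 (\<tau> i))"
  have x: "cmval (of_int (a i)) (pi * of_int (b i) / of_int (a i)) x"
    unfolding x_def by (rule cmval_tau[OF Ri(1,3,4,2)])
  have p0: "p \<ge> 2" using prime_ge_2_int[OF p] .
  have a2: "2 \<le> a i" using Ri(1) i(2) by simp
  have "0 \<le> p * p" using p0 by simp
  then have p3: "3 * p\<^sup>2 \<le> - \<Delta>" using size unfolding power2_eq_square by linarith
  have cop: "coprime p b0 \<or> coprime p c0" using prim prime_imp_coprime[OF p] by blast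
  have "0 < p" using p0 by simp
  from cmval_form[OF this f cop p3] obtain y where y: "cmval (of_int p) (pi * of_int b0 / of_int p) y" by blast
  have r: "2 \<le> real_of_int (a i)" "2 \<le> real_of_int p" using a2 p0 by simp_all
  from size show False
  proof
    assume s: "p \<le> 13 \<and> 810000 * p * p \<le> - 98596 * \<Delta>"
    then have "of_int (9 * p) \<le> X" using p0 by (intro X_ge) (auto simp: power2_eq_square)
    then have L: "9 * real_of_int p \<le> X" by simp
    show False
    proof (cases "a i < p")
      case True
      then have "14 * a i \<le> 13 * p" using s by linarith
      then have "14 * real_of_int (a i) \<le> 13 * real_of_int p" by linarith
      moreover have "9 * real_of_int (a i) \<le> X" using L True by linarith
      ultimately show False using pair9[OF x y r(1)] by blast
    next
      case False
      then have "14 * p \<le> 13 * a i" using s i(3) by linarith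
      then have "14 * real_of_int p \<le> 13 * real_of_int (a i)" by linarith
      then show False using pair9[OF y x r(2)] L by blast
    qed
  next
    assume s: "p \<le> 17 \<and> 1000000 * p * p \<le> - 98596 * \<Delta>"
    then have "of_int (10 * p) \<le> X" using p0 by (intro X_ge) (auto simp: power2_eq_square)
    then have L: "10 * real_of_int p \<le> X" by simp
    show False
    proof (cases "a i < p")
      case True
      then have "18 * a i \<le> 17 * p" using s by linarith
      then have "18 * real_of_int (a i) \<le> 17 * real_of_int p" by linarith
      moreover have "10 * real_of_int (a i) \<le> X" using L True by linarith
      ultimately show False using pair10[OF x y r(1)] by blast
    next
      case False
      then have "18 * p \<le> 17 * a i" using s i(3) by linarith
      then have "18 * real_of_int p \<le> 17 * real_of_int (a i)" by linarith
      then show False using pair10[OF y x r(2)] L by blast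
    qed
  qed
qed

lemma not_good: "\<not> good (- \<Delta>)"
proof
  assume "good (- \<Delta>)"
  then have "\<exists>p\<in>set [2, 3, 5, 7, 11, 13, 17]. (p \<le> 13 \<and> 810000 * p * p \<le> 98596 * - \<Delta> \<or> p \<le> 17 \<and> 1000000 * p * p \<le> 98596 * - \<Delta>) \<and>
    (\<exists>b\<in>set [0..2 * p - 1]. (b * b + - \<Delta>) mod (4 * p) = 0 \<and> (b mod p \<noteq> 0 \<or> ((b * b + - \<Delta>) div (4 * p)) mod p \<noteq> 0))"
    by (simp only: good_def list_ex_iff)
  then obtain p where p: "p \<in> set [2, 3, 5, 7, 11, 13, 17]"
    and q: "(p \<le> 13 \<and> 810000 * p * p \<le> 98596 * - \<Delta> \<or> p \<le> 17 \<and> 1000000 * p * p \<le> 98596 * - \<Delta>) \<and>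
    (\<exists>b\<in>set [0..2 * p - 1]. (b * b + - \<Delta>) mod (4 * p) = 0 \<and> (b mod p \<noteq> 0 \<or> ((b * b + - \<Delta>) div (4 * p)) mod p \<noteq> 0))"
    by (rule bexE)
  note s = conjunct1[OF q]
  from conjunct2[OF q] obtain b where b': "(b * b + - \<Delta>) mod (4 * p) = 0 \<and> (b mod p \<noteq> 0 \<or> ((b * b + - \<Delta>) div (4 * p)) mod p \<noteq> 0)"
    by (rule bexE)
  note b = conjunct1[OF b'] conjunct2[OF b']
  define c where "c = (b * b + - \<Delta>) div (4 * p)"
  have "prime p" using p by auto
  moreover have "b * b + - \<Delta> = 4 * p * c" using b(1) by (auto simp: c_def)
  then have "b\<^sup>2 - 4 * p * c = \<Delta>" by (simp add: power2_eq_square)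
  moreover have "\<not> p dvd b \<or> \<not> p dvd c" using b(2) by (auto simp: c_def)
  ultimately show False using prime_form s by simp
qed

lemma many_forms: "\<not> length (red_forms (- \<Delta>)) \<le> 3"
proof
  assume l: "length (red_forms (- \<Delta>)) \<le> 3"
  obtain a b c :: "nat \<Rightarrow> int" and \<tau> :: "nat \<Rightarrow> complex" where
    R1: "\<And>i. i < 4 \<Longrightarrow> a i > 0 \<and> (b i)\<^sup>2 - 4 * a i * c i = \<Delta> \<and> - a i < b i \<and> b i \<le> a i \<and> a i \<le> c i \<and>
      3 * (a i)\<^sup>2 \<le> - \<Delta> \<and> gcd (gcd (a i) (b i)) (c i) = 1 \<and>
      \<tau> i = (- of_int (b i) + sqrt_disc \<Delta>) / (2 * of_int (a i)) \<and> multiplier_ring (zspan 1 (\<tau> i)) = quad_order \<Delta>"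
    and R2: "\<And>i j k. i < 4 \<Longrightarrow> j < 4 \<Longrightarrow> k \<noteq> 0 \<Longrightarrow> zspan 1 (\<tau> i) = (*) k ` zspan 1 (\<tau> j) \<Longrightarrow> i = j"
    by (rule reduced_forms) blast
  have "(a i, b i) \<in> set (red_forms (- \<Delta>))" if i: "i < 4" for i
  proof -
    have r: "a i > 0" "(b i)\<^sup>2 - 4 * a i * c i = \<Delta>" "- a i < b i" "b i \<le> a i" "a i \<le> c i" "3 * (a i)\<^sup>2 \<le> - \<Delta>"
      "gcd (gcd (a i) (b i)) (c i) = 1" using R1[OF i] by auto
    have e: "b i * b i + - \<Delta> = 4 * a i * c i" using r(2) by (simp add: power2_eq_square)
    have m: "(b i * b i + - \<Delta>) mod (4 * a i) = 0" "(b i * b i + - \<Delta>) div (4 * a i) = c i" unfolding e using r(1) by simp_all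
    have "a i * 1 \<le> a i * a i" using r(1) by (intro mult_left_mono) auto
    then have "a i \<le> - \<Delta>" using r(6) r(1) unfolding power2_eq_square by linarith
    moreover have "3 * a i * a i \<le> - \<Delta>" using r(6) by (simp add: power2_eq_square)
    ultimately show ?thesis unfolding red_forms_def using r m by auto
  qed
  then have "(\<lambda>i. (a i, b i)) ` {..<4} \<subseteq> set (red_forms (- \<Delta>))" by auto
  then have "card ((\<lambda>i. (a i, b i)) ` {..<4}) \<le> card (set (red_forms (- \<Delta>)))" by (intro card_mono) auto
  moreover have "inj_on (\<lambda>i. (a i, b i)) {..<4}"
  proof (rule inj_onI)
    fix i j assume ij: "i \<in> {..<4}" "j \<in> {..<4}" "(a i, b i) = (a j, b j)"
    then have "\<tau> i = \<tau> j" using R1[of i] R1[of j] by simp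
    then have "zspan 1 (\<tau> i) = (*) 1 ` zspan 1 (\<tau> j)" by simp
    then show "i = j" using R2[of i j 1] ij by simp
  qed
  then have "card ((\<lambda>i. (a i, b i)) ` {..<4}) = 4" by (simp add: card_image)
  ultimately show False using l card_length[of "red_forms (- \<Delta>)"] by linarith
qed

text \<open>The constant term B is nonzero, so no singular modulus is 0; this is what makes
  \<open>j_injective\<close> applicable and puts all of them into the residue disc of 1728.\<close>

lemma not_inert: "\<Delta> mod 7 \<notin> {3, 5, 6}"
proof
  assume i7: "\<Delta> mod 7 \<in> {3, 5, 6}"
  obtain \<tau> :: "nat \<Rightarrow> complex" where
    t: "\<And>i. i < 4 \<Longrightarrow> Im (\<tau> i) > 0 \<and> \<bar>Re (\<tau> i)\<bar> \<le> 1 / 2 \<and> norm (\<tau> i) \<ge> 1 \<and> multiplier_ring (zspan 1 (\<tau> i)) = quad_order \<Delta>"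
    and inj: "\<And>i j k. i < 4 \<Longrightarrow> j < 4 \<Longrightarrow> k \<noteq> 0 \<Longrightarrow> zspan 1 (\<tau> i) = (*) k ` zspan 1 (\<tau> j) \<Longrightarrow> i = j"
    by (rule four_reduced_points[OF disc hgt]) blast
  define J where "J i = j_invariant (zspan 1 (\<tau> i))" for i
  have sm: "J i \<in> singular_moduli \<Delta>" if "i < 4" for i
    unfolding J_def singular_moduli_def using t[OF that] imag_quad_order_of_disc_iff[OF disc] by blast
  have cx: "cx_lattice 1 (\<tau> i)" if "i < 4" for i using t[OF that] by (intro cx_lattice_tau) auto
  have r: "J i \<noteq> 0 \<and> J i ^ m + A * J i ^ n + B = 0" if "i < 4" for i
  proof -
    have "0 < m" using mn by simp
    then show ?thesis using root[OF sm[OF that]] mn nzB by (auto simp: zero_power)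
  qed
  have ne: "J i \<noteq> J j" if i4: "i < 4" and j4: "j < 4" and ij: "i \<noteq> j" for i j
  proof
    assume "J i = J j"
    then obtain k where "k \<noteq> 0" "zspan 1 (\<tau> j) = (*) k ` zspan 1 (\<tau> i)"
      using j_injective[OF cx[OF i4] cx[OF j4]] r[OF i4] unfolding J_def by blast
    then show False using inj[OF j4 i4] ij by blast
  qed
  have mult: "\<forall>l\<in>zspan 1 (\<tau> i). sqrt_disc \<Delta> * l \<in> zspan 1 (\<tau> i)" if "i < 4" for i
    using order_sqrt[OF disc] t[OF that] unfolding multiplier_ring_def by blast
  have all: "x \<noteq> 0 \<and> x ^ m + A * x ^ n + B = 0 \<and>
       (\<exists>w1 w2. cx_lattice w1 w2 \<and> x = j_invariant (zspan w1 w2) \<and> (\<forall>l \<in> zspan w1 w2. sqrt_disc \<Delta> * l \<in> zspan w1 w2))"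
    if x: "x \<in> {J 0, J 1, J 2}" for x
  proof -
    have "\<exists>i<4. x = J i" using x by (auto intro: exI[of _ 0] exI[of _ 1] exI[of _ 2])
    then obtain i where i: "i < 4" "x = J i" by blast
    show ?thesis unfolding i(2) using r[OF i(1)] cx[OF i(1)] mult[OF i(1)] unfolding J_def by blast
  qed
  show False
    by (rule no_trinomial_inert_7[OF i7 mn(2,1) sqrt_disc_sq[OF disc] all]) (use ne in auto)
qed

end

section \<open>Comparisons that use the argument of 1 / q\<close>

context trinomial_disc
begin

text \<open>The absolute value of the two leading terms 1/q + 744 of j. It keeps the angle, which
  the cruder estimate in \<open>norm_cmval\<close> discards.\<close>

definition R :: "real \<Rightarrow> real \<Rightarrow> real" where "R a \<theta> = norm (of_real (Q a) * cis \<theta> + 744)"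

lemma R_sq: "(R a \<theta>)\<^sup>2 = (Q a)\<^sup>2 + 553536 + 1488 * Q a * cos \<theta>"
proof -
  have "(R a \<theta>)\<^sup>2 = (Q a * cos \<theta> + 744)\<^sup>2 + (Q a * sin \<theta>)\<^sup>2" unfolding R_def cmod_power2 by simp
  also have "\<dots> = (Q a)\<^sup>2 * ((sin \<theta>)\<^sup>2 + (cos \<theta>)\<^sup>2) + 553536 + 1488 * Q a * cos \<theta>"
    by (simp add: power2_eq_square algebra_simps del: sin_cos_squared_add sin_cos_squared_add2 sin_cos_squared_add3)
  finally show ?thesis by simp
qed

lemma R_nonneg: "0 \<le> R a \<theta>" by (simp add: R_def)

lemma Q_pos: "0 < Q a" by (simp add: Q_def)

lemma norm_R:
  assumes "cmval a \<theta> x"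
  shows "390 \<le> Q a \<Longrightarrow> norm x \<le> R a \<theta> + 263000 / Q a" "900 \<le> Q a \<Longrightarrow> norm x \<le> R a \<theta> + 225000 / Q a"
    "900 \<le> Q a \<Longrightarrow> R a \<theta> - 225000 / Q a \<le> norm x"
proof -
  define z where "z = of_real (Q a) * cis \<theta> + 744"
  have e: "x - of_real (Q a) * cis \<theta> - 744 = x - z" by (simp add: z_def)
  have R: "R a \<theta> = norm z" by (simp add: z_def R_def)
  have u: "norm x \<le> norm z + norm (x - z)" "norm z \<le> norm x + norm (x - z)"
    using norm_triangle_ineq[of z "x - z"] norm_triangle_ineq4[of x "x - z"] by simp_all
  show "390 \<le> Q a \<Longrightarrow> norm x \<le> R a \<theta> + 263000 / Q a" "900 \<le> Q a \<Longrightarrow> norm x \<le> R a \<theta> + 225000 / Q a"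
    "900 \<le> Q a \<Longrightarrow> R a \<theta> - 225000 / Q a \<le> norm x"
    using assms u unfolding cmval_def e R by auto
qed

lemma gap_contra:
  assumes "cmval a \<theta> x" "2 \<le> a" "900 \<le> Q a" "cmval b \<phi> y" "20 < norm x - norm y"
  shows False
  using gap[OF assms(1-3), of y] assms(4,5) by (auto simp: cmval_def)

lemma Q_ge:
  assumes "0 < a" "t * a \<le> X" "K \<le> exp t" shows "K \<le> Q a"
proof -
  have "t \<le> X / a" using assms(1,2) by (simp add: pos_le_divide_eq)
  then have "exp t \<le> Q a" by (simp add: Q_def)
  then show ?thesis using assms(3) by linarith
qed

lemma Q_le:
  assumes "0 < a" "X \<le> t * a" "exp t \<le> K" shows "Q a \<le> K"
proof -
  have "X / a \<le> t" using assms(1,2) by (simp add: pos_divide_le_eq)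
  then have "Q a \<le> exp t" by (simp add: Q_def)
  then show ?thesis using assms(3) by linarith
qed

lemma X_le: assumes "0 \<le> k" "9872164 * real_of_int (- \<Delta>) \<le> 1000000 * k\<^sup>2" shows "X \<le> k"
proof -
  have "X \<le> 3.142 * sqrt (of_int (- \<Delta>))" unfolding X_def using pi_approx(2) neg by (intro mult_right_mono) auto
  also have "\<dots> = sqrt (3.142\<^sup>2 * of_int (- \<Delta>))" unfolding real_sqrt_mult by simp
  also have "\<dots> \<le> sqrt (k\<^sup>2)" by (rule real_sqrt_le_mono) (use assms(2) in \<open>simp add: power_divide\<close>)
  finally show ?thesis using assms(1) by simp
qed


lemma cos_lower: "1 - x\<^sup>2 / 2 \<le> cos (x :: real)"
proof -
  have "\<bar>sin (x / 2)\<bar>\<^sup>2 \<le> \<bar>x / 2\<bar>\<^sup>2" by (intro power_mono abs_sin_x_le_abs_x) simp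
  moreover have "cos x = 1 - 2 * (sin (x / 2))\<^sup>2" using cos_double_sin[of "x / 2"] by simp
  ultimately show ?thesis by (simp add: power_divide)
qed

text \<open>With Delta = 49 D, the forms (49, 7 b, (b^2 - D) / 4) share their leading coefficient,
  and only the angle pi b / 7 distinguishes them. The squares of |1/q + 744| differ by 1488 Q(49)
  times the difference of the cosines.\<close>

lemma discriminant_49:
  assumes d: "49 dvd \<Delta>" and big: "14700 \<le> - \<Delta>"
  shows False
proof -
  obtain D where D: "\<Delta> = 49 * D" using d by (rule dvdE)
  have m4: "(49 * D) mod 4 = D mod 4" using mod_mult_self2[of D 4 "12 * D"] by simp
  have D4: "D mod 4 = 0 \<or> D mod 4 = 1" using disc unfolding imag_quad_disc_def D by (simp add: m4)
  have form: "\<exists>x. cmval 49 (pi * of_int b / 7) x" if b: "(b * b - D) mod 4 = 0" "(b * b - D) mod 7 \<noteq> 0" for b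
  proof -
    obtain c where c: "b * b - D = 4 * c" using b(1) by (auto elim: dvdE)
    have c7: "\<not> 7 dvd c" using b(2) unfolding c by auto
    have "prime (7 :: int)" by simp
    then have "coprime 7 c" using c7 by (rule prime_imp_coprime)
    then have "coprime (7 ^ 2) c" unfolding coprime_power_left_iff by simp
    then have "coprime 49 c" by simp
    moreover have "(7 * b)\<^sup>2 - 4 * 49 * c = \<Delta>" unfolding D using c by (simp add: power2_eq_square)
    ultimately have "\<exists>x. cmval (of_int 49) (pi * of_int (7 * b) / of_int 49) x"
      by (intro cmval_form) (use big in auto)
    then show ?thesis by (simp add: field_simps)
  qed
  \<comment> \<open>A form with b^2 = D modulo 7 is divisible by 7. Two values of b with different
    squares modulo 7 cannot both suffer from this, so each candidate pair contains a usable
    b.\<close>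
  have ne: "(x - D) mod 7 \<noteq> 0 \<or> (y - D) mod 7 \<noteq> 0" if "\<not> 7 dvd x - y" for x y
  proof (rule ccontr)
    assume "\<not> ((x - D) mod 7 \<noteq> 0 \<or> (y - D) mod 7 \<noteq> 0)"
    then have d: "7 dvd x - D" "7 dvd y - D" by auto
    have "7 dvd (x - D) - (y - D)" by (rule dvd_diff[OF d])
    then show False using that by simp
  qed
  have pick: "\<exists>b x. (b = real_of_int u \<or> b = of_int v) \<and> cmval 49 (pi * b / 7) x"
    if "(u * u - D) mod 4 = 0" "(v * v - D) mod 4 = 0" "(u * u - D) mod 7 \<noteq> 0 \<or> (v * v - D) mod 7 \<noteq> 0" for u v
    using that(3)
  proof
    assume "(u * u - D) mod 7 \<noteq> 0"
    from form[OF that(1) this] show ?thesis by blast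
  next
    assume "(v * v - D) mod 7 \<noteq> 0"
    from form[OF that(2) this] show ?thesis by blast
  qed
  \<comment> \<open>The parity of b is that of D. One pair of candidates has angles near 0, {1, 3}
    or {0, 2}, the other has angles near pi, {5, 7} or {4, 6}; either way the cosines differ by at
    least 1/2.\<close>
  have "\<exists>\<theta> \<phi> x y. cmval 49 \<theta> x \<and> cmval 49 \<phi> y \<and> 1 / 2 \<le> cos \<theta> - cos \<phi>"
  proof (cases "even D")
    case False
    have "D mod 4 \<noteq> 0" using False by auto
    then have "D mod 4 = 1" using D4 by blast
    then have "D = 4 * (D div 4) + 1" using mult_div_mod_eq[of 4 D] by linarith
    then obtain E where E: "D = 4 * E + 1" by blast
    have m: "(x - D) mod 4 = 0" if "x = 4 * y + 1" for x y
    proof -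
      have "x - D = 4 * (y - E)" using that E by simp
      then show ?thesis by (metis mod_mult_self1_is_0)
    qed
    have "(1 * 1 - D) mod 4 = 0" "(3 * 3 - D) mod 4 = 0" "(5 * 5 - D) mod 4 = 0" "(7 * 7 - D) mod 4 = 0"
      by (rule m[of _ 0], simp, rule m[of _ 2], simp, rule m[of _ 6], simp, rule m[of _ 12], simp)
    moreover have "(1 * 1 - D) mod 7 \<noteq> 0 \<or> (3 * 3 - D) mod 7 \<noteq> 0" "(5 * 5 - D) mod 7 \<noteq> 0 \<or> (7 * 7 - D) mod 7 \<noteq> 0"
      by (rule ne, simp)+
    ultimately obtain b x b' y where b: "b = 1 \<or> b = 3" "cmval 49 (pi * b / 7) x" and b': "b' = 5 \<or> b' = 7" "cmval 49 (pi * b' / 7) y"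
      using pick[of 1 3] pick[of 5 7] unfolding of_int_numeral of_int_1 by metis
    have "0 \<le> pi * b / 7" "pi * b / 7 \<le> pi / 2" using b(1) by auto
    then have "0 \<le> cos (pi * b / 7)" using pi_gt_zero by (intro cos_ge_zero) linarith+
    moreover have "cos (pi * b' / 7) \<le> cos (2 * pi / 3)" using b'(1) pi_gt_zero by (intro cos_monotone_0_pi_le) auto
    ultimately have "1 / 2 \<le> cos (pi * b / 7) - cos (pi * b' / 7)" unfolding cos_120 by linarith
    then show ?thesis using b(2) b'(2) by blast
  next
    case True
    have "D mod 4 \<noteq> 1"
    proof
      assume "D mod 4 = 1"
      then have "D = 2 * (2 * (D div 4)) + 1" using mult_div_mod_eq[of 4 D] by linarith
      moreover have "odd (2 * (2 * (D div 4)) + 1)" by simp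
      ultimately show False using True by metis
    qed
    then have "D mod 4 = 0" using D4 by blast
    then have "D = 4 * (D div 4)" using mult_div_mod_eq[of 4 D] by linarith
    then obtain E where E: "D = 4 * E" by blast
    have m: "(x - D) mod 4 = 0" if "x = 4 * y" for x y
    proof -
      have "x - D = 4 * (y - E)" using that E by simp
      then show ?thesis by (metis mod_mult_self1_is_0)
    qed
    have "(0 * 0 - D) mod 4 = 0" "(2 * 2 - D) mod 4 = 0" "(4 * 4 - D) mod 4 = 0" "(6 * 6 - D) mod 4 = 0"
      by (rule m[of _ 0], simp, rule m[of _ 1], simp, rule m[of _ 4], simp, rule m[of _ 9], simp)
    moreover have "(0 * 0 - D) mod 7 \<noteq> 0 \<or> (2 * 2 - D) mod 7 \<noteq> 0" "(4 * 4 - D) mod 7 \<noteq> 0 \<or> (6 * 6 - D) mod 7 \<noteq> 0"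
      by (rule ne, simp)+
    ultimately obtain b x b' y where b: "b = 0 \<or> b = 2" "cmval 49 (pi * b / 7) x" and b': "b' = 4 \<or> b' = 6" "cmval 49 (pi * b' / 7) y"
      using pick[of 0 2] pick[of 4 6] unfolding of_int_numeral of_int_0 by metis
    have "cos (pi / 3) \<le> cos (pi * b / 7)" using b(1) pi_gt_zero by (intro cos_monotone_0_pi_le) auto
    moreover have "cos (pi * b' / 7) \<le> cos (pi / 2)" using b'(1) pi_gt_zero by (intro cos_monotone_0_pi_le) auto
    ultimately have "1 / 2 \<le> cos (pi * b / 7) - cos (pi * b' / 7)" unfolding cos_60 cos_pi_half by linarith
    then show ?thesis using b(2) b'(2) by blast
  qed
  then obtain \<theta> \<phi> x y where x: "cmval 49 \<theta> x" and y: "cmval 49 \<phi> y" and c: "1 / 2 \<le> cos \<theta> - cos \<phi>" by blast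
  have X: "380 \<le> X" using X_ge[of 380] big by simp
  have Q: "2100 \<le> Q 49"
  proof (rule Q_ge)
    show "2100 \<le> exp (7 + 0.7 :: real)" using exp_lower[of "0.7" 7] by (simp add: eval_nat_numeral)
  qed (use X in auto)
  define q where "q = Q 49"
  have le: "R 49 \<psi> \<le> q + 744" for \<psi>
    unfolding R_def q_def using norm_triangle_ineq[of "of_real (Q 49) * cis \<psi>" 744] by (simp add: norm_mult Q_def)
  \<comment> \<open>744 q > 274 (2 q + 1488) holds for q >= 2100, and 274 still exceeds 20 after
    subtracting both errors of at most 225000 / 2100.\<close>
  have "274 \<le> R 49 \<theta> - R 49 \<phi>"
  proof (rule ccontr)
    assume "\<not> 274 \<le> R 49 \<theta> - R 49 \<phi>"
    then have "(R 49 \<theta> - R 49 \<phi>) * (R 49 \<theta> + R 49 \<phi>) \<le> 274 * (R 49 \<theta> + R 49 \<phi>)"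
      using R_nonneg[of 49 \<theta>] R_nonneg[of 49 \<phi>] by (intro mult_right_mono) auto
    moreover have "(R 49 \<theta> - R 49 \<phi>) * (R 49 \<theta> + R 49 \<phi>) = (R 49 \<theta>)\<^sup>2 - (R 49 \<phi>)\<^sup>2"
      by (simp add: power2_eq_square algebra_simps)
    ultimately have "(R 49 \<theta>)\<^sup>2 - (R 49 \<phi>)\<^sup>2 \<le> 274 * (R 49 \<theta> + R 49 \<phi>)" by simp
    also have "\<dots> \<le> 274 * (2 * q + 1488)" using le[of \<theta>] le[of \<phi>] by simp
    also have "(R 49 \<theta>)\<^sup>2 - (R 49 \<phi>)\<^sup>2 = 1488 * q * (cos \<theta> - cos \<phi>)" unfolding R_sq q_def by (simp add: algebra_simps)
    finally have "1488 * q * (cos \<theta> - cos \<phi>) \<le> 274 * (2 * q + 1488)" .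
    moreover have "1488 * q * (1 / 2) \<le> 1488 * q * (cos \<theta> - cos \<phi>)" using c Q by (intro mult_left_mono) (auto simp: q_def)
    ultimately have "1488 * q * (1 / 2) \<le> 274 * (2 * q + 1488)" by (rule order_trans[rotated])
    then show False using Q unfolding q_def by simp
  qed
  moreover have "225000 / Q 49 \<le> 225000 / 2100" using Q by (intro divide_left_mono) auto
  ultimately have "20 < norm x - norm y" using norm_R(3)[OF x] norm_R(2)[OF y] Q by linarith
  then show False using gap_contra[OF x _ _ y] Q by simp
qed

section \<open>The exceptional discriminants\<close>

lemma cmval_bezout:
  assumes "0 < a" "b\<^sup>2 - 4 * a * c = \<Delta>" "u * a + v * b = 1 \<or> u * a + v * c = 1" "3 * a\<^sup>2 \<le> - \<Delta>"
  shows "\<exists>x. cmval (of_int a) (pi * of_int b / of_int a) x"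
proof (rule cmval_form[OF assms(1,2) _ assms(4)])
  have "coprime x y" if "u * x + v * y = 1" for x y
    using that by (metis coprimeI dvd_add dvd_mult)
  then show "coprime a b \<or> coprime a c" using assms(3) by blast
qed

lemma not_160: "\<Delta> \<noteq> - 160"
proof
  assume D: "\<Delta> = - 160"
  obtain x where x: "cmval (of_int 4) (pi * of_int 4 / of_int 4) x"
    using cmval_bezout[of 4 4 11 "3" "-1"] D by auto
  obtain y where y: "cmval (of_int 5) (pi * of_int 0 / of_int 5) y"
    using cmval_bezout[of 5 0 8 "-3" "2"] D by auto
  show False using pair9[OF x y] X_ge[of 36] D by simp
qed

lemma not_208: "\<Delta> \<noteq> - 208"
proof
  assume D: "\<Delta> = - 208"
  obtain x where x: "cmval (of_int 4) (pi * of_int 0 / of_int 4) x"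
    using cmval_bezout[of 4 0 13 "-3" "1"] D by auto
  obtain y where y: "cmval (of_int 7) (pi * of_int 4 / of_int 7) y"
    using cmval_bezout[of 7 4 8 "-1" "2"] D by auto
  show False using pair9[OF x y] X_ge[of 36] D by simp
qed

lemma not_1323: "\<Delta> \<noteq> - 1323"
proof
  assume D: "\<Delta> = - 1323"
  obtain x where x: "cmval (of_int 9) (pi * of_int 3 / of_int 9) x"
    using cmval_bezout[of 9 3 37 "-4" "1"] D by auto
  obtain y where y: "cmval (of_int 13) (pi * of_int 9 / of_int 13) y"
    using cmval_bezout[of 13 9 27 "-2" "1"] D by auto
  show False using pair9[OF x y] X_ge[of 81] D by simp
qed

text \<open>X is about 41.1, short of the 45 that \<open>pair9\<close> asks for with a = 5; the
  large ratio 7/5 of the leading coefficients compensates.\<close>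

lemma not_171: "\<Delta> \<noteq> - 171"
proof
  assume D: "\<Delta> = - 171"
  obtain x where x: "cmval (of_int 5) (pi * of_int 3 / of_int 5) x"
    using cmval_bezout[of 5 3 9 "2" "-1"] D by auto
  obtain y where y: "cmval (of_int 7) (pi * of_int 5 / of_int 7) y"
    using cmval_bezout[of 7 5 7 "-2" "3"] D by auto
  have X: "41 \<le> X" "X \<le> 42" using X_ge[of 41] X_le[of 42] D by simp_all
  have "3600 \<le> Q 5"
  proof (rule Q_ge)
    show "3600 \<le> exp (8 + 0.2 :: real)" using exp_lower[of "0.2" 8] by (simp add: eval_nat_numeral)
  qed (use X in auto)
  moreover have "320000 / Q 5 \<le> 320000 / 3600" using calculation by (intro divide_left_mono) auto
  moreover have "Q 7 \<le> 405" by (rule Q_le[OF _ _ exp_6_upper]) (use X in auto)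
  ultimately have "2910 + 320000 / Q 5 \<le> Q 5 - Q 7" "900 \<le> Q 5" by auto
  then show False using pair[OF x y] by simp
qed

text \<open>The coefficients 7 and 8 are too close for sizes alone. At angle 0 the constant 744 adds
  to Q(7) in full, while at 3 pi / 4 it works against Q(8).\<close>

lemma not_252: "\<Delta> \<noteq> - 252"
proof
  assume D: "\<Delta> = - 252"
  obtain x where x: "cmval (of_int 7) (pi * of_int 0 / of_int 7) x"
    using cmval_bezout[of 7 0 9 "4" "-3"] D by auto
  obtain y where y: "cmval (of_int 8) (pi * of_int 6 / of_int 8) y"
    using cmval_bezout[of 8 6 9 "-1" "1"] D by auto
  have X: "49 \<le> X" "X \<le> 50" using X_ge[of 49] X_le[of 50] D by simp_all
  have Q7: "1090 \<le> Q 7"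
  proof (rule Q_ge)
    show "1090 \<le> exp (7 + 0 :: real)" using exp_lower[of 0 7] by (simp add: eval_nat_numeral)
  qed (use X in auto)
  have Q8: "450 \<le> Q 8"
  proof (rule Q_ge)
    show "450 \<le> exp (6 + 0.125 :: real)" using exp_lower[of "0.125" 6] by (simp add: eval_nat_numeral)
  qed (use X in auto)
  have Q8': "Q 8 \<le> 532"
  proof (rule Q_le)
    have "exp (1/4 :: real) \<le> 1 + 1/4 + (1/4)\<^sup>2" by (rule exp_bound) auto
    then have "exp (6 :: real) * exp (1/4) \<le> 405 * (21 / 16)" by (intro mult_mono exp_6_upper) (auto simp: power2_eq_square)
    then show "exp (6 + 1/4 :: real) \<le> 532" unfolding exp_add by linarith
  qed (use X in auto)
  have z: "of_real (Q 7) * cis 0 + 744 = complex_of_real (Q 7 + 744)" by simp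
  have "R 7 0 = Q 7 + 744" unfolding R_def z norm_of_real using Q_pos[of 7] by simp
  moreover have "225000 / Q 7 \<le> 225000 / 1090" using Q7 by (intro divide_left_mono) auto
  ultimately have nx: "1620 \<le> norm x" using norm_R(3)[OF x] Q7 by simp
  have "cos (pi * 6 / 8) \<le> cos (pi / 2)" using pi_gt_zero by (intro cos_monotone_0_pi_le) auto
  then have "1488 * Q 8 * cos (pi * 6 / 8) \<le> 0" using Q_pos[of 8] by (intro mult_nonneg_nonpos) auto
  moreover have "(Q 8)\<^sup>2 \<le> 532\<^sup>2" using Q8' Q_pos[of 8] by (intro power_mono) auto
  ultimately have "(R 8 (pi * 6 / 8))\<^sup>2 \<le> 920\<^sup>2" unfolding R_sq by simp
  then have "R 8 (pi * 6 / 8) \<le> 920" by (rule power2_le_imp_le) simp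
  moreover have "263000 / Q 8 \<le> 263000 / 450" using Q8 by (intro divide_left_mono) auto
  ultimately have "norm y \<le> 1510" using norm_R(1)[OF y] Q8 by simp
  then show False using gap_contra[OF x _ _ y] nx Q7 by simp
qed

lemma X_7987: assumes "\<Delta> = - 7987" shows "280.7 \<le> X" "X \<le> 282"
proof -
  have "89.36 \<le> sqrt (7987 :: real)" by (rule real_le_rsqrt) (simp add: power2_eq_square)
  then have "3.1415 * 89.36 \<le> pi * sqrt (7987 :: real)" using pi_approx(1) by (intro mult_mono) auto
  moreover have "X = pi * sqrt 7987" by (subst X_def) (simp add: assms)
  ultimately show "280.7 \<le> X" by simp
  show "X \<le> 282" using X_le[of 282] assms by simp
qed

text \<open>For the forms (41, 7, 49) and (47, 35, 49) the cosines have opposite signs, so 744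
  enlarges one modulus and diminishes the other. The margin is small, whence the sharp bounds for X
  and the exponentials; 6.84 = 8 * 171/200 and 5.97 = 6 * 199/200.\<close>

lemma not_7987: "\<Delta> \<noteq> - 7987"
proof
  assume D: "\<Delta> = - 7987"
  obtain x where x: "cmval (of_int 41) (pi * of_int 7 / of_int 41) x"
    using cmval_bezout[of 41 7 49 "6" "-5"] D by auto
  obtain y where y: "cmval (of_int 47) (pi * of_int 35 / of_int 47) y"
    using cmval_bezout[of 47 35 49 "-32" "43"] D by auto
  note X = X_7987[OF D]
  have Qx: "930 \<le> Q 41"
  proof (rule Q_ge)
    have "(\<Sum>k<6. (171/200) ^ k / fact k) \<le> exp (171/200 :: real)" by (rule exp_ge_sum) simp
    then have "2.35 \<le> exp (171/200 :: real)" by (simp add: eval_nat_numeral fact_numeral)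
    then have "2.35 ^ 8 \<le> exp (171/200 :: real) ^ 8" by (intro power_mono) auto
    also have "\<dots> = exp (6.84 :: real)" by (simp flip: exp_of_nat_mult)
    finally show "930 \<le> exp (6.84 :: real)" by (simp add: eval_nat_numeral)
  qed (use X in auto)
  have Qy: "390 \<le> Q 47"
  proof (rule Q_ge)
    have "(\<Sum>k<7. (199/200) ^ k / fact k) \<le> exp (199/200 :: real)" by (rule exp_ge_sum) simp
    then have "2.704 \<le> exp (199/200 :: real)" by (simp add: eval_nat_numeral fact_numeral)
    then have "2.704 ^ 6 \<le> exp (199/200 :: real) ^ 6" by (intro power_mono) auto
    also have "\<dots> = exp (5.97 :: real)" by (simp flip: exp_of_nat_mult)
    finally show "390 \<le> exp (5.97 :: real)" by (simp add: eval_nat_numeral)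
  qed (use X in auto)
  have Qy': "Q 47 \<le> 405" by (rule Q_le[OF _ _ exp_6_upper]) (use X in auto)
  have "pi * 7 / 41 \<le> 0.54" "0 \<le> pi * 7 / 41" using pi_approx(2) by simp_all
  then have "(pi * 7 / 41)\<^sup>2 \<le> 0.54\<^sup>2" by (intro power_mono)
  then have "17 / 20 \<le> cos (pi * 7 / 41)" using cos_lower[of "pi * 7 / 41"] by (simp add: power2_eq_square)
  then have "1488 * Q 41 * (17 / 20) \<le> 1488 * Q 41 * cos (pi * 7 / 41)" using Qx by (intro mult_left_mono) auto
  moreover have "930\<^sup>2 \<le> (Q 41)\<^sup>2" using Qx by (intro power_mono) auto
  then have "864900 \<le> (Q 41)\<^sup>2" by simp
  moreover have "1610\<^sup>2 = (2592100 :: real)" by simp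
  ultimately have "1610\<^sup>2 \<le> (R 41 (pi * 7 / 41))\<^sup>2" unfolding R_sq using Qx by linarith
  then have "1610 \<le> R 41 (pi * 7 / 41)" by (rule power2_le_imp_le) (rule R_nonneg)
  moreover have "225000 / Q 41 \<le> 225000 / 930" using Qx by (intro divide_left_mono) auto
  ultimately have nx: "1368 \<le> norm x" using norm_R(3)[OF x] Qx by simp
  have "cos (pi * 35 / 47) \<le> cos (2 * pi / 3)" using pi_gt_zero by (intro cos_monotone_0_pi_le) auto
  then have "1488 * Q 47 * cos (pi * 35 / 47) \<le> 1488 * Q 47 * (- 1 / 2)" using Qy unfolding cos_120 by (intro mult_left_mono) auto
  moreover have "(Q 47)\<^sup>2 \<le> 405\<^sup>2" using Qy' Q_pos[of 47] by (intro power_mono) auto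
  then have "(Q 47)\<^sup>2 \<le> 164025" by simp
  moreover have "655\<^sup>2 = (429025 :: real)" by simp
  ultimately have "(R 47 (pi * 35 / 47))\<^sup>2 \<le> 655\<^sup>2" unfolding R_sq using Qy by linarith
  then have "R 47 (pi * 35 / 47) \<le> 655" by (rule power2_le_imp_le) simp
  moreover have "263000 / Q 47 \<le> 263000 / 390" using Qy by (intro divide_left_mono) auto
  ultimately have "norm y \<le> 1330" using norm_R(1)[OF y] Qy by simp
  then show False using gap_contra[OF x _ _ y] nx Qx by simp
qed

lemma contradiction: False
proof -
  define N where "N = - \<Delta>"
  have "\<Delta> < 0" "\<Delta> mod 4 = 0 \<or> \<Delta> mod 4 = 1" "\<Delta> mod 7 \<noteq> 3" "\<Delta> mod 7 \<noteq> 5" "\<Delta> mod 7 \<noteq> 6"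
    using disc not_inert unfolding imag_quad_disc_def by auto
  then have N: "N > 0" "N mod 4 = 0 \<or> N mod 4 = 3" "N mod 7 \<noteq> 1" "N mod 7 \<noteq> 2" "N mod 7 \<noteq> 4"
    unfolding N_def zmod_zminus1_eq_if by auto
  have N4: "N mod 4 \<noteq> 1" "N mod 4 \<noteq> 2" using N(2) by auto
  have good: "\<not> good N" and forms: "\<not> length (red_forms N) \<le> 3" using not_good many_forms by (simp_all add: N_def)
  have exc: "N \<noteq> 160" "N \<noteq> 171" "N \<noteq> 208" "N \<noteq> 252" "N \<noteq> 1323" "N \<noteq> 7987"
    using not_160 not_171 not_208 not_252 not_1323 not_7987 by (auto simp: N_def)
  have n402: "\<not> N \<le> 402"
  proof
    assume "N \<le> 402"
    then have "N \<in> set [1..402]" using N(1) by simp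
    with small_discriminants have "N mod 4 = 1 \<or> N mod 4 = 2 \<or> N mod 7 = 1 \<or> N mod 7 = 2 \<or> N mod 7 = 4 \<or> good N \<or>
        length (red_forms N) \<le> 3 \<or> N = 160 \<or> N = 171 \<or> N = 208 \<or> N = 252"
      unfolding list_all_iff by blast
    then show False using N(3-5) N4 good forms exc by blast
  qed
  show False
  proof (cases "49 dvd N")
    case True
    then obtain k where k: "N = 49 * k" by (rule dvdE)
    \<comment> \<open>When 49 divides N, the forms with leading coefficient 7 may be imprimitive, so
      large N go to \<open>discriminant_49\<close> and the others to the table; 14700 = 49 *
      300.\<close>
    have "\<not> 14700 \<le> N" using discriminant_49 True by (auto simp: N_def)
    then have "k \<in> set [1..299]" using N(1) k by simp
    with small_discriminants_49 have "(49 * k) mod 4 = 1 \<or> (49 * k) mod 4 = 2 \<or> good (49 * k) \<or> k = 27 \<or> k = 163"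
      unfolding list_all_iff by blast
    moreover have "k \<noteq> 27" "k \<noteq> 163" using exc k by auto
    ultimately show False using N4 good unfolding k by blast
  next
    case False
    have "r = 0 \<or> r = 3 \<or> r = 5 \<or> r = 6" if "0 \<le> r" "r < 7" "r \<noteq> 1" "r \<noteq> 2" "r \<noteq> 4" for r :: int
      using that by presburger
    from this[of "N mod 7"] have N7: "N mod 7 = 0 \<or> N mod 7 = 3 \<or> N mod 7 = 5 \<or> N mod 7 = 6" using N(3-5) by simp
    \<comment> \<open>As 7 is not inert, - N is a square modulo 4 and modulo 7; the witnesses below
      solve both congruences at once, depending only on the residues of N.\<close>
    have w: "\<exists>b. 28 dvd b * b + N" if "(b * b + N mod 4) mod 4 = 0" "(b * b + N mod 7) mod 7 = 0" for b
    proof -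
      have "4 dvd b * b + N" using that(1) unfolding mod_add_right_eq by (rule mod_0_imp_dvd)
      then obtain u where u: "b * b + N = 4 * u" by (rule dvdE)
      have "7 dvd b * b + N" using that(2) unfolding mod_add_right_eq by (rule mod_0_imp_dvd)
      then obtain v where v: "b * b + N = 7 * v" by (rule dvdE)
      have "b * b + N = 28 * (2 * v - u)" using u v by algebra
      then have "28 dvd b * b + N" by (metis dvd_triv_left)
      then show ?thesis by blast
    qed
    have "\<exists>b. 28 dvd b * b + N" using N(2)
    proof
      assume N4: "N mod 4 = 0"
      from N7 show ?thesis
      proof (elim disjE)
        assume "N mod 7 = 0" then show ?thesis using N4 by (intro w[of 0]) simp_all
      next
        assume "N mod 7 = 3" then show ?thesis using N4 by (intro w[of 2]) simp_all
      next
        assume "N mod 7 = 5" then show ?thesis using N4 by (intro w[of 10]) simp_all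
      next
        assume "N mod 7 = 6" then show ?thesis using N4 by (intro w[of 6]) simp_all
      qed
    next
      assume N4: "N mod 4 = 3"
      from N7 show ?thesis
      proof (elim disjE)
        assume "N mod 7 = 0" then show ?thesis using N4 by (intro w[of 7]) simp_all
      next
        assume "N mod 7 = 3" then show ?thesis using N4 by (intro w[of 5]) simp_all
      next
        assume "N mod 7 = 5" then show ?thesis using N4 by (intro w[of 3]) simp_all
      next
        assume "N mod 7 = 6" then show ?thesis using N4 by (intro w[of 1]) simp_all
      qed
    qed
    then obtain b where "28 dvd b * b + N" by blast
    then obtain c where c: "b * b + N = 28 * c" by (rule dvdE)
    have "\<not> (7 dvd b \<and> 7 dvd c)"
    proof
      assume "7 dvd b \<and> 7 dvd c"
      then obtain u v where "b = 7 * u" "c = 7 * v" by (auto elim!: dvdE)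
      then have "N = 49 * (4 * v - u * u)" using c by simp
      then show False using False by simp
    qed
    moreover have "b\<^sup>2 - 4 * 7 * c = \<Delta>" using c by (simp add: N_def power2_eq_square)
    ultimately show False using prime_form[of 7 b c] n402 by (simp add: N_def)
  qed
qed

end

theorem theorem6p2:
  "\<not> (\<exists>\<Delta>::int. imag_quad_disc \<Delta> \<and> \<bar>\<Delta>\<bar> \<le> 10 ^ 11 \<and> disc_class_number \<Delta> > 3 \<and>
        (\<exists>(A::rat) (B::rat) (m::nat) (n::nat). m > n \<and> n > 0 \<and> B \<noteq> 0 \<and>
           (\<forall>x\<in>singular_moduli \<Delta>.
              poly (map_poly of_rat (monom 1 m + monom A n + [:B:])) x = 0)))"
proof (clarify)
  fix \<Delta> :: int and A B :: rat and m n :: nat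
  assume h: "imag_quad_disc \<Delta>" "disc_class_number \<Delta> > 3" "n < m" "0 < n" "B \<noteq> 0"
    and r: "\<forall>x\<in>singular_moduli \<Delta>. poly (map_poly of_rat (monom 1 m + monom A n + [:B:])) x = 0"
  have e: "poly (map_poly of_rat (monom 1 m + monom A n + [:B:])) x = x ^ m + of_rat A * x ^ n + of_rat B" for x :: complex
  proof -
    have add: "map_poly of_rat (p + q) = (map_poly of_rat p + map_poly of_rat q :: complex poly)" for p q
      by (intro poly_eqI) (simp add: coeff_map_poly of_rat_add)
    have "map_poly of_rat [:B:] = [:of_rat B :: complex:]" by (simp add: map_poly_pCons)
    then show ?thesis unfolding add by (simp add: map_poly_monom poly_monom)
  qed
  have "\<forall>x\<in>singular_moduli \<Delta>. x ^ m + of_rat A * x ^ n + of_rat B = 0" using r by (simp only: e)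
  moreover have "(of_rat B :: complex) \<noteq> 0" using h(5) by simp
  ultimately interpret trinomial_disc \<Delta> "of_rat A" "of_rat B" m n
    using h(1-4) by unfold_locales blast+
  show False by (rule contradiction)
qed

end
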